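(* Let $p$ be an odd prime and $R$ a $p$-torsion-free commutative $\mathbb{Z}_{(p)}$-algebra. Then $\mathrm{HP}_i(R/\!/p)=0$ for $i$ odd, and for any even $i$ the $R$-module $\mathrm{HP}_i(R/\!/p)$ is isomorphic to $$R^{\wedge}\times R/1\times R/3\times R/5\times\cdots=R^{\wedge}\times\prod_{n\ge 1,\ n\text{ odd}}R/n,$$ where $R^{\wedge}$ denotes the $p$-adic completion of $R$.
   Context: $R/\!/p$ denotes the differential graded $R$-algebra whose underlying graded algebra is $R[x]$ with $x$ in degree $1$ (the tensor algebra on $x$; it is not graded commutative), with differential $\delta$ of degree $-1$ determined by $\delta x=p$ and the graded Leibniz rule, so $\delta x^n=p\,x^{n-1}$ for $n$ odd and $\delta x^n=0$ for $n$ even. $\mathrm{HP}_i(R/\!/p)$ denotes the periodic cyclic homology of $R/\!/p$ over $R$ (all tensor products over $R$, usual Koszul signs for dg algebras, computed by the product totalization of the periodic bicomplex). "$p$-torsion-free" means multiplication by $p$ is injective on $R$. $R/n$ means $R/nR$. *)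

theory Defs
  imports Complex_Main "HOL-Computational_Algebra.Primes" "HOL-Algebra.UnivPoly"
begin

section \<open>Modules\<close>

text \<open>
  Modules are records of type \<^typ>\<open>('a, 'b) module\<close>. This record type extends
  rings; the fields \<open>mult\<close> and \<open>one\<close> play no role for modules and are left undefined.
\<close>

definition ring_module :: "('a, 'r) ring_scheme \<Rightarrow> ('a, 'a) module" where
  "ring_module R = \<lparr>carrier = carrier R, mult = undefined, one = undefined,
     zero = \<zero>\<^bsub>R\<^esub>, add = add R, smult = mult R\<rparr>"

definition quot_module :: "('a, 'b, 'm) module_scheme \<Rightarrow> 'b set \<Rightarrow> ('a, 'b set) module" where
  "quot_module M N = \<lparr>carrier = a_rcosets\<^bsub>M\<^esub> N, mult = undefined, one = undefined,
     zero = N, add = (\<lambda>X Y. X <+>\<^bsub>M\<^esub> Y),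
     smult = (\<lambda>r X. N <+>\<^bsub>M\<^esub> ((\<lambda>x. r \<odot>\<^bsub>M\<^esub> x) ` X))\<rparr>"

definition prod_module :: "'i set \<Rightarrow> ('i \<Rightarrow> ('a, 'b, 'm) module_scheme) \<Rightarrow> ('a, 'i \<Rightarrow> 'b) module" where
  "prod_module I M = \<lparr>carrier = (\<Pi>\<^sub>E i\<in>I. carrier (M i)), mult = undefined, one = undefined,
     zero = (\<lambda>i\<in>I. \<zero>\<^bsub>M i\<^esub>), add = (\<lambda>f g. \<lambda>i\<in>I. f i \<oplus>\<^bsub>M i\<^esub> g i),
     smult = (\<lambda>r f. \<lambda>i\<in>I. r \<odot>\<^bsub>M i\<^esub> f i)\<rparr>"

definition pair_module ::
  "('a, 'b, 'm) module_scheme \<Rightarrow> ('a, 'c, 'n) module_scheme \<Rightarrow> ('a, 'b \<times> 'c) module" where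
  "pair_module M N = \<lparr>carrier = carrier M \<times> carrier N, mult = undefined, one = undefined,
     zero = (\<zero>\<^bsub>M\<^esub>, \<zero>\<^bsub>N\<^esub>), add = (\<lambda>(x, y) (x', y'). (x \<oplus>\<^bsub>M\<^esub> x', y \<oplus>\<^bsub>N\<^esub> y')),
     smult = (\<lambda>r (x, y). (r \<odot>\<^bsub>M\<^esub> x, r \<odot>\<^bsub>N\<^esub> y))\<rparr>"

definition module_iso ::
  "('a, 'r) ring_scheme \<Rightarrow> ('a, 'b, 'm) module_scheme \<Rightarrow> ('a, 'c, 'n) module_scheme \<Rightarrow> ('b \<Rightarrow> 'c) set" where
  "module_iso R M N = {h \<in> iso (add_monoid M) (add_monoid N).
     \<forall>r\<in>carrier R. \<forall>x\<in>carrier M. h (r \<odot>\<^bsub>M\<^esub> x) = r \<odot>\<^bsub>N\<^esub> h x}"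

definition module_isomorphic ::
  "('a, 'r) ring_scheme \<Rightarrow> ('a, 'b, 'm) module_scheme \<Rightarrow> ('a, 'c, 'n) module_scheme \<Rightarrow> bool" where
  "module_isomorphic R M N \<longleftrightarrow> module_iso R M N \<noteq> {}"

definition submodule_span ::
  "('a, 'r) ring_scheme \<Rightarrow> ('a, 'b, 'm) module_scheme \<Rightarrow> 'b set \<Rightarrow> 'b set" where
  "submodule_span R M S = \<Inter>{N. submodule N R M \<and> S \<subseteq> N}"

definition free_module :: "('a, 'r) ring_scheme \<Rightarrow> 'x set \<Rightarrow> ('a, 'x \<Rightarrow> 'a) module" where
  "free_module R X = \<lparr>carrier = {f \<in> UNIV \<rightarrow> carrier R.
       (\<forall>x. x \<notin> X \<longrightarrow> f x = \<zero>\<^bsub>R\<^esub>) \<and> finite {x. f x \<noteq> \<zero>\<^bsub>R\<^esub>}},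
     mult = undefined, one = undefined, zero = (\<lambda>x. \<zero>\<^bsub>R\<^esub>),
     add = (\<lambda>f g x. f x \<oplus>\<^bsub>R\<^esub> g x), smult = (\<lambda>r f x. r \<otimes>\<^bsub>R\<^esub> f x)\<rparr>"

definition free_gen :: "('a, 'r) ring_scheme \<Rightarrow> 'x \<Rightarrow> 'x \<Rightarrow> 'a" where
  "free_gen R x = (\<lambda>y. if y = x then \<one>\<^bsub>R\<^esub> else \<zero>\<^bsub>R\<^esub>)"

definition lin_ext ::
  "('a, 'r) ring_scheme \<Rightarrow> ('a, 'b, 'm) module_scheme \<Rightarrow> ('x \<Rightarrow> 'b) \<Rightarrow> ('x \<Rightarrow> 'a) \<Rightarrow> 'b" where
  "lin_ext R M g f = (\<Oplus>\<^bsub>M\<^esub>x\<in>{x. f x \<noteq> \<zero>\<^bsub>R\<^esub>}. f x \<odot>\<^bsub>M\<^esub> g x)"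

definition sgn_pow :: "('b, 'm) ring_scheme \<Rightarrow> nat \<Rightarrow> 'b \<Rightarrow> 'b" where
  "sgn_pow M k x = (if even k then x else \<ominus>\<^bsub>M\<^esub> x)"


section \<open>Differential graded algebras\<close>

text \<open>
  Chain dg algebras concentrated in degrees at least \<open>0\<close>: \<open>grade A d\<close> is the
  submodule of homogeneous elements of degree \<open>d\<close>.
\<close>

record ('a, 'b) dg_alg = "('a, 'b) module" +
  grade :: "nat \<Rightarrow> 'b set"
  differential :: "'b \<Rightarrow> 'b"

locale dg_algebra = module R A + ring A
  for R :: "('a, 'r) ring_scheme" and A :: "('a, 'b, 'm) dg_alg_scheme" +
  assumes smult_mult_left: "\<lbrakk>r \<in> carrier R; x \<in> carrier A; y \<in> carrier A\<rbrakk> \<Longrightarrow>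
      (r \<odot>\<^bsub>A\<^esub> x) \<otimes>\<^bsub>A\<^esub> y = r \<odot>\<^bsub>A\<^esub> (x \<otimes>\<^bsub>A\<^esub> y)"
    and smult_mult_right: "\<lbrakk>r \<in> carrier R; x \<in> carrier A; y \<in> carrier A\<rbrakk> \<Longrightarrow>
      x \<otimes>\<^bsub>A\<^esub> (r \<odot>\<^bsub>A\<^esub> y) = r \<odot>\<^bsub>A\<^esub> (x \<otimes>\<^bsub>A\<^esub> y)"
    and grade_submodule: "submodule (grade A d) R A"
    and grade_direct_sum: "x \<in> carrier A \<Longrightarrow>
      \<exists>!c. (\<forall>d. c d \<in> grade A d) \<and> finite {d. c d \<noteq> \<zero>\<^bsub>A\<^esub>} \<and>
           x = (\<Oplus>\<^bsub>A\<^esub>d\<in>{d. c d \<noteq> \<zero>\<^bsub>A\<^esub>}. c d)"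
    and one_grade: "\<one>\<^bsub>A\<^esub> \<in> grade A 0"
    and mult_grade: "\<lbrakk>x \<in> grade A d; y \<in> grade A e\<rbrakk> \<Longrightarrow> x \<otimes>\<^bsub>A\<^esub> y \<in> grade A (d + e)"
    and diff_add: "\<lbrakk>x \<in> carrier A; y \<in> carrier A\<rbrakk> \<Longrightarrow>
      differential A (x \<oplus>\<^bsub>A\<^esub> y) = differential A x \<oplus>\<^bsub>A\<^esub> differential A y"
    and diff_smult: "\<lbrakk>r \<in> carrier R; x \<in> carrier A\<rbrakk> \<Longrightarrow>
      differential A (r \<odot>\<^bsub>A\<^esub> x) = r \<odot>\<^bsub>A\<^esub> differential A x"
    and diff_grade: "x \<in> grade A (Suc d) \<Longrightarrow> differential A x \<in> grade A d"
    and diff_grade_0: "x \<in> grade A 0 \<Longrightarrow> differential A x = \<zero>\<^bsub>A\<^esub>"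
    and diff_diff: "x \<in> carrier A \<Longrightarrow> differential A (differential A x) = \<zero>\<^bsub>A\<^esub>"
    and Leibniz: "\<lbrakk>x \<in> grade A d; y \<in> carrier A\<rbrakk> \<Longrightarrow> differential A (x \<otimes>\<^bsub>A\<^esub> y) =
      differential A x \<otimes>\<^bsub>A\<^esub> y \<oplus>\<^bsub>A\<^esub> sgn_pow A d (x \<otimes>\<^bsub>A\<^esub> differential A y)"


section \<open>Tensor powers over the ground ring\<close>

text \<open>
  \<open>tensor_power R A n m\<close> is the part of internal degree \<open>m\<close> of the tensor power of \<open>A\<close>
  over \<open>R\<close> with \<open>n + 1\<close> factors. It is presented by homogeneous elementary tensors modulo
  multilinearity: a list \<open>[(d\<^sub>0, a\<^sub>0), ..., (d\<^sub>n, a\<^sub>n)]\<close> stands for the tensor of the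
  \<open>a\<^sub>i \<in> grade A d\<^sub>i\<close>. The degrees are recorded because \<open>\<zero>\<close> lies in every degree.
\<close>

definition tdeg :: "(nat \<times> 'b) list \<Rightarrow> nat" where
  "tdeg l = sum_list (map fst l)"

definition tensor_gens :: "('a, 'b, 'm) dg_alg_scheme \<Rightarrow> nat \<Rightarrow> nat \<Rightarrow> (nat \<times> 'b) list set" where
  "tensor_gens A n m = {l. length l = n + 1 \<and> (\<forall>(d, a)\<in>set l. a \<in> grade A d) \<and> tdeg l = m}"

definition tensor_free ::
  "('a, 'r) ring_scheme \<Rightarrow> ('a, 'b, 'm) dg_alg_scheme \<Rightarrow> nat \<Rightarrow> nat \<Rightarrow>
   ('a, (nat \<times> 'b) list \<Rightarrow> 'a) module" where
  "tensor_free R A n m = free_module R (tensor_gens A n m)"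

definition tensor_rels ::
  "('a, 'r) ring_scheme \<Rightarrow> ('a, 'b, 'm) dg_alg_scheme \<Rightarrow> nat \<Rightarrow> nat \<Rightarrow>
   ((nat \<times> 'b) list \<Rightarrow> 'a) set" where
  "tensor_rels R A n m = submodule_span R (tensor_free R A n m)
     ({free_gen R (u @ (d, a \<oplus>\<^bsub>A\<^esub> b) # v) \<ominus>\<^bsub>tensor_free R A n m\<^esub>
         (free_gen R (u @ (d, a) # v) \<oplus>\<^bsub>tensor_free R A n m\<^esub> free_gen R (u @ (d, b) # v)) |u d a b v.
         u @ (d, a) # v \<in> tensor_gens A n m \<and> u @ (d, b) # v \<in> tensor_gens A n m} \<union>
      {free_gen R (u @ (d, r \<odot>\<^bsub>A\<^esub> a) # v) \<ominus>\<^bsub>tensor_free R A n m\<^esub>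
         (r \<odot>\<^bsub>tensor_free R A n m\<^esub> free_gen R (u @ (d, a) # v)) |u d r a v.
         r \<in> carrier R \<and> u @ (d, a) # v \<in> tensor_gens A n m})"

definition tensor_power ::
  "('a, 'r) ring_scheme \<Rightarrow> ('a, 'b, 'm) dg_alg_scheme \<Rightarrow> nat \<Rightarrow> nat \<Rightarrow>
   ('a, ((nat \<times> 'b) list \<Rightarrow> 'a) set) module" where
  "tensor_power R A n m = quot_module (tensor_free R A n m) (tensor_rels R A n m)"

definition tensor ::
  "('a, 'r) ring_scheme \<Rightarrow> ('a, 'b, 'm) dg_alg_scheme \<Rightarrow> nat \<Rightarrow> nat \<Rightarrow>
   (nat \<times> 'b) list \<Rightarrow> ((nat \<times> 'b) list \<Rightarrow> 'a) set" where
  "tensor R A n m l = tensor_rels R A n m +>\<^bsub>tensor_free R A n m\<^esub> free_gen R l"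

text \<open>
  The linear map on a tensor power whose value on the elementary tensor \<open>l\<close> is \<open>g l\<close>, for \<open>g\<close>
  linear in each factor: the linear extension of \<open>g\<close> takes a single value on each coset.
\<close>

definition tensor_map ::
  "('a, 'r) ring_scheme \<Rightarrow> ('a, 'c, 'n) module_scheme \<Rightarrow> ((nat \<times> 'b) list \<Rightarrow> 'c) \<Rightarrow>
   ((nat \<times> 'b) list \<Rightarrow> 'a) set \<Rightarrow> 'c" where
  "tensor_map R M g X = the_elem (lin_ext R M g ` X)"


section \<open>The periodic cyclic bicomplex\<close>

definition face :: "('a, 'b, 'm) dg_alg_scheme \<Rightarrow> nat \<Rightarrow> (nat \<times> 'b) list \<Rightarrow> (nat \<times> 'b) list" where
  "face A i l = take i l @
     (fst (l ! i) + fst (l ! Suc i), snd (l ! i) \<otimes>\<^bsub>A\<^esub> snd (l ! Suc i)) # drop (i + 2) l"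

definition last_face :: "('a, 'b, 'm) dg_alg_scheme \<Rightarrow> (nat \<times> 'b) list \<Rightarrow> (nat \<times> 'b) list" where
  "last_face A l =
     (fst (last l) + fst (hd l), snd (last l) \<otimes>\<^bsub>A\<^esub> snd (hd l)) # butlast (tl l)"

text \<open>Exponent of the Koszul sign for moving the last factor to the front.\<close>

definition rot_exp :: "(nat \<times> 'b) list \<Rightarrow> nat" where
  "rot_exp l = fst (last l) * tdeg (butlast l)"

text \<open>\<open>hoch_b'\<close> and \<open>hoch_b\<close> map \<open>tensor_power R A (n + 1) m\<close> to \<open>tensor_power R A n m\<close>.\<close>

definition hoch_b' ::
  "('a, 'r) ring_scheme \<Rightarrow> ('a, 'b, 'm) dg_alg_scheme \<Rightarrow> nat \<Rightarrow> nat \<Rightarrow>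
   ((nat \<times> 'b) list \<Rightarrow> 'a) set \<Rightarrow> ((nat \<times> 'b) list \<Rightarrow> 'a) set" where
  "hoch_b' R A n m = tensor_map R (tensor_power R A n m)
     (\<lambda>l. \<Oplus>\<^bsub>tensor_power R A n m\<^esub>i\<in>{..n}.
            sgn_pow (tensor_power R A n m) i (tensor R A n m (face A i l)))"

definition hoch_b ::
  "('a, 'r) ring_scheme \<Rightarrow> ('a, 'b, 'm) dg_alg_scheme \<Rightarrow> nat \<Rightarrow> nat \<Rightarrow>
   ((nat \<times> 'b) list \<Rightarrow> 'a) set \<Rightarrow> ((nat \<times> 'b) list \<Rightarrow> 'a) set" where
  "hoch_b R A n m = tensor_map R (tensor_power R A n m)
     (\<lambda>l. (\<Oplus>\<^bsub>tensor_power R A n m\<^esub>i\<in>{..n}.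
            sgn_pow (tensor_power R A n m) i (tensor R A n m (face A i l)))
          \<oplus>\<^bsub>tensor_power R A n m\<^esub>
          sgn_pow (tensor_power R A n m) (n + 1 + rot_exp l) (tensor R A n m (last_face A l)))"

definition cyclic_t ::
  "('a, 'r) ring_scheme \<Rightarrow> ('a, 'b, 'm) dg_alg_scheme \<Rightarrow> nat \<Rightarrow> nat \<Rightarrow>
   ((nat \<times> 'b) list \<Rightarrow> 'a) set \<Rightarrow> ((nat \<times> 'b) list \<Rightarrow> 'a) set" where
  "cyclic_t R A n m = tensor_map R (tensor_power R A n m)
     (\<lambda>l. sgn_pow (tensor_power R A n m) (n + rot_exp l)
            (tensor R A n m (last l # butlast l)))"

definition cyclic_norm ::
  "('a, 'r) ring_scheme \<Rightarrow> ('a, 'b, 'm) dg_alg_scheme \<Rightarrow> nat \<Rightarrow> nat \<Rightarrow>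
   ((nat \<times> 'b) list \<Rightarrow> 'a) set \<Rightarrow> ((nat \<times> 'b) list \<Rightarrow> 'a) set" where
  "cyclic_norm R A n m X = (\<Oplus>\<^bsub>tensor_power R A n m\<^esub>j\<in>{..n}. (cyclic_t R A n m ^^ j) X)"

text \<open>
  The differential \<open>tensor_power R A n (m + 1) \<rightarrow> tensor_power R A n m\<close> induced by the one of \<open>A\<close>.
  Factors of degree \<open>0\<close> are cycles and contribute nothing.
\<close>

definition tensor_diff ::
  "('a, 'r) ring_scheme \<Rightarrow> ('a, 'b, 'm) dg_alg_scheme \<Rightarrow> nat \<Rightarrow> nat \<Rightarrow>
   ((nat \<times> 'b) list \<Rightarrow> 'a) set \<Rightarrow> ((nat \<times> 'b) list \<Rightarrow> 'a) set" where
  "tensor_diff R A n m = tensor_map R (tensor_power R A n m)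
     (\<lambda>l. \<Oplus>\<^bsub>tensor_power R A n m\<^esub>i\<in>{i. i \<le> n \<and> 0 < fst (l ! i)}.
        sgn_pow (tensor_power R A n m) (tdeg (take i l))
          (tensor R A n m (l[i := (fst (l ! i) - 1, differential A (snd (l ! i)))])))"

text \<open>
  The periodic bicomplex has columns \<open>q \<in> \<int>\<close>, each of which is the Hochschild (\<open>q\<close> even) or bar
  (\<open>q\<close> odd) complex of the dg algebra \<open>A\<close>. In total degree \<open>i\<close> the summand
  \<open>tensor_power R A n m\<close> of its column \<open>q\<close> satisfies \<open>q + n + m = i\<close>, so \<open>q\<close> is determined by
  \<open>(n, m)\<close>, every pair \<open>(n, m)\<close> occurs exactly once, and the product totalization is, for every \<open>i\<close>,
  the product over all \<open>(n, m)\<close>. (Each column has only finitely many summands in a given degree.)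
\<close>

definition periodic_tot ::
  "('a, 'r) ring_scheme \<Rightarrow> ('a, 'b, 'm) dg_alg_scheme \<Rightarrow>
   ('a, nat \<times> nat \<Rightarrow> ((nat \<times> 'b) list \<Rightarrow> 'a) set) module" where
  "periodic_tot R A = prod_module UNIV (\<lambda>(n, m). tensor_power R A n m)"

text \<open>
  The total differential from degree \<open>i\<close> to degree \<open>i - 1\<close>; below, \<open>q\<close> is the column of the target.
  Even columns carry \<open>b + (-1)\<^sup>n \<delta>\<close>, odd columns \<open>- (b' + (-1)\<^sup>n \<delta>)\<close>; the horizontal maps are
  \<open>1 - t\<close> from odd to even columns and the norm \<open>1 + t + ... + t\<^sup>n\<close> from even to odd columns.
\<close>

definition periodic_diff ::
  "('a, 'r) ring_scheme \<Rightarrow> ('a, 'b, 'm) dg_alg_scheme \<Rightarrow> int \<Rightarrow>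
   (nat \<times> nat \<Rightarrow> ((nat \<times> 'b) list \<Rightarrow> 'a) set) \<Rightarrow> nat \<times> nat \<Rightarrow> ((nat \<times> 'b) list \<Rightarrow> 'a) set" where
  "periodic_diff R A i z = (\<lambda>(n, m).
     let q = i - 1 - int n - int m; T = tensor_power R A n m in
     if even q
     then hoch_b R A n m (z (n + 1, m))
          \<oplus>\<^bsub>T\<^esub> sgn_pow T n (tensor_diff R A n m (z (n, m + 1)))
          \<oplus>\<^bsub>T\<^esub> (z (n, m) \<ominus>\<^bsub>T\<^esub> cyclic_t R A n m (z (n, m)))
     else \<ominus>\<^bsub>T\<^esub> (hoch_b' R A n m (z (n + 1, m))
              \<oplus>\<^bsub>T\<^esub> sgn_pow T n (tensor_diff R A n m (z (n, m + 1))))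
          \<oplus>\<^bsub>T\<^esub> cyclic_norm R A n m (z (n, m)))"

definition HP ::
  "('a, 'r) ring_scheme \<Rightarrow> ('a, 'b, 'm) dg_alg_scheme \<Rightarrow> int \<Rightarrow>
   ('a, (nat \<times> nat \<Rightarrow> ((nat \<times> 'b) list \<Rightarrow> 'a) set) set) module" where
  "HP R A i = quot_module
     (periodic_tot R A
        \<lparr>carrier := {z \<in> carrier (periodic_tot R A). periodic_diff R A i z = \<zero>\<^bsub>periodic_tot R A\<^esub>}\<rparr>)
     (periodic_diff R A (i + 1) ` carrier (periodic_tot R A))"


section \<open>The dg algebra obtained by killing a number\<close>

text \<open>
  The differential sends \<open>x\<^bsup>n + 1\<^esup>\<close> to \<open>p x\<^sup>n\<close> for \<open>n\<close> even and to \<open>0\<close> for \<open>n\<close> odd; it is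
  written here through the coefficients of a polynomial.
\<close>

definition dg_kill :: "('a, 'r) ring_scheme \<Rightarrow> nat \<Rightarrow> ('a, nat \<Rightarrow> 'a) dg_alg" where
  "dg_kill R p = \<lparr>carrier = carrier (UP R), mult = mult (UP R), one = \<one>\<^bsub>UP R\<^esub>,
     zero = \<zero>\<^bsub>UP R\<^esub>, add = add (UP R), smult = smult (UP R),
     grade = (\<lambda>d. (\<lambda>r. monom (UP R) r d) ` carrier R),
     differential = (\<lambda>f n. if even n then [p] \<cdot>\<^bsub>R\<^esub> f (Suc n) else \<zero>\<^bsub>R\<^esub>)\<rparr>"


lemma dg_kill_simps:
  "carrier (dg_kill R p) = carrier (UP R)" "mult (dg_kill R p) = mult (UP R)"
  "one (dg_kill R p) = one (UP R)" "zero (dg_kill R p) = zero (UP R)"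
  "add (dg_kill R p) = add (UP R)" "smult (dg_kill R p) = smult (UP R)"
  "grade (dg_kill R p) d = (\<lambda>r. monom (UP R) r d) ` carrier R"
  "differential (dg_kill R p) = (\<lambda>f n. if even n then [p] \<cdot>\<^bsub>R\<^esub> f (Suc n) else \<zero>\<^bsub>R\<^esub>)"
  by (simp_all add: dg_kill_def)

lemma dg_algebra_dg_kill:
  assumes "cring R"
  shows "dg_algebra R (dg_kill R p)"
proof -
  interpret cring R by fact
  interpret U: UP_cring R "UP R" by (simp add: UP_cring_def assms)
  let ?A = "dg_kill R p"
  let ?d = "\<lambda>f n. if even n then [p] \<cdot>\<^bsub>R\<^esub> f (Suc n) else \<zero>\<^bsub>R\<^esub>"
  have alg: "algebra R ?A"
  proof (rule algebraI)
    show "cring ?A"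
    proof (rule cringI)
      show "abelian_group ?A"
        by (rule abelian_groupI) (auto simp: dg_kill_simps intro: U.P.a_assoc U.P.a_comm U.P.add.l_inv_ex)
      show "Group.comm_monoid ?A"
        by (rule comm_monoidI) (auto simp: dg_kill_simps intro: U.P.m_assoc U.P.m_comm)
    qed (simp add: dg_kill_simps U.P.l_distr)
  qed (use assms in \<open>auto simp: dg_kill_simps U.UP_smult_l_distr U.UP_smult_r_distr
        U.UP_smult_assoc1 U.UP_smult_assoc2\<close>)
  interpret A: algebra R ?A by (rule alg)
  have cA: "carrier ?A = up R" by (simp add: dg_kill_simps UP_def)
  have addA: "(f \<oplus>\<^bsub>?A\<^esub> g) = (\<lambda>n. f n \<oplus>\<^bsub>R\<^esub> g n)" if "f \<in> carrier ?A" "g \<in> carrier ?A" for f g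
    using that unfolding cA by (simp add: dg_kill_simps UP_def)
  have smA: "(r \<odot>\<^bsub>?A\<^esub> g) = (\<lambda>n. r \<otimes>\<^bsub>R\<^esub> g n)" if "r \<in> carrier R" "g \<in> carrier ?A" for r g
    using that unfolding cA by (simp add: dg_kill_simps UP_def)
  have zA: "\<zero>\<^bsub>?A\<^esub> = (\<lambda>n. \<zero>\<^bsub>R\<^esub>)" by (simp add: dg_kill_simps UP_def)
  have val: "f n \<in> carrier R" if "f \<in> carrier ?A" for f n
    using that unfolding cA by (auto simp: up_def)
  have invA: "(\<ominus>\<^bsub>?A\<^esub> f) = (\<lambda>n. \<ominus>\<^bsub>R\<^esub> f n)" if "f \<in> carrier ?A" for f
  proof
    fix n
    have "f \<oplus>\<^bsub>?A\<^esub> (\<ominus>\<^bsub>?A\<^esub> f) = \<zero>\<^bsub>?A\<^esub>" using that by (rule A.r_neg)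
    hence "f n \<oplus>\<^bsub>R\<^esub> (\<ominus>\<^bsub>?A\<^esub> f) n = \<zero>\<^bsub>R\<^esub>"
      using that by (metis A.a_inv_closed addA zA)
    thus "(\<ominus>\<^bsub>?A\<^esub> f) n = \<ominus>\<^bsub>R\<^esub> f n"
      using that val[OF that] val[OF A.a_inv_closed[OF that]]
      by (metis a_comm minus_equality)
  qed
  have mon: "monom (UP R) r d = (\<lambda>i. if i = d then r else \<zero>\<^bsub>R\<^esub>)" if "r \<in> carrier R" for r d
    using that by (auto simp: UP_def)
  have monc: "monom (UP R) r d \<in> carrier ?A" if "r \<in> carrier R" for r d
    using that by (simp add: dg_kill_simps)
  have monc': "(\<lambda>i. if i = d then r else \<zero>\<^bsub>R\<^esub>) \<in> carrier ?A" if "r \<in> carrier R" for r d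
    using monc[OF that, of d] by (simp add: mon[OF that])
  have dc: "?d f \<in> carrier ?A" if "f \<in> carrier ?A" for f
  proof -
    from that obtain n where "bound \<zero>\<^bsub>R\<^esub> n f" by (auto simp: cA up_def)
    hence "bound \<zero>\<^bsub>R\<^esub> n (?d f)" by (auto simp: bound_def)
    thus ?thesis using val[OF that] by (auto simp: cA up_def)
  qed
  have mm: "(monom (UP R) r d \<otimes>\<^bsub>?A\<^esub> g) = (\<lambda>n. if d \<le> n then r \<otimes>\<^bsub>R\<^esub> g (n - d) else \<zero>\<^bsub>R\<^esub>)"
    if r: "r \<in> carrier R" and g: "g \<in> carrier ?A" for r d g
  proof
    fix n
    have "(monom (UP R) r d \<otimes>\<^bsub>?A\<^esub> g) n
        = (\<Oplus>\<^bsub>R\<^esub>i\<in>{..n}. (if i = d then r else \<zero>\<^bsub>R\<^esub>) \<otimes>\<^bsub>R\<^esub> g (n - i))"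
      using monc[OF r, of d] g unfolding cA mon[OF r] by (simp add: dg_kill_simps UP_def)
    also have "\<dots> = (\<Oplus>\<^bsub>R\<^esub>i\<in>{..n}. if d = i then r \<otimes>\<^bsub>R\<^esub> g (n - i) else \<zero>\<^bsub>R\<^esub>)"
      using r val[OF g] by (intro finsum_cong) (auto simp: simp_implies_def)
    also have "\<dots> = (if d \<le> n then r \<otimes>\<^bsub>R\<^esub> g (n - d) else \<zero>\<^bsub>R\<^esub>)"
    proof (cases "d \<le> n")
      case True
      thus ?thesis using r val[OF g]
        by (simp add: add.finprod_singleton[of d "{..n}" "\<lambda>i. r \<otimes>\<^bsub>R\<^esub> g (n - i)"])
    next
      case False
      hence "(\<Oplus>\<^bsub>R\<^esub>i\<in>{..n}. if d = i then r \<otimes>\<^bsub>R\<^esub> g (n - i) else \<zero>\<^bsub>R\<^esub>) = (\<Oplus>\<^bsub>R\<^esub>i\<in>{..n}. \<zero>\<^bsub>R\<^esub>)"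
        by (intro finsum_cong) (auto simp: simp_implies_def)
      thus ?thesis using False by simp
    qed
    finally show "(monom (UP R) r d \<otimes>\<^bsub>?A\<^esub> g) n = (if d \<le> n then r \<otimes>\<^bsub>R\<^esub> g (n - d) else \<zero>\<^bsub>R\<^esub>)" .
  qed
  have fs: "(\<Oplus>\<^bsub>?A\<^esub>d\<in>S. c d) n = (\<Oplus>\<^bsub>R\<^esub>d\<in>S. c d n)"
    if "finite S" "\<And>d. c d \<in> carrier ?A" for S and c :: "nat \<Rightarrow> nat \<Rightarrow> 'a" and n
    using that(1)
  proof (induction S rule: finite_induct)
    case empty thus ?case by (simp add: zA)
  next
    case (insert x F)
    show ?case using insert that(2) val[OF that(2)]
      by (simp add: addA A.finsum_closed Pi_def)
  qed
  have np: "[p] \<cdot>\<^bsub>R\<^esub> (x \<otimes>\<^bsub>R\<^esub> y) = x \<otimes>\<^bsub>R\<^esub> [p] \<cdot>\<^bsub>R\<^esub> y" "[p] \<cdot>\<^bsub>R\<^esub> (x \<otimes>\<^bsub>R\<^esub> y) = [p] \<cdot>\<^bsub>R\<^esub> x \<otimes>\<^bsub>R\<^esub> y"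
    if "x \<in> carrier R" "y \<in> carrier R" for x y
    using that by (simp_all add: add_pow_ldistr add_pow_rdistr)
  have dmon: "?d (monom (UP R) r d) = (if odd d then monom (UP R) ([p] \<cdot>\<^bsub>R\<^esub> r) (d - 1) else \<zero>\<^bsub>?A\<^esub>)"
    if "r \<in> carrier R" for r d
    using that by (auto simp: mon zA fun_eq_iff)
  show ?thesis
  proof (intro dg_algebra.intro dg_algebra_axioms.intro)
    show "module R ?A" by (rule A.module)
    show "ring ?A" by (rule cring.axioms(1)[OF A.M_cring])
    fix r x y assume r: "r \<in> carrier R" and x: "x \<in> carrier ?A" and y: "y \<in> carrier ?A"
    show "(r \<odot>\<^bsub>?A\<^esub> x) \<otimes>\<^bsub>?A\<^esub> y = r \<odot>\<^bsub>?A\<^esub> (x \<otimes>\<^bsub>?A\<^esub> y)" using r x y by (rule A.smult_assoc2)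
    show "x \<otimes>\<^bsub>?A\<^esub> (r \<odot>\<^bsub>?A\<^esub> y) = r \<odot>\<^bsub>?A\<^esub> (x \<otimes>\<^bsub>?A\<^esub> y)" using r x y
      by (metis cring.cring_simprules(14)[OF A.M_cring] A.smult_assoc2 A.smult_closed)
  next
    fix d
    show "submodule (grade ?A d) R ?A"
    proof (rule A.submoduleI)
      show "grade ?A d \<subseteq> carrier ?A" using monc by (auto simp: dg_kill_simps)
      show "\<zero>\<^bsub>?A\<^esub> \<in> grade ?A d" unfolding dg_kill_simps(7)
        by (rule image_eqI[of _ _ "\<zero>\<^bsub>R\<^esub>"]) (auto simp: mon[OF zero_closed] zA simp del: U.monom_zero)
      fix a assume "a \<in> grade ?A d"
      then obtain r where r: "r \<in> carrier R" "a = monom (UP R) r d" by (auto simp: dg_kill_simps)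
      show "\<ominus>\<^bsub>?A\<^esub> a \<in> grade ?A d" unfolding dg_kill_simps(7)
        by (rule image_eqI[of _ _ "\<ominus>\<^bsub>R\<^esub> r"]) (use r in \<open>auto simp: mon invA[OF monc'] simp del: U.monom_zero U.monom_a_inv U.monom_add U.monom_mult_smult\<close>)
      { fix s assume s: "s \<in> carrier R"
        show "s \<odot>\<^bsub>?A\<^esub> a \<in> grade ?A d" unfolding dg_kill_simps(7)
          by (rule image_eqI[of _ _ "s \<otimes>\<^bsub>R\<^esub> r"]) (use r s in \<open>auto simp: mon smA[OF _ monc'] simp del: U.monom_zero U.monom_a_inv U.monom_add U.monom_mult_smult\<close>) }
      fix b assume "b \<in> grade ?A d"
      then obtain s where s: "s \<in> carrier R" "b = monom (UP R) s d" by (auto simp: dg_kill_simps)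
      show "a \<oplus>\<^bsub>?A\<^esub> b \<in> grade ?A d" unfolding dg_kill_simps(7)
        by (rule image_eqI[of _ _ "r \<oplus>\<^bsub>R\<^esub> s"]) (use r s in \<open>auto simp: mon addA[OF monc' monc'] simp del: U.monom_zero U.monom_a_inv U.monom_add U.monom_mult_smult\<close>)
    qed
  next
    fix x assume x: "x \<in> carrier ?A"
    let ?P = "\<lambda>c. (\<forall>d. c d \<in> grade ?A d) \<and> finite {d. c d \<noteq> \<zero>\<^bsub>?A\<^esub>} \<and>
           x = (\<Oplus>\<^bsub>?A\<^esub>d\<in>{d. c d \<noteq> \<zero>\<^bsub>?A\<^esub>}. c d)"
    have key: "(\<Oplus>\<^bsub>?A\<^esub>d\<in>{d. c d \<noteq> \<zero>\<^bsub>?A\<^esub>}. c d) n = r n"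
      if c: "\<And>d. c d = monom (UP R) (r d) d" "\<And>d. r d \<in> carrier R"
        "finite {d. c d \<noteq> \<zero>\<^bsub>?A\<^esub>}" for c r n
    proof -
      have "(\<Oplus>\<^bsub>?A\<^esub>d\<in>{d. c d \<noteq> \<zero>\<^bsub>?A\<^esub>}. c d) n = (\<Oplus>\<^bsub>R\<^esub>d\<in>{d. c d \<noteq> \<zero>\<^bsub>?A\<^esub>}. c d n)"
        by (rule fs) (use c monc in auto)
      also have "\<dots> = (\<Oplus>\<^bsub>R\<^esub>d\<in>{d. c d \<noteq> \<zero>\<^bsub>?A\<^esub>}. if n = d then r d else \<zero>\<^bsub>R\<^esub>)"
        using c(1,2) by (intro finsum_cong) (auto simp: simp_implies_def mon)
      also have "\<dots> = r n"
      proof (cases "c n = \<zero>\<^bsub>?A\<^esub>")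
        case True
        hence "r n = \<zero>\<^bsub>R\<^esub>" using c(1)[of n] c(2)[of n] by (auto simp: mon zA fun_eq_iff split: if_splits)
        moreover have "(\<Oplus>\<^bsub>R\<^esub>d\<in>{d. c d \<noteq> \<zero>\<^bsub>?A\<^esub>}. if n = d then r d else \<zero>\<^bsub>R\<^esub>)
          = (\<Oplus>\<^bsub>R\<^esub>d\<in>{d. c d \<noteq> \<zero>\<^bsub>?A\<^esub>}. \<zero>\<^bsub>R\<^esub>)"
          using True by (intro finsum_cong) (auto simp: simp_implies_def)
        ultimately show ?thesis by simp
      next
        case False
        thus ?thesis using c(2,3) by (simp add: add.finprod_singleton)
      qed
      finally show ?thesis .
    qed
    let ?c = "\<lambda>d. monom (UP R) (x d) d"
    have cz: "(?c d = \<zero>\<^bsub>?A\<^esub>) = (x d = \<zero>\<^bsub>R\<^esub>)" for d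
      using val[OF x] by (auto simp: mon zA fun_eq_iff)
    obtain b where "bound \<zero>\<^bsub>R\<^esub> b x" using x by (auto simp: cA up_def)
    hence "{d. ?c d \<noteq> \<zero>\<^bsub>?A\<^esub>} \<subseteq> {..b}"
      unfolding cz by (auto simp: bound_def) (meson not_less)
    hence fin: "finite {d. ?c d \<noteq> \<zero>\<^bsub>?A\<^esub>}" by (rule finite_subset) simp
    show "\<exists>!c. ?P c"
    proof (rule ex1I[of _ ?c])
      show "?P ?c" using fin key[of ?c x] val[OF x] by (auto simp: dg_kill_simps(7))
    next
      fix c assume c: "?P c"
      then obtain r where r: "\<And>d. c d = monom (UP R) (r d) d" "\<And>d. r d \<in> carrier R"
        unfolding dg_kill_simps(7) image_iff by metis
      have "x n = r n" for n using key[of c r n] r c by metis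
      thus "c = ?c" using r(1) by auto
    qed
  next
    show "\<one>\<^bsub>?A\<^esub> \<in> grade ?A 0" unfolding dg_kill_simps(7)
      by (rule image_eqI[of _ _ "\<one>\<^bsub>R\<^esub>"]) (auto simp: dg_kill_simps)
  next
    fix x y d e assume "x \<in> grade ?A d" "y \<in> grade ?A e"
    then obtain r s where rs: "r \<in> carrier R" "x = monom (UP R) r d" "s \<in> carrier R" "y = monom (UP R) s e"
      by (auto simp: dg_kill_simps)
    show "x \<otimes>\<^bsub>?A\<^esub> y \<in> grade ?A (d + e)" unfolding dg_kill_simps(7)
      by (rule image_eqI[of _ _ "r \<otimes>\<^bsub>R\<^esub> s"]) (use rs in \<open>auto simp: dg_kill_simps\<close>)
  next
    fix x y assume x: "x \<in> carrier ?A" and y: "y \<in> carrier ?A"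
    show "differential ?A (x \<oplus>\<^bsub>?A\<^esub> y) = differential ?A x \<oplus>\<^bsub>?A\<^esub> differential ?A y"
      unfolding dg_kill_simps(8) addA[OF x y] addA[OF dc[OF x] dc[OF y]]
      using val[OF x] val[OF y] by (auto simp: fun_eq_iff add.nat_pow_distrib)
  next
    fix r x assume r: "r \<in> carrier R" and x: "x \<in> carrier ?A"
    show "differential ?A (r \<odot>\<^bsub>?A\<^esub> x) = r \<odot>\<^bsub>?A\<^esub> differential ?A x"
      unfolding dg_kill_simps(8) smA[OF r x] smA[OF r dc[OF x]]
      using val[OF x] r by (auto simp: fun_eq_iff np(1))
  next
    fix x d assume "x \<in> grade ?A (Suc d)"
    then obtain r where r: "r \<in> carrier R" "x = monom (UP R) r (Suc d)" by (auto simp: dg_kill_simps)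
    show "differential ?A x \<in> grade ?A d"
      unfolding dg_kill_simps(7,8) r(2) dmon[OF r(1)]
      by (rule image_eqI[of _ _ "if even d then [p] \<cdot>\<^bsub>R\<^esub> r else \<zero>\<^bsub>R\<^esub>"]) (use r in \<open>auto simp: zA mon\<close>)
  next
    fix x assume "x \<in> grade ?A 0"
    then obtain r where r: "r \<in> carrier R" "x = monom (UP R) r 0" by (auto simp: dg_kill_simps)
    show "differential ?A x = \<zero>\<^bsub>?A\<^esub>"
      unfolding dg_kill_simps(8) r(2) dmon[OF r(1)] by (simp add: dg_kill_simps)
  next
    fix x assume x: "x \<in> carrier ?A"
    show "differential ?A (differential ?A x) = \<zero>\<^bsub>?A\<^esub>"
      unfolding zA by (auto simp: dg_kill_simps(8) fun_eq_iff)
  next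
    fix x y d assume "x \<in> grade ?A d" and y: "y \<in> carrier ?A"
    then obtain r where r: "r \<in> carrier R" "x = monom (UP R) r d" by (auto simp: dg_kill_simps)
    have x: "x \<in> carrier ?A" using r monc by auto
    let ?s = "\<lambda>n. if even d then (x \<otimes>\<^bsub>?A\<^esub> ?d y) n else \<ominus>\<^bsub>R\<^esub> (x \<otimes>\<^bsub>?A\<^esub> ?d y) n"
    have s: "sgn_pow ?A d (x \<otimes>\<^bsub>?A\<^esub> ?d y) = ?s"
      using x dc[OF y] by (auto simp: sgn_pow_def invA)
    have sc: "sgn_pow ?A d (x \<otimes>\<^bsub>?A\<^esub> ?d y) \<in> carrier ?A"
      using x dc[OF y] by (auto simp: sgn_pow_def)
    have prc: "[p] \<cdot>\<^bsub>R\<^esub> r \<in> carrier R" using r by simp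
    have dx: "?d x \<otimes>\<^bsub>?A\<^esub> y = (\<lambda>n. if odd d \<and> d \<le> Suc n then [p] \<cdot>\<^bsub>R\<^esub> r \<otimes>\<^bsub>R\<^esub> y (Suc n - d) else \<zero>\<^bsub>R\<^esub>)"
    proof (cases "odd d")
      case True
      then obtain e where "d = Suc e" by (cases d) auto
      thus ?thesis using True using \<open>d = Suc e\<close> unfolding r(2) dmon[OF r(1)] by (simp add: mm[OF prc y] fun_eq_iff)
    next
      case False
      thus ?thesis unfolding r(2) dmon[OF r(1)] using y by (simp add: zA[symmetric])
    qed
    have "?d (x \<otimes>\<^bsub>?A\<^esub> y) = ?d x \<otimes>\<^bsub>?A\<^esub> y \<oplus>\<^bsub>?A\<^esub> sgn_pow ?A d (x \<otimes>\<^bsub>?A\<^esub> ?d y)"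
      unfolding addA[OF cring.cring_simprules(5)[OF A.M_cring, OF dc[OF x] y] sc]
      unfolding s dx
      unfolding r(2) mm[OF r(1) y] mm[OF r(1) dc[OF y]]
    proof
      fix n
      have yc: "y k \<in> carrier R" for k by (rule val[OF y])
      have odd_le: "d \<noteq> Suc n" if "even d = even n" using that by auto
      show "?d (\<lambda>n. if d \<le> n then r \<otimes>\<^bsub>R\<^esub> y (n - d) else \<zero>\<^bsub>R\<^esub>) n =
        (if odd d \<and> d \<le> Suc n then [p] \<cdot>\<^bsub>R\<^esub> r \<otimes>\<^bsub>R\<^esub> y (Suc n - d) else \<zero>\<^bsub>R\<^esub>) \<oplus>\<^bsub>R\<^esub>
        (if even d then (if d \<le> n then r \<otimes>\<^bsub>R\<^esub> ?d y (n - d) else \<zero>\<^bsub>R\<^esub>)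
         else \<ominus>\<^bsub>R\<^esub> (if d \<le> n then r \<otimes>\<^bsub>R\<^esub> ?d y (n - d) else \<zero>\<^bsub>R\<^esub>))"
      proof (cases "d \<le> n")
        case True
        hence "Suc n - d = Suc (n - d)" "even (n - d) \<longleftrightarrow> even n = even d" by auto
        thus ?thesis using True r(1) yc np[OF r(1) yc]
          by (cases "even n"; cases "even d") (simp_all add: r_neg)
      next
        case False
        thus ?thesis using r(1) yc np[OF r(1) yc] odd_le
          by (cases "even n"; cases "even d") (auto simp: le_Suc_eq)
      qed
    qed
    thus "differential ?A (x \<otimes>\<^bsub>?A\<^esub> y) =
      differential ?A x \<otimes>\<^bsub>?A\<^esub> y \<oplus>\<^bsub>?A\<^esub> sgn_pow ?A d (x \<otimes>\<^bsub>?A\<^esub> differential ?A y)"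
      unfolding dg_kill_simps(8) .
  qed
qed


section \<open>The ground ring and the modules in the conclusion\<close>

text \<open>The subring of the rationals whose denominators are prime to \<open>p\<close>.\<close>

definition localized_integers :: "nat \<Rightarrow> rat ring" where
  "localized_integers p = \<lparr>carrier = {r. \<not> int p dvd snd (quotient_of r)},
     mult = (*), one = 1, zero = 0, add = (+)\<rparr>"

definition multiples :: "('a, 'r) ring_scheme \<Rightarrow> nat \<Rightarrow> 'a set" where
  "multiples R n = (\<lambda>x. [n] \<cdot>\<^bsub>R\<^esub> x) ` carrier R"

definition ring_mod :: "('a, 'r) ring_scheme \<Rightarrow> nat \<Rightarrow> ('a, 'a set) module" where
  "ring_mod R n = quot_module (ring_module R) (multiples R n)"

text \<open>
  The limit of the modules \<open>R / p\<^sup>k\<close>; the transition map sends a coset \<open>X\<close> of \<open>p\<^bsup>k + 1\<^esup> R\<close>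
  to the coset \<open>X + p\<^sup>k R\<close>.
\<close>

definition adic_completion :: "('a, 'r) ring_scheme \<Rightarrow> nat \<Rightarrow> ('a, nat \<Rightarrow> 'a set) module" where
  "adic_completion R p = (prod_module UNIV (\<lambda>k. ring_mod R (p ^ k)))
     \<lparr>carrier := {c \<in> carrier (prod_module UNIV (\<lambda>k. ring_mod R (p ^ k))).
        \<forall>k. c (Suc k) <+>\<^bsub>R\<^esub> multiples R (p ^ k) = c k}\<rparr>"

end

theory Submission
  imports Defs
begin

text \<open>
  Let \<open>A = R//p\<close>. Over \<open>R\<close>, the tensor power of \<open>A\<close>
  with \<open>n + 1\<close> factors is free on the words \<open>[d\<^sub>0, ...,
  d\<^sub>n]\<close> of natural numbers, which stand for \<open>x\<^bsup>d\<^sub>0\<^esup>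
  \<otimes> ... \<otimes> x\<^bsup>d\<^sub>n\<^esup>\<close>. The product totalization
  therefore consists, in every degree, of all functions from the nonempty words to
  \<open>R\<close>, and the differential is a matrix of integers with finite rows
  (\<open>periodic_coord\<close>). All identities between such matrices are proved for their
  transposes, which act on integer functions of words.

  As a graded algebra \<open>A\<close> is a tensor algebra, so, as in the theory of the
  X-complex of Cuntz and Quillen, only \<open>A\<close> itself and the commutator quotient
  of its bimodule of 1-forms should matter. Both are free of rank at most one in each
  internal degree \<open>m\<close>, hence a chain of the small complex is a sequence
  \<open>x\<close> in \<open>R\<close>, with \<open>x\<^sub>0 = 0\<close> in odd degrees
  since there are no 1-forms of internal degree \<open>0\<close>. The small differential
  vanishes on even degrees and sends a sequence of odd degree to the sequence with entries
  \<open>\<lambda>\<^sub>m x\<^sub>m + p x\<^bsub>m+1\<^esub>\<close>, where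
  \<open>\<lambda>\<^sub>m\<close> is \<open>2\<close> for even \<open>m\<close> and
  \<open>- m\<close> for odd \<open>m\<close> (\<open>tot_proj_form\<close>). The projection
  to the small complex is surjective (\<open>proj_surj\<close>) and its kernel is acyclic
  (\<open>kernel_acyclic\<close>): the odd columns are contracted by inserting a unit, the
  even ones, from the third tensor factor on, by a homotopy that expands
  \<open>d(x\<^sup>k)\<close> by the Leibniz rule. A cycle in the kernel is written as a
  boundary one word length at a time, and the infinitely many corrections have a sum because
  the total complex is a product.

  Multiplication by \<open>p\<close> is injective, so the bidiagonal map \<open>x \<mapsto>
  \<lambda> x + p (shift x)\<close> is injective on the sequences with \<open>x\<^sub>0 =
  0\<close> (\<open>bidiag_inj\<close>). This gives the vanishing in odd degrees, and in
  even degrees the homology is the cokernel of the bidiagonal map. Without the superdiagonal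
  \<open>p\<close> the cokernel would be the product of \<open>R\<close> (from the index
  \<open>0\<close>), of the zero modules \<open>R/2\<close>, as \<open>p\<close> is odd, and
  of the modules \<open>R/m\<close> for odd \<open>m\<close>. The superdiagonal can be
  removed by changes of coordinates in the source and in the target
  (\<open>bidiag_Top\<close>). Their entries are products of fractions \<open>-
  p/\<lambda>\<^sub>l\<close>; taken over windows of length \<open>2
  v\<^sub>p(\<lambda>\<^sub>n)\<close> these are integral at \<open>p\<close>, and both
  changes of coordinates are congruent to the identity modulo \<open>p\<close>. They can
  therefore be inverted modulo each power of \<open>p\<close>. Modulo odd \<open>m\<close> a
  finite precision determines the new coordinate of index \<open>m\<close>, because
  \<open>m\<close> divides \<open>p\<^sup>m\<close> in \<open>R\<close>, whereas the
  coordinate of index \<open>0\<close> is determined only as an element of the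
  \<open>p\<close>-adic completion. The resulting map \<open>compare\<close> has the image
  of the bidiagonal map as its kernel (\<open>compare_eq_iff\<close>), where
  torsion-freeness is used once more (\<open>approx_imp_bidiag\<close>), and it is
  surjective (\<open>compare_surj\<close>).
\<close>

section \<open>The periodic differential on words of exponents\<close>

definition sg :: "nat \<Rightarrow> int" where "sg k = (- 1) ^ k"

lemma sg_simps [simp]: "sg 0 = 1" "sg (Suc k) = - sg k" "sg k * sg k = 1" "sg k * (sg k * x) = x"
  by (auto simp: sg_def simp flip: power_add mult.assoc)

lemma sg_add: "sg (a + b) = sg a * sg b"
  by (simp add: sg_def power_add)

lemma sg_cong: "even a = even b \<Longrightarrow> sg a = sg b"
  by (simp add: sg_def minus_one_power_iff)

lemma sg_parity: "sg k = (if even k then 1 else -1)"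
  by (simp add: sg_def minus_one_power_iff)

text \<open>
  The operators below act on functions \<open>\<xi>\<close> of words and are transposed to
  the operators of the periodic complex: \<open>bar\<close> to \<open>b'\<close>,
  \<open>hoch\<close> to \<open>b\<close>, \<open>rot\<close> to the cyclic operator
  \<open>t\<close>, \<open>norm_op\<close> to the norm and \<open>delta_op\<close> to the
  internal differential \<open>\<delta>\<close>. Products of the operators occur in the
  opposite order: a word \<open>d\<close> is first sent to a combination of words and
  \<open>\<xi>\<close> is evaluated there. The recursion for \<open>bar\<close> splits off
  the face that merges the first two letters.
\<close>

fun bar :: "(nat list \<Rightarrow> int) \<Rightarrow> nat list \<Rightarrow> int" where
  "bar \<xi> (a # c # l) = \<xi> ((a + c) # l) - bar (\<lambda>e. \<xi> (a # e)) (c # l)"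
| "bar \<xi> _ = 0"

definition merge_at :: "nat \<Rightarrow> nat list \<Rightarrow> nat list" where
  "merge_at i d = take i d @ (d ! i + d ! Suc i) # drop (i + 2) d"

definition face_op :: "nat \<Rightarrow> (nat list \<Rightarrow> int) \<Rightarrow> nat list \<Rightarrow> int" where
  "face_op i \<xi> d = (if Suc i < length d then sg i * \<xi> (merge_at i d) else 0)"

definition rot :: "(nat list \<Rightarrow> int) \<Rightarrow> nat list \<Rightarrow> int" where
  "rot \<xi> d = (if d = [] then 0
     else sg (length d - 1 + last d * sum_list (butlast d)) * \<xi> (last d # butlast d))"

definition hoch :: "(nat list \<Rightarrow> int) \<Rightarrow> nat list \<Rightarrow> int" where
  "hoch \<xi> d = bar \<xi> d + rot (face_op 0 \<xi>) d"

definition norm_op :: "(nat list \<Rightarrow> int) \<Rightarrow> nat list \<Rightarrow> int" where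
  "norm_op \<xi> d = (\<Sum>j<length d. (rot ^^ j) \<xi> d)"

fun delta_op :: "nat \<Rightarrow> (nat list \<Rightarrow> int) \<Rightarrow> nat list \<Rightarrow> int" where
  "delta_op p \<xi> [] = 0"
| "delta_op p \<xi> (a # l) = (if odd a then int p * \<xi> ((a - 1) # l) else 0) + sg a * delta_op p (\<lambda>e. \<xi> (a # e)) l"

lemma face0_Cons [simp]: "face_op 0 \<xi> (a # c # l) = \<xi> ((a + c) # l)" "face_op 0 \<xi> [a] = 0" "face_op 0 \<xi> [] = 0"
  by (simp_all add: face_op_def merge_at_def)

lemma rot_snoc [simp]: "rot \<xi> (l @ [c]) = sg (length l + c * sum_list l) * \<xi> (c # l)"
  by (simp add: rot_def)

lemma rot_Nil [simp]: "rot \<xi> [] = 0" by (simp add: rot_def)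

lemma length_merge_at [simp]: "Suc i < length d \<Longrightarrow> length (merge_at i d) = length d - 1"
  by (auto simp: merge_at_def)

lemma sum_merge_at [simp]: "Suc i < length d \<Longrightarrow> sum_list (merge_at i d) = sum_list d"
proof (induction d arbitrary: i)
  case (Cons a d)
  thus ?case
    by (cases i; cases d) (auto simp: merge_at_def)
qed simp

lemma merge_at_not_Nil [simp]: "merge_at i d \<noteq> []"
  by (simp add: merge_at_def)

lemma merge_at_Cons: "merge_at (Suc i) (a # d) = a # merge_at i d"
  by (simp add: merge_at_def)

lemma merge_at_snoc: "Suc i < length d \<Longrightarrow> merge_at i (d @ [c]) = merge_at i d @ [c]"
  by (auto simp: merge_at_def nth_append)

lemma bar_eq_sum: "bar \<xi> d = (\<Sum>i<length d - 1. face_op i \<xi> d)"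
proof (induction \<xi> d rule: bar.induct)
  case (1 \<xi> a c l)
  have "(\<Sum>i<length (a # c # l) - 1. face_op i \<xi> (a # c # l))
      = face_op 0 \<xi> (a # c # l) + (\<Sum>i<length l. face_op (Suc i) \<xi> (a # c # l))"
    by (simp add: sum.lessThan_Suc_shift del: sum.lessThan_Suc)
  also have "(\<Sum>i<length l. face_op (Suc i) \<xi> (a # c # l)) = - (\<Sum>i<length l. face_op i (\<lambda>e. \<xi> (a # e)) (c # l))"
    by (simp add: face_op_def merge_at_Cons flip: sum_negf)
  finally show ?case using 1 by simp
qed auto

lemma bar_cong:
  assumes "\<And>e. \<lbrakk>length e = length d - 1; sum_list e = sum_list d; e \<noteq> []\<rbrakk> \<Longrightarrow> \<xi> e = \<eta> e"
  shows "bar \<xi> d = bar \<eta> d"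
proof -
  have "face_op i \<xi> d = face_op i \<eta> d" for i
    unfolding face_op_def using assms[of "merge_at i d"] by auto
  thus ?thesis by (simp add: bar_eq_sum)
qed

lemma rot_cong:
  assumes "\<And>e. \<lbrakk>length e = length d; sum_list e = sum_list d; e \<noteq> []\<rbrakk> \<Longrightarrow> \<xi> e = \<eta> e"
  shows "rot \<xi> d = rot \<eta> d"
proof (cases d rule: rev_cases)
  case (snoc l c)
  show ?thesis using assms[of "c # l"] by (simp add: snoc)
qed simp

lemma face_op_cong:
  assumes "\<And>e. \<lbrakk>length e = length d - 1; sum_list e = sum_list d; e \<noteq> []\<rbrakk> \<Longrightarrow> \<xi> e = \<eta> e"
  shows "face_op i \<xi> d = face_op i \<eta> d"
  unfolding face_op_def using assms[of "merge_at i d"] by auto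

lemma hoch_cong:
  assumes "\<And>e. \<lbrakk>length e = length d - 1; sum_list e = sum_list d; e \<noteq> []\<rbrakk> \<Longrightarrow> \<xi> e = \<eta> e"
  shows "hoch \<xi> d = hoch \<eta> d"
  unfolding hoch_def
  by (intro arg_cong2[of _ _ _ _ "(+)"] bar_cong rot_cong face_op_cong assms) auto

lemma rotpow_cong:
  assumes "\<And>e. \<lbrakk>length e = length d; sum_list e = sum_list d; e \<noteq> []\<rbrakk> \<Longrightarrow> \<xi> e = \<eta> e"
    and "d \<noteq> []"
  shows "(rot ^^ j) \<xi> d = (rot ^^ j) \<eta> d"
  using assms
proof (induction j arbitrary: d)
  case (Suc j)
  show ?case unfolding funpow.simps o_def
    by (rule rot_cong, rule Suc.IH) (use Suc.prems in auto)
qed auto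

lemma norm_op_cong:
  assumes "\<And>e. \<lbrakk>length e = length d; sum_list e = sum_list d; e \<noteq> []\<rbrakk> \<Longrightarrow> \<xi> e = \<eta> e"
  shows "norm_op \<xi> d = norm_op \<eta> d"
  unfolding norm_op_def by (cases "d = []") (auto intro!: sum.cong rotpow_cong assms)

lemma delta_op_cong:
  assumes "\<And>e. \<lbrakk>length e = length d; Suc (sum_list e) = sum_list d; e \<noteq> []\<rbrakk> \<Longrightarrow> \<xi> e = \<eta> e"
  shows "delta_op p \<xi> d = delta_op p \<eta> d"
  using assms
proof (induction d arbitrary: \<xi> \<eta>)
  case (Cons a l)
  have "delta_op p (\<lambda>e. \<xi> (a # e)) l = delta_op p (\<lambda>e. \<eta> (a # e)) l"
    by (rule Cons.IH) (auto intro!: Cons.prems)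
  moreover have "\<xi> ((a - 1) # l) = \<eta> ((a - 1) # l)" if "odd a"
    by (rule Cons.prems) (use that in \<open>auto elim: oddE\<close>)
  ultimately show ?case by auto
qed simp

lemma bar_lin: "bar (\<lambda>e. x * \<xi> e + y * \<eta> e) d = x * bar \<xi> d + y * bar \<eta> d"
  by (simp add: bar_eq_sum face_op_def sum.distrib sum_distrib_left algebra_simps if_distrib cong: if_cong)
     (auto simp: algebra_simps sum_distrib_left simp flip: sum.distrib intro!: sum.cong)

lemma rot_lin: "rot (\<lambda>e. x * \<xi> e + y * \<eta> e) d = x * rot \<xi> d + y * rot \<eta> d"
  by (simp add: rot_def algebra_simps)

lemma face_op_lin: "face_op i (\<lambda>e. x * \<xi> e + y * \<eta> e) d = x * face_op i \<xi> d + y * face_op i \<eta> d"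
  by (simp add: face_op_def algebra_simps)

lemma hoch_lin: "hoch (\<lambda>e. x * \<xi> e + y * \<eta> e) d = x * hoch \<xi> d + y * hoch \<eta> d"
  by (simp add: hoch_def bar_lin face_op_lin[abs_def] rot_lin algebra_simps)

lemma rotpow_lin: "(rot ^^ j) (\<lambda>e. x * \<xi> e + y * \<eta> e) d = x * (rot ^^ j) \<xi> d + y * (rot ^^ j) \<eta> d"
proof (induction j arbitrary: d)
  case (Suc j)
  have "(rot ^^ j) (\<lambda>e. x * \<xi> e + y * \<eta> e) = (\<lambda>e. x * (rot ^^ j) \<xi> e + y * (rot ^^ j) \<eta> e)"
    using Suc by blast
  thus ?case by (simp add: rot_lin)
qed simp

lemma norm_op_lin: "norm_op (\<lambda>e. x * \<xi> e + y * \<eta> e) d = x * norm_op \<xi> d + y * norm_op \<eta> d"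
  by (simp add: norm_op_def rotpow_lin sum.distrib sum_distrib_left)

lemma delta_op_lin: "delta_op p (\<lambda>e. x * \<xi> e + y * \<eta> e) d = x * delta_op p \<xi> d + y * delta_op p \<eta> d"
  by (induction d arbitrary: \<xi> \<eta>) (simp_all add: algebra_simps)

abbreviation addhd :: "nat \<Rightarrow> nat list \<Rightarrow> nat list" where
  "addhd a e \<equiv> (a + hd e) # tl e"

lemma bar_addhd: "bar \<xi> ((a + c) # l) = bar (\<lambda>e. \<xi> (addhd a e)) (c # l)"
proof (cases l)
  case (Cons b l')
  have "bar (\<lambda>e. \<xi> ((a + c) # e)) (b # l') = bar (\<lambda>e. \<xi> (addhd a (c # e))) (b # l')" by simp
  thus ?thesis by (simp add: Cons add.assoc)
qed simp

text \<open>
  Merging at the front commutes up to sign with all faces but the first one, and with the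
  first one it gives two consecutive merges at the front.
\<close>

lemma bar_face0: "face_op 0 (bar \<xi>) d + bar (face_op 0 \<xi>) d = face_op 0 (face_op 0 \<xi>) d"
proof (cases d rule: remdups_adj.cases)
  case (3 a c l)
  have "bar (\<lambda>e. face_op 0 \<xi> (a # e)) (c # l) = bar (\<lambda>e. \<xi> (addhd a e)) (c # l)"
    by (rule bar_cong) (auto simp: neq_Nil_conv)
  thus ?thesis using 3 by (simp add: bar_addhd)
qed auto

lemma bar_bar: "bar (bar \<xi>) d = 0"
proof (induction d arbitrary: \<xi> rule: length_induct)
  case (1 d)
  show ?case
  proof (cases d rule: remdups_adj.cases)
    case d: (3 a c l)
    have "bar (\<lambda>e. bar \<xi> (a # e)) (c # l) = bar (\<lambda>e. \<xi> (addhd a e) - bar (\<lambda>e. \<xi> (a # e)) e) (c # l)"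
      by (rule bar_cong) (auto simp: neq_Nil_conv)
    also have "\<dots> = bar (\<lambda>e. \<xi> (addhd a e)) (c # l) - bar (bar (\<lambda>e. \<xi> (a # e))) (c # l)"
      using bar_lin[of 1 _ "-1"] by simp
    also have "bar (bar (\<lambda>e. \<xi> (a # e))) (c # l) = 0" using 1 d by simp
    finally show ?thesis using d by (simp add: bar_addhd)
  qed auto
qed

lemma face_op_rot: "Suc (Suc i) < length d \<Longrightarrow> face_op i (rot \<xi>) d = rot (face_op (Suc i) \<xi>) d"
proof (cases d rule: rev_cases)
  case (snoc l c)
  assume "Suc (Suc i) < length d"
  hence l: "Suc i < length l" using snoc by simp
  hence "sg (length l + k) = - sg (length l - 1 + k)" for k
    by (cases "length l") auto
  thus ?thesis using l rot_snoc[of \<xi> "merge_at i l" c] by (simp add: snoc face_op_def merge_at_snoc merge_at_Cons)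
qed simp

lemma merge_at_last: "merge_at (length l) (l @ [a, c]) = l @ [a + c]"
  by (simp add: merge_at_def nth_append)

lemma face_op_last_rot: "length d = Suc (Suc n) \<Longrightarrow> face_op n (rot \<xi>) d = rot (rot (face_op 0 \<xi>)) d"
proof -
  assume d: "length d = Suc (Suc n)"
  obtain l c a where l: "d = l @ [c, a]" "length l = n"
    using d by (cases d rule: rev_cases; cases "butlast d" rule: rev_cases) auto
  have "rot (rot (face_op 0 \<xi>)) d = sg (Suc n + a * (sum_list l + c)) * rot (face_op 0 \<xi>) ((a # l) @ [c])"
    using rot_snoc[of "rot (face_op 0 \<xi>)" "l @ [c]" a] l by simp
  also have "\<dots> = sg (Suc n + a * (sum_list l + c)) * sg (Suc n + c * (a + sum_list l)) * \<xi> ((c + a) # l)"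
    unfolding rot_snoc using l by simp
  also have "sg (Suc n + a * (sum_list l + c)) * sg (Suc n + c * (a + sum_list l)) = sg ((c + a) * sum_list l)"
    unfolding sg_add[symmetric] by (rule sg_cong) auto
  finally have 1: "rot (rot (face_op 0 \<xi>)) d = sg ((c + a) * sum_list l) * \<xi> ((c + a) # l)" .
  have "face_op n (rot \<xi>) d = sg n * rot \<xi> (l @ [c + a])"
    using l merge_at_last[of l c a] by (simp add: face_op_def)
  thus ?thesis unfolding 1 using l by (simp add: sg_add)
qed

text \<open>
  The identity \<open>(1 - t) b = b' (1 - t)\<close>: conjugation by \<open>t\<close>
  shifts the faces by one, and the last summand of \<open>b\<close> is the first face
  composed with \<open>t\<close>.
\<close>

lemma bar_rot: "hoch \<xi> d - rot (hoch \<xi>) d = bar \<xi> d - bar (rot \<xi>) d"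
proof (cases "length d \<ge> 2")
  case True
  then obtain n where n: "length d = Suc (Suc n)" by (auto simp: numeral_2_eq_2 le_iff_add)
  have "bar (rot \<xi>) d = (\<Sum>i<n. rot (face_op (Suc i) \<xi>) d) + rot (rot (face_op 0 \<xi>)) d"
    using n by (simp add: bar_eq_sum face_op_rot face_op_last_rot)
  moreover have "rot (bar \<xi>) d = (\<Sum>i<Suc n. rot (face_op i \<xi>) d)"
    using n by (auto simp: rot_def bar_eq_sum sum_distrib_left algebra_simps simp flip: sum_negf intro!: sum.cong)
  moreover have "rot (hoch \<xi>) d = rot (bar \<xi>) d + rot (rot (face_op 0 \<xi>)) d"
    unfolding hoch_def using rot_lin[of 1 "bar \<xi>" 1] by simp
  moreover have "(\<Sum>i<Suc n. rot (face_op i \<xi>) d) = rot (face_op 0 \<xi>) d + (\<Sum>i<n. rot (face_op (Suc i) \<xi>) d)"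
    by (rule sum.lessThan_Suc_shift)
  ultimately show ?thesis by (simp add: hoch_def)
next
  case False
  then consider "d = []" | a where "d = [a]" by (cases d rule: remdups_adj.cases) auto
  thus ?thesis by cases (auto simp: hoch_def rot_def)
qed

lemma hoch_hoch: "hoch (hoch \<xi>) d = 0"
proof (cases "length d \<ge> 3")
  case True
  let ?f = "face_op 0 \<xi>"
  have "bar (rot ?f) d = bar ?f d - hoch ?f d + rot (hoch ?f) d" using bar_rot[of ?f d] by simp
  also have "\<dots> = rot (bar ?f) d + rot (rot (face_op 0 ?f)) d - rot (face_op 0 ?f) d"
    unfolding hoch_def using rot_lin[of 1 "bar ?f" 1 "rot (face_op 0 ?f)" d] by simp
  finally have 1: "bar (rot ?f) d = rot (bar ?f) d + rot (rot (face_op 0 ?f)) d - rot (face_op 0 ?f) d" .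
  have 2: "rot (face_op 0 (hoch \<xi>)) d = rot (face_op 0 (bar \<xi>)) d + rot (face_op 0 (rot ?f)) d"
  proof -
    have "face_op 0 (hoch \<xi>) = (\<lambda>e. 1 * face_op 0 (bar \<xi>) e + 1 * face_op 0 (rot ?f) e)"
      using face_op_lin[of 0 1 "bar \<xi>" 1 "rot ?f"] by (simp add: hoch_def[abs_def] fun_eq_iff)
    thus ?thesis by (simp only: rot_lin)
  qed
  have 3: "rot (face_op 0 (rot ?f)) d = rot (rot (face_op (Suc 0) ?f)) d"
    by (rule rot_cong, rule face_op_rot) (use True in auto)
  have 4: "face_op (Suc 0) ?f e = - face_op 0 ?f e" if "length e \<ge> 3" for e
  proof -
    from that obtain x y z w where "e = x # y # z # w" by (auto simp: numeral_3_eq_3 Suc_le_length_iff)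
    thus ?thesis by (simp add: face_op_def merge_at_def add.assoc)
  qed
  have 5: "rot (rot (face_op (Suc 0) ?f)) d = - rot (rot (face_op 0 ?f)) d"
  proof -
    have "rot (rot (face_op (Suc 0) ?f)) d = rot (rot (\<lambda>e. - face_op 0 ?f e)) d"
      by (rule rot_cong, rule rot_cong, rule 4) (use True in auto)
    thus ?thesis by (simp add: rot_def)
  qed
  have 6: "rot (face_op 0 (bar \<xi>)) d + rot (bar ?f) d = rot (face_op 0 ?f) d"
    using rot_lin[of 1 "face_op 0 (bar \<xi>)" 1 "bar ?f" d] by (simp add: bar_face0)
  have "bar (hoch \<xi>) d = bar (bar \<xi>) d + bar (rot ?f) d"
    using bar_lin[of 1 "bar \<xi>" 1 "rot ?f" d] by (simp add: hoch_def[abs_def])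
  thus ?thesis using 1 2 3 5 6 by (simp add: hoch_def[of "hoch \<xi>"] bar_bar)
next
  case False
  have 0: "hoch \<xi> [x] = 0" for x by (simp add: hoch_def rot_def)
  consider "d = []" | a where "d = [a]" | a b where "d = [a,b]"
    using False by (cases d rule: remdups_adj.cases) (auto simp: numeral_3_eq_3 not_le less_Suc_eq)
  thus ?thesis by cases (auto simp: hoch_def[of "hoch \<xi>"] rot_def 0)
qed

definition lin_op :: "((nat list \<Rightarrow> int) \<Rightarrow> nat list \<Rightarrow> int) \<Rightarrow> bool" where
  "lin_op F \<longleftrightarrow> (\<forall>x y \<xi> \<eta> d. F (\<lambda>e. x * \<xi> e + y * \<eta> e) d = x * F \<xi> d + y * F \<eta> d)"

lemma lin_op_simps:
  assumes "lin_op F"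
  shows "F (\<lambda>e. \<xi> e + \<eta> e) d = F \<xi> d + F \<eta> d"
    "F (\<lambda>e. \<xi> e - \<eta> e) d = F \<xi> d - F \<eta> d"
    "F (\<lambda>e. x * \<xi> e) d = x * F \<xi> d"
    "F (\<lambda>e. - \<xi> e) d = - F \<xi> d"
    "F (\<lambda>e. 0) d = 0"
proof -
  have *: "F (\<lambda>e. x * \<xi> e + y * \<eta> e) d = x * F \<xi> d + y * F \<eta> d" for x y \<xi> \<eta> d
    using assms by (simp add: lin_op_def)
  show "F (\<lambda>e. \<xi> e + \<eta> e) d = F \<xi> d + F \<eta> d" using *[of 1 \<xi> 1 \<eta>] by simp
  show "F (\<lambda>e. \<xi> e - \<eta> e) d = F \<xi> d - F \<eta> d" using *[of 1 \<xi> "-1" \<eta>] by simp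
  show "F (\<lambda>e. x * \<xi> e) d = x * F \<xi> d" using *[of x \<xi> 0 \<xi>] by simp
  show "F (\<lambda>e. - \<xi> e) d = - F \<xi> d" using *[of "-1" \<xi> 0 \<xi>] by simp
  show "F (\<lambda>e. 0) d = 0" using *[of 0 \<xi> 0 \<xi>] by simp
qed

lemma lin_op_sum:
  assumes "lin_op F"
  shows "F (\<lambda>e. \<Sum>i\<in>I. f i e) d = (\<Sum>i\<in>I. F (f i) d)"
  by (induction I rule: infinite_finite_induct) (simp_all add: lin_op_simps[OF assms])

lemma lin_ops: "lin_op bar" "lin_op rot" "lin_op (face_op i)" "lin_op hoch" "lin_op (rot ^^ j)" "lin_op norm_op" "lin_op (delta_op p)"
  by (simp_all add: lin_op_def bar_lin rot_lin face_op_lin hoch_lin rotpow_lin norm_op_lin delta_op_lin)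

lemmas lin = lin_ops[THEN lin_op_simps(1)] lin_ops[THEN lin_op_simps(2)]
  lin_ops[THEN lin_op_simps(3)] lin_ops[THEN lin_op_simps(4)] lin_ops[THEN lin_op_simps(5)]

lemma rotpow_append:
  "(rot ^^ length r) \<xi> (l @ r)
     = sg (Suc (length (l @ r)) * length r + sum_list r * Suc (sum_list (l @ r))) * \<xi> (r @ l)"
proof (induction r arbitrary: l rule: rev_induct)
  case (snoc c r)
  have "(rot ^^ length (r @ [c])) \<xi> (l @ r @ [c]) = rot ((rot ^^ length r) \<xi>) ((l @ r) @ [c])" by simp
  also have "\<dots> = sg (length (l @ r) + c * sum_list (l @ r)) * (rot ^^ length r) \<xi> ((c # l) @ r)"
    by (simp only: rot_snoc append_Cons)
  also have "\<dots> = (sg (length (l @ r) + c * sum_list (l @ r)) *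
      sg (Suc (length ((c # l) @ r)) * length r + sum_list r * Suc (sum_list ((c # l) @ r)))) * \<xi> (r @ c # l)"
    by (simp only: snoc mult.assoc)
  also have "sg (length (l @ r) + c * sum_list (l @ r)) *
      sg (Suc (length ((c # l) @ r)) * length r + sum_list r * Suc (sum_list ((c # l) @ r)))
    = sg (Suc (length (l @ r @ [c])) * length (r @ [c]) + sum_list (r @ [c]) * Suc (sum_list (l @ r @ [c])))"
    unfolding sg_add[symmetric] by (rule sg_cong) auto
  finally show ?case by simp
qed simp

lemma rotpow_length: "(rot ^^ length d) \<xi> d = \<xi> d"
proof -
  have "sg (Suc (length d) * length d + sum_list d * Suc (sum_list d)) = sg 0" by (rule sg_cong) auto
  thus ?thesis using rotpow_append[of d \<xi> "[]"] by simp
qed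

lemma norm_op_rot: "norm_op (rot \<xi>) d = norm_op \<xi> d"
proof -
  have "norm_op (rot \<xi>) d = (\<Sum>j<length d. (rot ^^ Suc j) \<xi> d)"
    by (simp add: norm_op_def funpow_swap1)
  also have "\<xi> d + \<dots> = (\<Sum>j<Suc (length d). (rot ^^ j) \<xi> d)"
    by (subst sum.lessThan_Suc_shift) simp
  also have "\<dots> = norm_op \<xi> d + \<xi> d" by (simp add: norm_op_def rotpow_length)
  finally show ?thesis by simp
qed

lemma rot_norm_op: "rot (norm_op \<xi>) d = norm_op \<xi> d"
proof -
  have "rot (norm_op \<xi>) d = rot (\<lambda>e. \<Sum>j<length d. (rot ^^ j) \<xi> e) d"
    by (rule rot_cong) (simp add: norm_op_def)
  also have "\<dots> = (\<Sum>j<length d. rot ((rot ^^ j) \<xi>) d)" by (rule lin_op_sum) (rule lin_ops)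
  also have "\<dots> = norm_op (rot \<xi>) d" by (simp add: norm_op_def funpow_swap1)
  finally show ?thesis by (simp add: norm_op_rot)
qed

lemma norm_op_rotpow: "norm_op ((rot ^^ i) \<xi>) d = norm_op \<xi> d"
  by (induction i) (simp_all add: norm_op_rot)

text \<open>
  All faces are conjugates of the first one by powers of \<open>t\<close>. This is what
  turns \<open>b'\<close> and \<open>b\<close> into the same operator next to the norm in
  the next lemma.
\<close>

lemma face_op_eq_conj:
  assumes "length d = Suc n" "i < n"
  shows "face_op i \<xi> d = (rot ^^ (Suc n - i)) (face_op 0 ((rot ^^ i) \<xi>)) d"
  using assms
proof (induction i arbitrary: d \<xi>)
  case 0
  thus ?case using rotpow_length[of d "face_op 0 \<xi>"] by (simp del: funpow.simps)
next
  case (Suc i)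
  let ?Y = "(rot ^^ (n - i)) (face_op 0 ((rot ^^ Suc i) \<xi>))"
  have *: "rot (face_op (Suc i) \<xi>) e = rot ?Y e" if "length e = Suc n" for e
  proof -
    have "rot (face_op (Suc i) \<xi>) e = face_op i (rot \<xi>) e"
      by (rule face_op_rot[symmetric]) (use that Suc in auto)
    also have "\<dots> = (rot ^^ (Suc n - i)) (face_op 0 ((rot ^^ i) (rot \<xi>))) e"
      by (rule Suc.IH) (use that Suc in auto)
    also have "\<dots> = rot ?Y e" using Suc.prems by (simp add: Suc_diff_le funpow_swap1)
    finally show ?thesis .
  qed
  have "face_op (Suc i) \<xi> d = (rot ^^ n) (rot (face_op (Suc i) \<xi>)) d"
    using rotpow_length[of d "face_op (Suc i) \<xi>"] Suc.prems by (simp add: funpow_swap1)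
  also have "\<dots> = (rot ^^ n) (rot ?Y) d"
    by (rule rotpow_cong) (use * Suc.prems in auto)
  also have "\<dots> = ?Y d"
    using rotpow_length[of d ?Y] Suc.prems by (simp add: funpow_swap1)
  finally show ?case by simp
qed

text \<open>
  The identity \<open>b' N = N b\<close>. As the norm absorbs \<open>t\<close> on either
  side, both composites are the first face with a norm on each side.
\<close>

lemma norm_op_bar: "norm_op (bar \<xi>) d = hoch (norm_op \<xi>) d"
proof (cases "length d")
  case (Suc n)
  let ?\<mu> = "\<lambda>e. \<Sum>j<n. (rot ^^ j) \<xi> e"
  have mu: "(rot ^^ i) ?\<mu> e = ?\<mu> e" if "length e = n" "e \<noteq> []" for i e
  proof -
    have "(rot ^^ i) ?\<mu> e = (rot ^^ i) (norm_op \<xi>) e"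
      by (rule rotpow_cong) (use that in \<open>auto simp: norm_op_def\<close>)
    also have "(rot ^^ i) (norm_op \<xi>) = norm_op \<xi>"
    proof -
      have "rot (norm_op \<xi>) = norm_op \<xi>" by (rule ext) (rule rot_norm_op)
      thus ?thesis by (induction i) simp_all
    qed
    finally show ?thesis using that by (simp add: norm_op_def)
  qed
  have "norm_op (bar \<xi>) d = norm_op (\<lambda>e. \<Sum>i<n. face_op i \<xi> e) d"
    by (rule norm_op_cong) (use Suc in \<open>simp add: bar_eq_sum\<close>)
  also have "\<dots> = (\<Sum>i<n. norm_op (face_op i \<xi>) d)" by (rule lin_op_sum) (rule lin_ops)
  also have "\<dots> = (\<Sum>i<n. norm_op (face_op 0 ((rot ^^ i) \<xi>)) d)"
  proof (rule sum.cong)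
    fix i assume "i \<in> {..<n}"
    hence "norm_op (face_op i \<xi>) d = norm_op ((rot ^^ (Suc n - i)) (face_op 0 ((rot ^^ i) \<xi>))) d"
      by (intro norm_op_cong face_op_eq_conj) (use Suc in auto)
    thus "norm_op (face_op i \<xi>) d = norm_op (face_op 0 ((rot ^^ i) \<xi>)) d" by (simp only: norm_op_rotpow)
  qed simp
  also have "\<dots> = norm_op (\<lambda>e. \<Sum>i<n. face_op 0 ((rot ^^ i) \<xi>) e) d"
    by (rule lin_op_sum[symmetric]) (rule lin_ops)
  also have "\<dots> = norm_op (face_op 0 ?\<mu>) d"
    using lin_op_sum[OF lin_ops(3), of 0 "\<lambda>i. (rot ^^ i) \<xi>" "{..<n}"] by (simp add: fun_eq_iff cong: norm_op_cong)
  finally have 1: "norm_op (bar \<xi>) d = norm_op (face_op 0 ?\<mu>) d" .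
  have "hoch (norm_op \<xi>) d = hoch ?\<mu> d"
    by (rule hoch_cong) (use Suc in \<open>simp add: norm_op_def\<close>)
  also have "\<dots> = (\<Sum>i<n. face_op i ?\<mu> d) + rot (face_op 0 ?\<mu>) d"
    using Suc by (simp add: hoch_def bar_eq_sum)
  also have "(\<Sum>i<n. face_op i ?\<mu> d) = (\<Sum>i<n. (rot ^^ (Suc n - i)) (face_op 0 ?\<mu>) d)"
  proof (rule sum.cong)
    fix i assume i: "i \<in> {..<n}"
    hence "face_op i ?\<mu> d = (rot ^^ (Suc n - i)) (face_op 0 ((rot ^^ i) ?\<mu>)) d"
      using face_op_eq_conj Suc by auto
    also have "\<dots> = (rot ^^ (Suc n - i)) (face_op 0 ?\<mu>) d"
      using Suc by (intro rotpow_cong face_op_cong mu) auto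
    finally show "face_op i ?\<mu> d = (rot ^^ (Suc n - i)) (face_op 0 ?\<mu>) d" .
  qed simp
  also have "\<dots> + rot (face_op 0 ?\<mu>) d = (\<Sum>i<Suc n. (rot ^^ (Suc n - i)) (face_op 0 ?\<mu>) d)"
    by simp
  also have "\<dots> = (\<Sum>i<Suc n. (rot ^^ Suc i) (face_op 0 ?\<mu>) d)"
    by (subst sum.nat_diff_reindex[symmetric]) (auto intro!: sum.cong simp del: funpow.simps simp: Suc_diff_le)
  also have "\<dots> = norm_op (rot (face_op 0 ?\<mu>)) d"
    using Suc by (simp add: norm_op_def funpow_swap1 del: sum.lessThan_Suc)
  finally show ?thesis using 1 by (simp add: norm_op_rot)
qed (simp add: norm_op_def hoch_def)

lemma delta_op_face0: "delta_op p (face_op 0 \<xi>) d = face_op 0 (delta_op p \<xi>) d"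
  by (cases d rule: remdups_adj.cases) (auto simp: algebra_simps sg_parity elim!: oddE)

lemma delta_op_bar: "delta_op p (bar \<xi>) d = bar (delta_op p \<xi>) d"
proof (induction d arbitrary: \<xi> rule: length_induct)
  case (1 d)
  show ?case
  proof (cases d rule: remdups_adj.cases)
    case d: (3 a c l)
    have IH: "delta_op p (bar (\<lambda>e. \<xi> (a # e))) (c # l) = bar (delta_op p (\<lambda>e. \<xi> (a # e))) (c # l)"
      using 1 d by (simp del: delta_op.simps bar.simps)
    have "delta_op p (\<lambda>e. bar \<xi> (a # e)) (c # l) = delta_op p (\<lambda>e. \<xi> (addhd a e) - bar (\<lambda>e. \<xi> (a # e)) e) (c # l)"
      by (rule delta_op_cong) (auto simp: neq_Nil_conv)
    also have "\<dots> = delta_op p (\<lambda>e. \<xi> (addhd a e)) (c # l) - bar (delta_op p (\<lambda>e. \<xi> (a # e))) (c # l)"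
      by (simp add: lin IH del: delta_op.simps)
    finally have 2: "delta_op p (\<lambda>e. bar \<xi> (a # e)) (c # l) = \<dots>" .
    have 3: "delta_op p (face_op 0 \<xi>) d = face_op 0 (delta_op p \<xi>) d" by (rule delta_op_face0)
    have 4: "delta_op p (\<lambda>e. face_op 0 \<xi> (a # e)) (c # l) = delta_op p (\<lambda>e. \<xi> (addhd a e)) (c # l)"
      by (rule delta_op_cong) (auto simp: neq_Nil_conv)
    have L: "delta_op p (bar \<xi>) d = (if odd a then int p * bar \<xi> ((a - 1) # c # l) else 0)
        + sg a * (delta_op p (\<lambda>e. \<xi> (addhd a e)) (c # l) - bar (delta_op p (\<lambda>e. \<xi> (a # e))) (c # l))"
      unfolding d delta_op.simps(2)[of p _ a] 2 ..
    have L2: "bar \<xi> ((a - 1) # c # l) = \<xi> ((a - 1 + c) # l) - bar (\<lambda>e. \<xi> ((a - 1) # e)) (c # l)"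
      by simp
    have R: "bar (delta_op p \<xi>) d = delta_op p \<xi> ((a + c) # l) - ((if odd a then int p else 0) * bar (\<lambda>e. \<xi> ((a - 1) # e)) (c # l)
        + sg a * bar (delta_op p (\<lambda>e. \<xi> (a # e))) (c # l))"
    proof -
      have "bar (\<lambda>e. delta_op p \<xi> (a # e)) (c # l)
          = bar (\<lambda>e. (if odd a then int p else 0) * \<xi> ((a - 1) # e) + sg a * delta_op p (\<lambda>e. \<xi> (a # e)) e) (c # l)"
        by (rule bar_cong) simp
      thus ?thesis unfolding d bar.simps(1)[of _ a] by (simp add: bar_lin)
    qed
    have Q: "delta_op p \<xi> ((a + c) # l) = (if odd a then int p * \<xi> ((a - 1 + c) # l) else 0) + sg a * delta_op p (\<lambda>e. \<xi> (addhd a e)) (c # l)"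
      using 3 unfolding d delta_op.simps(2)[of p _ a] 4 face0_Cons by (simp del: delta_op.simps)
    show ?thesis unfolding L L2 R Q by (simp add: algebra_simps)
  qed auto
qed

lemma delta_op_snoc: "delta_op p \<xi> (l @ [c]) = delta_op p (\<lambda>e. \<xi> (e @ [c])) l
    + sg (sum_list l) * (if odd c then int p * \<xi> (l @ [c - 1]) else 0)"
  by (induction l arbitrary: \<xi>) (auto simp: sg_add algebra_simps)

lemma delta_op_rot: "delta_op p (rot \<xi>) d = rot (delta_op p \<xi>) d"
proof (cases d rule: rev_cases)
  case (snoc l c)
  let ?s = "sg (length l + c * sum_list l)"
  have "delta_op p (\<lambda>e. rot \<xi> (e @ [c])) l = delta_op p (\<lambda>e. (?s * sg c) * \<xi> (c # e)) l"
  proof (rule delta_op_cong)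
    fix e assume "length e = length l" "Suc (sum_list e) = sum_list l"
    moreover from this have "even (sum_list e) = odd (sum_list l)" by (metis even_Suc)
    hence "sg (length l + c * sum_list e) = ?s * sg c"
      unfolding sg_add[symmetric] by (intro sg_cong) auto
    ultimately show "rot \<xi> (e @ [c]) = (?s * sg c) * \<xi> (c # e)" by simp
  qed
  also have "\<dots> = ?s * sg c * delta_op p (\<lambda>e. \<xi> (c # e)) l" by (simp add: lin)
  finally have 1: "delta_op p (\<lambda>e. rot \<xi> (e @ [c])) l = \<dots>" .
  have 2: "sg (sum_list l) * rot \<xi> (l @ [c - 1]) = ?s * \<xi> ((c - 1) # l)" if "odd c"
  proof -
    have "sg (sum_list l) * sg (length l + (c - 1) * sum_list l) = ?s"
      unfolding sg_add[symmetric] using that by (intro sg_cong) auto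
    thus ?thesis by (simp flip: mult.assoc)
  qed
  have "rot (delta_op p \<xi>) (l @ [c]) = ?s * ((if odd c then int p * \<xi> ((c - 1) # l) else 0) + sg c * delta_op p (\<lambda>e. \<xi> (c # e)) l)"
    by simp
  moreover have "delta_op p (rot \<xi>) (l @ [c]) = ?s * sg c * delta_op p (\<lambda>e. \<xi> (c # e)) l
      + (if odd c then int p * (?s * \<xi> ((c - 1) # l)) else 0)"
    unfolding delta_op_snoc 1 using 2 by (simp add: mult.left_commute)
  ultimately show ?thesis unfolding snoc by (simp add: algebra_simps)
qed simp

lemma delta_op_delta_op: "delta_op p (delta_op p \<xi>) d = 0"
proof (induction d arbitrary: \<xi>)
  case (Cons a l)
  thus ?case by (cases "odd a") (simp_all add: lin sg_parity)
qed simp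

lemma delta_op_rotpow: "delta_op p ((rot ^^ j) \<xi>) d = (rot ^^ j) (delta_op p \<xi>) d"
proof -
  have "delta_op p ((rot ^^ j) \<xi>) = (rot ^^ j) (delta_op p \<xi>)"
  proof (induction j)
    case (Suc j)
    have "delta_op p (rot ((rot ^^ j) \<xi>)) = rot (delta_op p ((rot ^^ j) \<xi>))" by (rule ext) (rule delta_op_rot)
    thus ?case using Suc by simp
  qed simp
  thus ?thesis by simp
qed

lemma delta_op_norm_op: "delta_op p (norm_op \<xi>) d = norm_op (delta_op p \<xi>) d"
proof -
  have "delta_op p (norm_op \<xi>) d = delta_op p (\<lambda>e. \<Sum>j<length d. (rot ^^ j) \<xi> e) d"
    by (rule delta_op_cong) (simp add: norm_op_def)
  thus ?thesis by (simp add: lin_op_sum[OF lin_ops(7)] delta_op_rotpow norm_op_def)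
qed

lemma delta_op_hoch: "delta_op p (hoch \<xi>) d = hoch (delta_op p \<xi>) d"
proof -
  have "delta_op p (rot (face_op 0 \<xi>)) d = rot (delta_op p (face_op 0 \<xi>)) d" by (rule delta_op_rot)
  also have "delta_op p (face_op 0 \<xi>) = face_op 0 (delta_op p \<xi>)" by (simp add: fun_eq_iff delta_op_face0)
  finally show ?thesis by (simp add: hoch_def[abs_def] lin delta_op_bar)
qed

text \<open>
  The word \<open>d\<close>, viewed in total degree \<open>i\<close>, lies in the column
  \<open>i - n - m\<close> for \<open>n + 1 = length d\<close> and \<open>m = sum_list
  d\<close>.
\<close>

definition even_col :: "int \<Rightarrow> nat list \<Rightarrow> bool" where
  "even_col i d \<longleftrightarrow> even (i + int (length d) + int (sum_list d) + 1)"

text \<open>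
  The transpose of the total differential from degree \<open>i\<close> to degree \<open>i
  - 1\<close>. In the transpose the case distinction is on the column of the source: an
  even column is mapped to itself by \<open>b \<plusminus> \<delta>\<close> and to an odd
  one by the norm, an odd column to itself by \<open>- (b' \<plusminus> \<delta>)\<close>
  and to an even one by \<open>1 - t\<close>. The value at the empty word, which is not a
  basis element, is a default.
\<close>

definition tot :: "nat \<Rightarrow> int \<Rightarrow> (nat list \<Rightarrow> int) \<Rightarrow> nat list \<Rightarrow> int" where
  "tot p i \<xi> d = (if d = [] then 0
     else if even_col i d then hoch \<xi> d + sg (length d - 1) * delta_op p \<xi> d + norm_op \<xi> d
     else - (bar \<xi> d + sg (length d - 1) * delta_op p \<xi> d) + (\<xi> d - rot \<xi> d))"

lemma tot_tot: "tot p i (tot p (i - 1) \<xi>) d = 0"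
proof (cases "d = []")
  case False
  let ?\<eta> = "tot p (i - 1) \<xi>" and ?s = "sg (length d - 1)"
  have s: "sg (length d - Suc (Suc 0)) = - ?s" if "length e = length d - 1" "e \<noteq> []" for e :: "nat list"
  proof -
    from that have "length d - 1 = Suc (length d - Suc (Suc 0))" by (cases e) auto
    thus ?thesis by simp
  qed
  have pe: "even_col (i - 1) e \<longleftrightarrow> even_col i d"
    if "(length e = length d - Suc 0 \<and> sum_list e = sum_list d) \<or>
        (length e = length d \<and> Suc (sum_list e) = sum_list d)" "e \<noteq> []" for e
  proof -
    have "int (length e) + int (sum_list e) + 1 = int (length d) + int (sum_list d)"
      using that False by (cases d) auto
    thus ?thesis unfolding even_col_def by presburger
  qed
  have ph: "even_col (i - 1) e \<longleftrightarrow> \<not> even_col i d" if "length e = length d" "sum_list e = sum_list d" for e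
    using that by (auto simp: even_col_def)
  show ?thesis
  proof (cases "even_col i d")
    case True
    have "hoch ?\<eta> d = hoch (\<lambda>e. hoch \<xi> e + (- ?s) * delta_op p \<xi> e + norm_op \<xi> e) d"
      by (rule hoch_cong) (frule (1) s, simp add: tot_def pe True)
    moreover have "delta_op p ?\<eta> d = delta_op p (\<lambda>e. hoch \<xi> e + ?s * delta_op p \<xi> e + norm_op \<xi> e) d"
      by (rule delta_op_cong) (simp add: tot_def pe True)
    moreover have "norm_op ?\<eta> d = norm_op (\<lambda>e. - (bar \<xi> e + ?s * delta_op p \<xi> e) + (\<xi> e - rot \<xi> e)) d"
      by (rule norm_op_cong) (simp add: tot_def ph True)
    moreover have "tot p i ?\<eta> d = hoch ?\<eta> d + ?s * delta_op p ?\<eta> d + norm_op ?\<eta> d"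
      using True False by (simp add: tot_def[of p i])
    ultimately show ?thesis
      by (simp add: lin hoch_hoch delta_op_hoch delta_op_delta_op delta_op_norm_op norm_op_bar norm_op_rot distrib_left)
  next
    case ev: False
    have "bar ?\<eta> d = bar (\<lambda>e. - (bar \<xi> e + (- ?s) * delta_op p \<xi> e) + (\<xi> e - rot \<xi> e)) d"
      by (rule bar_cong) (frule (1) s, simp add: tot_def pe ev)
    moreover have "delta_op p ?\<eta> d = delta_op p (\<lambda>e. - (bar \<xi> e + ?s * delta_op p \<xi> e) + (\<xi> e - rot \<xi> e)) d"
      by (rule delta_op_cong) (simp add: tot_def pe ev)
    moreover have "rot ?\<eta> d = rot (\<lambda>e. hoch \<xi> e + ?s * delta_op p \<xi> e + norm_op \<xi> e) d"
      by (rule rot_cong) (simp add: tot_def ph ev)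
    moreover have "?\<eta> d = hoch \<xi> d + ?s * delta_op p \<xi> d + norm_op \<xi> d"
      using ev False ph[of d] by (simp add: tot_def)
    moreover have "bar (rot \<xi>) d = bar \<xi> d - hoch \<xi> d + rot (hoch \<xi>) d" using bar_rot[of \<xi> d] by simp
    moreover have "tot p i ?\<eta> d = - (bar ?\<eta> d + ?s * delta_op p ?\<eta> d) + (?\<eta> d - rot ?\<eta> d)"
      using ev False by (simp add: tot_def[of p i])
    ultimately show ?thesis
      by (simp add: lin bar_bar delta_op_bar delta_op_delta_op delta_op_rot rot_norm_op distrib_left right_diff_distrib)
  qed
qed (simp add: tot_def)

lemma tot_lin: "lin_op (tot p i)"
  unfolding lin_op_def tot_def by (simp add: bar_lin rot_lin hoch_lin norm_op_lin delta_op_lin algebra_simps)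

text \<open>
  A bound on the support of the columns. It makes the rows of the transposed matrix
  finite, so that the transpose acts on arbitrary functions on words and not just on the
  finitely supported ones.
\<close>

definition local_op :: "((nat list \<Rightarrow> int) \<Rightarrow> nat list \<Rightarrow> int) \<Rightarrow> bool" where
  "local_op F \<longleftrightarrow> lin_op F \<and> (\<forall>\<xi> d. (\<forall>e. length d \<le> Suc (length e) \<longrightarrow> sum_list d \<le> Suc (sum_list e) \<longrightarrow> e \<noteq> [] \<longrightarrow> \<xi> e = 0) \<longrightarrow> F \<xi> d = 0)"

lemma local_op_zero:
  assumes "local_op F" "\<And>e. \<lbrakk>length d \<le> Suc (length e); sum_list d \<le> Suc (sum_list e); e \<noteq> []\<rbrakk> \<Longrightarrow> \<xi> e = 0"
  shows "F \<xi> d = 0"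
  using assms unfolding local_op_def by blast

lemma lin_zero: "lin_op F \<Longrightarrow> F (\<lambda>_. 0) d = 0"
  using lin_op_simps(5) .

lemma local_tot: "local_op (tot p i)"
  unfolding local_op_def
proof (intro conjI allI impI tot_lin)
  fix \<xi> :: "nat list \<Rightarrow> int" and d :: "nat list"
  assume *: "\<forall>e. length d \<le> Suc (length e) \<longrightarrow> sum_list d \<le> Suc (sum_list e) \<longrightarrow> e \<noteq> [] \<longrightarrow> \<xi> e = 0"
  have "hoch \<xi> d = hoch (\<lambda>_. 0) d" "bar \<xi> d = bar (\<lambda>_. 0) d" "rot \<xi> d = rot (\<lambda>_. 0) d" "norm_op \<xi> d = norm_op (\<lambda>_. 0) d" "delta_op p \<xi> d = delta_op p (\<lambda>_. 0) d"
    using * by (auto intro!: hoch_cong bar_cong rot_cong norm_op_cong delta_op_cong)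
  thus "tot p i \<xi> d = 0" using * by (simp add: tot_def lin_ops lin_zero)
qed

section \<open>Homotopies for the columns\<close>

definition bar_htpy :: "(nat list \<Rightarrow> int) \<Rightarrow> nat list \<Rightarrow> int" where
  "bar_htpy \<xi> d = \<xi> (0 # d)"

text \<open>
  Inserting the unit on the left contracts the complex with differential
  \<open>b'\<close>.
\<close>

lemma bar_htpy_bar: "d \<noteq> [] \<Longrightarrow> bar_htpy (bar \<xi>) d = \<xi> d - bar (bar_htpy \<xi>) d"
  by (cases d) (simp_all add: bar_htpy_def[abs_def])

text \<open>
  The Koszul sign for moving \<open>x\<^sup>j\<close> to the front of a word of internal
  degree \<open>S\<close>.
\<close>

definition shift_sign :: "nat \<Rightarrow> nat \<Rightarrow> int" where
  "shift_sign S j = sg (j * Suc S)"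

text \<open>
  By the Leibniz rule, \<open>d(x\<^sup>k)\<close> is the sum of the \<open>x\<^sup>j dx
  x\<^bsup>k-1-j\<^esup>\<close>. Correspondingly the homotopy replaces the last factor
  \<open>x\<^sup>k\<close> of a word by \<open>x\<^bsup>k-1-j\<^esup> \<otimes> x\<close>
  and moves \<open>x\<^sup>j\<close> to the first factor. The term with the letters
  \<open>[0, 0]\<close> takes care of the words that contain units, since the complex is
  not normalized.
\<close>

definition hoch_htpy :: "(nat list \<Rightarrow> int) \<Rightarrow> nat list \<Rightarrow> int" where
  "hoch_htpy \<xi> d = (if length d < 2 then 0 else
     let u = butlast d; k = last d; S = sum_list d in
     sg (length u) * ((\<Sum>j<k. shift_sign S j * \<xi> (addhd j u @ [k - 1 - j, 1])) - shift_sign S k * \<xi> (addhd k u @ [0, 0])))"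

lemma hoch_htpy_snoc: "hoch_htpy \<xi> (a # w @ [k]) = sg (Suc (length w)) *
    ((\<Sum>j<k. shift_sign (a + sum_list w + k) j * \<xi> ((j + a) # w @ [k - 1 - j, 1]))
      - shift_sign (a + sum_list w + k) k * \<xi> ((k + a) # w @ [0, 0]))"
proof -
  have "butlast (a # w @ [k]) = a # w" "last (a # w @ [k]) = k" by (simp_all add: butlast_append)
  thus ?thesis by (simp add: hoch_htpy_def add.assoc Let_def)
qed

lemma bar_snoc: "u \<noteq> [] \<Longrightarrow> bar \<xi> (u @ [z]) = bar (\<lambda>e. \<xi> (e @ [z])) u
    + sg (length u - 1) * \<xi> (butlast u @ [last u + z])"
proof (induction u arbitrary: \<xi>)
  case (Cons a u)
  show ?case
  proof (cases u)
    case (Cons b v)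
    have "bar (\<lambda>e. \<xi> (a # e)) (u @ [z]) = bar (\<lambda>e. \<xi> (a # e @ [z])) u
        + sg (length u - 1) * \<xi> (a # butlast u @ [last u + z])"
      using Cons.IH[of "\<lambda>e. \<xi> (a # e)"] Cons by simp
    thus ?thesis using Cons by simp
  qed simp
qed simp

lemma bar_snoc2: "bar \<xi> (a # w @ [c, y, z]) = bar (\<lambda>e. \<xi> (e @ [y, z])) (a # w @ [c])
    + sg (Suc (length w)) * \<xi> (a # w @ [c + y, z]) - sg (Suc (length w)) * \<xi> (a # w @ [c, y + z])"
proof -
  have "bar \<xi> (a # w @ [c, y, z]) = bar (\<lambda>e. \<xi> (e @ [z])) (a # w @ [c, y])
     - sg (Suc (length w)) * \<xi> (a # w @ [c, y + z])"
    using bar_snoc[of "a # w @ [c, y]" \<xi> z] by (simp add: butlast_append)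
  also have "bar (\<lambda>e. \<xi> (e @ [z])) (a # w @ [c, y]) = bar (\<lambda>e. \<xi> (e @ [y, z])) (a # w @ [c])
    + sg (Suc (length w)) * \<xi> (a # w @ [c + y, z])"
    using bar_snoc[of "a # w @ [c]" "\<lambda>e. \<xi> (e @ [z])" y] by (simp add: butlast_append)
  finally show ?thesis by simp
qed

lemma shift_sign_add: "shift_sign S (a + b) = shift_sign S a * shift_sign S b"
  by (simp add: shift_sign_def sg_add algebra_simps)

lemma shift_sign_0 [simp]: "shift_sign S 0 = 1" by (simp add: shift_sign_def)

text \<open>
  The bimodule of 1-forms of a tensor algebra is free, so the columns with differential
  \<open>b\<close> are exact from the third tensor factor on. In the computation all faces
  that stay away from the last letter cancel, and what remains of the sums over
  \<open>j\<close> telescopes.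
\<close>

lemma hoch_htpy_hoch:
  assumes "length d \<ge> 3"
  shows "hoch_htpy (hoch \<xi>) d + hoch (hoch_htpy \<xi>) d = \<xi> d"
proof -
  obtain a w c k where d: "d = a # w @ [c, k]"
  proof -
    obtain x k where 1: "d = x @ [k]" using assms by (cases d rule: rev_cases) auto
    then obtain y c where 2: "x = y @ [c]" using assms by (cases x rule: rev_cases) auto
    then obtain a w where "y = a # w" using assms 1 by (cases y) auto
    thus thesis using 1 2 that by simp
  qed
  define n where "n = Suc (Suc (length w))"
  define S where "S = a + sum_list w + c + k"
  let ?u = "a # w @ [c]"
  have lenu: "length ?u = n" and sumu: "sum_list ?u + k = S" by (simp_all add: n_def S_def)
  have hex: "hoch_htpy \<zeta> d = sg n * ((\<Sum>j<k. shift_sign S j * \<zeta> ((j + a) # w @ [c, k - 1 - j, 1])) - shift_sign S k * \<zeta> ((k + a) # w @ [c, 0, 0]))" for \<zeta>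
    using hoch_htpy_snoc[of \<zeta> a "w @ [c]" k] by (simp add: d n_def S_def add.assoc)
  have b: "bar \<xi> ((j + a) # w @ [c, y, z]) = bar (\<lambda>e. \<xi> (addhd j e @ [y, z])) ?u
    - sg n * \<xi> ((j + a) # w @ [c + y, z]) + sg n * \<xi> ((j + a) # w @ [c, y + z])" for j y z
    using bar_snoc2[of \<xi> "j + a" w c y z] bar_addhd[of "\<lambda>e. \<xi> (e @ [y, z])" j a "w @ [c]"]
    by (simp add: n_def)
  have l: "rot (face_op 0 \<xi>) ((j + a) # w @ [c, y, z]) = - sg n * sg (z * (j + a + sum_list w + c + y)) * \<xi> ((z + j + a) # w @ [c, y])" for j y z
    using rot_snoc[of "face_op 0 \<xi>" "(j + a) # w @ [c, y]" z] by (simp add: n_def sg_add add.assoc)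
  let ?F = "\<lambda>j. shift_sign S j * \<xi> ((j + a) # w @ [c, k - j])"
  have T12: "hoch_htpy (hoch \<xi>) d = sg n * ((\<Sum>j<k. shift_sign S j * bar (\<lambda>e. \<xi> (addhd j e @ [k - 1 - j, 1])) ?u)
      - shift_sign S k * bar (\<lambda>e. \<xi> (addhd k e @ [0, 0])) ?u)
      - ((\<Sum>j<k. shift_sign S j * \<xi> ((j + a) # w @ [c + k - 1 - j, 1])) - shift_sign S k * \<xi> ((k + a) # w @ [c, 0]))
      + (\<Sum>j<k. ?F j - ?F (Suc j))" (is "_ = sg n * (?X - ?Y) - (?Z - ?W) + ?V")
  proof -
    have 1: "shift_sign S j * hoch \<xi> ((j + a) # w @ [c, k - 1 - j, 1])
      = shift_sign S j * bar (\<lambda>e. \<xi> (addhd j e @ [k - 1 - j, 1])) ?u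
       - sg n * (shift_sign S j * \<xi> ((j + a) # w @ [c + k - 1 - j, 1])) + sg n * (?F j - ?F (Suc j))"
      if "j < k" for j
    proof -
      have e1: "c + (k - 1 - j) = c + k - 1 - j" using that by simp
      have e2: "k - 1 - j + 1 = k - j" using that by simp
      have e3: "1 + j + a = Suc j + a" "k - Suc j = k - 1 - j" by simp_all
      have "sg (1 * (j + a + sum_list w + c + (k - 1 - j))) * shift_sign S j = shift_sign S (Suc j)"
      proof -
        have "1 * (j + a + sum_list w + c + (k - 1 - j)) + 1 = S" using that by (simp add: S_def)
        hence "sg S = - sg (1 * (j + a + sum_list w + c + (k - 1 - j)))" by (metis Suc_eq_plus1 sg_simps(2))
        moreover have "shift_sign S (Suc j) = sg (Suc S) * shift_sign S j" by (simp add: shift_sign_def sg_add)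
        ultimately show ?thesis by simp
      qed
      hence 2: "shift_sign S j * (sg n * sg (1 * (j + a + sum_list w + c + (k - 1 - j))) * x) = sg n * (shift_sign S (Suc j) * x)" for x
        by (metis (no_types, opaque_lifting) mult.assoc mult.commute)
      have gen: "e * (B - s * X + s * Y + - s * t * x) = e * B - s * (e * X) + s * (e * Y - e' * x)"
        if "e * (s * t * x) = s * (e' * x)" for e s t x e' B X Y :: int
      proof -
        have "e * (B - s * X + s * Y + - s * t * x) = e * B - s * (e * X) + s * (e * Y) - e * (s * t * x)"
          by (simp add: algebra_simps)
        thus ?thesis using that by (simp add: right_diff_distrib)
      qed
      show ?thesis unfolding hoch_def b l e1 e2 e3 by (rule gen) (rule 2)
    qed
    have 3: "shift_sign S k * hoch \<xi> ((k + a) # w @ [c, 0, 0]) = shift_sign S k * bar (\<lambda>e. \<xi> (addhd k e @ [0, 0])) ?u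
       - sg n * (shift_sign S k * \<xi> ((k + a) # w @ [c, 0]))"
      unfolding hoch_def b l by (simp add: algebra_simps)
    show ?thesis unfolding hex 3
      by (subst sum.cong[OF refl 1], simp)
         (simp add: sum.distrib sum_subtractf right_diff_distrib distrib_left flip: sum_distrib_left)
  qed
  have V: "?V = ?F 0 - ?F k" by (rule sum_lessThan_telescope')
  have T3: "bar (hoch_htpy \<xi>) d = - sg n * (?X - ?Y) - sg n * hoch_htpy \<xi> (a # w @ [c + k])"
  proof -
    have "bar (hoch_htpy \<xi>) d = bar (\<lambda>e. hoch_htpy \<xi> (e @ [k])) ?u - sg n * hoch_htpy \<xi> (a # w @ [c + k])"
      using bar_snoc[of ?u "hoch_htpy \<xi>" k] by (simp add: d n_def butlast_append)
    also have "bar (\<lambda>e. hoch_htpy \<xi> (e @ [k])) ?u = bar (\<lambda>e. - sg n * ((\<Sum>j<k. shift_sign S j * \<xi> (addhd j e @ [k - 1 - j, 1])) - shift_sign S k * \<xi> (addhd k e @ [0, 0]))) ?u"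
    proof (rule bar_cong)
      fix e assume e: "length e = length ?u - 1" "sum_list e = sum_list ?u" "e \<noteq> []"
      then obtain x v where "e = x # v" by (cases e) auto
      moreover from this e have "Suc (length v) = Suc (length w)" "x + sum_list v + k = S" using sumu by auto
      ultimately show "hoch_htpy \<xi> (e @ [k]) = - sg n * ((\<Sum>j<k. shift_sign S j * \<xi> (addhd j e @ [k - 1 - j, 1])) - shift_sign S k * \<xi> (addhd k e @ [0, 0]))"
        using hoch_htpy_snoc[of \<xi> x v k] by (simp add: n_def)
    qed
    also have "\<dots> = - sg n * (?X - ?Y)"
      using lin_op_sum[OF lin_ops(1), of "\<lambda>j e. shift_sign S j * \<xi> (addhd j e @ [k - 1 - j, 1])" "{..<k}" ?u]
      by (simp only: lin)
    finally show ?thesis .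
  qed
  have T4: "rot (face_op 0 (hoch_htpy \<xi>)) d = sg n * shift_sign S k * hoch_htpy \<xi> ((k + a) # w @ [c])"
  proof -
    have "sg (k * (a + sum_list w + c)) = shift_sign S k"
      unfolding shift_sign_def by (rule sg_cong) (auto simp: S_def)
    thus ?thesis using rot_snoc[of "face_op 0 (hoch_htpy \<xi>)" ?u k] by (simp add: d n_def sg_add add.assoc)
  qed
  have H1: "- sg n * hoch_htpy \<xi> (a # w @ [c + k]) = (\<Sum>j<c + k. shift_sign S j * \<xi> ((j + a) # w @ [c + k - 1 - j, 1])) - shift_sign S (c + k) * \<xi> ((c + k + a) # w @ [0, 0])"
    using hoch_htpy_snoc[of \<xi> a w "c + k"] by (simp add: n_def S_def add.assoc)
  have H2: "sg n * shift_sign S k * hoch_htpy \<xi> ((k + a) # w @ [c]) = - (\<Sum>j<c. shift_sign S (k + j) * \<xi> ((k + j + a) # w @ [c - 1 - j, 1])) + shift_sign S (c + k) * \<xi> ((c + k + a) # w @ [0, 0])"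
  proof -
    have S': "k + a + sum_list w + c = S" by (simp add: S_def)
    have "hoch_htpy \<xi> ((k + a) # w @ [c]) = - sg n * ((\<Sum>j<c. shift_sign S j * \<xi> ((j + (k + a)) # w @ [c - 1 - j, 1])) - shift_sign S c * \<xi> ((c + (k + a)) # w @ [0, 0]))"
      using hoch_htpy_snoc[of \<xi> "k + a" w c] unfolding S' by (simp add: n_def)
    moreover have "shift_sign S k * (\<Sum>j<c. shift_sign S j * \<xi> ((j + (k + a)) # w @ [c - 1 - j, 1]))
        = (\<Sum>j<c. shift_sign S (k + j) * \<xi> ((k + j + a) # w @ [c - 1 - j, 1]))"
      by (simp add: sum_distrib_left shift_sign_add mult.assoc add.left_commute add.assoc)
    moreover have "shift_sign S k * (shift_sign S c * \<xi> ((c + (k + a)) # w @ [0, 0])) = shift_sign S (c + k) * \<xi> ((c + k + a) # w @ [0, 0])"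
      by (simp add: shift_sign_add add.assoc)
    moreover have "sg n * e * (- sg n * (A - e' * x)) = - (e * A) + e * (e' * x)" for e A e' x
      by (simp add: algebra_simps)
    ultimately show ?thesis by simp
  qed
  have split: "(\<Sum>j<c + k. shift_sign S j * \<xi> ((j + a) # w @ [c + k - 1 - j, 1]))
    = ?Z + (\<Sum>j<c. shift_sign S (k + j) * \<xi> ((k + j + a) # w @ [c - 1 - j, 1]))"
  proof -
    have "(\<Sum>j\<in>{k..<c + k}. shift_sign S j * \<xi> ((j + a) # w @ [c + k - 1 - j, 1]))
       = (\<Sum>j<c. shift_sign S (k + j) * \<xi> ((k + j + a) # w @ [c - 1 - j, 1]))"
      by (rule sum.reindex_bij_witness[of _ "\<lambda>j. k + j" "\<lambda>j. j - k"]) (auto simp: algebra_simps)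
    moreover have "{..<c + k} = {..<k} \<union> {k..<c + k}" by auto
    ultimately show ?thesis by (simp add: sum.union_disjoint ivl_disj_int)
  qed
  have "hoch_htpy (hoch \<xi>) d + hoch (hoch_htpy \<xi>) d = ?F 0"
    unfolding hoch_def[of "hoch_htpy \<xi>"] T12 T3 T4 V using H1 H2 split by (simp add: algebra_simps)
  thus ?thesis by (simp add: d)
qed

text \<open>
  The sum of the signs \<open>shift_sign\<close> for \<open>j < k\<close>: the coefficient
  with which the class of \<open>x\<^sup>a d(x\<^sup>k)\<close> in the commutator quotient
  of the 1-forms is a multiple of \<open>x\<^bsup>a+k-1\<^esup> dx\<close>.
\<close>

definition pair_coeff :: "nat \<Rightarrow> nat \<Rightarrow> int" where
  "pair_coeff a k = (if odd (a + k) then int k else if even k then 0 else 1)"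

lemma sum_shift_sign: "(\<Sum>j<k. shift_sign (a + k) j) = pair_coeff a k"
proof (cases "odd (a + k)")
  case True
  hence "shift_sign (a + k) j = 1" for j by (simp add: shift_sign_def sg_parity)
  thus ?thesis using True by (simp add: pair_coeff_def)
next
  case False
  hence "shift_sign (a + k) j = sg j" for j by (simp add: shift_sign_def sg_parity)
  moreover have "(\<Sum>j<k. sg j) = (if even k then 0 else 1)" by (induction k) (auto simp: sg_parity)
  ultimately show ?thesis using False by (simp add: pair_coeff_def)
qed

lemma hoch_triple: "hoch \<xi> [x, y, z] = \<xi> [x + y, z] - \<xi> [x, y + z] + sg (z * (x + y)) * \<xi> [z + x, y]"
  using rot_snoc[of "face_op 0 \<xi>" "[x, y]" z] by (simp add: hoch_def sg_add)

text \<open>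
  For two tensor factors the homotopy retracts a word to the multiple of \<open>[a + k -
  1, 1]\<close> that represents the same class of 1-forms.
\<close>

lemma hoch_htpy_hoch_pair: "hoch_htpy (hoch \<xi>) [a, k] = \<xi> [a, k] - pair_coeff a k * \<xi> [a + k - 1, 1]"
proof -
  let ?F = "\<lambda>j. shift_sign (a + k) j * \<xi> [j + a, k - j]"
  have 1: "shift_sign (a + k) j * hoch \<xi> [j + a, k - 1 - j, 1] = shift_sign (a + k) j * \<xi> [a + k - 1, 1] - (?F j - ?F (Suc j))"
    if "j < k" for j
  proof -
    have "sg (j + a + (k - 1 - j)) * shift_sign (a + k) j = shift_sign (a + k) (Suc j)"
    proof -
      have "Suc (j + a + (k - 1 - j)) = a + k" using that by simp
      hence "sg (j + a + (k - 1 - j)) = sg (Suc (a + k))" by (metis sg_simps(2) minus_minus)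
      thus ?thesis by (simp add: shift_sign_def sg_add)
    qed
    hence "shift_sign (a + k) j * (sg (j + a + (k - 1 - j)) * x) = shift_sign (a + k) (Suc j) * x" for x
      by (metis mult.assoc mult.commute)
    moreover have "j + a + (k - 1 - j) = a + k - 1" "k - 1 - j + 1 = k - j" "1 + (j + a) = Suc j + a" "k - 1 - j = k - Suc j"
      using that by auto
    ultimately show ?thesis unfolding hoch_triple by (simp add: right_diff_distrib distrib_left)
  qed
  have "hoch_htpy (hoch \<xi>) [a, k] = - ((\<Sum>j<k. shift_sign (a + k) j * hoch \<xi> [j + a, k - 1 - j, 1]) - shift_sign (a + k) k * hoch \<xi> [k + a, 0, 0])"
    using hoch_htpy_snoc[of "hoch \<xi>" a "[]" k] by simp
  also have "(\<Sum>j<k. shift_sign (a + k) j * hoch \<xi> [j + a, k - 1 - j, 1]) = pair_coeff a k * \<xi> [a + k - 1, 1] - (?F 0 - ?F k)"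
  proof -
    have "(\<Sum>j<k. shift_sign (a + k) j * hoch \<xi> [j + a, k - 1 - j, 1])
        = (\<Sum>j<k. shift_sign (a + k) j * \<xi> [a + k - 1, 1] - (?F j - ?F (Suc j)))"
      by (rule sum.cong[OF refl], rule 1) simp
    also have "\<dots> = (\<Sum>j<k. shift_sign (a + k) j * \<xi> [a + k - 1, 1]) - (\<Sum>j<k. ?F j - ?F (Suc j))"
      by (rule sum_subtractf)
    also have "(\<Sum>j<k. ?F j - ?F (Suc j)) = ?F 0 - ?F k" by (rule sum_lessThan_telescope')
    finally show ?thesis by (simp only: sum_shift_sign flip: sum_distrib_right)
  qed
  finally show ?thesis by (simp add: hoch_triple)
qed

section \<open>The functionals that define the projection\<close>

definition lam :: "nat \<Rightarrow> int" where "lam m = (if even m then 2 else - int m)"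

text \<open>
  The coordinate \<open>m\<close> of the projection in degree \<open>i\<close>. If
  \<open>i + m\<close> is even, then \<open>[m]\<close> lies in an even column and its
  coefficient is taken. Otherwise the words \<open>[a, k]\<close> with \<open>a + k =
  m\<close> lie in an even column and contribute the class of \<open>x\<^sup>a
  d(x\<^sup>k)\<close>, up to sign. For even \<open>i\<close> there is then also a term at
  the word \<open>[m]\<close> of an odd column. It makes up for the value of \<open>1 -
  t\<close> on words of length two.
\<close>

definition proj_form :: "int \<Rightarrow> nat \<Rightarrow> nat list \<Rightarrow> int" where
  "proj_form i m d = (if even (i + int m) then (if d = [m] then 1 else 0)
     else if even i then
       - (if d = [m] then int m else if length d = 2 \<and> sum_list d = m then int (d ! 1) else 0)
     else if length d = 2 \<and> sum_list d = m \<and> odd (d ! 1) then 1 else 0)"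

lemma proj_form_long: "3 \<le> length e \<Longrightarrow> proj_form i m e = 0"
  by (auto simp: proj_form_def)

lemma norm_op_single: "norm_op \<xi> [x] = \<xi> [x]"
  by (simp add: norm_op_def)

lemma rot_single: "rot \<xi> [x] = \<xi> [x]"
  by (simp add: rot_def)

lemma rot_pair: "rot \<xi> [x, y] = - sg (y * x) * \<xi> [y, x]"
  using rot_snoc[of \<xi> "[x]" y] by simp

lemma hoch_pair: "hoch \<xi> [x, y] = \<xi> [x + y] - sg (y * x) * \<xi> [y + x]"
  by (simp add: hoch_def rot_pair)

lemma norm_op_pair: "norm_op \<xi> [x, y] = \<xi> [x, y] - sg (y * x) * \<xi> [y, x]"
  by (simp add: norm_op_def rot_pair numeral_2_eq_2)

lemma list_cases4:
  obtains "d = []" | x where "d = [x]" | x y where "d = [x, y]" | x y z where "d = [x, y, z]" | "length d \<ge> 4"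
proof -
  consider "length d = 0" | "length d = 1" | "length d = 2" | "length d = 3" | "length d \<ge> 4" by linarith
  thus thesis
    by cases (use that in \<open>auto simp: length_Suc_conv numeral_2_eq_2 numeral_3_eq_3\<close>)
qed

text \<open>
  The projection is a chain map to the small complex with differentials \<open>0\<close>
  and \<open>\<lambda> + p shift\<close>. Both sides vanish on words of length at least
  four, so this is a comparison of coefficients on short words, by parity.
\<close>

lemma tot_proj_form: "tot p i (proj_form (i - 1) m) d
    = (if odd i then lam m * proj_form i m d + int p * proj_form i (Suc m) d else 0)"
proof (cases d rule: list_cases4)
  case 1
  thus ?thesis by (simp add: tot_def proj_form_def)
next
  case (2 x)
  show ?thesis unfolding 2
    by (auto simp: tot_def proj_form_def even_col_def lam_def hoch_def norm_op_single rot_single elim!: oddE)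
next
  case (3 x y)
  have h: "odd x \<Longrightarrow> (x - Suc 0 + y = m) = (x + y = Suc m)" "odd y \<Longrightarrow> (x + (y - Suc 0) = m) = (x + y = Suc m)"
    "odd y \<Longrightarrow> int (y - Suc 0) = int y - 1" "odd y \<Longrightarrow> even (y - Suc 0)"
    by (cases x; cases y; auto)+
  let ?\<eta> = "proj_form (i - 1) m"
  have b: "bar ?\<eta> [x, y] = ?\<eta> [x + y]" by simp
  have t: "tot p i ?\<eta> [x, y] = (if even_col i [x, y]
      then ?\<eta> [x + y] - sg (y * x) * ?\<eta> [y + x] - delta_op p ?\<eta> [x, y] + (?\<eta> [x, y] - sg (y * x) * ?\<eta> [y, x])
      else - (?\<eta> [x + y] - delta_op p ?\<eta> [x, y]) + (?\<eta> [x, y] + sg (y * x) * ?\<eta> [y, x]))"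
    unfolding tot_def b hoch_pair norm_op_pair rot_pair by simp
  consider "x + y = m" | "x + y = Suc m" | "x + y \<noteq> m" "x + y \<noteq> Suc m" by blast
  thus ?thesis
  proof cases
    case 1
    hence h': "\<not> (odd x \<and> x - Suc 0 + y = m)" "\<not> (odd y \<and> x + (y - Suc 0) = m)" using h by auto
    have d0: "delta_op p ?\<eta> [x, y] = 0" using h' by (auto simp: proj_form_def)
    show ?thesis unfolding 3 t d0 unfolding 1[symmetric]
      by (cases "even i"; cases "even x"; cases "even y") (simp_all add: proj_form_def even_col_def lam_def sg_parity add.commute)
  next
    case 2
    have m: "even m = (even x \<noteq> even y)" using arg_cong[OF 2, of even] by auto
    have m2: "y + x = Suc m" using 2 by simp
    have h': "odd x \<Longrightarrow> x - Suc 0 + y = m" "odd y \<Longrightarrow> x + (y - Suc 0) = m" using h 2 by auto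
    have h'': "odd x \<Longrightarrow> y + (x - Suc 0) = m" using h'(1) by simp
    have d0: "delta_op p ?\<eta> [x, y] = (if odd x then int p * ?\<eta> [x - Suc 0, y] else 0) + sg x * (if odd y then int p * ?\<eta> [x, y - Suc 0] else 0)"
      by simp
    show ?thesis unfolding 3 t d0
      by (cases "even i"; cases "even x"; cases "even y")
         (simp_all add: proj_form_def even_col_def lam_def sg_parity m m2 2 h h' h'' algebra_simps)
  next
    case n: 3
    have h': "\<not> (odd x \<and> x - Suc 0 + y = m)" "\<not> (odd y \<and> x + (y - Suc 0) = m)" using h(1,2) n(2) by blast+
    have d0: "delta_op p ?\<eta> [x, y] = 0" using h' by (auto simp: proj_form_def)
    show ?thesis unfolding 3 t d0 using n by (auto simp: proj_form_def)
  qed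
next
  case (4 x y z)
  have dz: "delta_op p (proj_form (i - 1) m) [x, y, z] = 0" by (simp add: proj_form_long)
  have nz: "norm_op (proj_form (i - 1) m) [x, y, z] = 0"
  proof -
    have "norm_op (proj_form (i - 1) m) [x, y, z] = norm_op (\<lambda>_. 0) [x, y, z]" by (rule norm_op_cong) (simp add: proj_form_long)
    thus ?thesis by (simp add: lin)
  qed
  have rz: "rot (proj_form (i - 1) m) [x, y, z] = 0" by (simp add: rot_def proj_form_long)
  have T: "tot p i (proj_form (i - 1) m) [x, y, z] = (if even_col i [x, y, z] then hoch (proj_form (i - 1) m) [x, y, z] else - bar (proj_form (i - 1) m) [x, y, z])"
    by (simp add: tot_def nz dz rz proj_form_long del: delta_op.simps bar.simps)
  have b: "bar (proj_form (i - 1) m) [x, y, z] = proj_form (i - 1) m [x + y, z] - proj_form (i - 1) m [x, y + z]" by simp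
  show ?thesis
  proof (cases "x + y + z = m")
    case True
    show ?thesis unfolding 4 T hoch_triple b unfolding True[symmetric]
      by (cases "even i"; cases "even x"; cases "even y"; cases "even z") (simp_all add: proj_form_def even_col_def sg_parity)
  next
    case False
    hence "proj_form (i - 1) m [x + y, z] = 0" "proj_form (i - 1) m [x, y + z] = 0" "proj_form (i - 1) m [z + x, y] = 0"
      by (auto simp: proj_form_def)
    thus ?thesis unfolding 4 T hoch_triple b by (simp add: proj_form_long)
  qed
next
  case 5
  have "tot p i (proj_form (i - 1) m) d = 0"
    by (rule local_op_zero[OF local_tot], rule proj_form_long) (use 5 in linarith)
  moreover have "proj_form i m d = 0" "proj_form i (Suc m) d = 0" by (rule proj_form_long, use 5 in linarith)+
  ultimately show ?thesis by simp
qed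

section \<open>The homotopy of the total complex\<close>

definition tot_htpy :: "int \<Rightarrow> (nat list \<Rightarrow> int) \<Rightarrow> nat list \<Rightarrow> int" where
  "tot_htpy i \<xi> d = (if d = [] then 0 else if even_col i d then hoch_htpy \<xi> d else - bar_htpy \<xi> d)"

lemma hoch_htpy_cong:
  assumes "\<And>e. \<lbrakk>length e = Suc (length d); sum_list e = sum_list d; e \<noteq> []\<rbrakk> \<Longrightarrow> \<xi> e = \<eta> e"
  shows "hoch_htpy \<xi> d = hoch_htpy \<eta> d"
proof (cases "length d < 2")
  case False
  then obtain a w k where d: "d = a # w @ [k]"
    by (cases d rule: rev_cases) (auto simp: neq_Nil_conv Suc_le_eq not_less numeral_2_eq_2 dest!: length_Suc_conv[THEN iffD1] elim: list.exhaust)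
  show ?thesis unfolding d hoch_htpy_snoc using assms d by (auto intro!: arg_cong2[where f = "(-)"] sum.cong)
qed (simp add: hoch_htpy_def)

lemma tot_htpy_cong:
  assumes "\<And>e. \<lbrakk>length e = Suc (length d); sum_list e = sum_list d; e \<noteq> []\<rbrakk> \<Longrightarrow> \<xi> e = \<eta> e"
  shows "tot_htpy i \<xi> d = tot_htpy i \<eta> d"
  using hoch_htpy_cong[OF assms] assms by (simp add: tot_htpy_def bar_htpy_def)

lemma hoch_htpy_lin: "hoch_htpy (\<lambda>e. x * \<xi> e + y * \<eta> e) d = x * hoch_htpy \<xi> d + y * hoch_htpy \<eta> d"
  by (simp add: hoch_htpy_def Let_def sum.distrib sum_distrib_left algebra_simps)

lemma tot_htpy_lin: "lin_op (tot_htpy i)"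
  by (simp add: lin_op_def tot_htpy_def bar_htpy_def hoch_htpy_lin algebra_simps)

lemma local_tot_htpy: "local_op (tot_htpy i)"
  unfolding local_op_def
proof (intro conjI allI impI tot_htpy_lin)
  fix \<xi> :: "nat list \<Rightarrow> int" and d :: "nat list"
  assume *: "\<forall>e. length d \<le> Suc (length e) \<longrightarrow> sum_list d \<le> Suc (sum_list e) \<longrightarrow> e \<noteq> [] \<longrightarrow> \<xi> e = 0"
  have "tot_htpy i \<xi> d = tot_htpy i (\<lambda>_. 0) d" by (rule tot_htpy_cong) (use * in auto)
  thus "tot_htpy i \<xi> d = 0" by (simp add: tot_htpy_lin lin_zero)
qed

lemma tot_top:
  assumes \<xi>: "\<And>e. length e = length d \<Longrightarrow> \<xi> e = 0" and d: "d \<noteq> []"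
  shows "tot p i \<xi> d = (if even_col i d then hoch \<xi> d else - bar \<xi> d)"
proof -
  have "rot \<xi> d = rot (\<lambda>_. 0) d" "norm_op \<xi> d = norm_op (\<lambda>_. 0) d" "delta_op p \<xi> d = delta_op p (\<lambda>_. 0) d"
    using \<xi> by (auto intro!: rot_cong norm_op_cong delta_op_cong)
  thus ?thesis using d \<xi> by (simp add: tot_def lin_ops lin_zero)
qed

text \<open>
  What the homotopy leaves of a function on words of a fixed length: the identity where
  the columns are contracted, the retraction to \<open>[m - 1, 1]\<close> on words of
  length two in even columns, and nothing on words of length one there.
\<close>

definition htpy_defect :: "int \<Rightarrow> (nat list \<Rightarrow> int) \<Rightarrow> nat list \<Rightarrow> int" where
  "htpy_defect i \<xi> d = (if even_col i d \<and> length d = 1 then 0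
     else if even_col i d \<and> length d = 2 then \<xi> d - pair_coeff (d ! 0) (d ! 1) * \<xi> [d ! 0 + d ! 1 - 1, 1]
     else \<xi> d)"

text \<open>
  The homotopy raises word length by one. On functions concentrated in one length, the
  length preserving parts of the total differential therefore do not contribute to the
  component considered here, and the homotopy formulas for \<open>b\<close> and
  \<open>b'\<close> apply column by column.
\<close>

lemma tot_htpy_tot:
  assumes \<xi>: "\<And>e. length e \<noteq> length d \<Longrightarrow> \<xi> e = 0" and d: "d \<noteq> []"
  shows "tot_htpy i (tot p (i + 1) \<xi>) d + tot p i (tot_htpy (i - 1) \<xi>) d = htpy_defect i \<xi> d"
proof -
  have 1: "tot_htpy i (tot p (i + 1) \<xi>) d = (if even_col i d then hoch_htpy (hoch \<xi>) d else bar_htpy (bar \<xi>) d)"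
  proof -
    have e: "tot p (i + 1) \<xi> e = (if even_col i d then hoch \<xi> e else - bar \<xi> e)"
      if "length e = Suc (length d)" "sum_list e = sum_list d" for e
      using that tot_top[of e \<xi> p "i + 1"] \<xi> by (cases "e = []") (auto simp: even_col_def)
    show ?thesis using e hoch_htpy_cong[of d "tot p (i + 1) \<xi>" "hoch \<xi>"] d by (simp add: tot_htpy_def bar_htpy_def)
  qed
  have 2: "tot p i (tot_htpy (i - 1) \<xi>) d = (if even_col i d then hoch (hoch_htpy \<xi>) d else bar (bar_htpy \<xi>) d)"
  proof -
    have z: "tot_htpy (i - 1) \<xi> e = 0" if "length e = length d" for e
    proof -
      have "tot_htpy (i - 1) \<xi> e = tot_htpy (i - 1) (\<lambda>_. 0) e" by (rule tot_htpy_cong) (use that \<xi> in auto)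
      thus ?thesis by (simp add: tot_htpy_lin lin_zero)
    qed
    have e: "tot_htpy (i - 1) \<xi> e = (if even_col i d then hoch_htpy \<xi> e else - bar_htpy \<xi> e)"
      if "length e = length d - 1" "sum_list e = sum_list d" "e \<noteq> []" for e
      using that by (cases "length d") (auto simp: tot_htpy_def even_col_def)
    have "hoch (tot_htpy (i - 1) \<xi>) d = hoch (hoch_htpy \<xi>) d" if "even_col i d"
      by (rule hoch_cong) (use e that in auto)
    moreover have "bar (tot_htpy (i - 1) \<xi>) d = - bar (bar_htpy \<xi>) d" if "\<not> even_col i d"
    proof -
      have "bar (tot_htpy (i - 1) \<xi>) d = bar (\<lambda>e. - bar_htpy \<xi> e) d" by (rule bar_cong) (use e that in auto)
      also have "\<dots> = - bar (bar_htpy \<xi>) d" by (simp add: lin)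
      finally show ?thesis .
    qed
    ultimately show ?thesis using tot_top[of d "tot_htpy (i - 1) \<xi>" p i] z d by simp
  qed
  consider "\<not> even_col i d" | "even_col i d" "length d = 1" | "even_col i d" "length d = 2" | "even_col i d" "length d \<ge> 3"
  proof -
    have "length d \<noteq> 0" using d by simp
    hence "length d = 1 \<or> length d = 2 \<or> length d \<ge> 3" by arith
    thus ?thesis using that by blast
  qed
  thus ?thesis
  proof cases
    case 1
    thus ?thesis using \<open>tot_htpy i _ d = _\<close> 2 bar_htpy_bar[OF d] by (simp add: htpy_defect_def)
  next
    case 2
    then obtain a where "d = [a]" by (auto simp: length_Suc_conv)
    thus ?thesis using 1 \<open>tot p i _ d = _\<close> 2 by (simp add: htpy_defect_def hoch_htpy_def hoch_def rot_single)
  next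
    case 3
    then obtain a c where dd: "d = [a, c]" by (auto simp: length_Suc_conv numeral_2_eq_2)
    have "hoch (hoch_htpy \<xi>) d = hoch (\<lambda>_. 0) d" by (rule hoch_cong) (use dd in \<open>auto simp: hoch_htpy_def\<close>)
    hence "hoch (hoch_htpy \<xi>) d = 0" by (simp add: lin_ops lin_zero)
    thus ?thesis using 1 2 3 hoch_htpy_hoch_pair[of \<xi> a c] by (simp add: htpy_defect_def dd)
  next
    case 4
    hence "length d \<noteq> Suc 0" "length d \<noteq> 2" by auto
    thus ?thesis using 1 2 4 hoch_htpy_hoch[OF 4(2), of \<xi>] by (simp add: htpy_defect_def)
  qed
qed

section \<open>Integrality of the changes of coordinates\<close>

definition Zp :: "nat \<Rightarrow> rat set" where "Zp p = carrier (localized_integers p)"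

lemma Zp_iff: "prime p \<Longrightarrow> r \<in> Zp p \<longleftrightarrow> (\<exists>a b. r = of_int a / of_int b \<and> \<not> int p dvd b)"
proof
  assume "r \<in> Zp p"
  thus "\<exists>a b. r = of_int a / of_int b \<and> \<not> int p dvd b"
    by (intro exI[of _ "fst (quotient_of r)"] exI[of _ "snd (quotient_of r)"])
       (auto simp: Zp_def localized_integers_def quotient_of_div)
next
  assume "prime p" "\<exists>a b. r = of_int a / of_int b \<and> \<not> int p dvd b"
  then obtain a b where ab: "r = of_int a / of_int b" "\<not> int p dvd b" by blast
  obtain c d where cd: "quotient_of r = (c, d)" by force
  have "d > 0" "coprime c d" "r = of_int c / of_int d"
    using cd quotient_of_denom_pos quotient_of_coprime quotient_of_div by auto
  moreover have "b \<noteq> 0" using ab by auto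
  ultimately have "of_int (c * b) = (of_int (a * d) :: rat)" using ab by (simp add: field_simps)
  hence "c * b = a * d" by (simp only: of_int_eq_iff)
  hence "d dvd c * b" by simp
  hence "d dvd b" using \<open>coprime c d\<close> by (simp add: coprime_commute coprime_dvd_mult_right_iff)
  hence "\<not> int p dvd d" using ab dvd_trans by blast
  thus "r \<in> Zp p" using cd by (simp add: Zp_def localized_integers_def)
qed

lemma Zp_of_int [simp]: "prime p \<Longrightarrow> of_int a \<in> Zp p"
  unfolding Zp_iff by (intro exI[of _ a] exI[of _ 1]) (auto simp: prime_nat_iff)

lemma Zp_numeral [simp]: "prime p \<Longrightarrow> 0 \<in> Zp p" "prime p \<Longrightarrow> 1 \<in> Zp p" "prime p \<Longrightarrow> of_nat n \<in> Zp p"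
  using Zp_of_int[of p 0] Zp_of_int[of p 1] Zp_of_int[of p "int n"] by simp_all

lemma Zp_mult [simp]: "prime p \<Longrightarrow> r \<in> Zp p \<Longrightarrow> s \<in> Zp p \<Longrightarrow> r * s \<in> Zp p"
  unfolding Zp_iff
proof (elim exE conjE)
  fix a b c d assume "prime p" "r = of_int a / of_int b" "\<not> int p dvd b" "s = of_int c / of_int d" "\<not> int p dvd d"
  thus "\<exists>a b. r * s = of_int a / of_int b \<and> \<not> int p dvd b"
    by (intro exI[of _ "a * c"] exI[of _ "b * d"]) (auto simp: prime_dvd_mult_iff)
qed

lemma Zp_add [simp]: "prime p \<Longrightarrow> r \<in> Zp p \<Longrightarrow> s \<in> Zp p \<Longrightarrow> r + s \<in> Zp p"
  unfolding Zp_iff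
proof (elim exE conjE)
  fix a b c d assume *: "prime p" "r = of_int a / of_int b" "\<not> int p dvd b" "s = of_int c / of_int d" "\<not> int p dvd d"
  show "\<exists>a b. r + s = of_int a / of_int b \<and> \<not> int p dvd b"
  proof (rule exI[of _ "a * d + c * b"], rule exI[of _ "b * d"])
    from * have "b \<noteq> 0" "d \<noteq> 0" by auto
    thus "r + s = of_int (a * d + c * b) / of_int (b * d) \<and> \<not> int p dvd b * d"
      using * by (simp add: prime_dvd_mult_iff add_frac_eq)
  qed
qed

lemma power_div_in_Zp:
  assumes p: "prime p" and L: "L \<noteq> 0" and e: "multiplicity (int p) L \<le> e"
  shows "of_nat p ^ e / of_int L \<in> Zp p"
proof -
  have P: "prime (int p)" using p by simp
  obtain m where m: "L = int p ^ multiplicity (int p) L * m" "\<not> int p dvd m"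
    using multiplicity_decompose'[of L "int p"] L P by (metis not_prime_unit)
  let ?k = "multiplicity (int p) L"
  have "of_nat p ^ e / of_int L = (of_nat p ^ e / of_nat p ^ ?k :: rat) / of_int m"
    by (subst m(1)) simp
  also have "(of_nat p ^ e / of_nat p ^ ?k :: rat) = of_int (int p ^ (e - ?k))"
    using e prime_gt_0_nat[OF p] power_diff[of "of_nat p :: rat" "multiplicity (int p) L" e] by simp
  finally show ?thesis unfolding Zp_iff[OF p] using m(2) by blast
qed

text \<open>
  The left-hand side is the valuation of the factorial of \<open>q\<close>. Only the
  multiples of \<open>p\<close> contribute, which leads from \<open>q\<close> to \<open>q
  div p\<close>, with \<open>2 (q div p) \<le> q\<close>.
\<close>

lemma sum_multiplicity_le:
  assumes p: "prime (p::nat)"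
  shows "(\<Sum>j=1..q. multiplicity p j) \<le> q"
proof (induction q rule: less_induct)
  case (less q)
  show ?case
  proof (cases "q = 0")
    case False
    have p2: "p \<ge> 2" using p by (rule prime_ge_2_nat)
    have "(\<Sum>j=1..q. multiplicity p j) = (\<Sum>j\<in>{j\<in>{1..q}. p dvd j}. multiplicity p j)"
      by (rule sum.mono_neutral_right) (auto simp: not_dvd_imp_multiplicity_0)
    also have "{j\<in>{1..q}. p dvd j} = (*) p ` {1..q div p}"
    proof (intro equalityI subsetI)
      fix j assume "j \<in> {j\<in>{1..q}. p dvd j}"
      then obtain k where "j = p * k" "1 \<le> p * k" "p * k \<le> q" by auto
      thus "j \<in> (*) p ` {1..q div p}"
        using p2 by (intro image_eqI[of _ _ k]) (auto simp: less_eq_div_iff_mult_less_eq mult.commute)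
    qed (use p2 in \<open>auto simp: less_eq_div_iff_mult_less_eq mult.commute\<close>)
    also have "sum (multiplicity p) \<dots> = (\<Sum>k=1..q div p. multiplicity p (p * k))"
      using p2 by (subst sum.reindex) (auto simp: inj_on_def)
    also have "\<dots> = (\<Sum>k=1..q div p. Suc (multiplicity p k))"
      using p2 p by (intro sum.cong) (auto simp: multiplicity_times_same)
    also have "\<dots> = q div p + (\<Sum>k=1..q div p. multiplicity p k)" by (simp add: sum.distrib Suc_eq_plus1 del: One_nat_def)
    also have "(\<Sum>k=1..q div p. multiplicity p k) \<le> q div p"
      using less[of "q div p"] False p2 by simp
    also have "q div p + q div p \<le> q"
    proof -
      have "2 * (q div p) \<le> p * (q div p)" using p2 by simp
      also have "\<dots> \<le> q" by simp
      finally show ?thesis by simp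
    qed
    finally show ?thesis by simp
  qed simp
qed

definition vlam :: "nat \<Rightarrow> nat \<Rightarrow> nat" where "vlam p n = multiplicity (int p) (lam n)"

lemma lam_nonzero [simp]: "lam n \<noteq> 0"
  by (auto simp: lam_def elim!: oddE)

lemma vlam_even: "prime p \<Longrightarrow> odd p \<Longrightarrow> even n \<Longrightarrow> vlam p n = 0"
proof -
  assume p: "prime p" "odd p" and n: "even n"
  have "\<not> int p dvd 2"
  proof
    assume "int p dvd 2"
    hence "p dvd 2" by (metis int_dvd_int_iff of_nat_numeral)
    hence "p = 2" using p(1) by (simp add: primes_dvd_imp_eq)
    thus False using p(2) by simp
  qed
  thus ?thesis using n by (simp add: vlam_def lam_def not_dvd_imp_multiplicity_0)
qed

lemma multiplicity_int:
  assumes "prime p" "n > 0"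
  shows "multiplicity (int p) (int n) = multiplicity p n"
proof (rule multiplicity_eqI)
  show "int p ^ multiplicity p n dvd int n"
    using multiplicity_dvd[of p n] by (metis int_dvd_int_iff of_nat_power)
  show "\<not> int p ^ Suc (multiplicity p n) dvd int n"
  proof
    assume "int p ^ Suc (multiplicity p n) dvd int n"
    hence "p ^ Suc (multiplicity p n) dvd n" by (metis int_dvd_int_iff of_nat_power)
    hence "Suc (multiplicity p n) \<le> multiplicity p n"
      using assms by (intro multiplicity_geI) (auto simp: prime_nat_iff)
    thus False by simp
  qed
qed

lemma vlam_odd: "prime p \<Longrightarrow> odd n \<Longrightarrow> vlam p n = multiplicity p n"
  using multiplicity_int[of p n] multiplicity_normalize_right[of "int p" "- int n"]
  by (auto simp: vlam_def lam_def odd_pos)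

text \<open>
  For \<open>p \<ge> 3\<close> the valuation \<open>v\<close> of
  \<open>\<lambda>\<^sub>n\<close> is so small that the window of the \<open>2 v\<close>
  indices below \<open>n\<close> is shorter than \<open>p\<^sup>v\<close> and stays away
  from \<open>0\<close>.
\<close>

lemma vlam_bound:
  assumes p: "prime p" "odd p" and n: "n \<ge> 1"
  shows "3 * vlam p n \<le> n" "2 * vlam p n < p ^ vlam p n" "odd n \<Longrightarrow> p ^ vlam p n dvd n"
proof -
  have p3: "p \<ge> 3" using p prime_ge_2_nat[of p] by (cases "p = 2") auto
  have e: "3 * v \<le> 3 ^ v" "2 * v < (3::nat) ^ v" for v
  proof -
    show "3 * v \<le> 3 ^ v"
    proof (induction v)
      case (Suc v)
      thus ?case by (cases v) auto
    qed simp
    show "2 * v < (3::nat) ^ v" by (induction v) auto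
  qed
  have le: "(3::nat) ^ v \<le> p ^ v" for v using p3 by (rule power_mono) simp
  show "2 * vlam p n < p ^ vlam p n" using e(2) le less_le_trans by blast
  show d: "p ^ vlam p n dvd n" if "odd n" using that p by (simp add: vlam_odd multiplicity_dvd)
  show "3 * vlam p n \<le> n"
  proof (cases "odd n")
    case True
    have "3 * vlam p n \<le> p ^ vlam p n" using e(1) le order_trans by blast
    also have "\<dots> \<le> n" using d[OF True] n by (simp add: dvd_imp_le)
    finally show ?thesis .
  qed (use p in \<open>simp add: vlam_even\<close>)
qed

lemma multiplicity_near:
  assumes p: "prime (p::nat)" and j: "0 < j" "j < p ^ multiplicity p n" "j < n"
  shows "multiplicity p (n - j) = multiplicity p j"
proof (rule multiplicity_eqI)
  let ?e = "multiplicity p j"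
  have "p ^ ?e dvd j" by (rule multiplicity_dvd)
  hence "p ^ ?e \<le> j" using j by (simp add: dvd_imp_le)
  hence "p ^ ?e < p ^ multiplicity p n" using j by simp
  hence "Suc ?e \<le> multiplicity p n" using p prime_gt_1_nat[of p] by (metis Suc_leI power_less_imp_less_exp)
  hence d: "p ^ Suc ?e dvd n" using multiplicity_dvd'[of "Suc ?e" p n] by simp
  show "p ^ ?e dvd n - j" using d \<open>p ^ ?e dvd j\<close> by (metis dvd_diff_nat dvd_trans le_imp_power_dvd le_Suc_eq order_refl)
  show "\<not> p ^ Suc ?e dvd n - j"
  proof
    assume "p ^ Suc ?e dvd n - j"
    hence "p ^ Suc ?e dvd j" using d j(3) by (metis dvd_diff_nat diff_diff_cancel less_imp_le)
    hence "Suc ?e \<le> ?e" using j(1) p by (intro multiplicity_geI) (auto simp: prime_nat_iff)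
    thus False by simp
  qed
qed

text \<open>
  Near \<open>n\<close> valuations are those of the distance to \<open>n\<close>. If the
  window is nonempty, then \<open>n\<close> is odd, and only the even distances \<open>2
  j\<close> lead to odd indices, where \<open>\<lambda>\<close> need not be a unit; there
  the valuation is that of \<open>j\<close>.
\<close>

lemma sum_vlam_window:
  assumes p: "prime p" "odd p" and n: "n \<ge> 1" and i: "i \<le> 2 * vlam p n"
  shows "(\<Sum>l\<in>{n - i..<n}. vlam p l) = (\<Sum>j=1..i div 2. multiplicity p j)"
  using i
proof (induction i)
  case (Suc i)
  have v: "vlam p n > 0" using Suc by (cases "vlam p n") auto
  hence odd: "odd n" using vlam_even[OF p] by (metis neq0_conv)
  have lt: "Suc i < n" using vlam_bound(1)[OF p n] Suc.prems v by linarith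
  have "{n - Suc i..<n} = insert (n - Suc i) {n - i..<n}" using lt by auto
  hence "(\<Sum>l\<in>{n - Suc i..<n}. vlam p l) = vlam p (n - Suc i) + (\<Sum>j=1..i div 2. multiplicity p j)"
    using Suc lt by simp
  also have "\<dots> = (\<Sum>j=1..Suc i div 2. multiplicity p j)"
  proof (cases "even i")
    case True
    hence "even (n - Suc i)" using odd lt by simp
    thus ?thesis using True vlam_even[OF p] by simp
  next
    case False
    then obtain r where "i = 2 * r + 1" by (auto elim!: oddE)
    hence q: "Suc i = 2 * Suc r" "i div 2 = Suc r - 1" "Suc r > 0" by auto
    define q where "q = Suc r"
    note q = q[folded q_def]
    have "odd (n - Suc i)" using odd lt False by simp
    moreover have "multiplicity p (n - Suc i) = multiplicity p (Suc i)"
      using multiplicity_near[OF p(1), of "Suc i" n] vlam_bound(2)[OF p n] Suc.prems lt vlam_odd[OF p(1) odd] by simp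
    moreover have "multiplicity p (2 * q) = multiplicity p q"
    proof -
      have "\<not> p dvd 2"
      proof
        assume "p dvd 2"
        hence "p = 2" using p(1) by (simp add: primes_dvd_imp_eq)
        thus False using p by simp
      qed
      hence "multiplicity p 2 = 0" by (rule not_dvd_imp_multiplicity_0)
      thus ?thesis using p q(3) prime_elem_multiplicity_mult_distrib[of p 2 q] by simp
    qed
    ultimately have "vlam p (n - Suc i) = multiplicity p q" using q p by (simp add: vlam_odd)
    moreover have "{1..q} = insert q {1..q - 1}" using q by auto
    hence "(\<Sum>j=1..q. multiplicity p j) = multiplicity p q + (\<Sum>j=1..q - 1. multiplicity p j)"
      using q by simp
    ultimately show ?thesis using q by simp
  qed
  finally show ?case .
qed simp

lemma multiplicity_window:
  assumes p: "prime p" "odd p" and n: "n \<ge> 1" and i: "i \<le> 2 * vlam p n"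
  shows "multiplicity (int p) (\<Prod>l\<in>{n - i..<n}. lam l) \<le> i div 2"
proof -
  have "multiplicity (int p) (\<Prod>l\<in>{n - i..<n}. lam l) = (\<Sum>l\<in>{n - i..<n}. vlam p l)"
    unfolding vlam_def using p by (intro prime_elem_multiplicity_prod_distrib) auto
  also have "\<dots> \<le> i div 2" using sum_vlam_window[OF assms] sum_multiplicity_le[OF p(1)] by simp
  finally show ?thesis .
qed

text \<open>change of basis\<close>

text \<open>
  Column \<open>n\<close> of the change of coordinates \<open>H\<close> solves
  \<open>\<lambda>\<^sub>k h\<^sub>k + p h\<^bsub>k+1\<^esub> = 0\<close> downwards from
  \<open>h\<^sub>n = 1\<close> and is cut off after \<open>2
  v\<^sub>p(\<lambda>\<^sub>n)\<close> steps. The remaining error is divisible by \<open>p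
  \<lambda>\<^sub>n\<close>, and the quotient of the error by
  \<open>\<lambda>\<^sub>n\<close> is the only entry off the diagonal in column
  \<open>n\<close> of the change of coordinates \<open>T\<close> of the target. With
  \<open>2 v\<^sub>p(\<lambda>\<^sub>n)\<close> steps this entry is divisible by
  \<open>p\<close> in spite of the denominators that occur in the window.
\<close>

definition hq :: "nat \<Rightarrow> nat \<Rightarrow> nat \<Rightarrow> rat" where
  "hq p n k = (if k \<le> n \<and> n \<le> k + 2 * vlam p n then (\<Prod>l\<in>{k..<n}. - of_nat p / of_int (lam l)) else 0)"

definition tq :: "nat \<Rightarrow> nat \<Rightarrow> nat \<Rightarrow> rat" where
  "tq p n k = (if k = n then 1 else if Suc (k + 2 * vlam p n) = n
     then of_nat p * hq p n (Suc k) / of_int (lam n) else 0)"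

text \<open>
  The equation \<open>B H = T \<Lambda>\<close> in column \<open>n\<close>, where
  \<open>B\<close> is the bidiagonal matrix and \<open>\<Lambda>\<close> its diagonal.
\<close>

lemma basis_change:
  assumes p: "prime p" "odd p" and n: "n \<ge> 1"
  shows "of_int (lam k) * hq p n k + of_nat p * hq p n (Suc k) = tq p n k * of_int (lam n)"
proof -
  consider "k > n" | "k = n" | "k < n" "n \<le> k + 2 * vlam p n" | "n = Suc (k + 2 * vlam p n)" | "n > Suc (k + 2 * vlam p n)"
    by linarith
  thus ?thesis
  proof cases
    case 3
    hence "{k..<n} = insert k {Suc k..<n}" by auto
    thus ?thesis using 3 by (simp add: hq_def tq_def)
  qed (auto simp: hq_def tq_def)
qed

lemma prod_neg_div:
  fixes x :: rat
  assumes "finite A"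
  shows "(\<Prod>l\<in>A. - 1 * (x / of_int (f l))) = (- 1) ^ card A * (x ^ card A / of_int (\<Prod>l\<in>A. f l))"
  using assms by (induction A) simp_all

text \<open>
  The numerator \<open>p\<^sup>i\<close> beats the denominator, whose valuation is at most
  \<open>i div 2\<close>, and a factor \<open>p\<close> is left over.
\<close>

lemma hq_int:
  assumes p: "prime p" "odd p" and n: "n \<ge> 1" and k: "k \<noteq> n"
  shows "hq p n k / of_nat p \<in> Zp p"
proof (cases "k \<le> n \<and> n \<le> k + 2 * vlam p n")
  case True
  define i where "i = n - k"
  have i: "i \<le> 2 * vlam p n" "k = n - i" "i > 0" "i \<le> n" using True k by (auto simp: i_def)
  let ?L = "\<Prod>l\<in>{n - i..<n}. lam l"
  have "hq p n k = (\<Prod>l\<in>{k..<n}. (- 1) * (of_nat p / of_int (lam l)))" using True by (simp add: hq_def)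
  also have "\<dots> = (- 1) ^ i * (of_nat p ^ i / of_int ?L)"
    using i by (subst prod_neg_div) auto
  also have "of_nat p ^ i = of_nat p * (of_nat p ^ (i - 1) :: rat)" using i by (cases i) auto
  finally have "hq p n k / of_nat p = of_int ((- 1) ^ i) * (of_nat p ^ (i - 1) / of_int ?L)"
    using p by (simp add: prime_gt_0_nat)
  moreover have "multiplicity (int p) ?L \<le> i - 1"
    using multiplicity_window[OF p n i(1)] i(3) by simp
  hence "of_nat p ^ (i - 1) / of_int ?L \<in> Zp p" by (intro power_div_in_Zp p) (auto simp: prod_zero_iff)
  ultimately show ?thesis using p by (simp only: Zp_mult Zp_of_int)
qed (use p in \<open>auto simp: hq_def\<close>)

lemma tq_int:
  assumes p: "prime p" "odd p" and n: "n \<ge> 1" and k: "k \<noteq> n"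
  shows "tq p n k / of_nat p \<in> Zp p"
proof (cases "Suc (k + 2 * vlam p n) = n")
  case True
  define i where "i = 2 * vlam p n"
  have i: "i \<le> 2 * vlam p n" "Suc k = n - i" "i \<le> n" using True by (auto simp: i_def)
  let ?L = "(\<Prod>l\<in>{n - i..<n}. lam l) * lam n"
  have "hq p n (Suc k) = (\<Prod>l\<in>{Suc k..<n}. (- 1) * (of_nat p / of_int (lam l)))" using i True by (simp add: hq_def)
  also have "\<dots> = (- 1) ^ i * (of_nat p ^ i / of_int (\<Prod>l\<in>{n - i..<n}. lam l))"
    using i by (subst prod_neg_div) auto
  finally have "tq p n k / of_nat p = of_int ((- 1) ^ i) * (of_nat p ^ i / of_int ?L)"
    using p True k by (simp add: tq_def prime_gt_0_nat field_simps)
  moreover have "multiplicity (int p) ?L \<le> i"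
  proof -
    have "multiplicity (int p) ?L = multiplicity (int p) (\<Prod>l\<in>{n - i..<n}. lam l) + vlam p n"
      unfolding vlam_def using p by (intro prime_elem_multiplicity_mult_distrib) (auto simp: prod_zero_iff)
    also have "\<dots> \<le> i div 2 + vlam p n" using multiplicity_window[OF p n i(1)] by simp
    finally show ?thesis by (simp add: i_def)
  qed
  hence "of_nat p ^ i / of_int ?L \<in> Zp p" by (intro power_div_in_Zp p) (auto simp: prod_zero_iff)
  ultimately show ?thesis using p by (simp only: Zp_mult Zp_of_int)
qed (use p k in \<open>auto simp: tq_def\<close>)

text \<open>
  Column \<open>n\<close> lives on the indices above \<open>n - 2 v - 2\<close>, and
  \<open>3 v \<le> n\<close>. Hence row \<open>k\<close> meets only finitely many columns
  and the matrices act on all sequences.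
\<close>

lemma hq_tq_support:
  assumes p: "prime p" "odd p" and n: "n \<ge> 1" "n > 3 * k + 3"
  shows "hq p n k = 0" "tq p n k = 0"
proof -
  have "3 * vlam p n \<le> n" using vlam_bound(1)[OF p n(1)] .
  hence "Suc (k + 2 * vlam p n) < n" using n by linarith
  thus "hq p n k = 0" "tq p n k = 0" by (auto simp: hq_def tq_def)
qed

text \<open>
  The change of coordinates in the source preserves the condition that the entry
  \<open>0\<close> vanishes.
\<close>

lemma hq_0: assumes p: "prime p" "odd p" and n: "n \<ge> 1" shows "hq p n 0 = 0"
proof -
  have "3 * vlam p n \<le> n" using vlam_bound(1)[OF p n] .
  hence "0 + 2 * vlam p n < n" using n by linarith
  thus ?thesis by (simp add: hq_def)
qed

lemma tq_hq_diag [simp]: "hq p n n = 1" "tq p n n = 1"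
  by (simp_all add: hq_def tq_def)

section \<open>Quotients, products and free modules\<close>

lemma quot_module_simps:
  "carrier (quot_module M N) = a_rcosets\<^bsub>M\<^esub> N" "zero (quot_module M N) = N"
  "add (quot_module M N) = (\<lambda>X Y. X <+>\<^bsub>M\<^esub> Y)"
  "smult (quot_module M N) = (\<lambda>r X. N <+>\<^bsub>M\<^esub> ((\<lambda>x. r \<odot>\<^bsub>M\<^esub> x) ` X))"
  by (simp_all add: quot_module_def)

lemma (in module) submodule_intro:
  assumes "N \<subseteq> carrier M" "\<zero>\<^bsub>M\<^esub> \<in> N" "\<And>x y. x \<in> N \<Longrightarrow> y \<in> N \<Longrightarrow> x \<oplus>\<^bsub>M\<^esub> y \<in> N"
    and sm: "\<And>r x. r \<in> carrier R \<Longrightarrow> x \<in> N \<Longrightarrow> r \<odot>\<^bsub>M\<^esub> x \<in> N"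
  shows "submodule N R M"
proof (rule submoduleI)
  fix x assume x: "x \<in> N"
  hence "\<ominus>\<^bsub>M\<^esub> x = (\<ominus>\<^bsub>R\<^esub> \<one>\<^bsub>R\<^esub>) \<odot>\<^bsub>M\<^esub> x"
    using assms(1) smult_l_minus[of "\<one>\<^bsub>R\<^esub>" x] by auto
  thus "\<ominus>\<^bsub>M\<^esub> x \<in> N" using sm[OF _ x, of "\<ominus>\<^bsub>R\<^esub> \<one>\<^bsub>R\<^esub>"] by simp
qed (use assms in auto)

locale submod = module R M + N: submodule N R M
  for R :: "('a, 'r) ring_scheme" (structure) and M :: "('a, 'b, 'm) module_scheme" and N
begin

sublocale ab: abelian_subgroup N M
  by (rule abelian_subgroupI3) (auto intro: additive_subgroup.intro N.subgroup_axioms M.abelian_group_axioms)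

abbreviation cs :: "'b \<Rightarrow> 'b set" where "cs x \<equiv> N +>\<^bsub>M\<^esub> x"

lemma N_subset: "x \<in> N \<Longrightarrow> x \<in> carrier M"
  using ab.a_subset by blast

lemma N_smult: "r \<in> carrier R \<Longrightarrow> x \<in> N \<Longrightarrow> r \<odot>\<^bsub>M\<^esub> x \<in> N"
  by (rule N.smult_closed)

lemma carrier_quot: "carrier (quot_module M N) = cs ` carrier M"
  by (auto simp: quot_module_simps A_RCOSETS_defs a_r_coset_def)

lemma zero_quot: "\<zero>\<^bsub>quot_module M N\<^esub> = cs \<zero>\<^bsub>M\<^esub>"
  by (simp add: quot_module_simps ab.a_subset)

lemma add_quot: "x \<in> carrier M \<Longrightarrow> y \<in> carrier M \<Longrightarrow> cs x \<oplus>\<^bsub>quot_module M N\<^esub> cs y = cs (x \<oplus>\<^bsub>M\<^esub> y)"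
  by (simp add: quot_module_simps ab.a_rcos_sum)

lemma cs_eq_iff:
  assumes "x \<in> carrier M" "y \<in> carrier M"
  shows "cs x = cs y \<longleftrightarrow> x \<ominus>\<^bsub>M\<^esub> y \<in> N"
proof -
  have "cs x = cs y \<longleftrightarrow> x \<in> cs y"
    using assms by (metis ab.a_rcos_self M.a_repr_independence N.subgroup_axioms)
  also have "\<dots> \<longleftrightarrow> (\<exists>h\<in>N. x = h \<oplus>\<^bsub>M\<^esub> y)" by (auto simp: a_r_coset_def')
  also have "\<dots> \<longleftrightarrow> x \<ominus>\<^bsub>M\<^esub> y \<in> N"
  proof
    assume "\<exists>h\<in>N. x = h \<oplus>\<^bsub>M\<^esub> y"
    then obtain h where h: "h \<in> N" "x = h \<oplus>\<^bsub>M\<^esub> y" by blast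
    hence "x \<ominus>\<^bsub>M\<^esub> y = h" using assms N_subset[OF h(1)] by (simp add: a_minus_def M.a_assoc M.r_neg)
    thus "x \<ominus>\<^bsub>M\<^esub> y \<in> N" using h by simp
  next
    assume "x \<ominus>\<^bsub>M\<^esub> y \<in> N"
    moreover have "x = (x \<ominus>\<^bsub>M\<^esub> y) \<oplus>\<^bsub>M\<^esub> y" using assms by (simp add: a_minus_def M.a_assoc M.l_neg)
    ultimately show "\<exists>h\<in>N. x = h \<oplus>\<^bsub>M\<^esub> y" by blast
  qed
  finally show ?thesis .
qed

lemma smult_quot:
  assumes r: "r \<in> carrier R" and x: "x \<in> carrier M"
  shows "r \<odot>\<^bsub>quot_module M N\<^esub> cs x = cs (r \<odot>\<^bsub>M\<^esub> x)"
proof -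
  have "N <+>\<^bsub>M\<^esub> ((\<lambda>x. r \<odot>\<^bsub>M\<^esub> x) ` cs x) = cs (r \<odot>\<^bsub>M\<^esub> x)"
  proof (intro equalityI subsetI)
    fix y assume "y \<in> N <+>\<^bsub>M\<^esub> ((\<lambda>x. r \<odot>\<^bsub>M\<^esub> x) ` cs x)"
    then obtain h k where hk: "h \<in> N" "k \<in> N" "y = h \<oplus>\<^bsub>M\<^esub> r \<odot>\<^bsub>M\<^esub> (k \<oplus>\<^bsub>M\<^esub> x)"
      by (auto simp: set_add_def' a_r_coset_def')
    hence "y = (h \<oplus>\<^bsub>M\<^esub> r \<odot>\<^bsub>M\<^esub> k) \<oplus>\<^bsub>M\<^esub> r \<odot>\<^bsub>M\<^esub> x"
      using r x N_subset[of h] N_subset[of k] by (simp add: smult_r_distr M.a_assoc)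
    moreover have "h \<oplus>\<^bsub>M\<^esub> r \<odot>\<^bsub>M\<^esub> k \<in> N" using hk N_smult[OF r] by auto
    ultimately show "y \<in> cs (r \<odot>\<^bsub>M\<^esub> x)" by (auto simp: a_r_coset_def')
  next
    fix y assume "y \<in> cs (r \<odot>\<^bsub>M\<^esub> x)"
    then obtain h where "h \<in> N" "y = h \<oplus>\<^bsub>M\<^esub> r \<odot>\<^bsub>M\<^esub> x" by (auto simp: a_r_coset_def')
    moreover have "x \<in> cs x" using x by (rule ab.a_rcos_self)
    ultimately show "y \<in> N <+>\<^bsub>M\<^esub> ((\<lambda>x. r \<odot>\<^bsub>M\<^esub> x) ` cs x)" by (auto simp: set_add_def')
  qed
  thus ?thesis by (simp add: quot_module_simps)
qed

lemma cs_quot [simp]: "x \<in> carrier M \<Longrightarrow> cs x \<in> carrier (quot_module M N)"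
  by (auto simp: carrier_quot)

lemma module_quot: "module R (quot_module M N)"
proof (rule moduleI)
  show "cring R" by (rule module.axioms(1)[OF module_axioms])
  show "abelian_group (quot_module M N)"
  proof (rule abelian_groupI)
    fix X assume "X \<in> carrier (quot_module M N)"
    then obtain x where x: "x \<in> carrier M" "X = cs x" by (auto simp: carrier_quot)
    thus "\<exists>Y\<in>carrier (quot_module M N). Y \<oplus>\<^bsub>quot_module M N\<^esub> X = \<zero>\<^bsub>quot_module M N\<^esub>"
      by (intro bexI[of _ "cs (\<ominus>\<^bsub>M\<^esub> x)"]) (auto simp: add_quot zero_quot M.l_neg)
  next
    fix X Y assume "X \<in> carrier (quot_module M N)" "Y \<in> carrier (quot_module M N)"
    then obtain x y where "x \<in> carrier M" "X = cs x" "y \<in> carrier M" "Y = cs y" by (auto simp: carrier_quot)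
    thus "X \<oplus>\<^bsub>quot_module M N\<^esub> Y = Y \<oplus>\<^bsub>quot_module M N\<^esub> X"
      using M.a_comm[of x y] by (simp add: add_quot)
  qed (auto simp: carrier_quot add_quot zero_quot M.a_assoc)
qed (auto simp: carrier_quot add_quot smult_quot smult_l_distr smult_r_distr smult_assoc1)

text \<open>
  The homomorphism theorem for quotients by a submodule, with the kernel given as the
  relation of having equal values.
\<close>

lemma quot_iso:
  assumes F: "\<And>x. x \<in> carrier M \<Longrightarrow> F x \<in> carrier Q"
    and Fadd: "\<And>x y. x \<in> carrier M \<Longrightarrow> y \<in> carrier M \<Longrightarrow> F (x \<oplus>\<^bsub>M\<^esub> y) = F x \<oplus>\<^bsub>Q\<^esub> F y"
    and Fsm: "\<And>r x. r \<in> carrier R \<Longrightarrow> x \<in> carrier M \<Longrightarrow> F (r \<odot>\<^bsub>M\<^esub> x) = r \<odot>\<^bsub>Q\<^esub> F x"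
    and surj: "\<And>y. y \<in> carrier Q \<Longrightarrow> \<exists>x\<in>carrier M. F x = y"
    and ker: "\<And>x y. x \<in> carrier M \<Longrightarrow> y \<in> carrier M \<Longrightarrow> F x = F y \<longleftrightarrow> x \<ominus>\<^bsub>M\<^esub> y \<in> N"
  shows "module_isomorphic R (quot_module M N) Q"
proof -
  define h where "h X = F (SOME x. x \<in> carrier M \<and> X = cs x)" for X
  have h: "h (cs x) = F x" if "x \<in> carrier M" for x
  proof -
    define y where "y = (SOME y. y \<in> carrier M \<and> cs x = cs y)"
    have "\<exists>y. y \<in> carrier M \<and> cs x = cs y" using that by blast
    from someI_ex[OF this] have y: "y \<in> carrier M" "cs x = cs y" by (simp_all add: y_def)
    have "F y = F x" using ker[OF y(1) that] cs_eq_iff[OF y(1) that] y(2) by simp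
    thus ?thesis by (simp add: h_def y_def)
  qed
  have "h \<in> module_iso R (quot_module M N) Q"
    unfolding module_iso_def iso_def hom_def bij_betw_def
  proof (intro CollectI conjI ballI funcsetI inj_onI)
    fix X Y assume XY: "X \<in> carrier (add_monoid (quot_module M N))" "Y \<in> carrier (add_monoid (quot_module M N))" "h X = h Y"
    then obtain x y where xy: "x \<in> carrier M" "y \<in> carrier M" "X = cs x" "Y = cs y" by (auto simp: carrier_quot)
    hence "x \<ominus>\<^bsub>M\<^esub> y \<in> N" using XY(3) ker[of x y] by (simp add: h)
    thus "X = Y" using xy cs_eq_iff by simp
  next
    show "h ` carrier (add_monoid (quot_module M N)) = carrier (add_monoid Q)"
      using F surj by (auto simp: carrier_quot h image_iff) (metis h)
  qed (auto simp: carrier_quot add_quot smult_quot h F Fadd Fsm)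
  thus ?thesis by (auto simp: module_isomorphic_def)
qed

end

lemma submodI: "module R M \<Longrightarrow> submodule N R M \<Longrightarrow> submod R M N"
  by (simp add: submod_def)

lemma prod_module_simps:
  "carrier (prod_module I M) = (\<Pi>\<^sub>E i\<in>I. carrier (M i))" "zero (prod_module I M) = (\<lambda>i\<in>I. \<zero>\<^bsub>M i\<^esub>)"
  "add (prod_module I M) = (\<lambda>f g. \<lambda>i\<in>I. f i \<oplus>\<^bsub>M i\<^esub> g i)"
  "smult (prod_module I M) = (\<lambda>r f. \<lambda>i\<in>I. r \<odot>\<^bsub>M i\<^esub> f i)"
  by (simp_all add: prod_module_def)

lemma module_prod:
  assumes R: "cring R" and M: "\<And>i. i \<in> I \<Longrightarrow> module R (M i)"
  shows "module R (prod_module I M)"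
proof (rule moduleI)
  have ab: "abelian_group (M i)" if "i \<in> I" for i using M[OF that] by (rule module.axioms)
  show "abelian_group (prod_module I M)"
  proof (rule abelian_groupI)
    fix f assume f: "f \<in> carrier (prod_module I M)"
    show "\<exists>g\<in>carrier (prod_module I M). g \<oplus>\<^bsub>prod_module I M\<^esub> f = \<zero>\<^bsub>prod_module I M\<^esub>"
      by (intro bexI[of _ "\<lambda>i\<in>I. \<ominus>\<^bsub>M i\<^esub> f i"])
        (use f ab in \<open>auto simp: prod_module_simps PiE_iff abelian_group.l_neg abelian_group.a_inv_closed intro!: restrict_ext\<close>)
  next
    fix f g h assume "f \<in> carrier (prod_module I M)" "g \<in> carrier (prod_module I M)" "h \<in> carrier (prod_module I M)"
    thus "f \<oplus>\<^bsub>prod_module I M\<^esub> g \<oplus>\<^bsub>prod_module I M\<^esub> h = f \<oplus>\<^bsub>prod_module I M\<^esub> (g \<oplus>\<^bsub>prod_module I M\<^esub> h)"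
      using abelian_groupE(3)[OF ab] by (auto simp: prod_module_simps PiE_iff intro!: restrict_ext)
  next
    fix f g assume "f \<in> carrier (prod_module I M)" "g \<in> carrier (prod_module I M)"
    thus "f \<oplus>\<^bsub>prod_module I M\<^esub> g = g \<oplus>\<^bsub>prod_module I M\<^esub> f" "f \<oplus>\<^bsub>prod_module I M\<^esub> g \<in> carrier (prod_module I M)"
      using abelian_groupE(1,4)[OF ab] by (auto simp: prod_module_simps PiE_iff intro!: restrict_ext)
  next
    fix f assume "f \<in> carrier (prod_module I M)"
    thus "\<zero>\<^bsub>prod_module I M\<^esub> \<oplus>\<^bsub>prod_module I M\<^esub> f = f"
      using abelian_groupE(5)[OF ab] by (auto simp: prod_module_simps PiE_iff extensional_def fun_eq_iff)
  qed (use abelian_groupE(2)[OF ab] in \<open>auto simp: prod_module_simps PiE_iff\<close>)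
next
  fix r s x y assume r: "r \<in> carrier R" "s \<in> carrier R" and x: "x \<in> carrier (prod_module I M)" "y \<in> carrier (prod_module I M)"
  have xi: "x i \<in> carrier (M i)" "y i \<in> carrier (M i)" if "i \<in> I" for i
    using x that by (auto simp: prod_module_simps)
  show "r \<odot>\<^bsub>prod_module I M\<^esub> x \<in> carrier (prod_module I M)"
    using r xi module.smult_closed[OF M] by (auto simp: prod_module_simps)
  show "(r \<oplus>\<^bsub>R\<^esub> s) \<odot>\<^bsub>prod_module I M\<^esub> x = r \<odot>\<^bsub>prod_module I M\<^esub> x \<oplus>\<^bsub>prod_module I M\<^esub> s \<odot>\<^bsub>prod_module I M\<^esub> x"
    using r xi module.smult_l_distr[OF M] by (auto simp: prod_module_simps intro!: restrict_ext)
  show "r \<odot>\<^bsub>prod_module I M\<^esub> (x \<oplus>\<^bsub>prod_module I M\<^esub> y) = r \<odot>\<^bsub>prod_module I M\<^esub> x \<oplus>\<^bsub>prod_module I M\<^esub> r \<odot>\<^bsub>prod_module I M\<^esub> y"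
    using r xi module.smult_r_distr[OF M] by (auto simp: prod_module_simps intro!: restrict_ext)
  show "(r \<otimes>\<^bsub>R\<^esub> s) \<odot>\<^bsub>prod_module I M\<^esub> x = r \<odot>\<^bsub>prod_module I M\<^esub> (s \<odot>\<^bsub>prod_module I M\<^esub> x)"
    using r xi module.smult_assoc1[OF M] by (auto simp: prod_module_simps intro!: restrict_ext)
next
  fix x assume x: "x \<in> carrier (prod_module I M)"
  hence "x i \<in> carrier (M i)" if "i \<in> I" for i using that by (auto simp: prod_module_simps)
  thus "\<one>\<^bsub>R\<^esub> \<odot>\<^bsub>prod_module I M\<^esub> x = x"
    using x module.smult_one[OF M] by (auto simp: prod_module_simps PiE_iff extensional_def fun_eq_iff)
qed (rule R)

lemma free_module_simps:
  "carrier (free_module R X) = {f \<in> UNIV \<rightarrow> carrier R.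
       (\<forall>x. x \<notin> X \<longrightarrow> f x = \<zero>\<^bsub>R\<^esub>) \<and> finite {x. f x \<noteq> \<zero>\<^bsub>R\<^esub>}}"
  "zero (free_module R X) = (\<lambda>x. \<zero>\<^bsub>R\<^esub>)" "add (free_module R X) = (\<lambda>f g x. f x \<oplus>\<^bsub>R\<^esub> g x)"
  "smult (free_module R X) = (\<lambda>r f x. r \<otimes>\<^bsub>R\<^esub> f x)"
  by (simp_all add: free_module_def)

lemma module_free:
  fixes R (structure)
  assumes R: "cring R"
  shows "module R (free_module R X)"
proof -
  interpret cring R by fact
  have add: "finite {x. f x \<oplus> g x \<noteq> \<zero>}" if "finite {x. f x \<noteq> \<zero>}" "finite {x. g x \<noteq> \<zero>}" "f \<in> UNIV \<rightarrow> carrier R" "g \<in> UNIV \<rightarrow> carrier R"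
    for f g :: "'c \<Rightarrow> 'a"
    by (rule finite_subset[of _ "{x. f x \<noteq> \<zero>} \<union> {x. g x \<noteq> \<zero>}"]) (use that in auto)
  have sm: "finite {x. r \<otimes> f x \<noteq> \<zero>}" if "finite {x. f x \<noteq> \<zero>}" "r \<in> carrier R" for r and f :: "'c \<Rightarrow> 'a"
    by (rule finite_subset[of _ "{x. f x \<noteq> \<zero>}"]) (use that in auto)
  show ?thesis
  proof (rule moduleI)
    show "abelian_group (free_module R X)"
    proof (rule abelian_groupI)
      fix f assume f: "f \<in> carrier (free_module R X)"
      have "{x. \<ominus> f x \<noteq> \<zero>} \<subseteq> {x. f x \<noteq> \<zero>}" by auto
      hence "finite {x. \<ominus> f x \<noteq> \<zero>}" using f finite_subset by (auto simp: free_module_simps)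
      thus "\<exists>g\<in>carrier (free_module R X). g \<oplus>\<^bsub>free_module R X\<^esub> f = \<zero>\<^bsub>free_module R X\<^esub>"
        by (intro bexI[of _ "\<lambda>x. \<ominus> f x"]) (use f in \<open>auto simp: free_module_simps Pi_iff l_neg fun_eq_iff\<close>)
    qed (auto simp: free_module_simps Pi_iff a_assoc fun_eq_iff add intro: a_comm)
  qed (use R in \<open>auto simp: free_module_simps Pi_iff fun_eq_iff sm l_distr r_distr m_assoc\<close>)
qed

lemma submodule_Inter:
  assumes M: "module R M" and ne: "\<S> \<noteq> {}" and S: "\<And>N. N \<in> \<S> \<Longrightarrow> submodule N R M"
  shows "submodule (\<Inter>\<S>) R M"
proof (rule module.submoduleI[OF M])
  show "\<Inter>\<S> \<subseteq> carrier M" using ne S module.submoduleE(1)[OF M] by blast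
  show "\<zero>\<^bsub>M\<^esub> \<in> \<Inter>\<S>" using S by (auto simp: submodule_def subgroup_def)
qed (use S module.submoduleE(3-5)[OF M] in blast)+

lemma submodule_span:
  assumes M: "module R M" and S: "S \<subseteq> carrier M"
  shows "submodule (submodule_span R M S) R M" "S \<subseteq> submodule_span R M S"
    "\<And>N. submodule N R M \<Longrightarrow> S \<subseteq> N \<Longrightarrow> submodule_span R M S \<subseteq> N"
proof -
  interpret module R M by fact
  have "submodule (carrier M) R M" by (rule carrier_is_submodule)
  thus "submodule (submodule_span R M S) R M" unfolding submodule_span_def
    using S by (intro submodule_Inter[OF M]) auto
qed (auto simp: submodule_span_def)

section \<open>Operators congruent to the identity\<close>

text \<open>
  The operator \<open>Top = 1 + \<pi> G\<close> need not be invertible, because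
  \<open>M\<close> need not be complete. Its geometric series, cut off at \<open>N\<close>
  terms in \<open>sol\<close>, is an inverse modulo \<open>\<pi>\<^sup>N\<close>.
\<close>

locale near_id = module R M for R :: "('a, 'r) ring_scheme" (structure) and M :: "('a, 'b, 'm) module_scheme" (structure) +
  fixes \<pi> :: 'a and G :: "'b \<Rightarrow> 'b"
  assumes pi_closed [simp]: "\<pi> \<in> carrier R"
    and G_closed [simp]: "x \<in> carrier M \<Longrightarrow> G x \<in> carrier M"
    and G_add: "x \<in> carrier M \<Longrightarrow> y \<in> carrier M \<Longrightarrow> G (x \<oplus>\<^bsub>M\<^esub> y) = G x \<oplus>\<^bsub>M\<^esub> G y"
    and G_smult: "r \<in> carrier R \<Longrightarrow> x \<in> carrier M \<Longrightarrow> G (r \<odot>\<^bsub>M\<^esub> x) = r \<odot>\<^bsub>M\<^esub> G x"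
begin

definition dv :: "nat \<Rightarrow> 'b set" where "dv N = (\<lambda>z. (\<pi> [^]\<^bsub>R\<^esub> N) \<odot>\<^bsub>M\<^esub> z) ` carrier M"

definition Top :: "'b \<Rightarrow> 'b" where "Top b = b \<oplus>\<^bsub>M\<^esub> \<pi> \<odot>\<^bsub>M\<^esub> G b"

primrec sol :: "'b \<Rightarrow> nat \<Rightarrow> 'b" where
  "sol a 0 = \<zero>\<^bsub>M\<^esub>"
| "sol a (Suc N) = a \<ominus>\<^bsub>M\<^esub> \<pi> \<odot>\<^bsub>M\<^esub> G (sol a N)"

lemma G_zero: "G \<zero>\<^bsub>M\<^esub> = \<zero>\<^bsub>M\<^esub>"
  using G_smult[of "\<zero>\<^bsub>R\<^esub>" "\<zero>\<^bsub>M\<^esub>"] by simp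

lemma G_neg: "x \<in> carrier M \<Longrightarrow> G (\<ominus>\<^bsub>M\<^esub> x) = \<ominus>\<^bsub>M\<^esub> G x"
  using G_add[of x "\<ominus>\<^bsub>M\<^esub> x"] by (metis G_closed G_zero M.add.inv_closed M.minus_equality M.r_neg M.a_comm)

lemma G_minus: "x \<in> carrier M \<Longrightarrow> y \<in> carrier M \<Longrightarrow> G (x \<ominus>\<^bsub>M\<^esub> y) = G x \<ominus>\<^bsub>M\<^esub> G y"
  by (simp add: a_minus_def G_add G_neg)

lemma sol_closed [simp]: "a \<in> carrier M \<Longrightarrow> sol a N \<in> carrier M"
  by (induction N) auto

lemma Top_closed [simp]: "a \<in> carrier M \<Longrightarrow> Top a \<in> carrier M"
  by (simp add: Top_def)

lemma smult_minus: "r \<in> carrier R \<Longrightarrow> x \<in> carrier M \<Longrightarrow> y \<in> carrier M \<Longrightarrow>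
    r \<odot>\<^bsub>M\<^esub> (x \<ominus>\<^bsub>M\<^esub> y) = r \<odot>\<^bsub>M\<^esub> x \<ominus>\<^bsub>M\<^esub> r \<odot>\<^bsub>M\<^esub> y"
  by (simp add: a_minus_def smult_r_distr smult_r_minus)

lemma sol_add: "a \<in> carrier M \<Longrightarrow> b \<in> carrier M \<Longrightarrow> sol (a \<oplus>\<^bsub>M\<^esub> b) N = sol a N \<oplus>\<^bsub>M\<^esub> sol b N"
proof (induction N)
  case (Suc N)
  thus ?case by (simp add: G_add smult_r_distr a_minus_def M.minus_add M.a_ac)
qed simp

lemma sol_smult: "r \<in> carrier R \<Longrightarrow> a \<in> carrier M \<Longrightarrow> sol (r \<odot>\<^bsub>M\<^esub> a) N = r \<odot>\<^bsub>M\<^esub> sol a N"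
proof (induction N)
  case (Suc N)
  thus ?case by (simp add: G_smult smult_minus smult_assoc1[symmetric] R.m_comm)
qed simp

lemma dv_submodule: "submodule (dv N) R M"
proof (rule submodule_intro)
  have pN: "\<pi> [^]\<^bsub>R\<^esub> N \<in> carrier R" by simp
  show "dv N \<subseteq> carrier M" by (auto simp: dv_def)
  show "\<zero>\<^bsub>M\<^esub> \<in> dv N" unfolding dv_def by (rule image_eqI[of _ _ "\<zero>\<^bsub>M\<^esub>"]) auto
  fix a assume "a \<in> dv N"
  then obtain z where z: "z \<in> carrier M" "a = (\<pi> [^]\<^bsub>R\<^esub> N) \<odot>\<^bsub>M\<^esub> z" by (auto simp: dv_def)
  fix b assume "b \<in> dv N"
  then obtain w where w: "w \<in> carrier M" "b = (\<pi> [^]\<^bsub>R\<^esub> N) \<odot>\<^bsub>M\<^esub> w" by (auto simp: dv_def)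
  show "a \<oplus>\<^bsub>M\<^esub> b \<in> dv N" unfolding dv_def
    by (rule image_eqI[of _ _ "z \<oplus>\<^bsub>M\<^esub> w"]) (use z w pN in \<open>auto simp: smult_r_distr\<close>)
next
  fix r a assume r: "r \<in> carrier R" and "a \<in> dv N"
  then obtain z where z: "z \<in> carrier M" "a = (\<pi> [^]\<^bsub>R\<^esub> N) \<odot>\<^bsub>M\<^esub> z" by (auto simp: dv_def)
  show "r \<odot>\<^bsub>M\<^esub> a \<in> dv N" unfolding dv_def
    by (rule image_eqI[of _ _ "r \<odot>\<^bsub>M\<^esub> z"]) (use r z in \<open>auto simp: smult_assoc1[symmetric] R.m_comm\<close>)
qed

lemmas dv_closed = submoduleE[OF dv_submodule]

lemma dv_carrier: "x \<in> dv N \<Longrightarrow> x \<in> carrier M"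
  using dv_closed(1) by blast

lemma dv_zero [simp]: "\<zero>\<^bsub>M\<^esub> \<in> dv N"
  unfolding dv_def by (rule image_eqI[of _ _ "\<zero>\<^bsub>M\<^esub>"]) auto

lemma dv_0: "dv 0 = carrier M"
  by (force simp: dv_def)

lemma dv_step: "x \<in> dv N \<Longrightarrow> \<pi> \<odot>\<^bsub>M\<^esub> G x \<in> dv (Suc N)"
proof -
  assume "x \<in> dv N"
  then obtain z where z: "z \<in> carrier M" "x = (\<pi> [^]\<^bsub>R\<^esub> N) \<odot>\<^bsub>M\<^esub> z" by (auto simp: dv_def)
  show ?thesis unfolding dv_def
    by (rule image_eqI[of _ _ "G z"]) (use z in \<open>auto simp: G_smult smult_assoc1[symmetric] R.m_comm\<close>)
qed

lemma dv_minus: "x \<in> dv N \<Longrightarrow> y \<in> dv N \<Longrightarrow> x \<ominus>\<^bsub>M\<^esub> y \<in> dv N"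
  using dv_closed(3,5) by (simp add: a_minus_def)

lemma dv_mono: "N \<le> K \<Longrightarrow> dv K \<subseteq> dv N"
proof
  fix x assume "N \<le> K" "x \<in> dv K"
  then obtain z d where z: "z \<in> carrier M" "x = (\<pi> [^]\<^bsub>R\<^esub> (N + d)) \<odot>\<^bsub>M\<^esub> z"
    by (auto simp: dv_def le_iff_add)
  thus "x \<in> dv N" unfolding dv_def
    by (intro image_eqI[of _ _ "(\<pi> [^]\<^bsub>R\<^esub> d) \<odot>\<^bsub>M\<^esub> z"]) (auto simp: smult_assoc1[symmetric] R.nat_pow_mult)
qed

lemma minus_chain: "\<lbrakk>x \<in> carrier M; y \<in> carrier M; z \<in> carrier M; x \<ominus>\<^bsub>M\<^esub> y \<in> dv N; y \<ominus>\<^bsub>M\<^esub> z \<in> dv N\<rbrakk> \<Longrightarrow> x \<ominus>\<^bsub>M\<^esub> z \<in> dv N"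
  using dv_closed(5)[of "x \<ominus>\<^bsub>M\<^esub> y" N "y \<ominus>\<^bsub>M\<^esub> z"]
  by (simp add: a_minus_def M.a_assoc M.r_neg1 M.r_neg2)

lemma minus_sym: "\<lbrakk>x \<in> carrier M; y \<in> carrier M; x \<ominus>\<^bsub>M\<^esub> y \<in> dv N\<rbrakk> \<Longrightarrow> y \<ominus>\<^bsub>M\<^esub> x \<in> dv N"
  using dv_closed(3)[of "x \<ominus>\<^bsub>M\<^esub> y" N] by (simp add: a_minus_def M.minus_add M.a_comm)

lemma sol_step: "a \<in> carrier M \<Longrightarrow> sol a (Suc N) \<ominus>\<^bsub>M\<^esub> sol a N \<in> dv N"
proof (induction N)
  case 0
  thus ?case by (simp add: dv_0)
next
  case (Suc N)
  let ?s = "sol a (Suc N)" and ?t = "sol a N"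
  have c: "?s \<in> carrier M" "?t \<in> carrier M" using Suc.prems by (simp_all del: sol.simps)
  have "\<ominus>\<^bsub>M\<^esub> (\<pi> \<odot>\<^bsub>M\<^esub> G (?s \<ominus>\<^bsub>M\<^esub> ?t)) \<in> dv (Suc N)"
    using dv_step[OF Suc.IH[OF Suc.prems]] dv_closed(3) by blast
  also have "\<ominus>\<^bsub>M\<^esub> (\<pi> \<odot>\<^bsub>M\<^esub> G (?s \<ominus>\<^bsub>M\<^esub> ?t)) = sol a (Suc (Suc N)) \<ominus>\<^bsub>M\<^esub> ?s"
  proof -
    have g: "\<ominus>\<^bsub>M\<^esub> (u \<ominus>\<^bsub>M\<^esub> v) = (a \<ominus>\<^bsub>M\<^esub> u) \<ominus>\<^bsub>M\<^esub> (a \<ominus>\<^bsub>M\<^esub> v)"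
      if "u \<in> carrier M" "v \<in> carrier M" for u v
    proof -
      have "(a \<ominus>\<^bsub>M\<^esub> u) \<ominus>\<^bsub>M\<^esub> (a \<ominus>\<^bsub>M\<^esub> v) = (\<ominus>\<^bsub>M\<^esub> u \<oplus>\<^bsub>M\<^esub> a) \<oplus>\<^bsub>M\<^esub> (\<ominus>\<^bsub>M\<^esub> a \<oplus>\<^bsub>M\<^esub> v)"
        using that Suc.prems by (simp add: a_minus_def M.minus_add M.a_comm)
      also have "\<dots> = \<ominus>\<^bsub>M\<^esub> u \<oplus>\<^bsub>M\<^esub> v" using that Suc.prems by (simp add: M.a_assoc M.r_neg2)
      finally show ?thesis using that by (simp add: a_minus_def M.minus_add)
    qed
    have "\<pi> \<odot>\<^bsub>M\<^esub> G (?s \<ominus>\<^bsub>M\<^esub> ?t) = \<pi> \<odot>\<^bsub>M\<^esub> G ?s \<ominus>\<^bsub>M\<^esub> \<pi> \<odot>\<^bsub>M\<^esub> G ?t"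
      using c by (simp add: G_minus smult_minus del: sol.simps)
    thus ?thesis using g[of "\<pi> \<odot>\<^bsub>M\<^esub> G ?s" "\<pi> \<odot>\<^bsub>M\<^esub> G ?t"] c by (simp add: sol.simps(2)[of a "Suc N"] sol.simps(2)[of a N] del: sol.simps)
  qed
  finally show ?case .
qed

lemma sol_cauchy: "N \<le> K \<Longrightarrow> a \<in> carrier M \<Longrightarrow> sol a K \<ominus>\<^bsub>M\<^esub> sol a N \<in> dv N"
proof (induction K rule: dec_induct)
  case base
  thus ?case by (simp add: a_minus_def M.r_neg)
next
  case (step K)
  have "sol a (Suc K) \<ominus>\<^bsub>M\<^esub> sol a K \<in> dv N" using sol_step[OF step.prems] dv_mono[OF step.hyps(1)] by blast
  thus ?case using step minus_chain[of "sol a (Suc K)" "sol a K" "sol a N" N] by (simp del: sol.simps)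
qed

lemma Top_sol: "a \<in> carrier M \<Longrightarrow> a \<ominus>\<^bsub>M\<^esub> Top (sol a N) \<in> dv N"
proof -
  assume a: "a \<in> carrier M"
  have "a \<ominus>\<^bsub>M\<^esub> Top (sol a N) = sol a (Suc N) \<ominus>\<^bsub>M\<^esub> sol a N"
    using a by (simp add: Top_def a_minus_def M.minus_add M.a_ac)
  thus ?thesis using sol_step[OF a, of N] by (simp del: sol.simps)
qed

lemma Top_minus: "x \<in> carrier M \<Longrightarrow> y \<in> carrier M \<Longrightarrow> Top (x \<ominus>\<^bsub>M\<^esub> y) = Top x \<ominus>\<^bsub>M\<^esub> Top y"
proof -
  assume x: "x \<in> carrier M" and y: "y \<in> carrier M"
  hence "Top (x \<ominus>\<^bsub>M\<^esub> y) = (x \<ominus>\<^bsub>M\<^esub> y) \<oplus>\<^bsub>M\<^esub> (\<pi> \<odot>\<^bsub>M\<^esub> G x \<ominus>\<^bsub>M\<^esub> \<pi> \<odot>\<^bsub>M\<^esub> G y)"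
    by (simp add: Top_def G_minus smult_minus)
  thus ?thesis using x y by (simp add: Top_def a_minus_def M.minus_add M.a_ac)
qed

text \<open>
  If \<open>b\<close> is divisible by \<open>\<pi>\<^sup>j\<close>, then \<open>\<pi> G
  b\<close> is divisible by \<open>\<pi>\<^bsup>j+1\<^esup>\<close>, and so is the
  difference \<open>b\<close> of \<open>Top b\<close> and \<open>\<pi> G b\<close> as long
  as \<open>j < N\<close>.
\<close>

lemma Top_dv_cancel: "Top b \<in> dv N \<Longrightarrow> b \<in> carrier M \<Longrightarrow> b \<in> dv N"
proof -
  assume o: "Top b \<in> dv N" and b: "b \<in> carrier M"
  have "j \<le> N \<Longrightarrow> b \<in> dv j" for j
  proof (induction j)
    case (Suc j)
    have "\<pi> \<odot>\<^bsub>M\<^esub> G b \<in> dv (Suc j)" using Suc by (simp add: dv_step)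
    moreover have "Top b \<in> dv (Suc j)" using o dv_mono[OF Suc.prems] by blast
    ultimately have "Top b \<ominus>\<^bsub>M\<^esub> \<pi> \<odot>\<^bsub>M\<^esub> G b \<in> dv (Suc j)" by (simp add: dv_minus)
    thus ?case using b by (simp add: Top_def a_minus_def M.a_assoc M.r_neg)
  qed (use b in \<open>simp add: dv_0\<close>)
  thus ?thesis by simp
qed

text \<open>
  Modulo \<open>\<pi>\<^sup>N\<close> the equation \<open>Top b = a\<close> has at most
  one solution, by \<open>Top_dv_cancel\<close>.
\<close>

lemma sol_unique:
  assumes a: "a \<in> carrier M" and b: "b \<in> carrier M" and ab: "a \<ominus>\<^bsub>M\<^esub> Top b \<in> dv N"
  shows "sol a N \<ominus>\<^bsub>M\<^esub> b \<in> dv N"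
proof -
  have "Top (sol a N) \<ominus>\<^bsub>M\<^esub> a \<in> dv N" by (rule minus_sym) (use Top_sol[OF a] a in auto)
  hence "Top (sol a N) \<ominus>\<^bsub>M\<^esub> Top b \<in> dv N" using ab a b minus_chain[of "Top (sol a N)" a "Top b" N] by simp
  hence "Top (sol a N \<ominus>\<^bsub>M\<^esub> b) \<in> dv N" using a b by (simp add: Top_minus)
  thus ?thesis using a b by (rule_tac Top_dv_cancel) auto
qed

lemma sol_dv: "a \<in> dv N \<Longrightarrow> sol a N \<in> dv N"
proof -
  assume a: "a \<in> dv N"
  have z: "x \<ominus>\<^bsub>M\<^esub> \<zero>\<^bsub>M\<^esub> = x" if "x \<in> carrier M" for x
    using that M.minus_equality[of "\<zero>\<^bsub>M\<^esub>" "\<zero>\<^bsub>M\<^esub>"] by (simp add: a_minus_def)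
  show ?thesis
    using sol_unique[of a "\<zero>\<^bsub>M\<^esub>" N] dv_carrier[OF a] a by (simp add: Top_def G_zero z)
qed

end

section \<open>The cokernel of the bidiagonal map\<close>

locale zp_algebra = cring R for R :: "('a, 'r) ring_scheme" (structure) +
  fixes p :: nat and \<phi> :: "rat \<Rightarrow> 'a"
  assumes prime_p: "prime p" and odd_p: "odd p"
    and phi_hom: "\<phi> \<in> ring_hom (localized_integers p) R"
    and torsion_free: "inj_on (\<lambda>x. [p] \<cdot> x) (carrier R)"
begin

lemma localized_simps: "mult (localized_integers p) = (*)" "add (localized_integers p) = (+)" "one (localized_integers p) = 1"
  by (simp_all add: localized_integers_def)

lemma phi_closed [simp]: "r \<in> Zp p \<Longrightarrow> \<phi> r \<in> carrier R"
  using ring_hom_closed[OF phi_hom] by (simp add: Zp_def)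

lemma phi_add: "r \<in> Zp p \<Longrightarrow> s \<in> Zp p \<Longrightarrow> \<phi> (r + s) = \<phi> r \<oplus> \<phi> s"
  using ring_hom_add[OF phi_hom] by (simp add: Zp_def localized_simps)

lemma phi_mult: "r \<in> Zp p \<Longrightarrow> s \<in> Zp p \<Longrightarrow> \<phi> (r * s) = \<phi> r \<otimes> \<phi> s"
  using ring_hom_mult[OF phi_hom] by (simp add: Zp_def localized_simps)

lemma phi_1 [simp]: "\<phi> 1 = \<one>"
  using ring_hom_one[OF phi_hom] by (simp add: localized_simps)

lemmas Zp_simps [simp] = Zp_of_int[OF prime_p] Zp_numeral[OF prime_p] Zp_mult[OF prime_p] Zp_add[OF prime_p]

lemma phi_0 [simp]: "\<phi> 0 = \<zero>"
  using phi_add[of 0 0] by (metis Zp_simps(2) add.l_cancel_one' add_0 phi_closed)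

lemma phi_neg: "r \<in> Zp p \<Longrightarrow> \<phi> (- r) = \<ominus> \<phi> r"
proof -
  assume r: "r \<in> Zp p"
  hence r': "- r \<in> Zp p" using Zp_simps(5)[of "of_int (- 1)" r] Zp_simps(1)[of "-1"] by simp
  show ?thesis using phi_add[OF r' r] r r' by (simp add: minus_equality)
qed

lemma phi_of_nat: "x \<in> carrier R \<Longrightarrow> \<phi> (of_nat n) \<otimes> x = [n] \<cdot> x"
proof (induction n)
  case (Suc n)
  have "\<phi> (of_nat (Suc n)) = \<phi> (of_nat n) \<oplus> \<one>" using phi_add[of "of_nat n" 1] by (simp add: add.commute)
  thus ?case using Suc by (simp add: l_distr)
qed simp

lemma phi_of_int: "x \<in> carrier R \<Longrightarrow> \<phi> (of_int k) \<otimes> x = [k] \<cdot> x"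
proof (cases "k \<ge> 0")
  case True
  assume x: "x \<in> carrier R"
  from True obtain n where "k = int n" using nonneg_int_cases by blast
  thus ?thesis using phi_of_nat[OF x, of n] by (simp add: add_pow_int_ge)
next
  case False
  assume x: "x \<in> carrier R"
  from False obtain n where n: "k = - int n" "n > 0" by (metis add.inverse_inverse int_cases neg_int_cases not_le zless_nat_conj)
  have "\<phi> (of_int k) \<otimes> x = \<ominus> (\<phi> (of_nat n)) \<otimes> x" using n phi_neg[of "of_nat n"] by simp
  also have "\<dots> = \<ominus> ([n] \<cdot> x)" using x phi_of_nat[OF x, of n] by (simp add: l_minus)
  also have "\<dots> = [k] \<cdot> x" using n add_pow_int_lt[of k R x] by simp
  finally show ?thesis .
qed

abbreviation seqs :: "('a, nat \<Rightarrow> 'a) module" where "seqs \<equiv> prod_module UNIV (\<lambda>_. ring_module R)"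

lemma module_ring: "module R (ring_module R)"
  by (rule moduleI) (auto simp: ring_module_def is_cring l_distr r_distr m_assoc
      intro!: abelian_groupI a_assoc a_comm exI bexI[of _ "\<ominus> _"] l_neg)

lemma module_seqs: "module R seqs"
  by (rule module_prod[OF is_cring module_ring])

lemma seqs_simps: "carrier seqs = {a. \<forall>k. a k \<in> carrier R}" "zero seqs = (\<lambda>_. \<zero>)"
  "add seqs = (\<lambda>a b k. a k \<oplus> b k)" "smult seqs = (\<lambda>r a k. r \<otimes> a k)"
  by (auto simp: prod_module_simps ring_module_def fun_eq_iff)

lemma seqs_neg: "a \<in> carrier seqs \<Longrightarrow> \<ominus>\<^bsub>seqs\<^esub> a = (\<lambda>k. \<ominus> a k)"
proof -
  interpret seqs: module R seqs by (rule module_seqs)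
  assume a: "a \<in> carrier seqs"
  hence "(\<lambda>k. \<ominus> a k) \<oplus>\<^bsub>seqs\<^esub> a = \<zero>\<^bsub>seqs\<^esub>" by (auto simp: seqs_simps l_neg)
  thus ?thesis using a by (intro seqs.minus_equality) (auto simp: seqs_simps)
qed

lemma seqs_minus: "a \<in> carrier seqs \<Longrightarrow> b \<in> carrier seqs \<Longrightarrow> a \<ominus>\<^bsub>seqs\<^esub> b = (\<lambda>k. a k \<ominus> b k)"
  by (simp add: a_minus_def seqs_neg) (simp add: seqs_simps)

definition pR :: 'a where "pR = \<phi> (of_nat p)"

lemma pR_closed [simp]: "pR \<in> carrier R" by (simp add: pR_def)

lemma Zp_pow [simp]: "of_nat p ^ N \<in> Zp p" using Zp_simps(4)[of "p ^ N"] by simp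

lemma pR_pow: "pR [^] (N::nat) = \<phi> (of_nat p ^ N)"
  by (induction N) (simp_all add: pR_def phi_mult[symmetric] mult.commute)

text \<open>
  The action on sequences of a rational matrix with \<open>p\<close>-integral entries,
  whose entry in row \<open>k\<close> and column \<open>n\<close> is \<open>c n k\<close>.
  The sum stops at \<open>3 k + 3\<close> because of \<open>hq_tq_support\<close>, and it
  starts at \<open>1\<close> because both changes of coordinates fix the unit sequence at
  the index \<open>0\<close>.
\<close>

definition mat :: "(nat \<Rightarrow> nat \<Rightarrow> rat) \<Rightarrow> (nat \<Rightarrow> 'a) \<Rightarrow> nat \<Rightarrow> 'a" where
  "mat c a k = (\<Oplus>n\<in>{1..3*k+3}. \<phi> (c n k) \<otimes> a n)"

lemma near_id_mat:
  assumes c: "\<And>n k. n \<ge> 1 \<Longrightarrow> c n k \<in> Zp p"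
  shows "near_id R seqs pR (mat c)"
proof -
  have cl: "(\<lambda>n. \<phi> (c n k) \<otimes> a n) \<in> {1..3*k+3} \<rightarrow> carrier R" if "a \<in> carrier seqs" for a k
    using that c by (auto simp: seqs_simps)
  show ?thesis
  proof (intro near_id.intro near_id_axioms.intro)
    show "module R seqs" by (rule module_seqs)
    show "pR \<in> carrier R" by simp
    show "mat c x \<in> carrier seqs" if "x \<in> carrier seqs" for x
      using cl[OF that] unfolding seqs_simps mat_def by (auto intro!: finsum_closed)
    show "mat c (x \<oplus>\<^bsub>seqs\<^esub> y) = mat c x \<oplus>\<^bsub>seqs\<^esub> mat c y" if "x \<in> carrier seqs" "y \<in> carrier seqs" for x y
    proof
      fix k
      have "mat c (x \<oplus>\<^bsub>seqs\<^esub> y) k = (\<Oplus>n\<in>{1..3*k+3}. \<phi> (c n k) \<otimes> x n \<oplus> \<phi> (c n k) \<otimes> y n)"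
        unfolding mat_def using that c by (intro finsum_cong') (auto simp: seqs_simps r_distr)
      also have "\<dots> = mat c x k \<oplus> mat c y k"
        unfolding mat_def by (rule finsum_addf) (use cl that in auto)
      finally show "mat c (x \<oplus>\<^bsub>seqs\<^esub> y) k = (mat c x \<oplus>\<^bsub>seqs\<^esub> mat c y) k" by (simp add: seqs_simps)
    qed
    show "mat c (r \<odot>\<^bsub>seqs\<^esub> x) = r \<odot>\<^bsub>seqs\<^esub> mat c x" if "r \<in> carrier R" "x \<in> carrier seqs" for r x
    proof
      fix k
      have "mat c (r \<odot>\<^bsub>seqs\<^esub> x) k = (\<Oplus>n\<in>{1..3*k+3}. r \<otimes> (\<phi> (c n k) \<otimes> x n))"
        unfolding mat_def using that c by (intro finsum_cong') (auto simp: seqs_simps m_lcomm)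
      also have "\<dots> = r \<otimes> mat c x k"
        unfolding mat_def by (rule finsum_rdistr[symmetric]) (use cl that in auto)
      finally show "mat c (r \<odot>\<^bsub>seqs\<^esub> x) k = (r \<odot>\<^bsub>seqs\<^esub> mat c x) k" by (simp add: seqs_simps)
    qed
  qed
qed

text \<open>
  The changes of coordinates are \<open>H = 1 + p ch\<close> and \<open>T = 1 + p
  ct\<close>.
\<close>

definition ch :: "nat \<Rightarrow> nat \<Rightarrow> rat" where "ch n k = (if k = n then 0 else hq p n k / of_nat p)"
definition ct :: "nat \<Rightarrow> nat \<Rightarrow> rat" where "ct n k = (if k = n then 0 else tq p n k / of_nat p)"

lemma ch_Zp [simp]: "n \<ge> 1 \<Longrightarrow> ch n k \<in> Zp p" and ct_Zp [simp]: "n \<ge> 1 \<Longrightarrow> ct n k \<in> Zp p"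
  using hq_int[OF prime_p odd_p, of n k] tq_int[OF prime_p odd_p, of n k] by (auto simp: ch_def ct_def)

sublocale H: near_id R seqs pR "mat ch" by (rule near_id_mat) (rule ch_Zp)
sublocale T: near_id R seqs pR "mat ct" by (rule near_id_mat) (rule ct_Zp)

definition bidiag :: "(nat \<Rightarrow> 'a) \<Rightarrow> nat \<Rightarrow> 'a" where
  "bidiag x k = [lam k] \<cdot> x k \<oplus> [int p] \<cdot> x (Suc k)"

definition diag :: "(nat \<Rightarrow> 'a) \<Rightarrow> nat \<Rightarrow> 'a" where "diag x k = [lam k] \<cdot> x k"

definition seqs0 :: "(nat \<Rightarrow> 'a) set" where "seqs0 = {x \<in> carrier seqs. x 0 = \<zero>}"

lemma mat_extend:
  assumes c: "\<And>n k. n \<ge> 1 \<Longrightarrow> c n k \<in> Zp p" and z: "\<And>n k. n > 3 * k + 3 \<Longrightarrow> c n k = 0"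
    and a: "a \<in> carrier seqs" and K: "3 * k + 3 \<le> K"
  shows "mat c a k = (\<Oplus>n\<in>{1..K}. \<phi> (c n k) \<otimes> a n)"
  unfolding mat_def
  by (rule add.finprod_mono_neutral_cong_left) (use assms in \<open>auto simp: seqs_simps\<close>)

text \<open>
  The bidiagonal map becomes diagonal after the two changes of coordinates; row
  \<open>k\<close> involves only finitely many columns, for each of which this is
  \<open>basis_change\<close>.
\<close>

lemma bidiag_Top: "x \<in> seqs0 \<Longrightarrow> bidiag (H.Top x) = T.Top (diag x)"
proof
  fix k
  assume x: "x \<in> seqs0"
  hence xF: "x \<in> carrier seqs" by (simp add: seqs0_def)
  hence xc [simp]: "x n \<in> carrier R" for n by (simp add: seqs_simps)
  have dgF: "diag x \<in> carrier seqs" by (simp add: seqs_simps diag_def)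
  define K where "K = 3 * Suc k + 3"
  have ch0: "ch n k = 0" "ct n k = 0" if "n > 3 * k + 3" for n k
    using hq_tq_support[OF prime_p odd_p, of n k] that by (auto simp: ch_def ct_def)
  have h1: "mat ch x j = (\<Oplus>n\<in>{1..K}. \<phi> (ch n j) \<otimes> x n)" if "j \<le> Suc k" for j
    by (rule mat_extend) (use ch0 xF that in \<open>auto simp: K_def\<close>)
  have t1: "mat ct (diag x) k = (\<Oplus>n\<in>{1..K}. \<phi> (ct n k) \<otimes> diag x n)"
    by (rule mat_extend) (use ch0 dgF in \<open>auto simp: K_def\<close>)
  have sc: "\<phi> r \<otimes> (\<Oplus>n\<in>{1..K}. \<phi> (c n) \<otimes> x n) = (\<Oplus>n\<in>{1..K}. \<phi> (r * c n) \<otimes> x n)"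
    if "r \<in> Zp p" "\<And>n. n \<ge> 1 \<Longrightarrow> c n \<in> Zp p" for r c
  proof -
    have "\<phi> r \<otimes> (\<Oplus>n\<in>{1..K}. \<phi> (c n) \<otimes> x n) = (\<Oplus>n\<in>{1..K}. \<phi> r \<otimes> (\<phi> (c n) \<otimes> x n))"
      by (rule finsum_rdistr) (use that in auto)
    also have "\<dots> = (\<Oplus>n\<in>{1..K}. \<phi> (r * c n) \<otimes> x n)"
      by (rule finsum_cong') (use that in \<open>auto simp: phi_mult m_assoc\<close>)
    finally show ?thesis .
  qed
  have ad: "(\<Oplus>n\<in>{1..K}. \<phi> (c n) \<otimes> x n) \<oplus> (\<Oplus>n\<in>{1..K}. \<phi> (d n) \<otimes> x n) = (\<Oplus>n\<in>{1..K}. \<phi> (c n + d n) \<otimes> x n)"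
    if "\<And>n. n \<ge> 1 \<Longrightarrow> c n \<in> Zp p" "\<And>n. n \<ge> 1 \<Longrightarrow> d n \<in> Zp p" for c d
  proof -
    have "(\<Oplus>n\<in>{1..K}. \<phi> (c n) \<otimes> x n \<oplus> \<phi> (d n) \<otimes> x n) = (\<Oplus>n\<in>{1..K}. \<phi> (c n + d n) \<otimes> x n)"
      by (rule finsum_cong') (use that in \<open>auto simp: phi_add l_distr\<close>)
    thus ?thesis using that by (subst finsum_addf[symmetric]) auto
  qed
  let ?P = "of_nat p :: rat" and ?l = "of_int (lam k) :: rat"
  let ?S = "\<lambda>c. \<Oplus>n\<in>{1..K}. \<phi> (c n) \<otimes> x n"
  have single: "?S (\<lambda>n. if n = Suc k then 1 else 0) = x (Suc k)"
  proof -
    have "?S (\<lambda>n. if n = Suc k then 1 else 0) = (\<Oplus>n\<in>{1..K}. if Suc k = n then x n else \<zero>)"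
      by (rule finsum_cong') auto
    also have "\<dots> = x (Suc k)" by (rule finsum_singleton) (auto simp: K_def)
    finally show ?thesis .
  qed
  have ht: "H.Top x j = x j \<oplus> pR \<otimes> mat ch x j" for j by (simp add: H.Top_def seqs_simps)
  have S_closed: "?S c \<in> carrier R" if "\<And>n. n \<ge> 1 \<Longrightarrow> c n \<in> Zp p" for c
    using that by (intro finsum_closed) auto
  have "bidiag (H.Top x) k = \<phi> ?l \<otimes> (x k \<oplus> \<phi> ?P \<otimes> ?S (\<lambda>n. ch n k)) \<oplus> \<phi> ?P \<otimes> (x (Suc k) \<oplus> \<phi> ?P \<otimes> ?S (\<lambda>n. ch n (Suc k)))"
  proof -
    have e: "H.Top x j = x j \<oplus> \<phi> ?P \<otimes> ?S (\<lambda>n. ch n j)" if "j \<le> Suc k" for j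
      unfolding ht h1[OF that] by (simp only: pR_def)
    have "H.Top x k \<in> carrier R" "H.Top x (Suc k) \<in> carrier R"
      using H.Top_closed[OF xF] by (simp_all add: seqs_simps)
    hence "bidiag (H.Top x) k = \<phi> ?l \<otimes> H.Top x k \<oplus> \<phi> (of_int (int p)) \<otimes> H.Top x (Suc k)"
      by (simp only: bidiag_def phi_of_int)
    thus ?thesis by (simp only: e le_refl le_SucI of_int_of_nat_eq)
  qed
  also have "\<dots> = \<phi> ?l \<otimes> x k \<oplus> (\<phi> ?l \<otimes> (\<phi> ?P \<otimes> ?S (\<lambda>n. ch n k)) \<oplus> (\<phi> ?P \<otimes> ?S (\<lambda>n. if n = Suc k then 1 else 0) \<oplus> \<phi> ?P \<otimes> (\<phi> ?P \<otimes> ?S (\<lambda>n. ch n (Suc k)))))"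
    using S_closed[of "\<lambda>n. ch n k"] S_closed[of "\<lambda>n. ch n (Suc k)"] unfolding single
    by (simp add: r_distr a_assoc del: One_nat_def)
  also have "\<dots> = \<phi> ?l \<otimes> x k \<oplus> ?S (\<lambda>n. ?l * (?P * ch n k) + (?P * (if n = Suc k then 1 else 0) + ?P * (?P * ch n (Suc k))))"
    by (subst sc ad, simp, simp)+ simp
  also have "?S (\<lambda>n. ?l * (?P * ch n k) + (?P * (if n = Suc k then 1 else 0) + ?P * (?P * ch n (Suc k))))
      = (\<Oplus>n\<in>{1..K}. \<phi> ?P \<otimes> (\<phi> (ct n k) \<otimes> diag x n))"
  proof (rule finsum_cong')
    fix n assume n: "n \<in> {1..K}"
    have P: "?P \<noteq> 0" using prime_p by (simp add: prime_gt_0_nat)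
    have "?l * (?P * ch n k) + (?P * (if n = Suc k then 1 else 0) + ?P * (?P * ch n (Suc k))) = ?P * (ct n k * of_int (lam n))"
      using basis_change[OF prime_p odd_p, of n k] n P by (auto simp: ch_def ct_def)
    thus "\<phi> (?l * (?P * ch n k) + (?P * (if n = Suc k then 1 else 0) + ?P * (?P * ch n (Suc k)))) \<otimes> x n = \<phi> ?P \<otimes> (\<phi> (ct n k) \<otimes> diag x n)"
      using n by (simp add: phi_mult m_assoc diag_def phi_of_int[symmetric])
  qed (auto simp: diag_def)
  also have "\<dots> = pR \<otimes> mat ct (diag x) k"
    unfolding t1 pR_def by (rule finsum_rdistr[symmetric]) (use dgF in \<open>auto simp: seqs_simps\<close>)
  finally show "bidiag (H.Top x) k = T.Top (diag x) k"
    by (simp add: T.Top_def seqs_simps diag_def phi_of_int)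
qed

subsection \<open>Cosets\<close>

lemma ring_module_simps: "carrier (ring_module R) = carrier R" "add (ring_module R) = add R"
  "zero (ring_module R) = \<zero>" "smult (ring_module R) = mult R"
  by (simp_all add: ring_module_def)

lemma ring_module_neg: "x \<in> carrier R \<Longrightarrow> \<ominus>\<^bsub>ring_module R\<^esub> x = \<ominus> x"
proof -
  interpret M: module R "ring_module R" by (rule module_ring)
  assume "x \<in> carrier R"
  thus ?thesis by (intro M.minus_equality) (auto simp: ring_module_simps l_neg)
qed

lemma ring_module_minus: "x \<in> carrier R \<Longrightarrow> y \<in> carrier R \<Longrightarrow> x \<ominus>\<^bsub>ring_module R\<^esub> y = x \<ominus> y"
  by (simp add: a_minus_def ring_module_neg ring_module_simps(2))

lemma nat_scalar: "x \<in> carrier R \<Longrightarrow> [n] \<cdot> x = \<phi> (of_nat n) \<otimes> x"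
  by (simp add: phi_of_nat)

lemma multiples_eq: "multiples R n = (\<lambda>x. \<phi> (of_nat n) \<otimes> x) ` carrier R"
  unfolding multiples_def by (rule image_cong) (auto simp: nat_scalar)

lemma submod_multiples: "submod R (ring_module R) (multiples R n)"
proof (rule submodI[OF module_ring], rule module.submodule_intro[OF module_ring])
  show "multiples R n \<subseteq> carrier (ring_module R)" by (auto simp: multiples_eq ring_module_simps)
  show "\<zero>\<^bsub>ring_module R\<^esub> \<in> multiples R n" unfolding multiples_eq ring_module_simps
    by (rule image_eqI[of _ _ \<zero>]) auto
  fix a assume "a \<in> multiples R n"
  then obtain x where x: "x \<in> carrier R" "a = \<phi> (of_nat n) \<otimes> x" by (auto simp: multiples_eq)
  { fix b assume "b \<in> multiples R n"
    then obtain y where y: "y \<in> carrier R" "b = \<phi> (of_nat n) \<otimes> y" by (auto simp: multiples_eq)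
    show "a \<oplus>\<^bsub>ring_module R\<^esub> b \<in> multiples R n" unfolding multiples_eq ring_module_simps
      by (rule image_eqI[of _ _ "x \<oplus> y"]) (use x y in \<open>auto simp: r_distr\<close>) }
  fix r assume r: "r \<in> carrier R"
  show "r \<odot>\<^bsub>ring_module R\<^esub> a \<in> multiples R n" unfolding multiples_eq ring_module_simps
    by (rule image_eqI[of _ _ "r \<otimes> x"]) (use x r in \<open>auto simp: m_lcomm\<close>)
qed

interpretation Mul: submod R "ring_module R" "multiples R n" for n
  by (rule submod_multiples)

abbreviation residue :: "nat \<Rightarrow> 'a \<Rightarrow> 'a set" where
  "residue n x \<equiv> multiples R n +>\<^bsub>ring_module R\<^esub> x"

lemma mult_closed:
  "x \<in> multiples R n \<Longrightarrow> x \<in> carrier R"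
  "x \<in> multiples R n \<Longrightarrow> y \<in> multiples R n \<Longrightarrow> x \<oplus> y \<in> multiples R n"
  "x \<in> multiples R n \<Longrightarrow> \<ominus> x \<in> multiples R n"
  "x \<in> multiples R n \<Longrightarrow> y \<in> multiples R n \<Longrightarrow> x \<ominus> y \<in> multiples R n"
  "r \<in> carrier R \<Longrightarrow> x \<in> multiples R n \<Longrightarrow> r \<otimes> x \<in> multiples R n"
  "\<zero> \<in> multiples R n"
proof -
  show 1: "x \<in> multiples R n \<Longrightarrow> x \<in> carrier R" for x using Mul.N_subset by (simp add: ring_module_simps)
  show 2: "x \<in> multiples R n \<Longrightarrow> y \<in> multiples R n \<Longrightarrow> x \<oplus> y \<in> multiples R n" for x y
    using Mul.ab.a_closed by (simp add: ring_module_simps)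
  show 3: "x \<in> multiples R n \<Longrightarrow> \<ominus> x \<in> multiples R n" for x
    using Mul.ab.a_inv_closed 1 ring_module_neg by metis
  show "x \<in> multiples R n \<Longrightarrow> y \<in> multiples R n \<Longrightarrow> x \<ominus> y \<in> multiples R n"
    using 2 3 by (simp add: a_minus_def)
  show "r \<in> carrier R \<Longrightarrow> x \<in> multiples R n \<Longrightarrow> r \<otimes> x \<in> multiples R n"
    using Mul.N_smult by (simp add: ring_module_simps)
  show "\<zero> \<in> multiples R n" using Mul.ab.zero_closed by (simp add: ring_module_simps)
qed

lemma residue_eq: "x \<in> carrier R \<Longrightarrow> y \<in> carrier R \<Longrightarrow> residue n x = residue n y \<longleftrightarrow> x \<ominus> y \<in> multiples R n"
  using Mul.cs_eq_iff by (simp add: ring_module_simps ring_module_minus)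

lemma residue_carrier: "carrier (ring_mod R n) = residue n ` carrier R"
  using Mul.carrier_quot by (simp add: ring_mod_def ring_module_simps)

lemma residue_add: "x \<in> carrier R \<Longrightarrow> y \<in> carrier R \<Longrightarrow> residue n x \<oplus>\<^bsub>ring_mod R n\<^esub> residue n y = residue n (x \<oplus> y)"
  using Mul.add_quot by (simp add: ring_mod_def ring_module_simps)

lemma residue_smult: "r \<in> carrier R \<Longrightarrow> x \<in> carrier R \<Longrightarrow> r \<odot>\<^bsub>ring_mod R n\<^esub> residue n x = residue n (r \<otimes> x)"
  using Mul.smult_quot by (simp add: ring_mod_def ring_module_simps)

lemma multiples_dvd: "m dvd n \<Longrightarrow> multiples R n \<subseteq> multiples R m"
proof
  fix x assume "m dvd n" "x \<in> multiples R n"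
  then obtain k y where "y \<in> carrier R" "x = \<phi> (of_nat (m * k)) \<otimes> y" by (auto simp: multiples_eq)
  thus "x \<in> multiples R m" unfolding multiples_eq
    by (intro image_eqI[of _ _ "\<phi> (of_nat k) \<otimes> y"]) (auto simp: phi_mult m_assoc)
qed

lemma residue_transition:
  assumes x: "x \<in> carrier R" and d: "m dvd n"
  shows "residue n x <+>\<^bsub>R\<^esub> multiples R m = residue m x"
proof (intro equalityI subsetI)
  fix y assume "y \<in> residue n x <+>\<^bsub>R\<^esub> multiples R m"
  then obtain h k where hk: "h \<in> multiples R n" "k \<in> multiples R m" "y = h \<oplus> x \<oplus> k"
    by (auto simp: set_add_def' a_r_coset_def' ring_module_simps)
  hence "y = (h \<oplus> k) \<oplus> x" using x mult_closed(1)[of h n] mult_closed(1)[of k m] by (simp add: a_ac)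
  moreover have "h \<oplus> k \<in> multiples R m" using hk multiples_dvd[OF d] mult_closed(2) by blast
  ultimately show "y \<in> residue m x" by (auto simp: a_r_coset_def' ring_module_simps)
next
  fix y assume "y \<in> residue m x"
  then obtain h where h: "h \<in> multiples R m" "y = h \<oplus> x" by (auto simp: a_r_coset_def' ring_module_simps)
  have "y = (\<zero> \<oplus> x) \<oplus> h" using h x mult_closed(1)[of h m] by (simp add: a_comm)
  thus "y \<in> residue n x <+>\<^bsub>R\<^esub> multiples R m"
    using h mult_closed(6) by (force simp: set_add_def' a_r_coset_def' ring_module_simps)
qed

lemma dv_iff: "a \<in> T.dv N \<longleftrightarrow> (\<forall>k. a k \<in> multiples R (p ^ N))"
proof
  assume "a \<in> T.dv N"
  then obtain z where z: "z \<in> carrier seqs" "a = (pR [^] N) \<odot>\<^bsub>seqs\<^esub> z" by (auto simp: T.dv_def)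
  thus "\<forall>k. a k \<in> multiples R (p ^ N)" by (auto simp: seqs_simps pR_pow multiples_eq)
next
  assume "\<forall>k. a k \<in> multiples R (p ^ N)"
  hence "\<forall>k. \<exists>z. z \<in> carrier R \<and> a k = pR [^] N \<otimes> z" by (auto simp: multiples_eq pR_pow)
  then obtain z where "\<And>k. z k \<in> carrier R" "\<And>k. a k = pR [^] N \<otimes> z k" by metis
  hence "z \<in> carrier seqs" "a = (pR [^] N) \<odot>\<^bsub>seqs\<^esub> z" by (auto simp: seqs_simps)
  thus "a \<in> T.dv N" by (auto simp: T.dv_def)
qed

lemma seqs_minus_closed: "a \<in> carrier seqs \<Longrightarrow> b \<in> carrier seqs \<Longrightarrow> a \<ominus>\<^bsub>seqs\<^esub> b \<in> carrier seqs"
  by (simp add: seqs_minus) (simp add: seqs_simps)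

lemma seqs_val: "a \<in> carrier seqs \<Longrightarrow> a k \<in> carrier R" by (simp add: seqs_simps)

lemma minus_dv_iff: "a \<in> carrier seqs \<Longrightarrow> b \<in> carrier seqs \<Longrightarrow> a \<ominus>\<^bsub>seqs\<^esub> b \<in> T.dv N \<longleftrightarrow> (\<forall>k. a k \<ominus> b k \<in> multiples R (p ^ N))"
  by (simp add: dv_iff seqs_minus)

definition lamR :: "nat \<Rightarrow> 'a" where "lamR k = \<phi> (of_int (lam k))"

lemma lamR_closed [simp]: "lamR k \<in> carrier R" by (simp add: lamR_def)

lemma bidiag_eq: "x \<in> carrier seqs \<Longrightarrow> bidiag x k = lamR k \<otimes> x k \<oplus> pR \<otimes> x (Suc k)"
  using seqs_val[of x] phi_of_int[of "x (Suc k)" "int p"] by (simp add: bidiag_def lamR_def pR_def phi_of_int)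

lemma diag_eq: "x \<in> carrier seqs \<Longrightarrow> diag x k = lamR k \<otimes> x k"
  using seqs_val[of x] by (simp add: diag_def lamR_def phi_of_int)

lemma bidiag_closed [simp]: "x \<in> carrier seqs \<Longrightarrow> bidiag x \<in> carrier seqs"
  using seqs_val[of x] by (simp add: bidiag_eq seqs_simps)

lemma diag_closed [simp]: "x \<in> carrier seqs \<Longrightarrow> diag x \<in> carrier seqs"
  using seqs_val[of x] by (simp add: diag_eq seqs_simps)

lemma bidiag_minus: "x \<in> carrier seqs \<Longrightarrow> y \<in> carrier seqs \<Longrightarrow> bidiag (x \<ominus>\<^bsub>seqs\<^esub> y) = bidiag x \<ominus>\<^bsub>seqs\<^esub> bidiag y"
proof -
  assume xy: "x \<in> carrier seqs" "y \<in> carrier seqs"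
  hence c: "x k \<in> carrier R" "y k \<in> carrier R" for k by (auto simp: seqs_val)
  have "x \<ominus>\<^bsub>seqs\<^esub> y \<in> carrier seqs" using xy by (rule seqs_minus_closed)
  thus ?thesis using xy c by (simp add: fun_eq_iff bidiag_eq seqs_minus) (simp add: a_minus_def r_distr r_minus minus_add a_ac)
qed

lemma bidiag_dv: "x \<in> T.dv N \<Longrightarrow> bidiag x \<in> T.dv N"
  using T.dv_carrier[of x N] by (auto simp: dv_iff bidiag_eq intro!: mult_closed(2,5))

lemma Top_dv: "x \<in> T.dv N \<Longrightarrow> T.Top x \<in> T.dv N"
  using T.dv_step[of x N] T.dv_mono[of N "Suc N"] T.dv_closed(5) by (auto simp: T.Top_def)

lemma seqs0_D: "x \<in> seqs0 \<Longrightarrow> x \<in> carrier seqs" "x \<in> seqs0 \<Longrightarrow> x 0 = \<zero>" by (auto simp: seqs0_def)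

lemma mat_ch_0: "x \<in> carrier seqs \<Longrightarrow> mat ch x 0 = \<zero>"
  unfolding mat_def using hq_0[OF prime_p odd_p] seqs_val[of x]
  by (intro add.finprod_one_eqI) (auto simp: ch_def)

lemma H_sol_seqs0: "x \<in> seqs0 \<Longrightarrow> H.sol x N \<in> seqs0"
proof (induction N)
  case (Suc N)
  hence x: "x \<in> carrier seqs" "H.sol x N \<in> carrier seqs" by (auto simp: seqs0_D)
  have s: "pR \<odot>\<^bsub>seqs\<^esub> mat ch (H.sol x N) \<in> carrier seqs" using x by simp
  have "(pR \<odot>\<^bsub>seqs\<^esub> mat ch (H.sol x N)) 0 = \<zero>" using x by (simp add: seqs_simps(4) mat_ch_0)
  hence "H.sol x (Suc N) 0 = \<zero>" using seqs0_D(2)[OF Suc.prems] seqs_minus[OF x(1) s] by (simp add: a_minus_def)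
  moreover have "H.sol x (Suc N) \<in> carrier seqs" using x by (rule_tac H.sol_closed)
  ultimately show ?case by (simp add: seqs0_def)
qed (simp add: seqs0_def seqs_simps)

lemma H_Top_seqs0: "x \<in> seqs0 \<Longrightarrow> H.Top x \<in> seqs0"
proof -
  assume x: "x \<in> seqs0"
  hence "H.Top x \<in> carrier seqs" by (intro H.Top_closed) (simp add: seqs0_D)
  moreover have "H.Top x 0 = \<zero>" using x by (simp add: H.Top_def seqs_simps(3,4) seqs0_D mat_ch_0)
  ultimately show ?thesis by (simp add: seqs0_def)
qed

text \<open>
  In the new coordinates of the target, the image of the bidiagonal map consists of the
  multiples of the \<open>\<lambda>\<^sub>k\<close>, modulo every power of
  \<open>p\<close>.
\<close>

lemma sol_bidiag:
  assumes x: "x \<in> seqs0"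
  shows "T.sol (bidiag x) N \<ominus>\<^bsub>seqs\<^esub> diag (H.sol x N) \<in> T.dv N"
proof (rule T.sol_unique)
  have c: "x \<in> carrier seqs" "H.sol x N \<in> carrier seqs" using x by (auto simp: seqs0_D)
  thus "bidiag x \<in> carrier seqs" "diag (H.sol x N) \<in> carrier seqs" by auto
  have "bidiag (x \<ominus>\<^bsub>seqs\<^esub> H.Top (H.sol x N)) \<in> T.dv N" by (rule bidiag_dv, rule H.Top_sol) (rule c)
  thus "bidiag x \<ominus>\<^bsub>seqs\<^esub> T.Top (diag (H.sol x N)) \<in> T.dv N"
    using c by (simp add: bidiag_minus bidiag_Top[OF H_sol_seqs0[OF x], symmetric])
qed

text \<open>
  The part of \<open>n\<close> prime to \<open>p\<close> is a unit in \<open>R\<close>,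
  and the valuation of \<open>n\<close> is at most \<open>n\<close>.
\<close>

lemma pow_dvd_odd_scalar: "odd n \<Longrightarrow> multiples R (p ^ n) \<subseteq> multiples R n"
proof
  fix x assume n: "odd n" and "x \<in> multiples R (p ^ n)"
  then obtain y where y: "y \<in> carrier R" "x = \<phi> (of_nat (p ^ n)) \<otimes> y" by (auto simp: multiples_eq)
  have n1: "n \<ge> 1" using n by (cases n) auto
  have "multiplicity (int p) (int n) \<le> n"
  proof -
    have "multiplicity p n \<le> n" using vlam_bound(1)[OF prime_p odd_p n1] vlam_odd[OF prime_p n] by simp
    thus ?thesis using n1 prime_p by (simp add: multiplicity_int)
  qed
  hence r: "of_nat p ^ n / of_int (int n) \<in> Zp p" using n1 by (intro power_div_in_Zp prime_p) auto
  let ?r = "of_nat p ^ n / of_int (int n) :: rat"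
  have "of_nat (p ^ n) = of_nat n * ?r" using n1 by simp
  hence "x = \<phi> (of_nat n) \<otimes> (\<phi> ?r \<otimes> y)" using y r by (simp only: phi_mult Zp_simps m_assoc phi_closed)
  moreover have "\<phi> ?r \<otimes> y \<in> carrier R" using r y by (intro m_closed phi_closed)
  ultimately show "x \<in> multiples R n" unfolding multiples_eq by (rule image_eqI)
qed

lemma multiples_lam:
  assumes x: "x \<in> carrier R" and n: "n \<ge> 1" and o: "odd n \<Longrightarrow> x \<in> multiples R n"
  shows "\<exists>y\<in>carrier R. x = lamR n \<otimes> y"
proof (cases "odd n")
  case True
  then obtain y where y: "y \<in> carrier R" "x = \<phi> (of_nat n) \<otimes> y" using o by (auto simp: multiples_eq)
  have "lamR n = \<ominus> \<phi> (of_nat n)" using True phi_neg[of "of_nat n"] by (simp add: lamR_def lam_def)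
  thus ?thesis using y by (intro bexI[of _ "\<ominus> y"]) (auto simp: l_minus r_minus)
next
  case False
  have "multiplicity (int p) 2 \<le> 0"
    using vlam_even[OF prime_p odd_p, of 2] by (simp add: vlam_def lam_def)
  hence h: "1 / 2 \<in> Zp p" using power_div_in_Zp[OF prime_p, of 2 0] by simp
  have "\<phi> 2 \<otimes> \<phi> (1 / 2) = \<one>" using phi_mult[of 2 "1 / 2"] h Zp_simps(1)[of 2] by simp
  moreover have "\<phi> 2 \<in> carrier R" using Zp_simps(1)[of 2] phi_closed by simp
  ultimately have "x = lamR n \<otimes> (\<phi> (1 / 2) \<otimes> x)"
    using False x h by (simp add: lamR_def lam_def m_assoc[symmetric])
  thus ?thesis using h x by (intro bexI[of _ "\<phi> (1 / 2) \<otimes> x"]) auto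
qed

lemma lam_multiples: "odd n \<Longrightarrow> y \<in> carrier R \<Longrightarrow> lamR n \<otimes> y \<in> multiples R n"
proof -
  assume n: "odd n" and y: "y \<in> carrier R"
  have "lamR n = \<ominus> \<phi> (of_nat n)" using n phi_neg[of "of_nat n"] by (simp add: lamR_def lam_def)
  thus ?thesis unfolding multiples_eq using y
    by (intro image_eqI[of _ _ "\<ominus> y"]) (auto simp: l_minus r_minus)
qed

lemma pR_cancel: "pR [^] (N::nat) \<otimes> x = \<zero> \<Longrightarrow> x \<in> carrier R \<Longrightarrow> x = \<zero>"
proof (induction N)
  case (Suc N)
  have "[p] \<cdot> (pR [^] N \<otimes> x) = [p] \<cdot> \<zero>"
    using Suc.prems by (simp add: nat_scalar pR_def[symmetric] m_ac)
  hence "pR [^] N \<otimes> x = \<zero>" using torsion_free Suc.prems(2) unfolding inj_on_def by simp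
  thus ?case using Suc.IH Suc.prems(2) by blast
qed simp

subsection \<open>The comparison map\<close>

text \<open>
  A sequence is sent to its coordinates after the change of basis \<open>T\<close>. The
  coordinate \<open>0\<close> is read modulo all powers of \<open>p\<close>; for odd
  \<open>n\<close> the precision \<open>p\<^sup>n\<close> determines the coordinate
  \<open>n\<close> modulo \<open>n\<close>. For even \<open>n > 0\<close> the diagonal
  entry \<open>2\<close> is a unit and the coordinate is dropped.
\<close>

definition compare :: "(nat \<Rightarrow> 'a) \<Rightarrow> (nat \<Rightarrow> 'a set) \<times> (nat \<Rightarrow> 'a set)" where
  "compare a = (\<lambda>N. residue (p ^ N) (T.sol a N 0), \<lambda>n\<in>{n. odd n}. residue n (T.sol a n n))"

abbreviation "target \<equiv> pair_module (adic_completion R p) (prod_module {n. odd n} (ring_mod R))"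

lemma sol_c [simp]: "a \<in> carrier seqs \<Longrightarrow> T.sol a N k \<in> carrier R"
  using seqs_val[of "T.sol a N"] by simp

lemma residue_mono: "\<lbrakk>x \<in> carrier R; y \<in> carrier R; residue n x = residue n y; multiples R n \<subseteq> multiples R m\<rbrakk> \<Longrightarrow> residue m x = residue m y"
  by (auto simp: residue_eq)

lemma sol_cong: "a \<in> carrier seqs \<Longrightarrow> N \<le> K \<Longrightarrow> residue (p ^ N) (T.sol a K k) = residue (p ^ N) (T.sol a N k)"
  using T.sol_cauchy[of N K a] by (simp add: minus_dv_iff residue_eq)

lemma adic_simps: "carrier (adic_completion R p) = {c. (\<forall>k. c k \<in> carrier (ring_mod R (p ^ k))) \<and>
     (\<forall>k. c (Suc k) <+>\<^bsub>R\<^esub> multiples R (p ^ k) = c k)}"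
  "add (adic_completion R p) = (\<lambda>c d k. c k \<oplus>\<^bsub>ring_mod R (p ^ k)\<^esub> d k)"
  "smult (adic_completion R p) = (\<lambda>r c k. r \<odot>\<^bsub>ring_mod R (p ^ k)\<^esub> c k)"
  by (auto simp: adic_completion_def prod_module_def fun_eq_iff)

lemma pair_simps: "carrier (pair_module M N) = carrier M \<times> carrier N"
  "add (pair_module M N) = (\<lambda>(x, y) (x', y'). (x \<oplus>\<^bsub>M\<^esub> x', y \<oplus>\<^bsub>N\<^esub> y'))"
  "smult (pair_module M N) = (\<lambda>r (x, y). (r \<odot>\<^bsub>M\<^esub> x, r \<odot>\<^bsub>N\<^esub> y))"
  by (simp_all add: pair_module_def)

lemma compare_closed:
  assumes a: "a \<in> carrier seqs"
  shows "compare a \<in> carrier target"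
proof -
  have "residue (p ^ Suc N) (T.sol a (Suc N) 0) <+>\<^bsub>R\<^esub> multiples R (p ^ N) = residue (p ^ N) (T.sol a N 0)" for N
    using residue_transition[of "T.sol a (Suc N) 0" "p ^ N" "p ^ Suc N"] sol_cong[OF a, of N "Suc N" 0] a
    by (simp del: T.sol.simps power_Suc add: le_imp_power_dvd)
  thus ?thesis using a by (auto simp: compare_def pair_simps adic_simps prod_module_simps residue_carrier simp del: T.sol.simps)
qed

lemma compare_add: "a \<in> carrier seqs \<Longrightarrow> b \<in> carrier seqs \<Longrightarrow> compare (a \<oplus>\<^bsub>seqs\<^esub> b) = compare a \<oplus>\<^bsub>target\<^esub> compare b"
proof -
  assume ab: "a \<in> carrier seqs" "b \<in> carrier seqs"
  have s: "T.sol (a \<oplus>\<^bsub>seqs\<^esub> b) N k = T.sol a N k \<oplus> T.sol b N k" for N k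
    using T.sol_add[OF ab, of N] by (simp add: seqs_simps(3))
  have c: "T.sol a N k \<in> carrier R" "T.sol b N k \<in> carrier R" for N k using ab by simp_all
  show ?thesis unfolding compare_def s
    by (auto simp: pair_simps adic_simps prod_module_simps residue_add c fun_eq_iff restrict_def)
qed

lemma compare_smult: "r \<in> carrier R \<Longrightarrow> a \<in> carrier seqs \<Longrightarrow> compare (r \<odot>\<^bsub>seqs\<^esub> a) = r \<odot>\<^bsub>target\<^esub> compare a"
proof -
  assume r: "r \<in> carrier R" and a: "a \<in> carrier seqs"
  have s: "T.sol (r \<odot>\<^bsub>seqs\<^esub> a) N k = r \<otimes> T.sol a N k" for N k
    using T.sol_smult[OF r a, of N] by (simp add: seqs_simps(4))
  have c: "T.sol a N k \<in> carrier R" for N k using a by simp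
  show ?thesis unfolding compare_def s
    by (auto simp: pair_simps adic_simps prod_module_simps residue_smult c r fun_eq_iff restrict_def)
qed

lemma residue_zero_iff: "x \<in> carrier R \<Longrightarrow> residue n x = residue n \<zero> \<longleftrightarrow> x \<in> multiples R n"
  using residue_eq[of x \<zero> n] by (simp add: a_minus_def)

text \<open>
  The image of the bidiagonal map is closed in the \<open>p\<close>-adic sense. With
  \<open>x\<^sub>0 = 0\<close>, solving \<open>c\<^sub>m = \<lambda>\<^sub>m x\<^sub>m + p
  x\<^bsub>m+1\<^esub>\<close> from the top down prescribes \<open>p\<^sup>m x\<^sub>m =
  S\<^sub>m\<close> for a sequence \<open>S\<close> that depends only on \<open>c\<close>,
  and as \<open>p\<close> is not a zero divisor a solution exists as soon as
  \<open>p\<^sup>m\<close> divides \<open>S\<^sub>m\<close>. A solution modulo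
  \<open>p\<^sup>m\<close> suffices for that divisibility.
\<close>

lemma approx_imp_bidiag:
  assumes c: "c \<in> carrier seqs" and ap: "\<And>N. \<exists>x\<in>seqs0. c \<ominus>\<^bsub>seqs\<^esub> bidiag x \<in> T.dv N"
  shows "\<exists>x\<in>seqs0. c = bidiag x"
proof -
  (* The value that p^m x m must have. *)
  define S where "S = rec_nat \<zero> (\<lambda>m s. pR [^] m \<otimes> c m \<ominus> lamR m \<otimes> s)"
  have S0: "S 0 = \<zero>" and SS: "S (Suc m) = pR [^] m \<otimes> c m \<ominus> lamR m \<otimes> S m" for m by (simp_all add: S_def)
  have cc [simp]: "c k \<in> carrier R" for k using c by (simp add: seqs_val)
  have Sc [simp]: "S m \<in> carrier R" for m by (induction m) (simp_all add: S0 SS)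
  have mem: "S m \<in> multiples R (p ^ m)" for m
  proof -
    obtain x where x: "x \<in> seqs0" "c \<ominus>\<^bsub>seqs\<^esub> bidiag x \<in> T.dv m" using ap by blast
    have xF: "x \<in> carrier seqs" and x0: "x 0 = \<zero>" using x by (simp_all add: seqs0_D)
    have xc [simp]: "x k \<in> carrier R" for k using xF by (simp add: seqs_val)
    have e: "c k \<ominus> (lamR k \<otimes> x k \<oplus> pR \<otimes> x (Suc k)) \<in> multiples R (p ^ m)" for k
      using x(2) c xF by (simp add: minus_dv_iff bidiag_eq)
    have "S j \<ominus> pR [^] j \<otimes> x j \<in> multiples R (p ^ m)" for j
    proof (induction j)
      case 0
      thus ?case using mult_closed(6) by (simp add: S0 x0 a_minus_def)
    next
      case (Suc j)
      have "pR [^] j \<otimes> (c j \<ominus> (lamR j \<otimes> x j \<oplus> pR \<otimes> x (Suc j))) \<ominus> lamR j \<otimes> (S j \<ominus> pR [^] j \<otimes> x j) \<in> multiples R (p ^ m)"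
        by (intro mult_closed(4,5) e Suc) simp_all
      also have "pR [^] j \<otimes> (c j \<ominus> (lamR j \<otimes> x j \<oplus> pR \<otimes> x (Suc j))) \<ominus> lamR j \<otimes> (S j \<ominus> pR [^] j \<otimes> x j)
         = S (Suc j) \<ominus> pR [^] Suc j \<otimes> x (Suc j)"
      proof -
        have gen: "P \<otimes> (C \<ominus> (L \<otimes> X \<oplus> q \<otimes> Y)) \<ominus> L \<otimes> (s \<ominus> P \<otimes> X) = (P \<otimes> C \<ominus> L \<otimes> s) \<ominus> (P \<otimes> q) \<otimes> Y"
          if [simp]: "P \<in> carrier R" "C \<in> carrier R" "L \<in> carrier R" "X \<in> carrier R" "q \<in> carrier R" "Y \<in> carrier R" "s \<in> carrier R"
          for P C L X q Y s
        proof -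
          have "P \<otimes> (C \<ominus> (L \<otimes> X \<oplus> q \<otimes> Y)) \<ominus> L \<otimes> (s \<ominus> P \<otimes> X)
             = L \<otimes> (P \<otimes> X) \<oplus> (\<ominus> (L \<otimes> (P \<otimes> X)) \<oplus> (P \<otimes> C \<oplus> (\<ominus> (L \<otimes> s) \<oplus> \<ominus> (P \<otimes> (q \<otimes> Y)))))"
            by (simp add: a_minus_def r_distr r_minus minus_add a_ac m_ac)
          also have "\<dots> = P \<otimes> C \<oplus> (\<ominus> (L \<otimes> s) \<oplus> \<ominus> (P \<otimes> (q \<otimes> Y)))" by (simp add: r_neg2 r_neg1)
          finally show ?thesis by (simp add: a_minus_def a_ac m_assoc)
        qed
        show ?thesis unfolding SS by (subst gen) simp_all
      qed
      finally show ?case .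
    qed
    from this[of m] have "(S m \<ominus> pR [^] m \<otimes> x m) \<oplus> pR [^] m \<otimes> x m \<in> multiples R (p ^ m)"
      by (rule mult_closed(2)) (auto simp: multiples_eq pR_pow)
    thus ?thesis by (simp add: a_minus_def a_assoc l_neg)
  qed
  have "\<forall>m. \<exists>y. y \<in> carrier R \<and> S m = pR [^] m \<otimes> y" using mem by (auto simp: multiples_eq pR_pow)
  then obtain X where X: "\<And>m. X m \<in> carrier R" "\<And>m. S m = pR [^] m \<otimes> X m" by metis
  have XF: "X \<in> carrier seqs" using X by (simp add: seqs_simps)
  have "X 0 = \<zero>" using X(2)[of 0] X(1)[of 0] by (simp add: S0)
  moreover have "c = bidiag X"
  proof
    fix m
    have "pR [^] m \<otimes> (c m \<ominus> bidiag X m) = pR [^] m \<otimes> c m \<ominus> (lamR m \<otimes> (pR [^] m \<otimes> X m) \<oplus> pR [^] Suc m \<otimes> X (Suc m))"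
      using X XF by (simp add: bidiag_eq a_minus_def r_distr r_minus m_ac)
    also have "\<dots> = pR [^] m \<otimes> c m \<ominus> (lamR m \<otimes> S m \<oplus> S (Suc m))" using X by simp
    also have "\<dots> = \<zero>"
    proof -
      have gen: "u \<ominus> (v \<oplus> (u \<ominus> v)) = \<zero>" if "u \<in> carrier R" "v \<in> carrier R" for u v
        using that by (simp add: a_minus_def minus_add a_ac r_neg1 r_neg2 r_neg l_neg)
      show ?thesis unfolding SS by (rule gen) simp_all
    qed
    finally have "c m \<ominus> bidiag X m = \<zero>" using pR_cancel[of m "c m \<ominus> bidiag X m"] seqs_val[OF bidiag_closed[OF XF]] by simp
    moreover have "c m = (c m \<ominus> bidiag X m) \<oplus> bidiag X m"
      using seqs_val[OF bidiag_closed[OF XF], of m] by (simp add: a_minus_def a_assoc l_neg)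
    ultimately show "c m = bidiag X m" using seqs_val[OF bidiag_closed[OF XF], of m] by simp
  qed
  ultimately show ?thesis using XF by (auto simp: seqs0_def)
qed

text \<open>
  If the coordinates of \<open>c\<close> have the stated divisibility, then at every
  precision \<open>p\<^sup>N\<close> they are divided by the
  \<open>\<lambda>\<^sub>k\<close>; the quotients give a preimage of \<open>c\<close>
  modulo \<open>p\<^sup>N\<close>, and the previous lemma applies. For an odd index
  \<open>k > N\<close> the division is carried out at the higher precision
  \<open>p\<^sup>k\<close>.
\<close>

lemma compare_kernel:
  assumes c: "c \<in> carrier seqs"
  shows "(\<forall>N. T.sol c N 0 \<in> multiples R (p ^ N)) \<and> (\<forall>n. odd n \<longrightarrow> T.sol c n n \<in> multiples R n)
    \<longleftrightarrow> (\<exists>x\<in>seqs0. c = bidiag x)"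
proof
  assume "\<exists>x\<in>seqs0. c = bidiag x"
  then obtain x where x: "x \<in> seqs0" "c = bidiag x" by blast
  let ?d = "\<lambda>N. diag (H.sol x N)"
  have hF: "H.sol x N \<in> carrier seqs" "H.sol x N 0 = \<zero>" for N using H_sol_seqs0[OF x(1), of N] by (simp_all add: seqs0_D)
  hence hc: "H.sol x N k \<in> carrier R" for N k by (simp add: seqs_val)
  have s: "T.sol c N k \<ominus> ?d N k \<in> multiples R (p ^ N)" for N k
    using sol_bidiag[OF x(1), of N] c hF(1)[of N] x(2) by (simp add: minus_dv_iff)
  show "(\<forall>N. T.sol c N 0 \<in> multiples R (p ^ N)) \<and> (\<forall>n. odd n \<longrightarrow> T.sol c n n \<in> multiples R n)"
  proof (intro conjI allI impI)
    fix N show "T.sol c N 0 \<in> multiples R (p ^ N)"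
      using s[of N 0] hF[of N] c by (simp add: diag_eq a_minus_def)
  next
    fix n :: nat assume n: "odd n"
    have "(T.sol c n n \<ominus> ?d n n) \<oplus> ?d n n \<in> multiples R n"
    proof (rule mult_closed(2))
      show "T.sol c n n \<ominus> ?d n n \<in> multiples R n" using s[of n n] pow_dvd_odd_scalar[OF n] by blast
      show "?d n n \<in> multiples R n" using hF(1)[of n] hc n by (simp add: diag_eq lam_multiples)
    qed
    thus "T.sol c n n \<in> multiples R n" using c seqs_val[OF diag_closed[OF hF(1)[of n]]] by (simp add: a_minus_def a_assoc l_neg)
  qed
next
  assume K: "(\<forall>N. T.sol c N 0 \<in> multiples R (p ^ N)) \<and> (\<forall>n. odd n \<longrightarrow> T.sol c n n \<in> multiples R n)"
  have "\<exists>x\<in>seqs0. c \<ominus>\<^bsub>seqs\<^esub> bidiag x \<in> T.dv N" for N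
  proof -
    have "\<exists>y. y \<in> carrier R \<and> (k = 0 \<longrightarrow> y = \<zero>) \<and> T.sol c N k \<ominus> lamR k \<otimes> y \<in> multiples R (p ^ N)" for k
    proof (cases "k = 0")
      case True
      thus ?thesis using K c by (intro exI[of _ \<zero>]) (simp add: a_minus_def)
    next
      case False
      show ?thesis
      proof (cases "odd k \<and> N < k")
        case True
        obtain y where y: "y \<in> carrier R" "T.sol c k k = lamR k \<otimes> y"
          using multiples_lam[of "T.sol c k k" k] K True False c by auto
        have "T.sol c k k \<ominus> T.sol c N k \<in> multiples R (p ^ N)"
          using sol_cong[OF c, of N k k] True c by (simp add: residue_eq)
        hence "\<ominus> (T.sol c k k \<ominus> T.sol c N k) \<in> multiples R (p ^ N)" by (rule mult_closed(3))
        also have "\<ominus> (T.sol c k k \<ominus> T.sol c N k) = T.sol c N k \<ominus> T.sol c k k"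
          using c by (simp add: a_minus_def minus_add a_comm)
        finally show ?thesis using y False by auto
      next
        case nt: False
        have "T.sol c N k \<in> multiples R k" if "odd k"
        proof -
          have "residue (p ^ k) (T.sol c N k) = residue (p ^ k) (T.sol c k k)" using sol_cong[OF c, of k N k] nt that by simp
          hence "residue k (T.sol c N k) = residue k (T.sol c k k)"
            using residue_mono[OF _ _ _ pow_dvd_odd_scalar[OF that]] c by simp
          also have "\<dots> = residue k \<zero>" using K that c by (simp add: residue_zero_iff)
          finally show ?thesis using c by (simp add: residue_zero_iff)
        qed
        then obtain y where "y \<in> carrier R" "T.sol c N k = lamR k \<otimes> y"
          using multiples_lam[of "T.sol c N k" k] False c by auto
        thus ?thesis using False mult_closed(6) by (intro exI[of _ y]) (simp add: a_minus_def r_neg)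
      qed
    qed
    then obtain y where y: "\<And>k. y k \<in> carrier R" "y 0 = \<zero>" "\<And>k. T.sol c N k \<ominus> lamR k \<otimes> y k \<in> multiples R (p ^ N)"
      by metis
    hence yF: "y \<in> seqs0" "y \<in> carrier seqs" by (simp_all add: seqs0_def seqs_simps)
    have "T.sol c N \<ominus>\<^bsub>seqs\<^esub> diag y \<in> T.dv N" using y(3) c yF by (simp add: minus_dv_iff diag_eq)
    hence "T.Top (T.sol c N) \<ominus>\<^bsub>seqs\<^esub> T.Top (diag y) \<in> T.dv N"
      using Top_dv c yF by (simp add: T.Top_minus[symmetric])
    moreover have "c \<ominus>\<^bsub>seqs\<^esub> T.Top (T.sol c N) \<in> T.dv N" by (rule T.Top_sol) (rule c)
    ultimately have "c \<ominus>\<^bsub>seqs\<^esub> T.Top (diag y) \<in> T.dv N"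
      using T.minus_chain[of c "T.Top (T.sol c N)" "T.Top (diag y)" N] c yF by simp
    thus ?thesis using H_Top_seqs0[OF yF(1)] bidiag_Top[OF yF(1)] by (intro bexI[of _ "H.Top y"]) simp_all
  qed
  thus "\<exists>x\<in>seqs0. c = bidiag x" by (rule approx_imp_bidiag[OF c])
qed

lemma dv_self: "a \<in> carrier seqs \<Longrightarrow> a \<ominus>\<^bsub>seqs\<^esub> a \<in> T.dv N"
  using mult_closed(6) seqs_val[of a] minus_dv_iff[of a a N] by (simp add: a_minus_def[of R] r_neg)

lemma sol_minus:
  assumes a: "a \<in> carrier seqs" and b: "b \<in> carrier seqs"
  shows "T.sol a N k \<ominus> T.sol b N k = T.sol (a \<ominus>\<^bsub>seqs\<^esub> b) N k"
proof -
  let ?c = "a \<ominus>\<^bsub>seqs\<^esub> b"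
  have c: "?c \<in> carrier seqs" using a b by (rule seqs_minus_closed)
  have ac: "a = ?c \<oplus>\<^bsub>seqs\<^esub> b" using a b by (simp add: seqs_minus seqs_simps(3) fun_eq_iff) (simp add: seqs_simps a_minus_def a_assoc l_neg)
  have "T.sol a N = T.sol ?c N \<oplus>\<^bsub>seqs\<^esub> T.sol b N" using T.sol_add[OF c b, of N] ac by simp
  hence "T.sol a N k = T.sol ?c N k \<oplus> T.sol b N k" by (simp add: seqs_simps(3))
  thus ?thesis using b c by (simp add: a_minus_def a_assoc r_neg)
qed

lemma compare_eq_iff:
  assumes a: "a \<in> carrier seqs" and b: "b \<in> carrier seqs"
  shows "compare a = compare b \<longleftrightarrow> (\<exists>x\<in>seqs0. a \<ominus>\<^bsub>seqs\<^esub> b = bidiag x)"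
proof -
  let ?c = "a \<ominus>\<^bsub>seqs\<^esub> b"
  have c: "?c \<in> carrier seqs" using a b by (rule seqs_minus_closed)
  have "compare a = compare b \<longleftrightarrow> (\<forall>N. residue (p ^ N) (T.sol a N 0) = residue (p ^ N) (T.sol b N 0)) \<and> (\<forall>n. odd n \<longrightarrow> residue n (T.sol a n n) = residue n (T.sol b n n))"
    by (simp add: compare_def fun_eq_iff restrict_def)
  also have "\<dots> \<longleftrightarrow> (\<exists>x\<in>seqs0. ?c = bidiag x)"
    unfolding compare_kernel[OF c, symmetric] using a b by (simp add: residue_eq sol_minus)
  finally show ?thesis .
qed

text \<open>
  In the cokernel of the bidiagonal map, \<open>p\<^sup>k s\<close> at the index
  \<open>0\<close> equals \<open>rho k \<otimes> s\<close> at the index \<open>k\<close>,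
  by \<open>k\<close> applications of the relation \<open>p e\<^bsub>j\<^esub> = -
  \<lambda>\<^bsub>j+1\<^esub> e\<^bsub>j+1\<^esub>\<close> between unit sequences.
\<close>

definition rho :: "nat \<Rightarrow> 'a" where "rho k = \<phi> (of_int (\<Prod>i=1..k. - lam i))"

lemma rho_closed [simp]: "rho k \<in> carrier R" by (simp add: rho_def del: of_int_prod)

lemma rho_Suc: "rho (Suc k) = \<ominus> (lamR (Suc k) \<otimes> rho k)"
proof -
  have "(\<Prod>i=1..Suc k. - lam i) = - (lam (Suc k) * (\<Prod>i=1..k. - lam i))" by simp
  hence "rho (Suc k) = \<phi> (- (of_int (lam (Suc k)) * of_int (\<Prod>i=1..k. - lam i)))"
    by (simp only: rho_def of_int_minus of_int_mult)
  thus ?thesis by (simp only: phi_neg phi_mult Zp_simps lamR_def rho_def)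
qed

lemma rho_multiples:
  assumes k: "p ^ N \<le> k" and y: "y \<in> carrier R"
  shows "rho k \<otimes> y \<in> multiples R (p ^ N)"
proof -
  have p0: "p ^ N \<ge> 1" using prime_p by (simp add: prime_gt_0_nat Suc_leI)
  have "odd (p ^ N)" using odd_p by simp
  hence "- lam (p ^ N) = int (p ^ N)" by (simp add: lam_def)
  moreover have "- lam (p ^ N) dvd (\<Prod>i=1..k. - lam i)" using p0 k by (intro dvd_prodI) auto
  ultimately obtain z where z: "(\<Prod>i=1..k. - lam i) = int (p ^ N) * z" by (metis dvdE)
  have "rho k = \<phi> (of_nat (p ^ N) * of_int z)" unfolding rho_def z by simp
  hence "rho k \<otimes> y = \<phi> (of_nat (p ^ N)) \<otimes> (\<phi> (of_int z) \<otimes> y)"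
    using y by (simp only: phi_mult Zp_simps m_assoc phi_closed)
  moreover have "\<phi> (of_int z) \<otimes> y \<in> carrier R" using y by (intro m_closed phi_closed) simp_all
  ultimately show ?thesis unfolding multiples_eq by (rule image_eqI)
qed

text \<open>
  An element of the completion is a series with terms \<open>p\<^sup>k s\<^sub>k\<close>.
  In the cokernel each term can be moved from the index \<open>0\<close> to the index
  \<open>k\<close>, where it becomes \<open>rho k \<otimes> s k\<close>. These terms sit
  at different indices, so they form a sequence although the series need not converge in
  \<open>R\<close>. Modulo \<open>p\<^sup>N\<close> the sequence is again equivalent to
  the partial sum at the index \<open>0\<close>, because \<open>p\<^sup>N\<close> divides
  \<open>rho k\<close> for \<open>k \<ge> p\<^sup>N\<close>.
\<close>

lemma compare_completion:
  assumes A: "\<And>N. A N \<in> carrier R" "A 0 = \<zero>" "\<And>N. residue (p ^ N) (A (Suc N)) = residue (p ^ N) (A N)"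
  shows "\<exists>a\<in>carrier seqs. (\<forall>N. residue (p ^ N) (T.sol a N 0) = residue (p ^ N) (A N)) \<and>
    (\<forall>n. odd n \<longrightarrow> residue n (T.sol a n n) = residue n \<zero>)"
proof -
  have "\<forall>N. \<exists>y. y \<in> carrier R \<and> A (Suc N) \<ominus> A N = pR [^] N \<otimes> y"
  proof
    fix N
    have "A (Suc N) \<ominus> A N \<in> multiples R (p ^ N)" using A(3)[of N] A(1) by (simp add: residue_eq)
    thus "\<exists>y. y \<in> carrier R \<and> A (Suc N) \<ominus> A N = pR [^] N \<otimes> y" by (auto simp: multiples_eq pR_pow)
  qed
  then obtain s where s: "\<And>N. s N \<in> carrier R" "\<And>N. A (Suc N) \<ominus> A N = pR [^] N \<otimes> s N" by metis
  have As: "A (Suc N) = A N \<oplus> pR [^] N \<otimes> s N" for N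
  proof -
    have "A (Suc N) = (A (Suc N) \<ominus> A N) \<oplus> A N" using A by (simp add: a_minus_def a_assoc l_neg)
    thus ?thesis using s A by (simp add: a_comm)
  qed
  have Amono: "N \<le> K \<Longrightarrow> residue (p ^ N) (A K) = residue (p ^ N) (A N)" for N K
  proof (induction K rule: dec_induct)
    case (step K)
    have "residue (p ^ N) (A (Suc K)) = residue (p ^ N) (A K)"
      using residue_mono[OF A(1) A(1) A(3)] multiples_dvd[of "p ^ N" "p ^ K"] step by (simp add: le_imp_power_dvd)
    thus ?case using step by simp
  qed simp
  define a where "a k = rho k \<otimes> s k" for k
  have aF: "a \<in> carrier seqs" using s by (simp add: a_def seqs_simps)
  (* u d k is the sum of the p^j s (k + j) for j < d. *)
  define u where "u = rec_nat (\<lambda>k. \<zero>) (\<lambda>d f k. s k \<oplus> pR \<otimes> f (Suc k))"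
  have u0: "u 0 k = \<zero>" and uS: "u (Suc d) k = s k \<oplus> pR \<otimes> u d (Suc k)" for d k by (simp_all add: u_def)
  have uc [simp]: "u d k \<in> carrier R" for d k by (induction d arbitrary: k) (simp_all add: u0 uS s)
  have Au: "A (k + d) = A k \<oplus> pR [^] k \<otimes> u d k" for k d
  proof (induction d arbitrary: k)
    case (Suc d)
    have "A (k + Suc d) = A (Suc k + d)" by simp
    also have "\<dots> = A (Suc k) \<oplus> pR [^] Suc k \<otimes> u d (Suc k)" by (rule Suc)
    finally show ?case using A s by (simp add: As uS r_distr a_assoc m_ac)
  qed (simp add: u0 A)
  have main: "\<exists>x\<in>seqs0. a \<ominus>\<^bsub>seqs\<^esub> (bidiag x \<oplus>\<^bsub>seqs\<^esub> (\<lambda>k. if k = 0 then A (p ^ N) else \<zero>)) \<in> T.dv N" for N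
  proof -
    define M where "M = p ^ N"
    have M1: "M \<ge> 1" using prime_p by (simp add: M_def prime_gt_0_nat Suc_leI)
    define t where "t k = u (M - k) k" for k
    have t: "t k \<in> carrier R" "k < M \<Longrightarrow> t k = s k \<oplus> pR \<otimes> t (Suc k)" "k \<ge> M \<Longrightarrow> t k = \<zero>" for k
    proof -
      show "k < M \<Longrightarrow> t k = s k \<oplus> pR \<otimes> t (Suc k)" using uS[of "M - Suc k" k] by (simp add: t_def Suc_diff_Suc)
    qed (auto simp: t_def u0)
    have t0: "t 0 = A M" using Au[of 0 M] A by (simp add: t_def)
    (* Moves all terms of index below M to the index 0, one index at a time; t k collects what arrives at k. *)
    define x where "x k = (if k = 0 then \<zero> else \<ominus> (rho (k - 1) \<otimes> t k))" for k
    have x: "x \<in> seqs0" "x \<in> carrier seqs" using t(1) by (simp_all add: x_def seqs0_def seqs_simps)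
    let ?w = "\<lambda>k. if k = 0 then A (p ^ N) else \<zero>"
    have w: "?w \<in> carrier seqs" using A by (simp add: seqs_simps)
    have bw: "bidiag x \<oplus>\<^bsub>seqs\<^esub> ?w \<in> carrier seqs" using x(2) w by simp
    have "a k \<ominus> (bidiag x \<oplus>\<^bsub>seqs\<^esub> ?w) k \<in> multiples R (p ^ N)" for k
    proof (cases k)
      case 0
      have "rho 0 = \<one>" by (simp add: rho_def)
      hence "a 0 = s 0" "x (Suc 0) = \<ominus> t (Suc 0)" using s t(1) by (simp_all add: a_def x_def)
      moreover have "A (p ^ N) = s 0 \<oplus> pR \<otimes> t (Suc 0)" using t(2)[of 0] t0 M1 by (metis M_def One_nat_def Suc_le_eq)
      ultimately have "a 0 \<ominus> (bidiag x \<oplus>\<^bsub>seqs\<^esub> ?w) 0 = s 0 \<ominus> (\<ominus> (pR \<otimes> t (Suc 0)) \<oplus> (s 0 \<oplus> pR \<otimes> t (Suc 0)))"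
        using x(2) s t(1) by (simp add: seqs_simps(3) bidiag_eq x_def[of 0] r_minus)
      also have "\<dots> = \<zero>" using s t(1) by (simp add: a_minus_def minus_add a_ac r_neg1 r_neg2 r_neg l_neg)
      finally show ?thesis using mult_closed(6) 0 by simp
    next
      case (Suc j)
      have r: "rho k = \<ominus> (lamR k \<otimes> rho j)" unfolding Suc by (rule rho_Suc)
      have "bidiag x k = \<ominus> (lamR k \<otimes> (rho j \<otimes> t k)) \<oplus> \<ominus> (pR \<otimes> (rho k \<otimes> t (Suc k)))"
        using x(2) t(1) Suc by (simp add: bidiag_eq x_def r_minus)
      also have "\<dots> = rho k \<otimes> t k \<ominus> rho k \<otimes> (pR \<otimes> t (Suc k))"
      proof -
        have "\<ominus> (lamR k \<otimes> (rho j \<otimes> t k)) = rho k \<otimes> t k" using t(1) by (simp add: r l_minus m_assoc)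
        moreover have "pR \<otimes> (rho k \<otimes> t (Suc k)) = rho k \<otimes> (pR \<otimes> t (Suc k))" using t(1) by (simp add: m_lcomm)
        ultimately show ?thesis by (simp add: a_minus_def)
      qed
      finally have b: "bidiag x k = \<dots>" .
      have "a k \<ominus> (bidiag x \<oplus>\<^bsub>seqs\<^esub> ?w) k = rho k \<otimes> s k \<ominus> (rho k \<otimes> t k \<ominus> rho k \<otimes> (pR \<otimes> t (Suc k)))"
      proof -
        have "k \<noteq> 0" using Suc by simp
        thus ?thesis using s t(1) by (simp add: seqs_simps(3) b a_def)
      qed
      also have "\<dots> \<in> multiples R (p ^ N)"
      proof (cases "k < M")
        case True
        have gen: "y \<ominus> ((y \<oplus> z) \<ominus> z) = \<zero>" if "y \<in> carrier R" "z \<in> carrier R" for y z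
          using that by (simp add: a_minus_def minus_add a_ac r_neg1 r_neg2 r_neg l_neg)
        show ?thesis using s t(1) mult_closed(6) by (simp add: t(2)[OF True] r_distr gen)
      next
        case False
        hence "rho k \<otimes> s k \<ominus> (rho k \<otimes> t k \<ominus> rho k \<otimes> (pR \<otimes> t (Suc k))) = rho k \<otimes> s k"
          using s t(3)[of k] t(3)[of "Suc k"] by (simp add: a_minus_def)
        thus ?thesis using rho_multiples[of N k "s k"] False s by (simp add: M_def)
      qed
      finally show ?thesis .
    qed
    hence "a \<ominus>\<^bsub>seqs\<^esub> (bidiag x \<oplus>\<^bsub>seqs\<^esub> ?w) \<in> T.dv N" using minus_dv_iff[OF aF bw] by blast
    thus ?thesis using x by blast
  qed
  have sol: "\<exists>y\<in>seqs0. \<forall>k. residue (p ^ N) (T.sol a N k) = residue (p ^ N) (lamR k \<otimes> y k \<oplus> (if k = 0 then A (p ^ N) else \<zero>))" for N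
  proof -
    let ?w = "\<lambda>k. if k = 0 then A (p ^ N) else \<zero>"
    have w: "?w \<in> carrier seqs" using A by (simp add: seqs_simps)
    obtain x where x: "x \<in> seqs0" and xa: "a \<ominus>\<^bsub>seqs\<^esub> (bidiag x \<oplus>\<^bsub>seqs\<^esub> ?w) \<in> T.dv N" using main by blast
    have xF: "x \<in> carrier seqs" using x by (simp add: seqs0_D)
    let ?y = "H.sol x N"
    have y: "?y \<in> seqs0" "?y \<in> carrier seqs" using H_sol_seqs0[OF x] by (simp_all add: seqs0_D)
    have Tw: "T.Top ?w = ?w"
    proof -
      have "mat ct ?w k = \<zero>" for k unfolding mat_def by (intro add.finprod_one_eqI) auto
      thus ?thesis using w seqs_val[OF w] by (simp add: T.Top_def seqs_simps(3,4) fun_eq_iff)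
    qed
    have bF: "bidiag x \<oplus>\<^bsub>seqs\<^esub> ?w \<in> carrier seqs" using xF w by simp
    have e1: "residue (p ^ N) (T.sol a N k) = residue (p ^ N) (T.sol (bidiag x \<oplus>\<^bsub>seqs\<^esub> ?w) N k)" for k
    proof -
      have "T.sol (a \<ominus>\<^bsub>seqs\<^esub> (bidiag x \<oplus>\<^bsub>seqs\<^esub> ?w)) N \<in> T.dv N" using xa by (rule T.sol_dv)
      moreover have "T.sol a N k \<ominus> T.sol (bidiag x \<oplus>\<^bsub>seqs\<^esub> ?w) N k = T.sol (a \<ominus>\<^bsub>seqs\<^esub> (bidiag x \<oplus>\<^bsub>seqs\<^esub> ?w)) N k" for k
        by (rule sol_minus[OF aF bF])
      ultimately show ?thesis using aF bF by (simp add: dv_iff residue_eq)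
    qed
    have e2: "residue (p ^ N) (T.sol (bidiag x) N k) = residue (p ^ N) (diag ?y k)" for k
      using sol_bidiag[OF x, of N] xF y(2) by (simp add: minus_dv_iff residue_eq seqs_val)
    have e3: "residue (p ^ N) (T.sol ?w N k) = residue (p ^ N) (?w k)" for k
    proof -
      have "T.sol ?w N \<ominus>\<^bsub>seqs\<^esub> ?w \<in> T.dv N"
        by (rule T.sol_unique[OF w w]) (simp only: Tw dv_self[OF w])
      thus ?thesis using minus_dv_iff[OF T.sol_closed[OF w] w] w seqs_val[OF w] by (simp add: residue_eq del: if_split)
    qed
    have "residue (p ^ N) (T.sol a N k) = residue (p ^ N) (lamR k \<otimes> ?y k \<oplus> ?w k)" for k
    proof -
      have "T.sol (bidiag x \<oplus>\<^bsub>seqs\<^esub> ?w) N k = T.sol (bidiag x) N k \<oplus> T.sol ?w N k"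
        using T.sol_add[OF bidiag_closed[OF xF] w, of N] by (simp add: seqs_simps(3))
      hence "residue (p ^ N) (T.sol a N k) = residue (p ^ N) (T.sol (bidiag x) N k) \<oplus>\<^bsub>ring_mod R (p ^ N)\<^esub> residue (p ^ N) (T.sol ?w N k)"
        using e1[of k] residue_add[of "T.sol (bidiag x) N k" "T.sol ?w N k"] xF w by (simp del: if_split)
      also have "\<dots> = residue (p ^ N) (diag ?y k) \<oplus>\<^bsub>ring_mod R (p ^ N)\<^esub> residue (p ^ N) (?w k)" by (simp only: e2 e3)
      also have "\<dots> = residue (p ^ N) (diag ?y k \<oplus> ?w k)" by (rule residue_add) (use seqs_val[OF diag_closed[OF y(2)]] seqs_val[OF w] in auto)
      finally show ?thesis using y(2) by (simp only: diag_eq)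
    qed
    thus ?thesis using y(1) by blast
  qed
  have N_le: "N \<le> p ^ N" for N
    using prime_gt_1_nat[OF prime_p] by (metis less_exp less_imp_le less_le_trans power_mono Suc_leI numeral_2_eq_2 One_nat_def zero_le)
  show ?thesis
  proof (intro bexI[OF _ aF] conjI allI impI)
    fix N
    obtain y where y: "y \<in> seqs0" and e: "residue (p ^ N) (T.sol a N k) = residue (p ^ N) (lamR k \<otimes> y k \<oplus> (if k = 0 then A (p ^ N) else \<zero>))" for k
      using sol[of N] by blast
    show "residue (p ^ N) (T.sol a N 0) = residue (p ^ N) (A N)"
      using e[of 0] y Amono[OF N_le[of N]] A by (simp add: seqs0_D)
  next
    fix n :: nat assume n: "odd n"
    hence n0: "n \<noteq> 0" by (cases n) auto
    obtain y where y: "y \<in> seqs0" and e: "residue (p ^ n) (T.sol a n k) = residue (p ^ n) (lamR k \<otimes> y k \<oplus> (if k = 0 then A (p ^ n) else \<zero>))" for k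
      using sol[of n] by blast
    have yc: "y n \<in> carrier R" using y by (simp add: seqs0_D seqs_val)
    have "residue (p ^ n) (T.sol a n n) = residue (p ^ n) (lamR n \<otimes> y n)" using e[of n] n0 yc by simp
    hence "residue n (T.sol a n n) = residue n (lamR n \<otimes> y n)"
      using residue_mono[OF _ _ _ pow_dvd_odd_scalar[OF n]] aF yc by simp
    thus "residue n (T.sol a n n) = residue n \<zero>" using lam_multiples[OF n yc] yc by (simp add: residue_zero_iff)
  qed
qed

text \<open>
  The two factors are hit separately: the completion by the previous lemma, the product
  over odd \<open>n\<close> by sequences of the form \<open>T B\<close>, whose coordinates
  are the entries of \<open>B\<close>.
\<close>

lemma compare_surj:
  assumes "y \<in> carrier target"
  shows "\<exists>a\<in>carrier seqs. compare a = y"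
proof -
  obtain c d where y: "y = (c, d)" by force
  have c: "\<And>k. c k \<in> carrier (ring_mod R (p ^ k))" "\<And>k. c (Suc k) <+>\<^bsub>R\<^esub> multiples R (p ^ k) = c k"
    and d: "d \<in> (\<Pi>\<^sub>E n\<in>{n. odd n}. carrier (ring_mod R n))"
    using assms by (auto simp: y pair_simps adic_simps prod_module_simps)
  have "\<exists>A. A \<in> carrier R \<and> c N = residue (p ^ N) A \<and> (N = 0 \<longrightarrow> A = \<zero>)" for N
  proof -
    obtain A where A: "A \<in> carrier R" "c N = residue (p ^ N) A" using c(1)[of N] by (auto simp: residue_carrier)
    show ?thesis
    proof (cases "N = 0")
      case True
      have "A \<in> multiples R (p ^ N)" unfolding multiples_eq using True A by (intro image_eqI[of _ _ A]) auto
      thus ?thesis using A True by (intro exI[of _ \<zero>]) (simp add: residue_zero_iff)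
    qed (use A in blast)
  qed
  then obtain A where A: "\<And>N. A N \<in> carrier R" "\<And>N. c N = residue (p ^ N) (A N)" "A 0 = \<zero>" by metis
  have "residue (p ^ N) (A (Suc N)) = residue (p ^ N) (A N)" for N
    using c(2)[of N] residue_transition[OF A(1), of "p ^ N" "p ^ Suc N" "Suc N"] A by (simp add: le_imp_power_dvd)
  then obtain a1 where a1: "a1 \<in> carrier seqs" "\<And>N. residue (p ^ N) (T.sol a1 N 0) = c N" "\<And>n. odd n \<Longrightarrow> residue n (T.sol a1 n n) = residue n \<zero>"
    using compare_completion[of A] A by auto
  have "\<forall>n. \<exists>B. B \<in> carrier R \<and> (odd n \<longrightarrow> d n = residue n B) \<and> (n = 0 \<longrightarrow> B = \<zero>)"
  proof
    fix n
    show "\<exists>B. B \<in> carrier R \<and> (odd n \<longrightarrow> d n = residue n B) \<and> (n = 0 \<longrightarrow> B = \<zero>)"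
    proof (cases "odd n")
      case True
      hence "d n \<in> carrier (ring_mod R n)" using d by auto
      then obtain B where "B \<in> carrier R" "d n = residue n B" by (auto simp: residue_carrier)
      thus ?thesis using True by (cases n) auto
    qed auto
  qed
  then obtain B where B: "\<And>n. B n \<in> carrier R" "\<And>n. odd n \<Longrightarrow> d n = residue n (B n)" "B 0 = \<zero>" by metis
  have BF: "B \<in> carrier seqs" using B by (simp add: seqs_simps)
  define a2 where "a2 = T.Top B"
  have a2: "a2 \<in> carrier seqs" using BF by (simp add: a2_def)
  have s2: "residue (p ^ N) (T.sol a2 N k) = residue (p ^ N) (B k)" for N k
  proof -
    have "T.sol a2 N \<ominus>\<^bsub>seqs\<^esub> B \<in> T.dv N"
      by (rule T.sol_unique[OF a2 BF]) (simp only: a2_def dv_self[OF a2[unfolded a2_def]])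
    thus ?thesis using minus_dv_iff[OF T.sol_closed[OF a2] BF] a2 B by (simp add: residue_eq)
  qed
  have sum: "residue n (T.sol (a1 \<oplus>\<^bsub>seqs\<^esub> a2) N k) = residue n (T.sol a1 N k) \<oplus>\<^bsub>ring_mod R n\<^esub> residue n (T.sol a2 N k)" for n N k
    using T.sol_add[OF a1(1) a2, of N] a1(1) a2 by (simp add: seqs_simps(3) residue_add)
  have "residue (p ^ N) (T.sol (a1 \<oplus>\<^bsub>seqs\<^esub> a2) N 0) = c N" for N
    unfolding sum a1(2) s2 B(3) A(2) using A by (simp add: residue_add)
  moreover have "residue n (T.sol (a1 \<oplus>\<^bsub>seqs\<^esub> a2) n n) = d n" if n: "odd n" for n
  proof -
    have "residue n (T.sol a2 n n) = residue n (B n)"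
      using residue_mono[OF _ _ s2 pow_dvd_odd_scalar[OF n]] a2 B by simp
    thus ?thesis unfolding sum a1(3)[OF n] B(2)[OF n] using B by (simp add: residue_add)
  qed
  ultimately have "compare (a1 \<oplus>\<^bsub>seqs\<^esub> a2) = y"
    using d by (auto simp: compare_def y PiE_iff extensional_def fun_eq_iff restrict_def)
  thus ?thesis using a1(1) a2 by (intro bexI[of _ "a1 \<oplus>\<^bsub>seqs\<^esub> a2"]) auto
qed

end

section \<open>Linear maps out of free modules\<close>

definition mhom :: "('a, 'r) ring_scheme \<Rightarrow> ('a, 'b, 'm) module_scheme \<Rightarrow> ('a, 'c, 'n) module_scheme \<Rightarrow> ('b \<Rightarrow> 'c) \<Rightarrow> bool" where
  "mhom R M N h \<longleftrightarrow> (\<forall>x\<in>carrier M. h x \<in> carrier N) \<and>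
     (\<forall>x\<in>carrier M. \<forall>y\<in>carrier M. h (x \<oplus>\<^bsub>M\<^esub> y) = h x \<oplus>\<^bsub>N\<^esub> h y) \<and>
     (\<forall>r\<in>carrier R. \<forall>x\<in>carrier M. h (r \<odot>\<^bsub>M\<^esub> x) = r \<odot>\<^bsub>N\<^esub> h x)"

lemma mhomD:
  assumes "mhom R M N h"
  shows "x \<in> carrier M \<Longrightarrow> h x \<in> carrier N"
    "x \<in> carrier M \<Longrightarrow> y \<in> carrier M \<Longrightarrow> h (x \<oplus>\<^bsub>M\<^esub> y) = h x \<oplus>\<^bsub>N\<^esub> h y"
    "r \<in> carrier R \<Longrightarrow> x \<in> carrier M \<Longrightarrow> h (r \<odot>\<^bsub>M\<^esub> x) = r \<odot>\<^bsub>N\<^esub> h x"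
  using assms by (auto simp: mhom_def)

lemma mhom_comp: "mhom R M N h \<Longrightarrow> mhom R N P k \<Longrightarrow> mhom R M P (\<lambda>x. k (h x))"
  by (auto simp: mhom_def)

lemma mhom_props:
  assumes M: "module R M" and N: "module R N" and h: "mhom R M N h"
  shows "h \<zero>\<^bsub>M\<^esub> = \<zero>\<^bsub>N\<^esub>" "x \<in> carrier M \<Longrightarrow> h (\<ominus>\<^bsub>M\<^esub> x) = \<ominus>\<^bsub>N\<^esub> h x"
    "x \<in> carrier M \<Longrightarrow> y \<in> carrier M \<Longrightarrow> h (x \<ominus>\<^bsub>M\<^esub> y) = h x \<ominus>\<^bsub>N\<^esub> h y"
    "finite I \<Longrightarrow> (\<And>i. i \<in> I \<Longrightarrow> f i \<in> carrier M) \<Longrightarrow> h (\<Oplus>\<^bsub>M\<^esub>i\<in>I. f i) = (\<Oplus>\<^bsub>N\<^esub>i\<in>I. h (f i))"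
    "x \<in> carrier M \<Longrightarrow> h (sgn_pow M k x) = sgn_pow N k (h x)"
proof -
  interpret M: module R M by fact
  interpret N: module R N by fact
  show z: "h \<zero>\<^bsub>M\<^esub> = \<zero>\<^bsub>N\<^esub>" using mhomD(3)[OF h, of "\<zero>\<^bsub>R\<^esub>" "\<zero>\<^bsub>M\<^esub>"] mhomD(1)[OF h] by simp
  show n: "h (\<ominus>\<^bsub>M\<^esub> x) = \<ominus>\<^bsub>N\<^esub> h x" if "x \<in> carrier M" for x
  proof -
    have "h (\<ominus>\<^bsub>M\<^esub> x) \<oplus>\<^bsub>N\<^esub> h x = \<zero>\<^bsub>N\<^esub>"
      using that mhomD(2)[OF h, of "\<ominus>\<^bsub>M\<^esub> x" x] by (simp add: M.l_neg z)
    thus ?thesis using that mhomD(1)[OF h] by (simp add: N.minus_equality)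
  qed
  show "h (x \<ominus>\<^bsub>M\<^esub> y) = h x \<ominus>\<^bsub>N\<^esub> h y" if "x \<in> carrier M" "y \<in> carrier M"
    using that by (simp add: a_minus_def mhomD(2)[OF h] n)
  show "h (\<Oplus>\<^bsub>M\<^esub>i\<in>I. f i) = (\<Oplus>\<^bsub>N\<^esub>i\<in>I. h (f i))" if "finite I" "\<And>i. i \<in> I \<Longrightarrow> f i \<in> carrier M"
    using that
  proof (induction I rule: finite_induct)
    case (insert i I)
    thus ?case using mhomD(1)[OF h] by (simp add: Pi_def mhomD(2)[OF h])
  qed (simp add: z)
  show "h (sgn_pow M k x) = sgn_pow N k (h x)" if "x \<in> carrier M"
    using that by (simp add: sgn_pow_def n)
qed

context cring
begin

lemma free_gen_closed: "x \<in> X \<Longrightarrow> free_gen R x \<in> carrier (free_module R X)"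
  by (auto simp: free_module_simps free_gen_def)

lemma free_val: "f \<in> carrier (free_module R X) \<Longrightarrow> f x \<in> carrier R"
  by (auto simp: free_module_simps)

lemma lin_ext_alt:
  assumes M: "module R M" and f: "f \<in> carrier (free_module R X)" and g: "\<And>x. x \<in> X \<Longrightarrow> g x \<in> carrier M"
    and S: "finite S" "{x. f x \<noteq> \<zero>} \<subseteq> S" "S \<subseteq> X"
  shows "lin_ext R M g f = (\<Oplus>\<^bsub>M\<^esub>x\<in>S. f x \<odot>\<^bsub>M\<^esub> g x)"
proof -
  interpret M: module R M by fact
  show ?thesis unfolding lin_ext_def
    using S f g by (intro M.add.finprod_mono_neutral_cong_left) (auto simp: free_val)
qed

lemma free_supp: "f \<in> carrier (free_module R X) \<Longrightarrow> finite {x. f x \<noteq> \<zero>} \<and> {x. f x \<noteq> \<zero>} \<subseteq> X"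
  by (auto simp: free_module_simps)

lemma mhom_lin_ext:
  assumes M: "module R M" and g: "\<And>x. x \<in> X \<Longrightarrow> g x \<in> carrier M"
  shows "mhom R (free_module R X) M (lin_ext R M g)"
proof -
  interpret M: module R M by fact
  interpret F: module R "free_module R X" by (rule module_free) (rule is_cring)
  show ?thesis unfolding mhom_def
  proof (intro conjI ballI)
    fix f assume f: "f \<in> carrier (free_module R X)"
    let ?S = "{x. f x \<noteq> \<zero>}"
    have S: "finite ?S" "?S \<subseteq> X" using free_supp[OF f] by auto
    have fc: "f x \<in> carrier R" for x by (rule free_val[OF f])
    have le: "lin_ext R M g f = (\<Oplus>\<^bsub>M\<^esub>x\<in>?S. f x \<odot>\<^bsub>M\<^esub> g x)" by (rule lin_ext_alt[OF M f g]) (use S in auto)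
    show "lin_ext R M g f \<in> carrier M" unfolding le using S g fc by (intro M.finsum_closed) auto
    { fix r assume r: "r \<in> carrier R"
      have "lin_ext R M g (r \<odot>\<^bsub>free_module R X\<^esub> f) = (\<Oplus>\<^bsub>M\<^esub>x\<in>?S. (r \<odot>\<^bsub>free_module R X\<^esub> f) x \<odot>\<^bsub>M\<^esub> g x)"
        by (rule lin_ext_alt[OF M F.smult_closed[OF r f] g]) (use S r in \<open>auto simp: free_module_simps\<close>)
      also have "\<dots> = (\<Oplus>\<^bsub>M\<^esub>x\<in>?S. r \<odot>\<^bsub>M\<^esub> (f x \<odot>\<^bsub>M\<^esub> g x))"
        using S g fc r by (intro M.finsum_cong') (auto simp: free_module_simps M.smult_assoc1)
      also have "\<dots> = r \<odot>\<^bsub>M\<^esub> lin_ext R M g f" unfolding le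
        using S g fc r by (intro M.finsum_smult_ldistr[symmetric]) auto
      finally show "lin_ext R M g (r \<odot>\<^bsub>free_module R X\<^esub> f) = r \<odot>\<^bsub>M\<^esub> lin_ext R M g f" . }
    fix f' assume f': "f' \<in> carrier (free_module R X)"
    let ?S = "{x. f x \<noteq> \<zero>} \<union> {x. f' x \<noteq> \<zero>}"
    have S: "finite ?S" "?S \<subseteq> X" using free_supp[OF f] free_supp[OF f'] by auto
    have fc': "f' x \<in> carrier R" for x by (rule free_val[OF f'])
    have "lin_ext R M g (f \<oplus>\<^bsub>free_module R X\<^esub> f') = (\<Oplus>\<^bsub>M\<^esub>x\<in>?S. (f \<oplus>\<^bsub>free_module R X\<^esub> f') x \<odot>\<^bsub>M\<^esub> g x)"
      by (rule lin_ext_alt[OF M F.M.add.m_closed[OF f f'] g]) (use S in \<open>auto simp: free_module_simps\<close>)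
    also have "\<dots> = (\<Oplus>\<^bsub>M\<^esub>x\<in>?S. f x \<odot>\<^bsub>M\<^esub> g x \<oplus>\<^bsub>M\<^esub> f' x \<odot>\<^bsub>M\<^esub> g x)"
      using S g fc fc' by (intro M.finsum_cong') (auto simp: free_module_simps M.smult_l_distr)
    also have "\<dots> = (\<Oplus>\<^bsub>M\<^esub>x\<in>?S. f x \<odot>\<^bsub>M\<^esub> g x) \<oplus>\<^bsub>M\<^esub> (\<Oplus>\<^bsub>M\<^esub>x\<in>?S. f' x \<odot>\<^bsub>M\<^esub> g x)"
      using S g fc fc' by (intro M.finsum_addf) auto
    also have "(\<Oplus>\<^bsub>M\<^esub>x\<in>?S. f x \<odot>\<^bsub>M\<^esub> g x) = lin_ext R M g f" by (rule lin_ext_alt[OF M f g, symmetric]) (use S in auto)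
    also have "(\<Oplus>\<^bsub>M\<^esub>x\<in>?S. f' x \<odot>\<^bsub>M\<^esub> g x) = lin_ext R M g f'" by (rule lin_ext_alt[OF M f' g, symmetric]) (use S in auto)
    finally show "lin_ext R M g (f \<oplus>\<^bsub>free_module R X\<^esub> f') = lin_ext R M g f \<oplus>\<^bsub>M\<^esub> lin_ext R M g f'" .
  qed
qed

lemma lin_ext_gen:
  assumes M: "module R M" and g: "g x \<in> carrier M"
  shows "lin_ext R M g (free_gen R x) = g x"
proof -
  interpret M: module R M by fact
  have "lin_ext R M g (free_gen R x) = (\<Oplus>\<^bsub>M\<^esub>y\<in>{x}. free_gen R x y \<odot>\<^bsub>M\<^esub> g y)"
    by (rule lin_ext_alt[OF M, of _ "{x}"]) (use g in \<open>auto simp: free_module_simps free_gen_def\<close>)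
  thus ?thesis using g by (simp add: free_gen_def)
qed

text \<open>
  Linear maps out of a free module are determined by their values on the generators. This
  is how maps on tensor powers are compared, since these are quotients of free modules.
\<close>

lemma lin_ext_unique:
  assumes M: "module R M" and h: "mhom R (free_module R X) M h" and g: "\<And>x. x \<in> X \<Longrightarrow> h (free_gen R x) = g x"
    and f: "f \<in> carrier (free_module R X)"
  shows "h f = lin_ext R M g f"
proof -
  interpret M: module R M by fact
  let ?F = "free_module R X"
  interpret F: module R ?F by (rule module_free) (rule is_cring)
  have gc: "g x \<in> carrier M" if "x \<in> X" for x using g[OF that] mhomD(1)[OF h free_gen_closed[OF that]] by simp
  have "h f = (\<Oplus>\<^bsub>M\<^esub>x\<in>S. f x \<odot>\<^bsub>M\<^esub> g x)"
    if "finite S" "S \<subseteq> X" "f \<in> carrier ?F" "{x. f x \<noteq> \<zero>} \<subseteq> S" for S f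
    using that
  proof (induction S arbitrary: f rule: finite_induct)
    case empty
    hence "f = \<zero>\<^bsub>?F\<^esub>" by (auto simp: free_module_simps)
    thus ?case using mhom_props(1)[OF F.module_axioms M h] by simp
  next
    case (insert x S)
    let ?f = "f(x := \<zero>)"
    have fc: "f y \<in> carrier R" for y by (rule free_val[OF insert.prems(2)])
    have "finite {y. ?f y \<noteq> \<zero>}"
      by (rule finite_subset[of _ "{y. f y \<noteq> \<zero>}"]) (use insert.prems(2) in \<open>auto simp: free_module_simps\<close>)
    hence f': "?f \<in> carrier ?F" using insert.prems(2) unfolding free_module_simps by (simp add: Pi_iff)
    have x: "x \<in> X" using insert by auto
    have "f = ?f \<oplus>\<^bsub>?F\<^esub> f x \<odot>\<^bsub>?F\<^esub> free_gen R x"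
      using fc by (auto simp: free_module_simps free_gen_def fun_eq_iff)
    hence "h f = h ?f \<oplus>\<^bsub>M\<^esub> f x \<odot>\<^bsub>M\<^esub> g x"
      using mhomD(2,3)[OF h] f' fc free_gen_closed[OF x] g[OF x] by (metis F.smult_closed)
    also have "h ?f = (\<Oplus>\<^bsub>M\<^esub>y\<in>S. ?f y \<odot>\<^bsub>M\<^esub> g y)"
      by (rule insert.IH[OF _ f']) (use insert in auto)
    also have "\<dots> = (\<Oplus>\<^bsub>M\<^esub>y\<in>S. f y \<odot>\<^bsub>M\<^esub> g y)"
      using insert fc gc by (intro M.finsum_cong') auto
    finally show ?case using insert fc gc by (simp add: Pi_def M.a_comm subset_iff)
  qed
  from this[of "{x. f x \<noteq> \<zero>}" f] show ?thesis using free_supp[OF f] f by (simp add: lin_ext_def)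
qed

end

section \<open>Coordinates on the tensor powers\<close>

definition degs :: "nat \<Rightarrow> nat \<Rightarrow> nat list set" where
  "degs n m = {d. length d = Suc n \<and> sum_list d = m}"

lemma finite_degs [simp]: "finite (degs n m)"
proof (rule finite_subset)
  show "degs n m \<subseteq> {d. set d \<subseteq> {..m} \<and> length d = Suc n}"
    by (auto simp: degs_def intro: member_le_sum_list)
  show "finite {d. set d \<subseteq> {..m} \<and> length d = Suc n}" by (rule finite_lists_length_eq) simp
qed

locale dg_poly = cring R for R :: "('a, 'r) ring_scheme" (structure) + fixes p :: nat
begin

abbreviation A :: "('a, nat \<Rightarrow> 'a) dg_alg" where "A \<equiv> dg_kill R p"
abbreviation gens :: "nat \<Rightarrow> nat \<Rightarrow> (nat \<times> (nat \<Rightarrow> 'a)) list set" where "gens n m \<equiv> tensor_gens A n m"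
abbreviation TF :: "nat \<Rightarrow> nat \<Rightarrow> ('a, (nat \<times> (nat \<Rightarrow> 'a)) list \<Rightarrow> 'a) module" where "TF n m \<equiv> tensor_free R A n m"
abbreviation TP :: "nat \<Rightarrow> nat \<Rightarrow> ('a, ((nat \<times> (nat \<Rightarrow> 'a)) list \<Rightarrow> 'a) set) module" where "TP n m \<equiv> tensor_power R A n m"
abbreviation V :: "nat \<Rightarrow> nat \<Rightarrow> ('a, nat list \<Rightarrow> 'a) module" where "V n m \<equiv> free_module R (degs n m)"

sublocale U: UP_cring R "UP R" by (simp add: UP_cring_def is_cring)

lemma coeff_monom: "r \<in> carrier R \<Longrightarrow> monom (UP R) r d = (\<lambda>i. if i = d then r else \<zero>)"
  by (auto simp: UP_def)

lemma gradeD: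
  assumes "a \<in> grade A d"
  shows "a d \<in> carrier R" "a = monom (UP R) (a d) d"
  using assms by (auto simp: dg_kill_simps coeff_monom)

lemma gradeI: "r \<in> carrier R \<Longrightarrow> monom (UP R) r d \<in> grade A d"
  by (auto simp: dg_kill_simps)

lemma monom_at: "r \<in> carrier R \<Longrightarrow> monom (UP R) r d d = r"
  by (simp add: coeff_monom)

lemma grade_add:
  assumes "a \<in> grade A d" "b \<in> grade A d"
  shows "a \<oplus>\<^bsub>A\<^esub> b \<in> grade A d" "(a \<oplus>\<^bsub>A\<^esub> b) d = a d \<oplus> b d"
proof -
  have "a \<oplus>\<^bsub>A\<^esub> b = monom (UP R) (a d \<oplus> b d) d"
    using gradeD[OF assms(1)] gradeD[OF assms(2)] by (metis U.monom_add dg_kill_simps(5))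
  thus "a \<oplus>\<^bsub>A\<^esub> b \<in> grade A d" "(a \<oplus>\<^bsub>A\<^esub> b) d = a d \<oplus> b d"
    using gradeD(1)[OF assms(1)] gradeD(1)[OF assms(2)] by (simp_all add: gradeI monom_at del: U.monom_add U.monom_mult)
qed

lemma grade_smult:
  assumes "a \<in> grade A d" "r \<in> carrier R"
  shows "r \<odot>\<^bsub>A\<^esub> a \<in> grade A d" "(r \<odot>\<^bsub>A\<^esub> a) d = r \<otimes> a d"
proof -
  have "r \<odot>\<^bsub>A\<^esub> a = monom (UP R) (r \<otimes> a d) d"
    using gradeD[OF assms(1)] assms(2) by (metis U.monom_mult_smult dg_kill_simps(6))
  thus "r \<odot>\<^bsub>A\<^esub> a \<in> grade A d" "(r \<odot>\<^bsub>A\<^esub> a) d = r \<otimes> a d"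
    using gradeD(1)[OF assms(1)] assms(2) by (simp_all add: gradeI monom_at)
qed

lemma grade_mult:
  assumes "a \<in> grade A d" "b \<in> grade A e"
  shows "a \<otimes>\<^bsub>A\<^esub> b \<in> grade A (d + e)" "(a \<otimes>\<^bsub>A\<^esub> b) (d + e) = a d \<otimes> b e"
proof -
  have "a \<otimes>\<^bsub>A\<^esub> b = monom (UP R) (a d \<otimes> b e) (d + e)"
    using gradeD[OF assms(1)] gradeD[OF assms(2)] by (metis U.monom_mult dg_kill_simps(2))
  thus "a \<otimes>\<^bsub>A\<^esub> b \<in> grade A (d + e)" "(a \<otimes>\<^bsub>A\<^esub> b) (d + e) = a d \<otimes> b e"
    using gradeD(1)[OF assms(1)] gradeD(1)[OF assms(2)] by (simp_all add: gradeI monom_at del: U.monom_add U.monom_mult)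
qed

lemma grade_diff:
  assumes "a \<in> grade A d" "0 < d"
  shows "differential A a \<in> grade A (d - 1)" "differential A a (d - 1) = (if odd d then [p] \<cdot> a d else \<zero>)"
proof -
  have a: "a = (\<lambda>i. if i = d then a d else \<zero>)" using gradeD[OF assms(1)] coeff_monom by metis
  have "differential A a = monom (UP R) (if odd d then [p] \<cdot> a d else \<zero>) (d - 1)"
  proof -
    have "(if odd d then [p] \<cdot> a d else \<zero>) \<in> carrier R" using gradeD(1)[OF assms(1)] by simp
    moreover have "differential A a n = (if n = d - 1 then if odd d then [p] \<cdot> a d else \<zero> else \<zero>)" for n
      using assms(2) by (subst a) (auto simp: dg_kill_simps)
    ultimately show ?thesis by (simp add: coeff_monom fun_eq_iff)
  qed
  thus "differential A a \<in> grade A (d - 1)" "differential A a (d - 1) = (if odd d then [p] \<cdot> a d else \<zero>)"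
    using gradeD(1)[OF assms(1)] by (simp_all add: gradeI monom_at)
qed

text \<open>
  A homogeneous element of degree \<open>d\<close> is \<open>r x\<^sup>d\<close> with
  \<open>r\<close> its value at \<open>d\<close>. So an elementary tensor is the product
  of these coefficients times the tensor of the powers of \<open>x\<close>.
\<close>

primrec coeff_prod :: "(nat \<times> (nat \<Rightarrow> 'a)) list \<Rightarrow> 'a" where
  "coeff_prod [] = \<one>"
| "coeff_prod (x # l) = snd x (fst x) \<otimes> coeff_prod l"

definition homog :: "(nat \<times> (nat \<Rightarrow> 'a)) list \<Rightarrow> bool" where
  "homog l \<longleftrightarrow> (\<forall>(d, a)\<in>set l. a \<in> grade A d)"

lemma homog_simps [simp]: "homog []" "homog (x # l) \<longleftrightarrow> snd x \<in> grade A (fst x) \<and> homog l"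
  "homog (l @ l') \<longleftrightarrow> homog l \<and> homog l'"
  by (auto simp: homog_def)

lemma gens_iff: "l \<in> gens n m \<longleftrightarrow> homog l \<and> map fst l \<in> degs n m"
  by (auto simp: tensor_gens_def homog_def degs_def tdeg_def)

lemma coeff_prod_closed [simp]: "homog l \<Longrightarrow> coeff_prod l \<in> carrier R"
  by (induction l) (auto intro: gradeD)

lemma coeff_prod_append: "homog l \<Longrightarrow> homog l' \<Longrightarrow> coeff_prod (l @ l') = coeff_prod l \<otimes> coeff_prod l'"
  by (induction l) (auto simp: m_assoc gradeD(1))

definition gV :: "(nat \<times> (nat \<Rightarrow> 'a)) list \<Rightarrow> nat list \<Rightarrow> 'a" where
  "gV l = (\<lambda>e. if e = map fst l then coeff_prod l else \<zero>)"

text \<open>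
  The coordinates on the free module that presents the tensor power. They kill the
  relations of multilinearity and induce \<open>tp_coord\<close> on the quotient.
\<close>

definition crd :: "nat \<Rightarrow> nat \<Rightarrow> ((nat \<times> (nat \<Rightarrow> 'a)) list \<Rightarrow> 'a) \<Rightarrow> nat list \<Rightarrow> 'a" where
  "crd n m = lin_ext R (V n m) gV"

lemma module_V: "module R (V n m)" by (rule module_free) (rule is_cring)

lemma module_TF: "module R (TF n m)" unfolding tensor_free_def by (rule module_free) (rule is_cring)

lemma gV_closed: "l \<in> gens n m \<Longrightarrow> gV l \<in> carrier (V n m)"
  using finite_subset[of "{x. gV l x \<noteq> \<zero>}" "{map fst l}"] by (auto simp: free_module_simps gV_def gens_iff)

lemma gV_eq: "l \<in> gens n m \<Longrightarrow> gV l = coeff_prod l \<odot>\<^bsub>V n m\<^esub> free_gen R (map fst l)"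
  by (auto simp: gV_def free_gen_def free_module_simps gens_iff fun_eq_iff)

lemma mhom_crd: "mhom R (TF n m) (V n m) (crd n m)"
  unfolding crd_def tensor_free_def by (rule mhom_lin_ext[OF module_V gV_closed])

lemma crd_gen: "l \<in> gens n m \<Longrightarrow> crd n m (free_gen R l) = gV l"
  unfolding crd_def by (rule lin_ext_gen[OF module_V]) (rule gV_closed)

definition rel_gens :: "nat \<Rightarrow> nat \<Rightarrow> ((nat \<times> (nat \<Rightarrow> 'a)) list \<Rightarrow> 'a) set" where
  "rel_gens n m =
     {free_gen R (u @ (d, a \<oplus>\<^bsub>A\<^esub> b) # v) \<ominus>\<^bsub>TF n m\<^esub>
         (free_gen R (u @ (d, a) # v) \<oplus>\<^bsub>TF n m\<^esub> free_gen R (u @ (d, b) # v)) |u d a b v.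
         u @ (d, a) # v \<in> gens n m \<and> u @ (d, b) # v \<in> gens n m} \<union>
      {free_gen R (u @ (d, r \<odot>\<^bsub>A\<^esub> a) # v) \<ominus>\<^bsub>TF n m\<^esub>
         (r \<odot>\<^bsub>TF n m\<^esub> free_gen R (u @ (d, a) # v)) |u d r a v.
         r \<in> carrier R \<and> u @ (d, a) # v \<in> gens n m}"

lemma tensor_rels_eq: "tensor_rels R A n m = submodule_span R (TF n m) (rel_gens n m)"
  by (simp add: tensor_rels_def rel_gens_def)

lemma gen_closed: "l \<in> gens n m \<Longrightarrow> free_gen R l \<in> carrier (TF n m)"
  unfolding tensor_free_def by (rule free_gen_closed)

lemma gens_add: "u @ (d, a) # v \<in> gens n m \<Longrightarrow> u @ (d, b) # v \<in> gens n m \<Longrightarrow> u @ (d, a \<oplus>\<^bsub>A\<^esub> b) # v \<in> gens n m"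
  by (auto simp: gens_iff grade_add)

lemma gens_smult: "r \<in> carrier R \<Longrightarrow> u @ (d, a) # v \<in> gens n m \<Longrightarrow> u @ (d, r \<odot>\<^bsub>A\<^esub> a) # v \<in> gens n m"
  by (auto simp: gens_iff grade_smult)

lemma rel_gens_crd:
  assumes "x \<in> rel_gens n m"
  shows "x \<in> carrier (TF n m) \<and> crd n m x = \<zero>\<^bsub>V n m\<^esub>"
proof -
  interpret TF: module R "TF n m" by (rule module_TF)
  interpret V: module R "V n m" by (rule module_V)
  note mp = mhom_props[OF module_TF module_V mhom_crd] mhomD[OF mhom_crd]
  from assms consider (add) u d a b v where "u @ (d, a) # v \<in> gens n m" "u @ (d, b) # v \<in> gens n m"
      "x = free_gen R (u @ (d, a \<oplus>\<^bsub>A\<^esub> b) # v) \<ominus>\<^bsub>TF n m\<^esub> (free_gen R (u @ (d, a) # v) \<oplus>\<^bsub>TF n m\<^esub> free_gen R (u @ (d, b) # v))"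
    | (sm) u d r a v where "r \<in> carrier R" "u @ (d, a) # v \<in> gens n m"
      "x = free_gen R (u @ (d, r \<odot>\<^bsub>A\<^esub> a) # v) \<ominus>\<^bsub>TF n m\<^esub> (r \<odot>\<^bsub>TF n m\<^esub> free_gen R (u @ (d, a) # v))"
    unfolding rel_gens_def by blast
  thus ?thesis
  proof cases
    case add
    have h: "homog u" "homog v" "a \<in> grade A d" "b \<in> grade A d" using add(1,2) by (auto simp: gens_iff)
    hence ad: "a d \<in> carrier R" "b d \<in> carrier R" by (auto intro: gradeD)
    have "gV (u @ (d, a \<oplus>\<^bsub>A\<^esub> b) # v) = gV (u @ (d, a) # v) \<oplus>\<^bsub>V n m\<^esub> gV (u @ (d, b) # v)"
      using h ad by (auto simp: gV_def free_module_simps coeff_prod_append grade_add fun_eq_iff l_distr r_distr)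
    moreover have "crd n m x = gV (u @ (d, a \<oplus>\<^bsub>A\<^esub> b) # v) \<ominus>\<^bsub>V n m\<^esub> (gV (u @ (d, a) # v) \<oplus>\<^bsub>V n m\<^esub> gV (u @ (d, b) # v))"
      using add(1,2) gens_add[OF add(1,2)] unfolding add(3) by (simp add: mp gen_closed crd_gen)
    ultimately show ?thesis using add gens_add[OF add(1,2)] gV_closed[OF add(1)] gV_closed[OF add(2)]
      by (simp add: a_minus_def V.r_neg gen_closed)
  next
    case sm
    have h: "homog u" "homog v" "a \<in> grade A d" using sm(2) by (auto simp: gens_iff)
    hence ad: "a d \<in> carrier R" by (auto intro: gradeD)
    have "gV (u @ (d, r \<odot>\<^bsub>A\<^esub> a) # v) = r \<odot>\<^bsub>V n m\<^esub> gV (u @ (d, a) # v)"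
      using h ad sm(1) by (auto simp: gV_def free_module_simps coeff_prod_append grade_smult fun_eq_iff m_ac)
    moreover have "crd n m x = gV (u @ (d, r \<odot>\<^bsub>A\<^esub> a) # v) \<ominus>\<^bsub>V n m\<^esub> (r \<odot>\<^bsub>V n m\<^esub> gV (u @ (d, a) # v))"
      using sm(1,2) gens_smult[OF sm(1,2)] unfolding sm(3) by (simp add: mp gen_closed crd_gen)
    ultimately show ?thesis using sm gens_smult[OF sm(1,2)] gV_closed[OF sm(2)]
      by (simp add: a_minus_def V.r_neg gen_closed)
  qed
qed

lemma mhom_kernel_submodule:
  assumes M: "module R M" and N: "module R N" and h: "mhom R M N h"
  shows "submodule {x \<in> carrier M. h x = \<zero>\<^bsub>N\<^esub>} R M"
proof -
  interpret M: module R M by fact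
  interpret N: module R N by fact
  show ?thesis
    by (rule M.submoduleI) (auto simp: mhom_props[OF M N h] mhomD[OF h])
qed

lemma rels_submodule: "submodule (tensor_rels R A n m) R (TF n m)"
  and rel_gens_rels: "rel_gens n m \<subseteq> tensor_rels R A n m"
  and rels_kernel: "x \<in> tensor_rels R A n m \<Longrightarrow> crd n m x = \<zero>\<^bsub>V n m\<^esub>"
proof -
  have c: "rel_gens n m \<subseteq> carrier (TF n m)" using rel_gens_crd by blast
  note sp = submodule_span[OF module_TF c, folded tensor_rels_eq]
  show "submodule (tensor_rels R A n m) R (TF n m)" "rel_gens n m \<subseteq> tensor_rels R A n m" by (rule sp)+
  have "rel_gens n m \<subseteq> {x \<in> carrier (TF n m). crd n m x = \<zero>\<^bsub>V n m\<^esub>}" using rel_gens_crd by blast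
  from sp(3)[OF mhom_kernel_submodule[OF module_TF module_V mhom_crd] this]
  show "x \<in> tensor_rels R A n m \<Longrightarrow> crd n m x = \<zero>\<^bsub>V n m\<^esub>" by blast
qed

sublocale TQ: submod R "TF n m" "tensor_rels R A n m" for n m
  by (rule submodI[OF module_TF rels_submodule])

abbreviation tn :: "nat \<Rightarrow> nat \<Rightarrow> (nat \<times> (nat \<Rightarrow> 'a)) list \<Rightarrow> ((nat \<times> (nat \<Rightarrow> 'a)) list \<Rightarrow> 'a) set" where
  "tn \<equiv> tensor R A"

lemma tn_eq: "tn n m l = TQ.cs n m (free_gen R l)"
  by (simp add: tensor_def)

lemma module_TP: "module R (TP n m)"
  unfolding tensor_power_def by (rule TQ.module_quot)

lemma tn_closed: "l \<in> gens n m \<Longrightarrow> tn n m l \<in> carrier (TP n m)"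
  unfolding tensor_power_def tn_eq by (intro TQ.cs_quot gen_closed)

lemma tn_smult:
  assumes r: "r \<in> carrier R" and l: "u @ (d, a) # v \<in> gens n m"
  shows "tn n m (u @ (d, r \<odot>\<^bsub>A\<^esub> a) # v) = r \<odot>\<^bsub>TP n m\<^esub> tn n m (u @ (d, a) # v)"
proof -
  interpret TF: module R "TF n m" by (rule module_TF)
  have "free_gen R (u @ (d, r \<odot>\<^bsub>A\<^esub> a) # v) \<ominus>\<^bsub>TF n m\<^esub> (r \<odot>\<^bsub>TF n m\<^esub> free_gen R (u @ (d, a) # v)) \<in> tensor_rels R A n m"
    using rel_gens_rels r l unfolding rel_gens_def by blast
  hence "tn n m (u @ (d, r \<odot>\<^bsub>A\<^esub> a) # v) = TQ.cs n m (r \<odot>\<^bsub>TF n m\<^esub> free_gen R (u @ (d, a) # v))"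
    unfolding tn_eq using r gen_closed[OF l] gen_closed[OF gens_smult[OF r l]] by (simp add: TQ.cs_eq_iff)
  thus ?thesis unfolding tn_eq tensor_power_def using r gen_closed[OF l] by (simp add: TQ.smult_quot)
qed

definition basis_word :: "nat list \<Rightarrow> (nat \<times> (nat \<Rightarrow> 'a)) list" where
  "basis_word e = map (\<lambda>d. (d, monom (UP R) \<one> d)) e"

lemma basis_word_simps [simp]: "map fst (basis_word e) = e" "homog (basis_word e)" "basis_word (d # e) = (d, monom (UP R) \<one> d) # basis_word e" "basis_word [] = []"
  by (auto simp: basis_word_def homog_def gradeI o_def)

lemma basis_word_gens: "e \<in> degs n m \<Longrightarrow> basis_word e \<in> gens n m"
  by (simp add: gens_iff)

lemma coeff_prod_basis_word [simp]: "coeff_prod (basis_word e) = \<one>"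
  by (induction e) (simp_all add: monom_at)

lemma tn_normal_aux: "u @ v \<in> gens n m \<Longrightarrow> tn n m (u @ v) = coeff_prod v \<odot>\<^bsub>TP n m\<^esub> tn n m (u @ basis_word (map fst v))"
proof (induction v arbitrary: u)
  case Nil
  interpret TP: module R "TP n m" by (rule module_TP)
  show ?case using Nil tn_closed[of u n m] by simp
next
  case (Cons x v)
  interpret TP: module R "TP n m" by (rule module_TP)
  obtain d a where x: "x = (d, a)" by force
  have h: "homog u" "a \<in> grade A d" "homog v" using Cons.prems by (auto simp: gens_iff x)
  let ?m = "monom (UP R) \<one> d"
  have am: "a = a d \<odot>\<^bsub>A\<^esub> ?m" using gradeD[OF h(2)] by (metis U.monom_mult_smult dg_kill_simps(6) one_closed r_one)
  have g: "u @ (d, ?m) # basis_word (map fst v) \<in> gens n m" using Cons.prems h by (auto simp: gens_iff x gradeI)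
  have "tn n m (u @ x # v) = coeff_prod v \<odot>\<^bsub>TP n m\<^esub> tn n m (u @ (d, a) # basis_word (map fst v))"
    using Cons.IH[of "u @ [x]"] Cons.prems by (simp add: x)
  also have "tn n m (u @ (d, a) # basis_word (map fst v)) = a d \<odot>\<^bsub>TP n m\<^esub> tn n m (u @ (d, ?m) # basis_word (map fst v))"
    using tn_smult[OF gradeD(1)[OF h(2)] g] am by simp
  finally show ?case using h gradeD(1)[OF h(2)] tn_closed[OF g] by (simp add: x TP.smult_assoc1[symmetric] m_comm)
qed

definition basis_tensor :: "nat list \<Rightarrow> ((nat \<times> (nat \<Rightarrow> 'a)) list \<Rightarrow> 'a) set" where
  "basis_tensor e = tn (length e - 1) (sum_list e) (basis_word e)"

lemma basis_tensor_eq: "e \<in> degs n m \<Longrightarrow> basis_tensor e = tn n m (basis_word e)"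
  by (auto simp: basis_tensor_def degs_def)

lemma basis_tensor_closed: "e \<in> degs n m \<Longrightarrow> basis_tensor e \<in> carrier (TP n m)"
  by (simp add: basis_tensor_eq tn_closed basis_word_gens)

lemma tn_normal: "l \<in> gens n m \<Longrightarrow> tn n m l = coeff_prod l \<odot>\<^bsub>TP n m\<^esub> basis_tensor (map fst l)"
  using tn_normal_aux[of "[]" l n m] basis_tensor_eq[of "map fst l" n m] by (simp add: gens_iff)

definition tp_coord :: "nat \<Rightarrow> nat \<Rightarrow> ((nat \<times> (nat \<Rightarrow> 'a)) list \<Rightarrow> 'a) set \<Rightarrow> nat list \<Rightarrow> 'a" where
  "tp_coord n m X = the_elem (crd n m ` X)"

lemma crd_cs:
  assumes f: "f \<in> carrier (TF n m)" and f': "f' \<in> TQ.cs n m f"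
  shows "f' \<in> carrier (TF n m)" "crd n m f' = crd n m f"
proof -
  interpret V: module R "V n m" by (rule module_V)
  obtain h where h: "h \<in> tensor_rels R A n m" "f' = h \<oplus>\<^bsub>TF n m\<^esub> f" using f' by (auto simp: a_r_coset_def')
  have hc: "h \<in> carrier (TF n m)" using TQ.N_subset[OF h(1)] .
  show "f' \<in> carrier (TF n m)" using h hc f by simp
  show "crd n m f' = crd n m f"
    unfolding h(2) using mhomD[OF mhom_crd] f hc by (simp add: rels_kernel[OF h(1)])
qed

lemma cs_image_const:
  assumes f: "f \<in> carrier (TF n m)" and F: "\<And>f'. f' \<in> TQ.cs n m f \<Longrightarrow> F f' = F f"
  shows "the_elem (F ` TQ.cs n m f) = F f"
proof -
  have "f \<in> TQ.cs n m f" using f by (rule TQ.ab.a_rcos_self)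
  hence "F ` TQ.cs n m f = {F f}" using F by blast
  thus ?thesis by simp
qed

lemma tp_coord_cs: "f \<in> carrier (TF n m) \<Longrightarrow> tp_coord n m (TQ.cs n m f) = crd n m f"
  unfolding tp_coord_def by (rule cs_image_const) (auto dest: crd_cs(2))

lemma TP_cases:
  assumes "X \<in> carrier (TP n m)"
  obtains f where "f \<in> carrier (TF n m)" "X = TQ.cs n m f"
  using assms by (auto simp: tensor_power_def TQ.carrier_quot)

lemma mhom_tp_coord: "mhom R (TP n m) (V n m) (tp_coord n m)"
  unfolding mhom_def
proof (intro conjI ballI)
  fix X assume "X \<in> carrier (TP n m)"
  then obtain f where f: "f \<in> carrier (TF n m)" "X = TQ.cs n m f" by (rule TP_cases)
  show "tp_coord n m X \<in> carrier (V n m)" using f mhomD[OF mhom_crd] by (simp add: tp_coord_cs)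
  { fix r assume "r \<in> carrier R"
    thus "tp_coord n m (r \<odot>\<^bsub>TP n m\<^esub> X) = r \<odot>\<^bsub>V n m\<^esub> tp_coord n m X"
      using f mhomD[OF mhom_crd] by (simp add: tensor_power_def TQ.smult_quot tp_coord_cs) }
  fix Y assume "Y \<in> carrier (TP n m)"
  then obtain g where g: "g \<in> carrier (TF n m)" "Y = TQ.cs n m g" by (rule TP_cases)
  show "tp_coord n m (X \<oplus>\<^bsub>TP n m\<^esub> Y) = tp_coord n m X \<oplus>\<^bsub>V n m\<^esub> tp_coord n m Y"
    using f g mhomD[OF mhom_crd] by (simp add: tensor_power_def TQ.add_quot tp_coord_cs)
qed

lemma tp_coord_tn: "l \<in> gens n m \<Longrightarrow> tp_coord n m (tn n m l) = gV l"
  unfolding tn_eq by (simp add: tp_coord_cs gen_closed crd_gen)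

lemma tp_coord_tb: "e \<in> degs n m \<Longrightarrow> tp_coord n m (basis_tensor e) = (\<lambda>d. if d = e then \<one> else \<zero>)"
  using tp_coord_tn[OF basis_word_gens] by (simp add: basis_tensor_eq gV_def cong: if_cong)

text \<open>
  The chosen extension \<open>tensor_map\<close> of a function \<open>g\<close> on
  elementary tensors is the linear map with the values \<open>G\<close> on the basis, as
  soon as \<open>g\<close> is multilinear in the sense that it depends on the coefficients
  only through their product.
\<close>

lemma tensor_map_eq:
  assumes M: "module R M" and G: "\<And>d. d \<in> degs n m \<Longrightarrow> G d \<in> carrier M"
    and g: "\<And>l. l \<in> gens n m \<Longrightarrow> g l = coeff_prod l \<odot>\<^bsub>M\<^esub> G (map fst l)"
    and X: "X \<in> carrier (TP n m)"
  shows "tensor_map R M g X = lin_ext R M G (tp_coord n m X)"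
proof -
  interpret M: module R M by fact
  obtain f where f: "f \<in> carrier (TF n m)" "X = TQ.cs n m f" using X by (rule TP_cases)
  have gc: "g l \<in> carrier M" if "l \<in> gens n m" for l
    using that G g by (auto simp: gens_iff)
  have hG: "mhom R (V n m) M (lin_ext R M G)" by (rule mhom_lin_ext[OF M G])
  have h: "mhom R (TF n m) M (\<lambda>f. lin_ext R M G (crd n m f))"
    by (rule mhom_comp[OF mhom_crd hG])
  have eq: "lin_ext R M G (crd n m f') = lin_ext R M g f'" if "f' \<in> carrier (TF n m)" for f'
  proof (rule lin_ext_unique[OF M h[unfolded tensor_free_def] _ that[unfolded tensor_free_def]])
    fix l assume l: "l \<in> gens n m"
    hence c: "coeff_prod l \<in> carrier R" "map fst l \<in> degs n m" by (auto simp: gens_iff)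
    show "lin_ext R M G (crd n m (free_gen R l)) = g l"
      using mhomD(3)[OF hG c(1) free_gen_closed[OF c(2)]] lin_ext_gen[OF M, where g = G and x = "map fst l"] G[OF c(2)]
      by (simp add: crd_gen[OF l] gV_eq[OF l] g[OF l])
  qed
  have "tensor_map R M g X = lin_ext R M g f" unfolding tensor_map_def f(2)
    by (rule cs_image_const[OF f(1)]) (use crd_cs[OF f(1)] eq f(1) in metis)
  thus ?thesis using eq[OF f(1)] f by (simp add: tp_coord_cs)
qed

text \<open>
  Both sides are linear on the presenting free module and agree on elementary tensors, by
  \<open>tn_normal\<close>.
\<close>

lemma tp_coord_inverse:
  assumes X: "X \<in> carrier (TP n m)"
  shows "lin_ext R (TP n m) basis_tensor (tp_coord n m X) = X"
proof -
  obtain f where f: "f \<in> carrier (TF n m)" "X = TQ.cs n m f" using X by (rule TP_cases)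
  have hc: "mhom R (TF n m) (TP n m) (TQ.cs n m)"
    unfolding mhom_def tensor_power_def by (auto simp: TQ.add_quot TQ.smult_quot)
  have 1: "TQ.cs n m f = lin_ext R (TP n m) (tn n m) f"
    using hc f by (intro lin_ext_unique[OF module_TP, of "gens n m"]) (auto simp: tensor_free_def[symmetric] tn_eq)
  have hG: "mhom R (V n m) (TP n m) (lin_ext R (TP n m) basis_tensor)" by (rule mhom_lin_ext[OF module_TP basis_tensor_closed])
  have h: "mhom R (TF n m) (TP n m) (\<lambda>f. lin_ext R (TP n m) basis_tensor (crd n m f))"
    by (rule mhom_comp[OF mhom_crd hG])
  have "lin_ext R (TP n m) basis_tensor (crd n m f) = lin_ext R (TP n m) (tn n m) f"
  proof (rule lin_ext_unique[OF module_TP h[unfolded tensor_free_def] _ f(1)[unfolded tensor_free_def]])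
    fix l assume l: "l \<in> gens n m"
    hence c: "coeff_prod l \<in> carrier R" "map fst l \<in> degs n m" by (auto simp: gens_iff)
    show "lin_ext R (TP n m) basis_tensor (crd n m (free_gen R l)) = tn n m l"
      using mhomD(3)[OF hG c(1) free_gen_closed[OF c(2)]] lin_ext_gen[OF module_TP[of n m], where g = basis_tensor and x = "map fst l"] basis_tensor_closed[OF c(2)]
      by (simp add: crd_gen[OF l] gV_eq[OF l] tn_normal[OF l])
  qed
  thus ?thesis using 1 f tp_coord_cs[OF f(1)] by metis
qed

lemma tp_coord_inj: "X \<in> carrier (TP n m) \<Longrightarrow> Y \<in> carrier (TP n m) \<Longrightarrow> tp_coord n m X = tp_coord n m Y \<Longrightarrow> X = Y"
  using tp_coord_inverse by metis

lemma tp_coord_surj: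
  assumes v: "v \<in> carrier (V n m)"
  shows "\<exists>X\<in>carrier (TP n m). tp_coord n m X = v"
proof
  have hG: "mhom R (V n m) (TP n m) (lin_ext R (TP n m) basis_tensor)" by (rule mhom_lin_ext[OF module_TP basis_tensor_closed])
  show "lin_ext R (TP n m) basis_tensor v \<in> carrier (TP n m)" using mhomD(1)[OF hG v] .
  have h: "mhom R (V n m) (V n m) (\<lambda>v. tp_coord n m (lin_ext R (TP n m) basis_tensor v))" by (rule mhom_comp[OF hG mhom_tp_coord])
  have i: "mhom R (V n m) (V n m) (\<lambda>v. v)" by (simp add: mhom_def)
  have "tp_coord n m (lin_ext R (TP n m) basis_tensor v) = lin_ext R (V n m) (free_gen R) v"
  proof (rule lin_ext_unique[OF module_V h _ v])
    fix e assume e: "e \<in> degs n m"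
    show "tp_coord n m (lin_ext R (TP n m) basis_tensor (free_gen R e)) = free_gen R e"
      using lin_ext_gen[OF module_TP[of n m], where g = basis_tensor and x = e] basis_tensor_closed[OF e] tp_coord_tb[OF e]
      by (simp add: free_gen_def)
  qed
  also have "\<dots> = v" by (rule lin_ext_unique[OF module_V i _ v, symmetric]) simp
  finally show "tp_coord n m (lin_ext R (TP n m) basis_tensor v) = v" .
qed

subsection \<open>Integer matrices acting on coordinates\<close>

definition int_comb :: "nat list set \<Rightarrow> (nat list \<Rightarrow> int) \<Rightarrow> (nat list \<Rightarrow> 'a) \<Rightarrow> 'a" where
  "int_comb S \<eta> v = (\<Oplus>d\<in>S. [\<eta> d] \<cdot> v d)"

abbreviation ind :: "nat list \<Rightarrow> nat list \<Rightarrow> int" where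
  "ind e d \<equiv> (if d = e then 1 else 0)"

lemma int_add: "x \<in> carrier R \<Longrightarrow> [(i + j :: int)] \<cdot> x = [i] \<cdot> x \<oplus> [j] \<cdot> x"
  by (rule add.int_pow_mult)

lemma int_zero [simp]: "[(0 :: int)] \<cdot> x = \<zero>"
  by (simp add: add_pow_def)

lemma int_one [simp]: "x \<in> carrier R \<Longrightarrow> [(1 :: int)] \<cdot> x = x"
  by (rule add.int_pow_1)

lemma int_neg: "x \<in> carrier R \<Longrightarrow> [(- i :: int)] \<cdot> x = \<ominus> ([i] \<cdot> x)"
  by (rule add.int_pow_neg)

lemma int_mult: "x \<in> carrier R \<Longrightarrow> [(i * j :: int)] \<cdot> x = [i] \<cdot> ([j] \<cdot> x)"
  using add.int_pow_pow[of x i j] by (simp add: mult.commute)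

lemma int_scalar: "x \<in> carrier R \<Longrightarrow> [(i :: int)] \<cdot> \<one> \<otimes> x = [i] \<cdot> x"
  by (simp add: add_pow_ldistr_int)

lemma int_sum:
  assumes x: "x \<in> carrier R"
  shows "finite I \<Longrightarrow> (\<Oplus>i\<in>I. [(k i :: int)] \<cdot> x) = [(\<Sum>i\<in>I. k i)] \<cdot> x"
  by (induction I rule: finite_induct) (simp_all add: x int_add Pi_def)

lemma V_val: "v \<in> carrier (V n m) \<Longrightarrow> v d \<in> carrier R"
  by (rule free_val)

lemma V_neg: "v \<in> carrier (V n m) \<Longrightarrow> (\<ominus>\<^bsub>V n m\<^esub> v) e = \<ominus> v e"
proof -
  interpret V: module R "V n m" by (rule module_V)
  assume v: "v \<in> carrier (V n m)"
  have "(\<ominus>\<^bsub>V n m\<^esub> v) e \<oplus> v e = (\<ominus>\<^bsub>V n m\<^esub> v \<oplus>\<^bsub>V n m\<^esub> v) e" by (simp add: free_module_simps)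
  also have "\<dots> = \<zero>" using v by (simp add: V.l_neg) (simp add: free_module_simps)
  finally show ?thesis using V_val[OF v] V_val[OF V.a_inv_closed[OF v]] by (simp add: minus_equality)
qed

lemma V_sgn: "v \<in> carrier (V n m) \<Longrightarrow> sgn_pow (V n m) s v e = [sg s] \<cdot> v e"
  using V_val[of v n m e] by (auto simp: sgn_pow_def sg_parity V_neg int_neg)

lemma V_finsum: "finite I \<Longrightarrow> (\<And>i. i \<in> I \<Longrightarrow> f i \<in> carrier (V n m)) \<Longrightarrow> (\<Oplus>\<^bsub>V n m\<^esub>i\<in>I. f i) e = (\<Oplus>i\<in>I. f i e)"
proof (induction I rule: finite_induct)
  case empty
  interpret V: module R "V n m" by (rule module_V)
  show ?case by (simp add: free_module_simps)
next
  case (insert i I)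
  interpret V: module R "V n m" by (rule module_V)
  have "(\<Oplus>\<^bsub>V n m\<^esub>i\<in>insert i I. f i) e = (f i \<oplus>\<^bsub>V n m\<^esub> (\<Oplus>\<^bsub>V n m\<^esub>i\<in>I. f i)) e"
    using insert by (simp add: Pi_def)
  moreover have "f j e \<in> carrier R" if "j \<in> insert i I" for j using insert.prems[OF that] by (rule V_val)
  ultimately show ?case using insert by (simp add: free_module_simps(3) Pi_def)
qed

lemma smult_sgn: "module R M \<Longrightarrow> r \<in> carrier R \<Longrightarrow> x \<in> carrier M \<Longrightarrow> sgn_pow M k (r \<odot>\<^bsub>M\<^esub> x) = r \<odot>\<^bsub>M\<^esub> sgn_pow M k x"
  by (simp add: sgn_pow_def module.smult_r_minus)

lemma sgn_closed: "module R M \<Longrightarrow> x \<in> carrier M \<Longrightarrow> sgn_pow M k x \<in> carrier M"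
  by (simp add: sgn_pow_def abelian_group.a_inv_closed module.axioms(2))

lemma tp_coord_val: "X \<in> carrier (TP n m) \<Longrightarrow> tp_coord n m X d \<in> carrier R"
  using mhomD(1)[OF mhom_tp_coord] V_val by blast

text \<open>
  All operators of the bicomplex send an elementary tensor to a signed sum of elementary
  tensors, each with a multiple \<open>c\<close> of the coefficient. In coordinates such
  an operator is an integer matrix, and its row \<open>e\<close> is the transposed
  operator applied to the indicator of \<open>e\<close>.
\<close>

lemma op_coord:
  fixes c :: "nat \<Rightarrow> nat list \<Rightarrow> int"
  assumes fin: "\<And>d. finite (I d)"
    and f: "\<And>l i. l \<in> gens n m \<Longrightarrow> i \<in> I (map fst l) \<Longrightarrow>
      f i l \<in> gens n' m' \<and> map fst (f i l) = F i (map fst l) \<and> coeff_prod (f i l) = [(c i (map fst l))] \<cdot> coeff_prod l"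
    and g: "\<And>l. l \<in> gens n m \<Longrightarrow> g l = (\<Oplus>\<^bsub>TP n' m'\<^esub>i\<in>I (map fst l). sgn_pow (TP n' m') (s i (map fst l)) (tn n' m' (f i l)))"
    and X: "X \<in> carrier (TP n m)"
  shows "tensor_map R (TP n' m') g X \<in> carrier (TP n' m')"
    and "tp_coord n' m' (tensor_map R (TP n' m') g X) e = int_comb (degs n m) (\<lambda>d. \<Sum>i\<in>I d. sg (s i d) * (c i d * ind e (F i d))) (tp_coord n m X)"
proof -
  let ?T = "TP n' m'"
  interpret T: module R ?T by (rule module_TP)
  interpret V: module R "V n m" by (rule module_V)
  have Fd: "F i d \<in> degs n' m'" if "d \<in> degs n m" "i \<in> I d" for i d
    using f[OF basis_word_gens[OF that(1)], of i] that by (auto simp: gens_iff)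
  define G where "G d = (\<Oplus>\<^bsub>?T\<^esub>i\<in>I d. sgn_pow ?T (s i d) (([c i d] \<cdot> \<one>) \<odot>\<^bsub>?T\<^esub> basis_tensor (F i d)))" for d
  have term_c: "sgn_pow ?T (s i d) (([c i d] \<cdot> \<one>) \<odot>\<^bsub>?T\<^esub> basis_tensor (F i d)) \<in> carrier ?T" if "d \<in> degs n m" "i \<in> I d" for i d
    using basis_tensor_closed[OF Fd[OF that]] by (intro sgn_closed[OF module_TP] T.smult_closed) auto
  have Gc: "G d \<in> carrier ?T" if "d \<in> degs n m" for d
    unfolding G_def using term_c[OF that] by (intro T.finsum_closed) auto
  have gG: "g l = coeff_prod l \<odot>\<^bsub>?T\<^esub> G (map fst l)" if l: "l \<in> gens n m" for l
  proof -
    let ?d = "map fst l"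
    have d: "?d \<in> degs n m" and h: "coeff_prod l \<in> carrier R" using l by (auto simp: gens_iff)
    have "coeff_prod l \<odot>\<^bsub>?T\<^esub> G ?d = (\<Oplus>\<^bsub>?T\<^esub>i\<in>I ?d. coeff_prod l \<odot>\<^bsub>?T\<^esub> sgn_pow ?T (s i ?d) (([(c i ?d)] \<cdot> \<one>) \<odot>\<^bsub>?T\<^esub> basis_tensor (F i ?d)))"
      unfolding G_def using term_c[OF d] h fin by (intro T.finsum_smult_ldistr) auto
    also have "\<dots> = (\<Oplus>\<^bsub>?T\<^esub>i\<in>I ?d. sgn_pow ?T (s i ?d) (tn n' m' (f i l)))"
    proof (rule T.finsum_cong')
      show "(\<lambda>i. sgn_pow ?T (s i ?d) (tn n' m' (f i l))) \<in> I ?d \<rightarrow> carrier ?T"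
        using f[OF l] tn_closed by (auto intro!: sgn_closed[OF module_TP])
      fix i assume i: "i \<in> I ?d"
      note fi = f[OF l i]
      have t: "basis_tensor (F i ?d) \<in> carrier ?T" by (rule basis_tensor_closed[OF Fd[OF d i]])
      have "tn n' m' (f i l) = ([(c i ?d)] \<cdot> coeff_prod l) \<odot>\<^bsub>?T\<^esub> basis_tensor (F i ?d)" using tn_normal[of "f i l"] fi by simp
      also have "[(c i ?d)] \<cdot> coeff_prod l = coeff_prod l \<otimes> [(c i ?d)] \<cdot> \<one>" using h int_scalar[OF h, of "c i ?d"] by (simp add: m_comm)
      finally have "tn n' m' (f i l) = coeff_prod l \<odot>\<^bsub>?T\<^esub> (([(c i ?d)] \<cdot> \<one>) \<odot>\<^bsub>?T\<^esub> basis_tensor (F i ?d))"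
        using h t by (simp add: T.smult_assoc1)
      thus "coeff_prod l \<odot>\<^bsub>?T\<^esub> sgn_pow ?T (s i ?d) (([(c i ?d)] \<cdot> \<one>) \<odot>\<^bsub>?T\<^esub> basis_tensor (F i ?d)) = sgn_pow ?T (s i ?d) (tn n' m' (f i l))"
        using h t by (simp add: smult_sgn[OF module_TP])
    qed simp
    finally show ?thesis using g[OF l] by simp
  qed
  have eq: "tensor_map R ?T g X = lin_ext R ?T G (tp_coord n m X)"
    by (rule tensor_map_eq[OF module_TP Gc gG X])
  have KX: "tp_coord n m X \<in> carrier (V n m)" by (rule mhomD(1)[OF mhom_tp_coord X])
  have le: "lin_ext R ?T G (tp_coord n m X) = (\<Oplus>\<^bsub>?T\<^esub>d\<in>degs n m. tp_coord n m X d \<odot>\<^bsub>?T\<^esub> G d)"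
    by (rule lin_ext_alt[OF module_TP KX Gc]) (use free_supp[OF KX] in auto)
  have tc: "tp_coord n m X d \<odot>\<^bsub>?T\<^esub> G d \<in> carrier ?T" if "d \<in> degs n m" for d
    using Gc[OF that] tp_coord_val[OF X] by simp
  show "tensor_map R ?T g X \<in> carrier ?T" unfolding eq le using tc by (intro T.finsum_closed) auto
  note mK = mhomD[OF mhom_tp_coord[of n' m']] and pK = mhom_props[OF module_TP module_V mhom_tp_coord[of n' m']]
  have KG: "tp_coord n' m' (G d) e = [(\<Sum>i\<in>I d. sg (s i d) * (c i d * ind e (F i d)))] \<cdot> \<one>" if d: "d \<in> degs n m" for d
  proof -
    have "tp_coord n' m' (G d) = (\<Oplus>\<^bsub>V n' m'\<^esub>i\<in>I d. tp_coord n' m' (sgn_pow ?T (s i d) (([c i d] \<cdot> \<one>) \<odot>\<^bsub>?T\<^esub> basis_tensor (F i d))))"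
      unfolding G_def using fin term_c[OF d] by (intro pK(4)) auto
    hence "tp_coord n' m' (G d) e = (\<Oplus>i\<in>I d. tp_coord n' m' (sgn_pow ?T (s i d) (([c i d] \<cdot> \<one>) \<odot>\<^bsub>?T\<^esub> basis_tensor (F i d))) e)"
      using fin term_c[OF d] mK(1) by (simp add: V_finsum)
    also have "\<dots> = (\<Oplus>i\<in>I d. [(sg (s i d) * (c i d * ind e (F i d)))] \<cdot> \<one>)"
    proof (rule finsum_cong')
      fix i assume i: "i \<in> I d"
      let ?t = "basis_tensor (F i d)"
      have t: "?t \<in> carrier ?T" by (rule basis_tensor_closed[OF Fd[OF d i]])
      have rt: "([c i d] \<cdot> \<one>) \<odot>\<^bsub>?T\<^esub> ?t \<in> carrier ?T" using t by simp
      have "tp_coord n' m' (sgn_pow ?T (s i d) (([c i d] \<cdot> \<one>) \<odot>\<^bsub>?T\<^esub> ?t)) e = [(sg (s i d))] \<cdot> tp_coord n' m' (([c i d] \<cdot> \<one>) \<odot>\<^bsub>?T\<^esub> ?t) e"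
        using pK(5)[OF rt] mK(1)[OF rt] by (simp add: V_sgn)
      also have "tp_coord n' m' (([c i d] \<cdot> \<one>) \<odot>\<^bsub>?T\<^esub> ?t) e = [c i d] \<cdot> \<one> \<otimes> ind1 e (F i d)"
        if "\<And>e d. ind1 e d = (if d = e then \<one> else \<zero>)" for ind1
        using mK(3)[of "[c i d] \<cdot> \<one>" ?t] t tp_coord_tb[OF Fd[OF d i]] that by (auto simp: free_module_simps(4))
      from this[of "\<lambda>e d. if d = e then \<one> else \<zero>"]
      have "tp_coord n' m' (([c i d] \<cdot> \<one>) \<odot>\<^bsub>?T\<^esub> ?t) e = [(c i d * ind e (F i d))] \<cdot> \<one>" by simp
      finally show "tp_coord n' m' (sgn_pow ?T (s i d) (([c i d] \<cdot> \<one>) \<odot>\<^bsub>?T\<^esub> ?t)) e = [(sg (s i d) * (c i d * ind e (F i d)))] \<cdot> \<one>"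
        by (simp only: int_mult one_closed)
    qed auto
    also have "\<dots> = [(\<Sum>i\<in>I d. sg (s i d) * (c i d * ind e (F i d)))] \<cdot> \<one>" by (rule int_sum) (use fin in auto)
    finally show ?thesis .
  qed
  have "tp_coord n' m' (tensor_map R ?T g X) = (\<Oplus>\<^bsub>V n' m'\<^esub>d\<in>degs n m. tp_coord n' m' (tp_coord n m X d \<odot>\<^bsub>?T\<^esub> G d))"
    unfolding eq le using tc by (intro pK(4)) auto
  hence "tp_coord n' m' (tensor_map R ?T g X) e = (\<Oplus>d\<in>degs n m. tp_coord n' m' (tp_coord n m X d \<odot>\<^bsub>?T\<^esub> G d) e)"
    using tc mK(1) by (simp add: V_finsum)
  also have "\<dots> = (\<Oplus>d\<in>degs n m. [(\<Sum>i\<in>I d. sg (s i d) * (c i d * ind e (F i d)))] \<cdot> tp_coord n m X d)"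
  proof (rule finsum_cong')
    fix d assume d: "d \<in> degs n m"
    have kx: "tp_coord n m X d \<in> carrier R" using tp_coord_val[OF X] .
    have "tp_coord n' m' (tp_coord n m X d \<odot>\<^bsub>?T\<^esub> G d) e = tp_coord n m X d \<otimes> tp_coord n' m' (G d) e"
      using mK(3)[OF kx Gc[OF d]] by (simp add: free_module_simps(4))
    thus "tp_coord n' m' (tp_coord n m X d \<odot>\<^bsub>?T\<^esub> G d) e = [(\<Sum>i\<in>I d. sg (s i d) * (c i d * ind e (F i d)))] \<cdot> tp_coord n m X d"
      unfolding KG[OF d] using kx by (subst (asm) m_comm) (simp_all add: int_scalar)
  qed (use tp_coord_val[OF X] in auto)
  finally show "tp_coord n' m' (tensor_map R ?T g X) e = int_comb (degs n m) (\<lambda>d. \<Sum>i\<in>I d. sg (s i d) * (c i d * ind e (F i d))) (tp_coord n m X)"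
    by (simp only: int_comb_def)
qed

lemma list_split2: "Suc i < length l \<Longrightarrow> \<exists>u x y v. l = u @ x # y # v \<and> length u = i"
  by (intro exI[of _ "take i l"] exI[of _ "l ! i"] exI[of _ "l ! Suc i"] exI[of _ "drop (i + 2) l"])
     (simp add: Cons_nth_drop_Suc)

lemma face_props:
  assumes l: "l \<in> gens (Suc n) m" and i: "i \<le> n"
  shows "face A i l \<in> gens n m \<and> map fst (face A i l) = merge_at i (map fst l) \<and> coeff_prod (face A i l) = [(1 :: int)] \<cdot> coeff_prod l"
proof -
  have len: "length l = Suc (Suc n)" using l by (auto simp: gens_iff degs_def dest: arg_cong[of _ _ length])
  obtain u x y v where s: "l = u @ x # y # v" "length u = i" using list_split2[of i l] len i by auto
  have f: "face A i l = u @ (fst x + fst y, snd x \<otimes>\<^bsub>A\<^esub> snd y) # v"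
    using s by (simp add: face_def nth_append)
  have h: "homog u" "homog v" "snd x \<in> grade A (fst x)" "snd y \<in> grade A (fst y)" using l s by (auto simp: gens_iff)
  have "map fst (face A i l) = merge_at i (map fst l)" using s unfolding f by (simp add: merge_at_def nth_append)
  moreover have "coeff_prod (face A i l) = coeff_prod l"
  proof -
    have "coeff_prod (face A i l) = coeff_prod u \<otimes> (snd x (fst x) \<otimes> snd y (fst y) \<otimes> coeff_prod v)"
      using h unfolding f by (simp add: coeff_prod_append grade_mult)
    moreover have "coeff_prod l = coeff_prod u \<otimes> (snd x (fst x) \<otimes> (snd y (fst y) \<otimes> coeff_prod v))"
      using h unfolding s(1) by (simp add: coeff_prod_append)
    ultimately show ?thesis using h gradeD(1)[OF h(3)] gradeD(1)[OF h(4)] by (simp add: m_assoc)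
  qed
  moreover have "homog (face A i l)" using h unfolding f by (simp add: grade_mult)
  moreover have "merge_at i (map fst l) \<in> degs n m" using l len i by (simp add: gens_iff degs_def)
  moreover have "coeff_prod l \<in> carrier R" using l by (simp add: gens_iff)
  ultimately show ?thesis by (simp add: gens_iff)
qed

lemma last_face_props:
  assumes l: "l \<in> gens (Suc n) m"
  shows "last_face A l \<in> gens n m \<and> map fst (last_face A l) = merge_at 0 (last (map fst l) # butlast (map fst l))
     \<and> coeff_prod (last_face A l) = [(1 :: int)] \<cdot> coeff_prod l"
    and "rot_exp l = last (map fst l) * sum_list (butlast (map fst l))"
proof -
  have len: "length l = Suc (Suc n)" using l by (auto simp: gens_iff degs_def dest: arg_cong[of _ _ length])
  obtain x w y where s: "l = x # w @ [y]"
    using len by (cases l; cases "tl l" rule: rev_cases) auto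
  have f: "last_face A l = (fst y + fst x, snd y \<otimes>\<^bsub>A\<^esub> snd x) # w" using s by (simp add: last_face_def)
  have h: "homog w" "snd x \<in> grade A (fst x)" "snd y \<in> grade A (fst y)" using l s by (auto simp: gens_iff)
  have "coeff_prod (last_face A l) = coeff_prod l"
  proof -
    have "coeff_prod (last_face A l) = snd y (fst y) \<otimes> snd x (fst x) \<otimes> coeff_prod w"
      using h unfolding f by (simp add: grade_mult)
    moreover have "coeff_prod l = snd x (fst x) \<otimes> (coeff_prod w \<otimes> snd y (fst y))"
      using h gradeD(1)[OF h(3)] unfolding s by (simp add: coeff_prod_append)
    ultimately show ?thesis using h gradeD(1)[OF h(2)] gradeD(1)[OF h(3)] by (simp add: m_ac)
  qed
  moreover have "homog (last_face A l)" using h unfolding f by (simp add: grade_mult)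
  moreover have "coeff_prod l \<in> carrier R" using l by (simp add: gens_iff)
  ultimately show "last_face A l \<in> gens n m \<and> map fst (last_face A l) = merge_at 0 (last (map fst l) # butlast (map fst l))
     \<and> coeff_prod (last_face A l) = [(1 :: int)] \<cdot> coeff_prod l"
    using l unfolding f by (simp add: gens_iff s merge_at_def butlast_append degs_def)
  show "rot_exp l = last (map fst l) * sum_list (butlast (map fst l))"
    by (simp add: s rot_exp_def tdeg_def butlast_append)
qed

lemma int_comb_cong: "(\<And>d. d \<in> S \<Longrightarrow> \<eta> d = \<theta> d) \<Longrightarrow> (\<And>d. d \<in> S \<Longrightarrow> v d \<in> carrier R) \<Longrightarrow> int_comb S \<eta> v = int_comb S \<theta> v"
  unfolding int_comb_def by (rule finsum_cong') auto

lemma bar_coord: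
  assumes X: "X \<in> carrier (TP (Suc n) m)"
  shows "hoch_b' R A n m X \<in> carrier (TP n m)" "tp_coord n m (hoch_b' R A n m X) e = int_comb (degs (Suc n) m) (bar (ind e)) (tp_coord (Suc n) m X)"
proof -
  show "hoch_b' R A n m X \<in> carrier (TP n m)" unfolding hoch_b'_def
    by (rule op_coord(1)[where I = "\<lambda>_. {..n}" and f = "\<lambda>i. face A i" and F = merge_at and c = "\<lambda>_ _. 1" and s = "\<lambda>i _. i", OF _ face_props refl X]) auto
  have "tp_coord n m (hoch_b' R A n m X) e = int_comb (degs (Suc n) m) (\<lambda>d. \<Sum>i\<in>{..n}. sg i * (1 * ind e (merge_at i d))) (tp_coord (Suc n) m X)"
    unfolding hoch_b'_def
    by (rule op_coord(2)[where I = "\<lambda>_. {..n}" and f = "\<lambda>i. face A i" and F = merge_at and c = "\<lambda>_ _. 1" and s = "\<lambda>i _. i", OF _ face_props refl X]) auto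
  also have "\<dots> = int_comb (degs (Suc n) m) (bar (ind e)) (tp_coord (Suc n) m X)"
    by (rule int_comb_cong) (auto simp: bar_eq_sum degs_def face_op_def lessThan_Suc_atMost tp_coord_val[OF X] intro!: sum.cong)
  finally show "tp_coord n m (hoch_b' R A n m X) e = \<dots>" .
qed

lemma hoch_coord:
  assumes X: "X \<in> carrier (TP (Suc n) m)"
  shows "hoch_b R A n m X \<in> carrier (TP n m)" "tp_coord n m (hoch_b R A n m X) e = int_comb (degs (Suc n) m) (hoch (ind e)) (tp_coord (Suc n) m X)"
proof -
  interpret T: module R "TP n m" by (rule module_TP)
  let ?g = "\<lambda>l. (\<Oplus>\<^bsub>TP n m\<^esub>i\<in>{..n}. sgn_pow (TP n m) i (tn n m (face A i l)))
          \<oplus>\<^bsub>TP n m\<^esub> sgn_pow (TP n m) (n + 1 + rot_exp l) (tn n m (last_face A l))"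
  let ?f = "\<lambda>i l. if i \<le> n then face A i l else last_face A l"
  let ?F = "\<lambda>i d. if i \<le> n then merge_at i d else merge_at 0 (last d # butlast d)"
  let ?s = "\<lambda>i d. if i \<le> n then i else n + 1 + last d * sum_list (butlast d)"
  have f: "?f i l \<in> gens n m \<and> map fst (?f i l) = ?F i (map fst l) \<and> coeff_prod (?f i l) = [(1 :: int)] \<cdot> coeff_prod l"
    if "l \<in> gens (Suc n) m" "i \<in> {..Suc n}" for i l
    using face_props[of l n m i] last_face_props(1)[of l n m] that by auto
  have g: "?g l = (\<Oplus>\<^bsub>TP n m\<^esub>i\<in>{..Suc n}. sgn_pow (TP n m) (?s i (map fst l)) (tn n m (?f i l)))"
    if l: "l \<in> gens (Suc n) m" for l
  proof -
    have c: "sgn_pow (TP n m) k (tn n m (?f i l)) \<in> carrier (TP n m)" if "i \<le> Suc n" for i k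
      using f[OF l, of i] that by (intro sgn_closed[OF module_TP] tn_closed) auto
    have "(\<Oplus>\<^bsub>TP n m\<^esub>i\<in>{..Suc n}. sgn_pow (TP n m) (?s i (map fst l)) (tn n m (?f i l)))
      = sgn_pow (TP n m) (?s (Suc n) (map fst l)) (tn n m (?f (Suc n) l)) \<oplus>\<^bsub>TP n m\<^esub>
        (\<Oplus>\<^bsub>TP n m\<^esub>i\<in>{..n}. sgn_pow (TP n m) (?s i (map fst l)) (tn n m (?f i l)))"
      by (rule T.finsum_Suc) (use c in auto)
    also have "(\<Oplus>\<^bsub>TP n m\<^esub>i\<in>{..n}. sgn_pow (TP n m) (?s i (map fst l)) (tn n m (?f i l)))
       = (\<Oplus>\<^bsub>TP n m\<^esub>i\<in>{..n}. sgn_pow (TP n m) i (tn n m (face A i l)))"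
    proof (rule T.finsum_cong')
      have "sgn_pow (TP n m) i (tn n m (face A i l)) \<in> carrier (TP n m)" if "i \<le> n" for i
        using c[of i i] that by simp
      thus "(\<lambda>i. sgn_pow (TP n m) i (tn n m (face A i l))) \<in> {..n} \<rightarrow> carrier (TP n m)" by auto
    qed auto
    also have "sgn_pow (TP n m) (?s (Suc n) (map fst l)) (tn n m (?f (Suc n) l)) = sgn_pow (TP n m) (n + 1 + rot_exp l) (tn n m (last_face A l))"
      using last_face_props(2)[OF l] by simp
    finally have 1: "(\<Oplus>\<^bsub>TP n m\<^esub>i\<in>{..Suc n}. sgn_pow (TP n m) (?s i (map fst l)) (tn n m (?f i l)))
      = sgn_pow (TP n m) (n + 1 + rot_exp l) (tn n m (last_face A l)) \<oplus>\<^bsub>TP n m\<^esub> (\<Oplus>\<^bsub>TP n m\<^esub>i\<in>{..n}. sgn_pow (TP n m) i (tn n m (face A i l)))" .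
    have "sgn_pow (TP n m) k (tn n m (face A i l)) \<in> carrier (TP n m)" if "i \<le> n" for i k
      using c[of i k] that by simp
    hence "(\<Oplus>\<^bsub>TP n m\<^esub>i\<in>{..n}. sgn_pow (TP n m) i (tn n m (face A i l))) \<in> carrier (TP n m)"
      by (intro T.finsum_closed) auto
    thus ?thesis unfolding 1 using c[of "Suc n" "n + 1 + rot_exp l"] by (simp add: T.a_comm)
  qed
  note oc = op_coord[where I = "\<lambda>_. {..Suc n}" and f = ?f and F = ?F and c = "\<lambda>_ _. 1" and s = ?s, OF _ f g X]
  show "hoch_b R A n m X \<in> carrier (TP n m)" unfolding hoch_b_def by (rule oc(1)) auto
  have "tp_coord n m (hoch_b R A n m X) e = int_comb (degs (Suc n) m) (\<lambda>d. \<Sum>i\<in>{..Suc n}. sg (?s i d) * (1 * ind e (?F i d))) (tp_coord (Suc n) m X)"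
    unfolding hoch_b_def by (rule oc(2)) auto
  also have "\<dots> = int_comb (degs (Suc n) m) (hoch (ind e)) (tp_coord (Suc n) m X)"
  proof (rule int_comb_cong)
    fix d assume d: "d \<in> degs (Suc n) m"
    have "(\<Sum>i\<in>{..Suc n}. sg (?s i d) * (1 * ind e (?F i d))) = (\<Sum>i\<in>{..n}. sg i * ind e (merge_at i d)) + sg (n + 1 + last d * sum_list (butlast d)) * ind e (merge_at 0 (last d # butlast d))"
      by simp
    also have "(\<Sum>i\<in>{..n}. sg i * ind e (merge_at i d)) = bar (ind e) d"
      using d by (auto simp: bar_eq_sum degs_def face_op_def lessThan_Suc_atMost intro!: sum.cong)
    also have "sg (n + 1 + last d * sum_list (butlast d)) * ind e (merge_at 0 (last d # butlast d)) = rot (face_op 0 (ind e)) d"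
      using d by (auto simp: rot_def degs_def face_op_def)
    finally show "(\<Sum>i\<in>{..Suc n}. sg (?s i d) * (1 * ind e (?F i d))) = hoch (ind e) d" by (simp only: hoch_def)
  qed (rule tp_coord_val[OF X])
  finally show "tp_coord n m (hoch_b R A n m X) e = \<dots>" .
qed

lemma cyclic_coord:
  assumes X: "X \<in> carrier (TP n m)"
  shows "cyclic_t R A n m X \<in> carrier (TP n m)" "tp_coord n m (cyclic_t R A n m X) e = int_comb (degs n m) (rot (ind e)) (tp_coord n m X)"
proof -
  interpret T: module R "TP n m" by (rule module_TP)
  let ?g = "\<lambda>l. sgn_pow (TP n m) (n + rot_exp l) (tn n m (last l # butlast l))"
  let ?F = "\<lambda>(i :: nat) d. last d # butlast d" and ?s = "\<lambda>(i :: nat) d. n + last d * sum_list (butlast d)"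
  have P: "last l # butlast l \<in> gens n m \<and> map fst (last l # butlast l) = ?F i (map fst l) \<and> coeff_prod (last l # butlast l) = [(1 :: int)] \<cdot> coeff_prod l"
      "rot_exp l = last (map fst l) * sum_list (butlast (map fst l))"
    if l: "l \<in> gens n m" for l and i :: nat
  proof -
    obtain w y where s: "l = w @ [y]" using l by (cases l rule: rev_cases) (auto simp: gens_iff degs_def)
    have h: "homog w" "snd y \<in> grade A (fst y)" using l s by (auto simp: gens_iff)
    show "last l # butlast l \<in> gens n m \<and> map fst (last l # butlast l) = ?F i (map fst l) \<and> coeff_prod (last l # butlast l) = [(1 :: int)] \<cdot> coeff_prod l"
      using l h gradeD(1)[OF h(2)] unfolding s by (auto simp: gens_iff degs_def coeff_prod_append m_comm)
    show "rot_exp l = last (map fst l) * sum_list (butlast (map fst l))"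
      by (simp add: s rot_exp_def tdeg_def)
  qed
  have g: "?g l = (\<Oplus>\<^bsub>TP n m\<^esub>i\<in>{0 :: nat}. sgn_pow (TP n m) (?s i (map fst l)) (tn n m (last l # butlast l)))"
    if l: "l \<in> gens n m" for l
    using sgn_closed[OF module_TP tn_closed, of "last l # butlast l" n m] P[OF l] by simp
  note oc = op_coord[where I = "\<lambda>_. {0}" and f = "\<lambda>_ l. last l # butlast l" and F = ?F and c = "\<lambda>_ _. 1" and s = ?s, OF _ P(1) g X]
  show "cyclic_t R A n m X \<in> carrier (TP n m)" unfolding cyclic_t_def by (rule oc(1)) auto
  have "tp_coord n m (cyclic_t R A n m X) e = int_comb (degs n m) (\<lambda>d. \<Sum>i\<in>{0}. sg (?s i d) * (1 * ind e (?F i d))) (tp_coord n m X)"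
    unfolding cyclic_t_def by (rule oc(2)) auto
  also have "\<dots> = int_comb (degs n m) (rot (ind e)) (tp_coord n m X)"
    by (rule int_comb_cong) (auto simp: rot_def degs_def tp_coord_val[OF X])
  finally show "tp_coord n m (cyclic_t R A n m X) e = \<dots>" .
qed

text \<open>
  The closed form of \<open>delta_op\<close>, matching the sum over the tensor factors
  that defines the internal differential of a tensor power.
\<close>

lemma delta_op_eq_sum: "delta_op q \<xi> d = (\<Sum>i<length d. if odd (d ! i) then sg (sum_list (take i d)) * (int q * \<xi> (d[i := d ! i - 1])) else 0)"
proof (induction d arbitrary: \<xi>)
  case (Cons a l)
  show ?case
    by (simp add: Cons sum.lessThan_Suc_shift sg_add sum_distrib_left if_distrib mult.assoc del: sum.lessThan_Suc cong: if_cong)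
qed simp

lemma coeff_prod_append_Cons:
  assumes "homog u" "homog v" "snd y (fst y) \<in> carrier R"
  shows "coeff_prod (u @ y # v) = coeff_prod u \<otimes> (snd y (fst y) \<otimes> coeff_prod v)"
  using assms by (induction u) (auto simp: m_assoc gradeD(1))

lemma diff_props:
  assumes l: "l \<in> gens n (Suc m)" and i: "i \<le> n" "0 < map fst l ! i"
  defines "l' \<equiv> l[i := (fst (l ! i) - 1, differential A (snd (l ! i)))]"
  shows "l' \<in> gens n m \<and> map fst l' = (map fst l)[i := map fst l ! i - 1]
    \<and> coeff_prod l' = [(if odd (map fst l ! i) then int p else 0)] \<cdot> coeff_prod l"
proof -
  have len: "length l = Suc n" using l by (auto simp: gens_iff degs_def dest: arg_cong[of _ _ length])
  obtain u x v where s: "l = u @ x # v" "length u = i"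
    using i len by (metis id_take_nth_drop le_imp_less_Suc length_take min.absorb4)
  have l': "l' = u @ (fst x - 1, differential A (snd x)) # v" unfolding l'_def s(1) s(2)[symmetric] by simp
  have h: "homog u" "homog v" "snd x \<in> grade A (fst x)" using l s by (auto simp: gens_iff)
  have x0: "0 < fst x" using i len s by (simp add: nth_append)
  note gd = grade_diff[OF h(3) x0]
  have a: "snd x (fst x) \<in> carrier R" by (rule gradeD(1)[OF h(3)])
  let ?k = "if odd (fst x) then int p else 0"
  have "coeff_prod l' = coeff_prod u \<otimes> ([?k] \<cdot> snd x (fst x) \<otimes> coeff_prod v)"
  proof -
    have "differential A (snd x) (fst x - 1) = [?k] \<cdot> snd x (fst x)"
      using gd(2) a by (simp add: add_pow_int_ge)
    moreover have "differential A (snd x) (fst x - 1) \<in> carrier R" using gradeD(1)[OF gd(1)] .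
    ultimately show ?thesis using h coeff_prod_append_Cons[of u v "(fst x - 1, differential A (snd x))"] by (simp add: l')
  qed
  also have "\<dots> = [?k] \<cdot> coeff_prod l"
  proof -
    have "[?k] \<cdot> snd x (fst x) = [?k] \<cdot> \<one> \<otimes> snd x (fst x)" using a by (simp add: int_scalar)
    moreover have "[?k] \<cdot> \<one> \<in> carrier R" by simp
    ultimately have "coeff_prod u \<otimes> ([?k] \<cdot> snd x (fst x) \<otimes> coeff_prod v) = [?k] \<cdot> \<one> \<otimes> (coeff_prod u \<otimes> (snd x (fst x) \<otimes> coeff_prod v))"
      using a h by (simp add: m_ac)
    also have "\<dots> = [?k] \<cdot> coeff_prod l" using a h coeff_prod_append_Cons[of u v x] by (simp add: s int_scalar)
    finally show ?thesis .
  qed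
  moreover have "map fst l ! i = fst x" using s by (simp add: nth_append)
  moreover have "map fst l' = (map fst l)[i := map fst l ! i - 1]" using i len by (simp add: l'_def map_update)
  moreover have "l' \<in> gens n m"
    using l h gd(1) x0 by (auto simp: gens_iff l' s degs_def)
  ultimately show ?thesis by simp
qed

lemma diff_coord:
  assumes X: "X \<in> carrier (TP n (Suc m))"
  shows "tensor_diff R A n m X \<in> carrier (TP n m)" "tp_coord n m (tensor_diff R A n m X) e = int_comb (degs n (Suc m)) (delta_op p (ind e)) (tp_coord n (Suc m) X)"
proof -
  interpret T: module R "TP n m" by (rule module_TP)
  let ?I = "\<lambda>d :: nat list. {i. i \<le> n \<and> 0 < d ! i}"
  let ?f = "\<lambda>i l. l[i := (fst (l ! i) - 1, differential A (snd (l ! i)))]"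
  let ?F = "\<lambda>i d. d[i := d ! i - 1]" and ?s = "\<lambda>i d. sum_list (take i d)"
  let ?c = "\<lambda>i d. if odd (d ! i) then int p else 0"
  have f: "?f i l \<in> gens n m \<and> map fst (?f i l) = ?F i (map fst l) \<and> coeff_prod (?f i l) = [(?c i (map fst l))] \<cdot> coeff_prod l"
    if "l \<in> gens n (Suc m)" "i \<in> ?I (map fst l)" for i l
    using diff_props[of l n m i] that by simp
  have g: "(\<Oplus>\<^bsub>TP n m\<^esub>i\<in>{i. i \<le> n \<and> 0 < fst (l ! i)}. sgn_pow (TP n m) (tdeg (take i l)) (tn n m (?f i l)))
     = (\<Oplus>\<^bsub>TP n m\<^esub>i\<in>?I (map fst l). sgn_pow (TP n m) (?s i (map fst l)) (tn n m (?f i l)))"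
    if l: "l \<in> gens n (Suc m)" for l
  proof (rule T.finsum_cong')
    have len: "length l = Suc n" using l by (auto simp: gens_iff degs_def dest: arg_cong[of _ _ length])
    show "{i. i \<le> n \<and> 0 < fst (l ! i)} = ?I (map fst l)" using len by (auto simp: nth_map)
    show "(\<lambda>i. sgn_pow (TP n m) (?s i (map fst l)) (tn n m (?f i l))) \<in> ?I (map fst l) \<rightarrow> carrier (TP n m)"
      using f[OF l] by (auto intro!: sgn_closed[OF module_TP] tn_closed)
    show "sgn_pow (TP n m) (tdeg (take i l)) (tn n m (?f i l)) = sgn_pow (TP n m) (?s i (map fst l)) (tn n m (?f i l))" for i
      by (simp add: tdeg_def take_map)
  qed
  have fin: "finite (?I d)" for d by simp
  note oc = op_coord[where I = ?I and f = ?f and F = ?F and c = ?c and s = ?s, OF fin f g X]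
  show "tensor_diff R A n m X \<in> carrier (TP n m)" unfolding tensor_diff_def by (rule oc(1))
  have "tp_coord n m (tensor_diff R A n m X) e = int_comb (degs n (Suc m)) (\<lambda>d. \<Sum>i\<in>?I d. sg (?s i d) * (?c i d * ind e (?F i d))) (tp_coord n (Suc m) X)"
    unfolding tensor_diff_def by (rule oc(2))
  also have "\<dots> = int_comb (degs n (Suc m)) (delta_op p (ind e)) (tp_coord n (Suc m) X)"
  proof (rule int_comb_cong)
    fix d assume d: "d \<in> degs n (Suc m)"
    have "(\<Sum>i\<in>?I d. sg (?s i d) * (?c i d * ind e (?F i d))) = (\<Sum>i<length d. if odd (d ! i) then sg (sum_list (take i d)) * (int p * ind e (d[i := d ! i - 1])) else 0)"
      by (rule sum.mono_neutral_cong_left) (use d in \<open>auto simp: degs_def less_Suc_eq_le\<close>)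
    thus "(\<Sum>i\<in>?I d. sg (?s i d) * (?c i d * ind e (?F i d))) = delta_op p (ind e) d" by (simp only: delta_op_eq_sum)
  qed (rule tp_coord_val[OF X])
  finally show "tp_coord n m (tensor_diff R A n m X) e = \<dots>" .
qed

lemma int_comb_closed [simp]: "(\<And>d. d \<in> S \<Longrightarrow> v d \<in> carrier R) \<Longrightarrow> int_comb S \<eta> v \<in> carrier R"
  unfolding int_comb_def by (intro finsum_closed) auto

lemma int_comb_ind: "finite S \<Longrightarrow> e \<in> S \<Longrightarrow> (\<And>d. d \<in> S \<Longrightarrow> v d \<in> carrier R) \<Longrightarrow> int_comb S (ind e) v = v e"
proof -
  assume S: "finite S" "e \<in> S" and v: "\<And>d. d \<in> S \<Longrightarrow> v d \<in> carrier R"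
  have "int_comb S (ind e) v = (\<Oplus>d\<in>S. if e = d then v d else \<zero>)"
    unfolding int_comb_def by (rule finsum_cong') (use v in auto)
  also have "\<dots> = v e" by (rule finsum_singleton) (use S v in auto)
  finally show ?thesis .
qed

lemma int_comb_add: "finite S \<Longrightarrow> (\<And>d. d \<in> S \<Longrightarrow> v d \<in> carrier R) \<Longrightarrow> int_comb S (\<lambda>d. \<eta> d + \<theta> d) v = int_comb S \<eta> v \<oplus> int_comb S \<theta> v"
proof -
  assume S: "finite S" and v: "\<And>d. d \<in> S \<Longrightarrow> v d \<in> carrier R"
  have "int_comb S (\<lambda>d. \<eta> d + \<theta> d) v = (\<Oplus>d\<in>S. [\<eta> d] \<cdot> v d \<oplus> [\<theta> d] \<cdot> v d)"
    unfolding int_comb_def by (rule finsum_cong') (use v in \<open>auto simp: int_add\<close>)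
  thus ?thesis unfolding int_comb_def using v by (subst (asm) finsum_addf) auto
qed

lemma int_comb_scale: "finite S \<Longrightarrow> (\<And>d. d \<in> S \<Longrightarrow> v d \<in> carrier R) \<Longrightarrow> int_comb S (\<lambda>d. k * \<eta> d) v = [k] \<cdot> int_comb S \<eta> v"
proof -
  assume S: "finite S" and v: "\<And>d. d \<in> S \<Longrightarrow> v d \<in> carrier R"
  have "int_comb S (\<lambda>d. k * \<eta> d) v = (\<Oplus>d\<in>S. [k] \<cdot> \<one> \<otimes> [\<eta> d] \<cdot> v d)"
    unfolding int_comb_def by (rule finsum_cong') (use v in \<open>auto simp: int_mult int_scalar\<close>)
  also have "\<dots> = [k] \<cdot> \<one> \<otimes> int_comb S \<eta> v" unfolding int_comb_def by (rule finsum_rdistr[symmetric]) (use S v in auto)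
  finally show ?thesis using v by (simp add: int_scalar)
qed

lemma int_comb_sum:
  assumes S: "finite S" and v: "\<And>d. d \<in> S \<Longrightarrow> v d \<in> carrier R"
  shows "finite I \<Longrightarrow> int_comb S (\<lambda>d. \<Sum>i\<in>I. f i d) v = (\<Oplus>i\<in>I. int_comb S (f i) v)"
proof (induction I rule: finite_induct)
  case empty
  show ?case by (simp add: int_comb_def)
next
  case (insert i I)
  thus ?case using S v by (simp add: int_comb_add Pi_def)
qed

lemma int_comb_mono:
  assumes "finite S" "T \<subseteq> S" "\<And>d. d \<in> S - T \<Longrightarrow> \<eta> d = 0" "\<And>d. d \<in> S \<Longrightarrow> v d \<in> carrier R"
  shows "int_comb S \<eta> v = int_comb T \<eta> v"
  unfolding int_comb_def by (rule add.finprod_mono_neutral_cong_right) (use assms in auto)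

subsection \<open>The periodic complex in coordinates\<close>

abbreviation PT :: "('a, nat \<times> nat \<Rightarrow> ((nat \<times> (nat \<Rightarrow> 'a)) list \<Rightarrow> 'a) set) module" where "PT \<equiv> periodic_tot R A"

lemma module_PT: "module R PT"
  unfolding periodic_tot_def by (rule module_prod[OF is_cring]) (auto simp: module_TP split: prod.split)

lemma PT_simps: "carrier PT = {z. \<forall>n m. z (n, m) \<in> carrier (TP n m)}"
  "zero PT = (\<lambda>(n, m). \<zero>\<^bsub>TP n m\<^esub>)"
  "add PT = (\<lambda>y z (n, m). y (n, m) \<oplus>\<^bsub>TP n m\<^esub> z (n, m))" "smult PT = (\<lambda>r z (n, m). r \<odot>\<^bsub>TP n m\<^esub> z (n, m))"
  by (auto simp: periodic_tot_def prod_module_simps fun_eq_iff PiE_iff split: prod.split)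

text \<open>
  A chain of the product totalization is the family of its blocks; its coordinate at
  \<open>d\<close> is the one in the block with \<open>length d\<close> tensor factors and
  internal degree \<open>sum_list d\<close>. The value at the empty word is a default.
\<close>

definition coord :: "(nat \<times> nat \<Rightarrow> ((nat \<times> (nat \<Rightarrow> 'a)) list \<Rightarrow> 'a) set) \<Rightarrow> nat list \<Rightarrow> 'a" where
  "coord z d = (if d = [] then \<zero> else tp_coord (length d - 1) (sum_list d) (z (length d - 1, sum_list d)) d)"

definition chain_space :: "(nat list \<Rightarrow> 'a) set" where
  "chain_space = {Z. (\<forall>d. Z d \<in> carrier R) \<and> Z [] = \<zero>}"

lemma chain_space_val: "Z \<in> chain_space \<Longrightarrow> Z d \<in> carrier R" by (simp add: chain_space_def)

lemma coord_degs: "d \<in> degs n m \<Longrightarrow> coord z d = tp_coord n m (z (n, m)) d"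
  by (auto simp: coord_def degs_def)

lemma coord_closed: "z \<in> carrier PT \<Longrightarrow> coord z \<in> chain_space"
proof -
  assume "z \<in> carrier PT"
  hence "z (n, m) \<in> carrier (TP n m)" for n m by (simp add: PT_simps)
  thus ?thesis by (simp add: chain_space_def coord_def tp_coord_val)
qed

lemma coord_add: "y \<in> carrier PT \<Longrightarrow> z \<in> carrier PT \<Longrightarrow> coord (y \<oplus>\<^bsub>PT\<^esub> z) d = coord y d \<oplus> coord z d"
  by (simp add: coord_def PT_simps mhomD(2)[OF mhom_tp_coord]) (simp add: free_module_simps)

lemma coord_smult: "r \<in> carrier R \<Longrightarrow> z \<in> carrier PT \<Longrightarrow> coord (r \<odot>\<^bsub>PT\<^esub> z) d = r \<otimes> coord z d"
  by (simp add: coord_def PT_simps mhomD(3)[OF mhom_tp_coord]) (simp add: free_module_simps)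

lemma coord_zero: "coord \<zero>\<^bsub>PT\<^esub> d = \<zero>"
  by (simp add: coord_def PT_simps mhom_props(1)[OF module_TP module_V mhom_tp_coord]) (simp add: free_module_simps)

lemma tp_coord_ext: "X \<in> carrier (TP n m) \<Longrightarrow> d \<notin> degs n m \<Longrightarrow> tp_coord n m X d = \<zero>"
  using mhomD(1)[OF mhom_tp_coord] by (auto simp: free_module_simps)

lemma coord_inj: "y \<in> carrier PT \<Longrightarrow> z \<in> carrier PT \<Longrightarrow> (\<And>d. coord y d = coord z d) \<Longrightarrow> y = z"
proof
  fix x :: "nat \<times> nat"
  assume y: "y \<in> carrier PT" and z: "z \<in> carrier PT" and e: "\<And>d. coord y d = coord z d"
  obtain n m where x: "x = (n, m)" by force
  have c: "y (n, m) \<in> carrier (TP n m)" "z (n, m) \<in> carrier (TP n m)" using y z by (auto simp: PT_simps)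
  have "tp_coord n m (y (n, m)) d = tp_coord n m (z (n, m)) d" for d
    using e[of d] coord_degs[of d n m] tp_coord_ext[OF c(1), of d] tp_coord_ext[OF c(2), of d] by (cases "d \<in> degs n m") auto
  thus "y x = z x" unfolding x using c by (intro tp_coord_inj) auto
qed

lemma coord_surj:
  assumes Z: "Z \<in> chain_space"
  shows "\<exists>z\<in>carrier PT. coord z = Z"
proof -
  have "\<exists>X\<in>carrier (TP n m). tp_coord n m X = (\<lambda>d. if d \<in> degs n m then Z d else \<zero>)" for n m
  proof (rule tp_coord_surj)
    have "finite {d. (if d \<in> degs n m then Z d else \<zero>) \<noteq> \<zero>}"
      by (rule finite_subset[OF _ finite_degs[of n m]]) auto
    thus "(\<lambda>d. if d \<in> degs n m then Z d else \<zero>) \<in> carrier (V n m)"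
      using chain_space_val[OF Z] unfolding free_module_simps by auto
  qed
  hence ex: "\<exists>X. X \<in> carrier (TP n m) \<and> tp_coord n m X = (\<lambda>d. if d \<in> degs n m then Z d else \<zero>)" for n m by blast
  define z where "z n m = (SOME X. X \<in> carrier (TP n m) \<and> tp_coord n m X = (\<lambda>d. if d \<in> degs n m then Z d else \<zero>))" for n m
  have z: "z n m \<in> carrier (TP n m)" "tp_coord n m (z n m) = (\<lambda>d. if d \<in> degs n m then Z d else \<zero>)" for n m
    using someI_ex[OF ex[of n m]] unfolding z_def by blast+
  have "coord (\<lambda>(n, m). z n m) = Z"
    using Z by (auto simp: coord_def z fun_eq_iff degs_def chain_space_def)
  moreover have "(\<lambda>(n, m). z n m) \<in> carrier PT" using z by (simp add: PT_simps)
  ultimately show ?thesis by blast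
qed

text \<open>
  A finite set of words that contains the support of row \<open>e\<close> of every local
  operator.
\<close>

definition box :: "nat list \<Rightarrow> nat list set" where
  "box e = {d. length d \<le> Suc (length e) \<and> sum_list d \<le> Suc (sum_list e)}"

lemma finite_box': "finite {d :: nat list. length d \<le> L \<and> sum_list d \<le> M}"
proof (rule finite_subset)
  show "{d :: nat list. length d \<le> L \<and> sum_list d \<le> M} \<subseteq> {d. set d \<subseteq> {..M} \<and> length d \<le> L}"
    by (auto dest: member_le_sum_list)
  show "finite {d :: nat list. set d \<subseteq> {..M} \<and> length d \<le> L}" by (rule finite_lists_length_le) simp
qed

lemma finite_box [simp]: "finite (box e)"
  unfolding box_def by (rule finite_box')

lemma ind_zero:
  "\<not> (length e = length d - 1 \<and> sum_list e = sum_list d \<and> e \<noteq> []) \<Longrightarrow> hoch (ind e) d = 0"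
  "\<not> (length e = length d - 1 \<and> sum_list e = sum_list d \<and> e \<noteq> []) \<Longrightarrow> bar (ind e) d = 0"
  "\<not> (length e = length d \<and> Suc (sum_list e) = sum_list d \<and> e \<noteq> []) \<Longrightarrow> delta_op q (ind e) d = 0"
  "\<not> (length e = length d \<and> sum_list e = sum_list d \<and> e \<noteq> []) \<Longrightarrow> rot (ind e) d = 0"
  "\<not> (length e = length d \<and> sum_list e = sum_list d \<and> e \<noteq> []) \<Longrightarrow> norm_op (ind e) d = 0"
proof -
  have z: "F (\<lambda>_. 0 :: int) d = 0" if "lin_op F" for F :: "(nat list \<Rightarrow> int) \<Rightarrow> nat list \<Rightarrow> int"
    using lin_op_simps(5)[OF that] .
  show "\<not> (length e = length d - 1 \<and> sum_list e = sum_list d \<and> e \<noteq> []) \<Longrightarrow> hoch (ind e) d = 0"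
    by (subst z[OF lin_ops(4), symmetric], rule hoch_cong) auto
  show "\<not> (length e = length d - 1 \<and> sum_list e = sum_list d \<and> e \<noteq> []) \<Longrightarrow> bar (ind e) d = 0"
    by (subst z[OF lin_ops(1), symmetric], rule bar_cong) auto
  show "\<not> (length e = length d \<and> Suc (sum_list e) = sum_list d \<and> e \<noteq> []) \<Longrightarrow> delta_op q (ind e) d = 0"
    by (subst z[OF lin_ops(7), symmetric], rule delta_op_cong) auto
  show "\<not> (length e = length d \<and> sum_list e = sum_list d \<and> e \<noteq> []) \<Longrightarrow> rot (ind e) d = 0"
    by (subst z[OF lin_ops(2), symmetric], rule rot_cong) auto
  show "\<not> (length e = length d \<and> sum_list e = sum_list d \<and> e \<noteq> []) \<Longrightarrow> norm_op (ind e) d = 0"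
    by (subst z[OF lin_ops(6), symmetric], rule norm_op_cong) auto
qed

lemma int_comb_disjoint3:
  assumes "finite S1" "finite S2" "finite S0" "S1 \<inter> S2 = {}" "(S1 \<union> S2) \<inter> S0 = {}"
    "\<And>d. v d \<in> carrier R"
  shows "int_comb (S1 \<union> S2 \<union> S0) \<eta> v = int_comb S1 \<eta> v \<oplus> int_comb S2 \<eta> v \<oplus> int_comb S0 \<eta> v"
  unfolding int_comb_def using assms by (simp add: finsum_Un_disjoint Pi_def)

text \<open>
  Row \<open>e\<close> of the \<open>j\<close>-th power of the cyclic operator is
  \<open>rot ^^ j\<close> applied to the indicator of \<open>e\<close>; the order of
  composition is reversed by transposition, which is harmless for powers.
\<close>

lemma norm_coord:
  assumes X: "X \<in> carrier (TP n m)"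
  shows "cyclic_norm R A n m X \<in> carrier (TP n m)" "tp_coord n m (cyclic_norm R A n m X) e = int_comb (degs n m) (norm_op (ind e)) (tp_coord n m X)"
proof -
  interpret T: module R "TP n m" by (rule module_TP)
  let ?t = "cyclic_t R A n m"
  have tc: "(?t ^^ j) X \<in> carrier (TP n m)" for j
    by (induction j) (auto simp: X intro: cyclic_coord(1))
  have kv: "tp_coord n m X d \<in> carrier R" if "X \<in> carrier (TP n m)" for X d using tp_coord_val[OF that] .
  have rp: "tp_coord n m ((?t ^^ j) X) e = int_comb (degs n m) ((rot ^^ j) (ind e)) (tp_coord n m X)" if "e \<in> degs n m" for j e
    using that
  proof (induction j arbitrary: e)
    case 0
    thus ?case using int_comb_ind[of "degs n m" e "tp_coord n m X"] tp_coord_val[OF X] by simp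
  next
    case (Suc j)
    have "tp_coord n m ((?t ^^ Suc j) X) e = int_comb (degs n m) (rot (ind e)) (tp_coord n m ((?t ^^ j) X))"
      using cyclic_coord(2)[OF tc] by simp
    also have "\<dots> = (\<Oplus>f\<in>degs n m. [(rot (ind e) f)] \<cdot> int_comb (degs n m) ((rot ^^ j) (ind f)) (tp_coord n m X))"
      unfolding int_comb_def[of "degs n m" "rot (ind e)"] by (rule finsum_cong') (use Suc.IH kv[OF X] kv[OF tc] in auto)
    also have "\<dots> = (\<Oplus>f\<in>degs n m. int_comb (degs n m) (\<lambda>d. rot (ind e) f * (rot ^^ j) (ind f) d) (tp_coord n m X))"
      by (rule finsum_cong') (use kv[OF X] in \<open>auto simp: int_comb_scale\<close>)
    also have "\<dots> = int_comb (degs n m) (\<lambda>d. \<Sum>f\<in>degs n m. rot (ind e) f * (rot ^^ j) (ind f) d) (tp_coord n m X)"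
      by (rule int_comb_sum[symmetric]) (use kv[OF X] in auto)
    also have "\<dots> = int_comb (degs n m) ((rot ^^ Suc j) (ind e)) (tp_coord n m X)"
    proof (rule int_comb_cong)
      fix d assume d: "d \<in> degs n m"
      have "(\<Sum>f\<in>degs n m. rot (ind e) f * (rot ^^ j) (ind f) d) = (rot ^^ j) (\<lambda>g. \<Sum>f\<in>degs n m. rot (ind e) f * ind f g) d"
        using lin_op_sum[OF lin_ops(5), of j "\<lambda>f g. rot (ind e) f * ind f g" "degs n m" d] by (simp add: lin)
      also have "\<dots> = (rot ^^ j) (rot (ind e)) d"
      proof (rule rotpow_cong)
        fix g :: "nat list" assume g: "length g = length d" "sum_list g = sum_list d"
        hence "g \<in> degs n m" using d by (simp add: degs_def)
        thus "(\<Sum>f\<in>degs n m. rot (ind e) f * ind f g) = rot (ind e) g"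
          by (simp add: if_distrib sum.delta' cong: if_cong)
      qed (use d in \<open>auto simp: degs_def\<close>)
      finally show "(\<Sum>f\<in>degs n m. rot (ind e) f * (rot ^^ j) (ind f) d) = (rot ^^ Suc j) (ind e) d"
        by (simp add: funpow_swap1)
    qed (rule kv[OF X])
    finally show ?case .
  qed
  show c: "cyclic_norm R A n m X \<in> carrier (TP n m)" unfolding cyclic_norm_def using tc by (intro T.finsum_closed) auto
  show "tp_coord n m (cyclic_norm R A n m X) e = int_comb (degs n m) (norm_op (ind e)) (tp_coord n m X)"
  proof (cases "e \<in> degs n m")
    case True
    have "tp_coord n m (cyclic_norm R A n m X) e = (\<Oplus>j\<in>{..n}. tp_coord n m ((?t ^^ j) X) e)"
      unfolding cyclic_norm_def using tc mhomD(1)[OF mhom_tp_coord tc]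
      by (simp add: mhom_props(4)[OF module_TP module_V mhom_tp_coord] V_finsum)
    also have "\<dots> = (\<Oplus>j\<in>{..n}. int_comb (degs n m) ((rot ^^ j) (ind e)) (tp_coord n m X))"
      by (rule finsum_cong') (use rp[OF True] kv[OF X] in auto)
    also have "\<dots> = int_comb (degs n m) (\<lambda>d. \<Sum>j\<in>{..n}. (rot ^^ j) (ind e) d) (tp_coord n m X)"
      by (rule int_comb_sum[symmetric]) (use kv[OF X] in auto)
    also have "\<dots> = int_comb (degs n m) (norm_op (ind e)) (tp_coord n m X)"
      by (rule int_comb_cong) (auto simp: norm_op_def degs_def lessThan_Suc_atMost kv[OF X])
    finally show ?thesis .
  next
    case False
    have "int_comb (degs n m) (norm_op (ind e)) (tp_coord n m X) = int_comb (degs n m) (\<lambda>_. 0) (tp_coord n m X)"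
      by (rule int_comb_cong) (use False ind_zero(5) kv[OF X] in \<open>auto simp: degs_def\<close>)
    thus ?thesis using tp_coord_ext[OF c False] by (simp add: int_comb_def)
  qed
qed

lemma even_col_block: "d \<in> degs n m \<Longrightarrow> even_col i d \<longleftrightarrow> even (i + int n + int m)"
  by (auto simp: even_col_def degs_def)

text \<open>
  The component of the total differential at \<open>e\<close> receives contributions from
  three blocks: one with an additional tensor factor, one with internal degree larger by
  one, and the block of \<open>e\<close> itself. The row given by \<open>tot\<close>
  splits accordingly.
\<close>

lemma periodic_coord:
  assumes z: "z \<in> carrier PT"
  shows "periodic_diff R A i z \<in> carrier PT"
    and "coord (periodic_diff R A i z) e = int_comb (box e) (tot p i (ind e)) (coord z)"
proof -
  have zc: "z (n, m) \<in> carrier (TP n m)" for n m using z by (simp add: PT_simps)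
  have Cv [simp]: "coord z d \<in> carrier R" for d using coord_closed[OF z] by (rule chain_space_val)
  have blk: "periodic_diff R A i z (n, m) \<in> carrier (TP n m) \<and>
     (e \<in> degs n m \<longrightarrow> tp_coord n m (periodic_diff R A i z (n, m)) e = int_comb (box e) (tot p i (ind e)) (coord z))" for n m e
  proof -
    interpret T: module R "TP n m" by (rule module_TP)
    let ?X1 = "z (Suc n, m)" and ?X2 = "z (n, Suc m)" and ?X0 = "z (n, m)"
    let ?S1 = "degs (Suc n) m" and ?S2 = "degs n (Suc m)" and ?S0 = "degs n m"
    note c = hoch_coord[OF zc] bar_coord[OF zc] diff_coord[OF zc] cyclic_coord[OF zc] norm_coord[OF zc]
    have sc: "sgn_pow (TP n m) n (tensor_diff R A n m ?X2) \<in> carrier (TP n m)"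
      by (intro sgn_closed[OF module_TP] c)
    have KC: "int_comb (degs n' m') \<eta> (tp_coord n' m' (z (n', m'))) = int_comb (degs n' m') \<eta> (coord z)" for n' m' \<eta>
      unfolding int_comb_def by (rule finsum_cong') (auto simp: coord_degs tp_coord_val[OF zc])
    have box: "int_comb (box e) (tot p i (ind e)) (coord z) = int_comb ?S1 (tot p i (ind e)) (coord z) \<oplus> int_comb ?S2 (tot p i (ind e)) (coord z) \<oplus> int_comb ?S0 (tot p i (ind e)) (coord z)"
      if e: "e \<in> degs n m"
    proof -
      have "int_comb (box e) (tot p i (ind e)) (coord z) = int_comb (?S1 \<union> ?S2 \<union> ?S0) (tot p i (ind e)) (coord z)"
      proof (rule int_comb_mono)
        show "?S1 \<union> ?S2 \<union> ?S0 \<subseteq> box e" using e by (auto simp: degs_def box_def)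
        show "tot p i (ind e) d = 0" if "d \<in> box e - (?S1 \<union> ?S2 \<union> ?S0)" for d
        proof (cases "d = []")
          case False
          have "length e = Suc n" "sum_list e = m" "e \<noteq> []" using e by (auto simp: degs_def)
          hence 1: "\<not> (length e = length d - 1 \<and> sum_list e = sum_list d \<and> e \<noteq> [])"
            "\<not> (length e = length d \<and> Suc (sum_list e) = sum_list d \<and> e \<noteq> [])"
            "\<not> (length e = length d \<and> sum_list e = sum_list d \<and> e \<noteq> [])" "d \<noteq> e"
            using that False by (auto simp: degs_def)
          show ?thesis using ind_zero(1,2)[OF 1(1)] ind_zero(3)[OF 1(2)] ind_zero(4,5)[OF 1(3)] 1(4) by (simp add: tot_def)
        qed (simp add: tot_def)
      qed auto
      also have "\<dots> = int_comb ?S1 (tot p i (ind e)) (coord z) \<oplus> int_comb ?S2 (tot p i (ind e)) (coord z) \<oplus> int_comb ?S0 (tot p i (ind e)) (coord z)"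
        by (rule int_comb_disjoint3[OF finite_degs finite_degs finite_degs]) (auto simp: degs_def)
      finally show ?thesis .
    qed
    note mK = mhomD[OF mhom_tp_coord[of n m]] and pK = mhom_props[OF module_TP module_V mhom_tp_coord[of n m]]
    have vadd: "(v \<oplus>\<^bsub>V n m\<^esub> w) e = v e \<oplus> w e" for v w e by (simp add: free_module_simps)
    have z1: "delta_op p (ind e) d = 0" "norm_op (ind e) d = 0" "rot (ind e) d = 0" "ind e d = 0" if "d \<in> ?S1" "e \<in> degs n m" for d
      using that by (auto simp: degs_def intro!: ind_zero)
    have z2: "hoch (ind e) d = 0" "bar (ind e) d = 0" "norm_op (ind e) d = 0" "rot (ind e) d = 0" "ind e d = 0" if "d \<in> ?S2" "e \<in> degs n m" for d
      using that by (auto simp: degs_def intro!: ind_zero)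
    have z0: "hoch (ind e) d = 0" "bar (ind e) d = 0" "delta_op p (ind e) d = 0" if "d \<in> ?S0" "e \<in> degs n m" for d
      using that by (auto simp: degs_def intro!: ind_zero)
    have ne: "d \<noteq> []" if "d \<in> degs n' m'" for d n' m' using that by (auto simp: degs_def)
    show ?thesis
    proof (cases "even (i - 1 - int n - int m)")
      case True
      hence ev: "even_col i d" if "d \<in> ?S1 \<union> ?S2" for d using that even_col_block[of d "Suc n" m i] even_col_block[of d n "Suc m" i] by auto
      have ev0: "\<not> even_col i d" if "d \<in> ?S0" for d using that even_col_block[of d n m i] True by auto
      let ?P = "hoch_b R A n m ?X1 \<oplus>\<^bsub>TP n m\<^esub> sgn_pow (TP n m) n (tensor_diff R A n m ?X2) \<oplus>\<^bsub>TP n m\<^esub> (?X0 \<ominus>\<^bsub>TP n m\<^esub> cyclic_t R A n m ?X0)"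
      have P: "periodic_diff R A i z (n, m) = ?P" using True by (simp add: periodic_diff_def Let_def)
      have sub: "?X0 \<ominus>\<^bsub>TP n m\<^esub> cyclic_t R A n m ?X0 \<in> carrier (TP n m)" using c zc by simp
      have "tp_coord n m ?P e = int_comb (box e) (tot p i (ind e)) (coord z)" if e: "e \<in> degs n m"
      proof -
        have "tp_coord n m ?P e = tp_coord n m (hoch_b R A n m ?X1) e \<oplus> tp_coord n m (sgn_pow (TP n m) n (tensor_diff R A n m ?X2)) e \<oplus> tp_coord n m (?X0 \<ominus>\<^bsub>TP n m\<^esub> cyclic_t R A n m ?X0) e"
          using c sc sub by (simp add: mK(2) vadd)
        also have "tp_coord n m (hoch_b R A n m ?X1) e = int_comb ?S1 (tot p i (ind e)) (coord z)"
          unfolding c(2) KC by (rule int_comb_cong) (use ev z1 ne e in \<open>auto simp: tot_def\<close>)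
        also have "tp_coord n m (sgn_pow (TP n m) n (tensor_diff R A n m ?X2)) e = int_comb ?S2 (tot p i (ind e)) (coord z)"
        proof -
          have "tp_coord n m (sgn_pow (TP n m) n (tensor_diff R A n m ?X2)) e = [(sg n)] \<cdot> int_comb ?S2 (delta_op p (ind e)) (coord z)"
            using pK(5)[OF c(5)] mK(1)[OF c(5)] by (simp add: V_sgn c(6) KC)
          also have "\<dots> = int_comb ?S2 (\<lambda>d. sg n * delta_op p (ind e) d) (coord z)" by (simp add: int_comb_scale)
          also have "\<dots> = int_comb ?S2 (tot p i (ind e)) (coord z)"
            by (rule int_comb_cong) (use ev z2 ne e in \<open>auto simp: tot_def degs_def\<close>)
          finally show ?thesis .
        qed
        also have "tp_coord n m (?X0 \<ominus>\<^bsub>TP n m\<^esub> cyclic_t R A n m ?X0) e = int_comb ?S0 (tot p i (ind e)) (coord z)"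
        proof -
          have "tp_coord n m (?X0 \<ominus>\<^bsub>TP n m\<^esub> cyclic_t R A n m ?X0) e = int_comb ?S0 (ind e) (coord z) \<oplus> [(- 1 :: int)] \<cdot> int_comb ?S0 (rot (ind e)) (coord z)"
          proof -
            have "tp_coord n m (?X0 \<ominus>\<^bsub>TP n m\<^esub> cyclic_t R A n m ?X0) e = coord z e \<oplus> \<ominus> int_comb ?S0 (rot (ind e)) (coord z)"
              using pK(2)[OF c(7)] mK(1)[OF c(7)] mK(2)[OF zc[of n m], of "\<ominus>\<^bsub>TP n m\<^esub> cyclic_t R A n m ?X0"] c(7)
              by (simp add: a_minus_def vadd V_neg c(8) KC coord_degs[OF e])
            moreover have "int_comb ?S0 (ind e) (coord z) = coord z e" using e by (intro int_comb_ind) auto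
            ultimately show ?thesis by (simp add: int_neg)
          qed
          also have "\<dots> = int_comb ?S0 (\<lambda>d. ind e d + (- 1) * rot (ind e) d) (coord z)" by (subst int_comb_add) (simp_all only: int_comb_scale finite_degs Cv)
          also have "\<dots> = int_comb ?S0 (tot p i (ind e)) (coord z)"
            by (rule int_comb_cong) (use ev0 z0 ne e in \<open>auto simp: tot_def\<close>)
          finally show ?thesis .
        qed
        finally show ?thesis using box[OF e] by simp
      qed
      thus ?thesis unfolding P using c sc sub by simp
    next
      case False
      hence ev: "\<not> even_col i d" if "d \<in> ?S1 \<union> ?S2" for d using that even_col_block[of d "Suc n" m i] even_col_block[of d n "Suc m" i] by auto
      have ev0: "even_col i d" if "d \<in> ?S0" for d using that even_col_block[of d n m i] False by auto
      let ?B = "hoch_b' R A n m ?X1" and ?Dtot = "sgn_pow (TP n m) n (tensor_diff R A n m ?X2)"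
      let ?P = "\<ominus>\<^bsub>TP n m\<^esub> (?B \<oplus>\<^bsub>TP n m\<^esub> ?Dtot) \<oplus>\<^bsub>TP n m\<^esub> cyclic_norm R A n m ?X0"
      have P: "periodic_diff R A i z (n, m) = ?P" using False by (simp add: periodic_diff_def Let_def)
      have BD: "?B \<oplus>\<^bsub>TP n m\<^esub> ?Dtot \<in> carrier (TP n m)" using c sc by simp
      have "tp_coord n m ?P e = int_comb (box e) (tot p i (ind e)) (coord z)" if e: "e \<in> degs n m"
      proof -
        have "tp_coord n m ?P e = tp_coord n m (\<ominus>\<^bsub>TP n m\<^esub> (?B \<oplus>\<^bsub>TP n m\<^esub> ?Dtot)) e \<oplus> tp_coord n m (cyclic_norm R A n m ?X0) e"
          using c BD by (simp add: mK(2) vadd)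
        also have "tp_coord n m (\<ominus>\<^bsub>TP n m\<^esub> (?B \<oplus>\<^bsub>TP n m\<^esub> ?Dtot)) e = \<ominus> (tp_coord n m ?B e \<oplus> tp_coord n m ?Dtot e)"
          using pK(2)[OF BD] mK(1)[OF BD] mK(2)[OF c(3) sc] by (simp add: V_neg vadd)
        also have "\<dots> = \<ominus> tp_coord n m ?B e \<oplus> \<ominus> tp_coord n m ?Dtot e"
          using tp_coord_val[OF c(3)] tp_coord_val[OF sc] by (simp add: minus_add a_comm)
        also have "\<ominus> tp_coord n m ?B e = int_comb ?S1 (tot p i (ind e)) (coord z)"
        proof -
          have "\<ominus> tp_coord n m ?B e = int_comb ?S1 (\<lambda>d. (- 1) * bar (ind e) d) (coord z)"
            unfolding c(4) KC by (subst int_comb_scale) (simp_all only: finite_degs Cv int_neg int_comb_closed int_one)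
          also have "\<dots> = int_comb ?S1 (tot p i (ind e)) (coord z)"
            by (rule int_comb_cong) (use ev z1 ne e in \<open>auto simp: tot_def\<close>)
          finally show ?thesis .
        qed
        also have "\<ominus> tp_coord n m ?Dtot e = int_comb ?S2 (tot p i (ind e)) (coord z)"
        proof -
          have "tp_coord n m ?Dtot e = [(sg n)] \<cdot> int_comb ?S2 (delta_op p (ind e)) (coord z)"
            using pK(5)[OF c(5)] mK(1)[OF c(5)] by (simp add: V_sgn c(6) KC)
          hence "\<ominus> tp_coord n m ?Dtot e = [(- sg n)] \<cdot> int_comb ?S2 (delta_op p (ind e)) (coord z)" by (simp add: int_neg)
          also have "\<dots> = int_comb ?S2 (\<lambda>d. (- sg n) * delta_op p (ind e) d) (coord z)" by (simp add: int_comb_scale del: mult_minus_left)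
          also have "\<dots> = int_comb ?S2 (tot p i (ind e)) (coord z)"
            by (rule int_comb_cong) (use ev z2 ne e in \<open>auto simp: tot_def degs_def\<close>)
          finally show ?thesis .
        qed
        also have "tp_coord n m (cyclic_norm R A n m ?X0) e = int_comb ?S0 (tot p i (ind e)) (coord z)"
          unfolding c(10) KC by (rule int_comb_cong) (use ev0 z0 ne e in \<open>auto simp: tot_def\<close>)
        finally show ?thesis using box[OF e] by simp
      qed
      thus ?thesis unfolding P using c BD by simp
    qed
  qed
  show "periodic_diff R A i z \<in> carrier PT" using blk by (simp add: PT_simps)
  show "coord (periodic_diff R A i z) e = int_comb (box e) (tot p i (ind e)) (coord z)"
  proof (cases "e = []")
    case True
    have "tot p i (ind e) d = 0" for d
      using ind_zero[of e d] True by (auto simp: tot_def)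
    thus ?thesis using True by (simp add: coord_def int_comb_def)
  next
    case False
    hence "e \<in> degs (length e - 1) (sum_list e)" by (simp add: degs_def)
    thus ?thesis using blk[of "length e - 1" "sum_list e" e] coord_degs by simp
  qed
qed

subsection \<open>Finite integral functionals and transposed operators\<close>

definition pairing :: "(nat list \<Rightarrow> int) \<Rightarrow> (nat list \<Rightarrow> 'a) \<Rightarrow> 'a" where
  "pairing \<eta> Z = int_comb {d. \<eta> d \<noteq> 0} \<eta> Z"

lemma pairing_eq: "\<lbrakk>finite S; \<And>d. \<eta> d \<noteq> 0 \<Longrightarrow> d \<in> S; Z \<in> chain_space\<rbrakk> \<Longrightarrow> pairing \<eta> Z = int_comb S \<eta> Z"
  unfolding pairing_def by (rule int_comb_mono[symmetric]) (use chain_space_val[of Z] in auto)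

lemma pairing_closed [simp]: "Z \<in> chain_space \<Longrightarrow> pairing \<eta> Z \<in> carrier R"
  unfolding pairing_def using chain_space_val[of Z] by simp

lemma pairing_cong: "(\<And>d. \<eta> d = \<theta> d) \<Longrightarrow> pairing \<eta> Z = pairing \<theta> Z"
  by (simp add: pairing_def int_comb_def)

lemma pairing_zero: "(\<And>d. \<eta> d = 0) \<Longrightarrow> pairing \<eta> Z = \<zero>"
  by (simp add: pairing_def int_comb_def)

lemma pairing_vanish:
  assumes "\<And>d. \<eta> d \<noteq> 0 \<Longrightarrow> Z d = \<zero>"
  shows "pairing \<eta> Z = \<zero>"
proof -
  have "pairing \<eta> Z = (\<Oplus>d\<in>{d. \<eta> d \<noteq> 0}. \<zero>)" unfolding pairing_def int_comb_def
    by (rule finsum_cong') (use assms in auto)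
  thus ?thesis by simp
qed

lemma pairing_local:
  assumes "\<And>d. \<eta> d \<noteq> 0 \<Longrightarrow> Z d = Y d" "Y \<in> chain_space"
  shows "pairing \<eta> Z = pairing \<eta> Y"
  unfolding pairing_def int_comb_def by (rule finsum_cong') (use assms(1) chain_space_val[OF assms(2)] in auto)

lemma pairing_ind: "Z \<in> chain_space \<Longrightarrow> pairing (ind e) Z = Z e"
proof -
  assume Z: "Z \<in> chain_space"
  have "pairing (ind e) Z = int_comb {e} (ind e) Z" by (rule pairing_eq[OF _ _ Z]) (auto split: if_splits)
  also have "\<dots> = Z e" by (rule int_comb_ind) (use chain_space_val[OF Z] in auto)
  finally show ?thesis .
qed

lemma pairing_add:
  assumes "finite {d. \<eta> d \<noteq> 0}" "finite {d. \<theta> d \<noteq> 0}" "Z \<in> chain_space"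
  shows "pairing (\<lambda>d. \<eta> d + \<theta> d) Z = pairing \<eta> Z \<oplus> pairing \<theta> Z"
proof -
  let ?S = "{d. \<eta> d \<noteq> 0} \<union> {d. \<theta> d \<noteq> 0}"
  have "pairing (\<lambda>d. \<eta> d + \<theta> d) Z = int_comb ?S (\<lambda>d. \<eta> d + \<theta> d) Z" "pairing \<eta> Z = int_comb ?S \<eta> Z" "pairing \<theta> Z = int_comb ?S \<theta> Z"
    by (rule pairing_eq; use assms in auto)+
  thus ?thesis using assms int_comb_add[of ?S Z \<eta> \<theta>] chain_space_val[OF assms(3)] by simp
qed

lemma pairing_scale:
  assumes "finite {d. \<eta> d \<noteq> 0}" "Z \<in> chain_space"
  shows "pairing (\<lambda>d. k * \<eta> d) Z = [k] \<cdot> pairing \<eta> Z"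
proof -
  have "pairing (\<lambda>d. k * \<eta> d) Z = int_comb {d. \<eta> d \<noteq> 0} (\<lambda>d. k * \<eta> d) Z" by (rule pairing_eq) (use assms in auto)
  thus ?thesis using assms(1) chain_space_val[OF assms(2)] by (simp add: pairing_def int_comb_scale)
qed

lemma pairing_add_right: "\<lbrakk>Y \<in> chain_space; Z \<in> chain_space\<rbrakk> \<Longrightarrow> pairing \<eta> (\<lambda>d. Y d \<oplus> Z d) = pairing \<eta> Y \<oplus> pairing \<eta> Z"
proof -
  assume *: "Y \<in> chain_space" "Z \<in> chain_space"
  have "pairing \<eta> (\<lambda>d. Y d \<oplus> Z d) = (\<Oplus>d\<in>{d. \<eta> d \<noteq> 0}. [\<eta> d] \<cdot> Y d \<oplus> [\<eta> d] \<cdot> Z d)"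
    unfolding pairing_def int_comb_def by (rule finsum_cong') (use chain_space_val[OF *(1)] chain_space_val[OF *(2)] in \<open>auto simp: add.int_pow_distrib\<close>)
  also have "\<dots> = pairing \<eta> Y \<oplus> pairing \<eta> Z" unfolding pairing_def int_comb_def by (rule finsum_addf) (use chain_space_val[OF *(1)] chain_space_val[OF *(2)] in auto)
  finally show ?thesis .
qed

lemma pairing_smult_right: "\<lbrakk>r \<in> carrier R; Z \<in> chain_space\<rbrakk> \<Longrightarrow> finite {d. \<eta> d \<noteq> 0} \<Longrightarrow> pairing \<eta> (\<lambda>d. r \<otimes> Z d) = r \<otimes> pairing \<eta> Z"
proof -
  assume *: "r \<in> carrier R" "Z \<in> chain_space" "finite {d. \<eta> d \<noteq> 0}"
  have "pairing \<eta> (\<lambda>d. r \<otimes> Z d) = (\<Oplus>d\<in>{d. \<eta> d \<noteq> 0}. r \<otimes> [\<eta> d] \<cdot> Z d)"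
    unfolding pairing_def int_comb_def by (rule finsum_cong') (use * chain_space_val[OF *(2)] in \<open>auto simp: add_pow_rdistr_int\<close>)
  also have "\<dots> = r \<otimes> pairing \<eta> Z" unfolding pairing_def int_comb_def by (rule finsum_rdistr[symmetric]) (use * chain_space_val[OF *(2)] in auto)
  finally show ?thesis .
qed

lemma chain_space_add: "Y \<in> chain_space \<Longrightarrow> Z \<in> chain_space \<Longrightarrow> (\<lambda>d. Y d \<oplus> Z d) \<in> chain_space"
  by (simp add: chain_space_def)

lemma chain_space_minus: "Y \<in> chain_space \<Longrightarrow> Z \<in> chain_space \<Longrightarrow> (\<lambda>d. Y d \<ominus> Z d) \<in> chain_space"
  by (simp add: chain_space_def a_minus_def)

lemma pairing_minus_right: "\<lbrakk>Y \<in> chain_space; Z \<in> chain_space\<rbrakk> \<Longrightarrow> pairing \<eta> (\<lambda>d. Y d \<ominus> Z d) = pairing \<eta> Y \<ominus> pairing \<eta> Z"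
proof -
  assume *: "Y \<in> chain_space" "Z \<in> chain_space"
  have YZ: "(\<lambda>d. Y d \<ominus> Z d) \<in> chain_space" using * by (rule chain_space_minus)
  have "pairing \<eta> (\<lambda>d. Y d \<ominus> Z d) \<oplus> pairing \<eta> Z = pairing \<eta> (\<lambda>d. (Y d \<ominus> Z d) \<oplus> Z d)"
    using pairing_add_right[OF YZ *(2)] by simp
  also have "(\<lambda>d. (Y d \<ominus> Z d) \<oplus> Z d) = Y"
    using chain_space_val[OF *(1)] chain_space_val[OF *(2)] by (simp add: fun_eq_iff a_minus_def a_assoc l_neg)
  finally have e: "pairing \<eta> (\<lambda>d. Y d \<ominus> Z d) \<oplus> pairing \<eta> Z = pairing \<eta> Y" .
  have c: "pairing \<eta> (\<lambda>d. Y d \<ominus> Z d) \<in> carrier R" "pairing \<eta> Z \<in> carrier R" using YZ * by simp_all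
  have "x = (x \<oplus> y) \<ominus> y" if "x \<in> carrier R" "y \<in> carrier R" for x y
    using that by (simp add: a_minus_def a_assoc r_neg)
  from this[OF c] show ?thesis unfolding e .
qed

text \<open>
  The operator on chains whose row \<open>e\<close> is \<open>F\<close> applied to the
  indicator of \<open>e\<close>.
\<close>

definition transpose_op :: "((nat list \<Rightarrow> int) \<Rightarrow> nat list \<Rightarrow> int) \<Rightarrow> (nat list \<Rightarrow> 'a) \<Rightarrow> nat list \<Rightarrow> 'a" where
  "transpose_op F Z e = pairing (F (ind e)) Z"

lemma local_supp: "local_op F \<Longrightarrow> F (ind e) d \<noteq> 0 \<Longrightarrow> d \<in> box e \<and> e \<noteq> []"
proof (rule ccontr)
  assume F: "local_op F" and nz: "F (ind e) d \<noteq> 0" and "\<not> (d \<in> box e \<and> e \<noteq> [])"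
  hence "F (ind e) d = 0" by (intro local_op_zero[OF F]) (auto simp: box_def)
  thus False using nz by simp
qed

lemma local_finite:
  assumes F: "local_op F" and \<eta>: "finite {d. \<eta> d \<noteq> 0}"
  shows "finite {d. F \<eta> d \<noteq> 0}" "F \<eta> d \<noteq> 0 \<Longrightarrow> d \<in> (\<Union>e\<in>{d. \<eta> d \<noteq> 0}. box e)"
proof -
  show *: "d \<in> (\<Union>e\<in>{d. \<eta> d \<noteq> 0}. box e)" if "F \<eta> d \<noteq> 0" for d
    using that F unfolding local_op_def box_def by blast
  show "finite {d. F \<eta> d \<noteq> 0}"
    by (rule finite_subset[of _ "\<Union>e\<in>{d. \<eta> d \<noteq> 0}. box e"]) (use * \<eta> in blast, use \<eta> in auto)
qed

lemma transpose_op_closed: "local_op F \<Longrightarrow> Z \<in> chain_space \<Longrightarrow> transpose_op F Z \<in> chain_space"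
  using local_supp[of F "[]"] by (auto simp: chain_space_def[of] transpose_op_def[abs_def] intro!: pairing_zero pairing_closed)

lemma transpose_op_eq_int_comb: "local_op F \<Longrightarrow> Z \<in> chain_space \<Longrightarrow> transpose_op F Z e = int_comb (box e) (F (ind e)) Z"
  unfolding transpose_op_def by (rule pairing_eq) (auto dest: local_supp)

text \<open>
  All sums are finite, so they can be exchanged; the matrix of \<open>F\<close> determines
  \<open>F\<close> on finitely supported functions by linearity.
\<close>

lemma adjoint:
  assumes F: "local_op F" and Z: "Z \<in> chain_space" and \<eta>: "finite {d. \<eta> d \<noteq> 0}"
  shows "pairing \<eta> (transpose_op F Z) = pairing (F \<eta>) Z"
proof -
  let ?S = "{d. \<eta> d \<noteq> 0}"
  define B where "B = (\<Union>e\<in>?S. box e)"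
  have B: "finite B" using \<eta> by (auto simp: B_def)
  note v = chain_space_val[OF Z]
  have "pairing \<eta> (transpose_op F Z) = (\<Oplus>e\<in>?S. int_comb B (\<lambda>d. \<eta> e * F (ind e) d) Z)"
    unfolding pairing_def int_comb_def[of ?S]
  proof (rule finsum_cong')
    fix e assume e: "e \<in> ?S"
    have "transpose_op F Z e = int_comb B (F (ind e)) Z" unfolding transpose_op_def
      by (rule pairing_eq[OF B _ Z]) (use e local_supp[OF F] in \<open>auto simp: B_def\<close>)
    thus "[\<eta> e] \<cdot> transpose_op F Z e = int_comb B (\<lambda>d. \<eta> e * F (ind e) d) Z" using B v by (simp add: int_comb_scale)
  qed (use v in auto)
  also have "\<dots> = int_comb B (\<lambda>d. \<Sum>e\<in>?S. \<eta> e * F (ind e) d) Z" by (rule int_comb_sum[symmetric]) (use B v \<eta> in auto)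
  also have "\<dots> = int_comb B (F \<eta>) Z"
  proof (rule int_comb_cong)
    fix d
    have l: "lin_op F" using F by (simp add: local_op_def)
    have "(\<Sum>e\<in>?S. \<eta> e * F (ind e) d) = F (\<lambda>x. \<Sum>e\<in>?S. \<eta> e * ind e x) d"
      using lin_op_sum[OF l, of "\<lambda>e x. \<eta> e * ind e x" ?S d] lin_op_simps(3)[OF l] by simp
    also have "(\<lambda>x. \<Sum>e\<in>?S. \<eta> e * ind e x) = \<eta>"
    proof
      fix x
      have "(\<Sum>e\<in>?S. \<eta> e * ind e x) = (\<Sum>e\<in>?S. if e = x then \<eta> e else 0)" by (rule sum.cong) auto
      thus "(\<Sum>e\<in>?S. \<eta> e * ind e x) = \<eta> x" using \<eta> by (simp add: sum.delta)
    qed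
    finally show "(\<Sum>e\<in>?S. \<eta> e * F (ind e) d) = F \<eta> d" .
  qed (rule v)
  also have "\<dots> = pairing (F \<eta>) Z" by (rule pairing_eq[symmetric]) (use B local_finite(2)[OF F \<eta>] Z in \<open>auto simp: B_def\<close>)
  finally show ?thesis .
qed

lemma finite_ind [simp]: "finite {d. ind e d \<noteq> 0}"
  by (rule finite_subset[of _ "{e}"]) auto

lemma transpose_op_add: "\<lbrakk>Y \<in> chain_space; Z \<in> chain_space\<rbrakk> \<Longrightarrow> transpose_op F (\<lambda>d. Y d \<oplus> Z d) e = transpose_op F Y e \<oplus> transpose_op F Z e"
  by (simp add: transpose_op_def pairing_add_right)

lemma transpose_op_minus: "\<lbrakk>Y \<in> chain_space; Z \<in> chain_space\<rbrakk> \<Longrightarrow> transpose_op F (\<lambda>d. Y d \<ominus> Z d) e = transpose_op F Y e \<ominus> transpose_op F Z e"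
  by (simp add: transpose_op_def pairing_minus_right)

definition Dtot :: "int \<Rightarrow> (nat list \<Rightarrow> 'a) \<Rightarrow> nat list \<Rightarrow> 'a" where "Dtot i = transpose_op (tot p i)"

definition Htot :: "int \<Rightarrow> (nat list \<Rightarrow> 'a) \<Rightarrow> nat list \<Rightarrow> 'a" where "Htot i = transpose_op (tot_htpy i)"

lemma Dtot_closed: "Z \<in> chain_space \<Longrightarrow> Dtot i Z \<in> chain_space" unfolding Dtot_def by (rule transpose_op_closed[OF local_tot])

lemma Htot_closed: "Z \<in> chain_space \<Longrightarrow> Htot i Z \<in> chain_space" unfolding Htot_def by (rule transpose_op_closed[OF local_tot_htpy])

lemma Dtot_minus: "\<lbrakk>Y \<in> chain_space; Z \<in> chain_space\<rbrakk> \<Longrightarrow> Dtot i (\<lambda>d. Y d \<ominus> Z d) e = Dtot i Y e \<ominus> Dtot i Z e"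
  unfolding Dtot_def by (rule transpose_op_minus)

lemma Dtot_add: "\<lbrakk>Y \<in> chain_space; Z \<in> chain_space\<rbrakk> \<Longrightarrow> Dtot i (\<lambda>d. Y d \<oplus> Z d) e = Dtot i Y e \<oplus> Dtot i Z e"
  unfolding Dtot_def by (rule transpose_op_add)

lemma coord_diff: "z \<in> carrier PT \<Longrightarrow> coord (periodic_diff R A i z) = Dtot i (coord z)"
  by (rule ext) (simp add: periodic_coord(2) Dtot_def transpose_op_eq_int_comb local_tot coord_closed)

lemma Dtot_Dtot:
  assumes Z: "Z \<in> chain_space"
  shows "Dtot (i - 1) (Dtot i Z) e = \<zero>"
proof -
  have "Dtot (i - 1) (Dtot i Z) e = pairing (tot p (i - 1) (ind e)) (transpose_op (tot p i) Z)" by (simp add: Dtot_def transpose_op_def)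
  also have "\<dots> = pairing (tot p i (tot p (i - 1) (ind e))) Z"
    by (rule adjoint[OF local_tot Z]) (rule local_finite(1)[OF local_tot finite_ind])
  also have "\<dots> = \<zero>" by (rule pairing_zero) (rule tot_tot)
  finally show ?thesis .
qed

subsection \<open>The projection to the small complex\<close>

definition proj :: "int \<Rightarrow> (nat list \<Rightarrow> 'a) \<Rightarrow> nat \<Rightarrow> 'a" where "proj i Z m = pairing (proj_form i m) Z"

lemma proj_form_supp: "proj_form i m d \<noteq> 0 \<Longrightarrow> (d = [m] \<and> (even (i + int m) \<or> even i)) \<or> (odd (i + int m) \<and> length d = 2 \<and> sum_list d = m)"
  by (auto simp: proj_form_def split: if_splits)

lemma finite_proj_form [simp]: "finite {d. proj_form i m d \<noteq> 0}"
  by (rule finite_subset[OF _ finite_box'[of 2 m]]) (auto dest: proj_form_supp)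

lemma proj_Dtot:
  assumes Z: "Z \<in> chain_space"
  shows "proj (i - 1) (Dtot i Z) m = (if odd i then [lam m] \<cdot> proj i Z m \<oplus> [int p] \<cdot> proj i Z (Suc m) else \<zero>)"
proof -
  have f: "finite {d. lam m * proj_form i m d \<noteq> 0}" "finite {d. int p * proj_form i (Suc m) d \<noteq> 0}"
    by (rule finite_subset[OF _ finite_proj_form[of i m]], force) (rule finite_subset[OF _ finite_proj_form[of i "Suc m"]], force)
  have "proj (i - 1) (Dtot i Z) m = pairing (tot p i (proj_form (i - 1) m)) Z" unfolding proj_def Dtot_def by (rule adjoint[OF local_tot Z finite_proj_form])
  also have "\<dots> = pairing (\<lambda>d. if odd i then lam m * proj_form i m d + int p * proj_form i (Suc m) d else 0) Z"
    by (rule pairing_cong) (rule tot_proj_form)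
  also have "\<dots> = (if odd i then [lam m] \<cdot> proj i Z m \<oplus> [int p] \<cdot> proj i Z (Suc m) else \<zero>)"
    using pairing_add[OF f Z] by (simp add: proj_def pairing_scale Z pairing_zero)
  finally show ?thesis .
qed

lemma proj_zero: "odd i \<Longrightarrow> proj i Z 0 = \<zero>"
  unfolding proj_def by (rule pairing_zero) (auto simp: proj_form_def length_Suc_conv numeral_2_eq_2)

lemma pairing_single:
  assumes Z: "Z \<in> chain_space" and "\<And>d. d \<noteq> e \<Longrightarrow> \<eta> d = 0 \<or> Z d = \<zero>"
    and fin: "finite {d. \<eta> d \<noteq> 0}"
  shows "pairing \<eta> Z = [\<eta> e] \<cdot> Z e"
proof -
  define Y where "Y d = (if d = e then Z d else \<zero>)" for d
  have Y: "Y \<in> chain_space" using Z by (auto simp: Y_def chain_space_def)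
  have "pairing \<eta> Z = pairing \<eta> Y" by (rule pairing_local[OF _ Y]) (use assms(2) in \<open>auto simp: Y_def\<close>)
  also have "\<dots> = [\<eta> e] \<cdot> Z e"
  proof (cases "\<eta> e = 0")
    case True
    thus ?thesis by (simp, intro pairing_vanish) (auto simp: Y_def)
  next
    case False
    have "pairing \<eta> Y = (\<Oplus>d\<in>{d. \<eta> d \<noteq> 0}. if e = d then [\<eta> d] \<cdot> Z d else \<zero>)"
      unfolding pairing_def int_comb_def by (rule finsum_cong') (use chain_space_val[OF Z] in \<open>auto simp: Y_def\<close>)
    also have "\<dots> = [\<eta> e] \<cdot> Z e" by (rule finsum_singleton) (use False fin chain_space_val[OF Z] in auto)
    finally show ?thesis .
  qed
  finally show ?thesis .
qed

text \<open>
  A section of the projection, supported on the words \<open>[m]\<close> and \<open>[m -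
  1, 1]\<close>. In odd degree the entry at \<open>0\<close> would require the nonexistent
  word \<open>[- 1, 1]\<close>.
\<close>

lemma proj_surj:
  assumes x: "\<And>m. x m \<in> carrier R" and x0: "odd i \<Longrightarrow> x 0 = \<zero>"
  shows "\<exists>Z\<in>chain_space. proj i Z = x"
proof -
  define Z where "Z d = (if length d = 1 \<and> even (i + int (sum_list d)) then x (sum_list d)
      else if length d = 2 \<and> d ! 1 = 1 \<and> odd (i + int (sum_list d)) then
        (if even i then \<ominus> x (sum_list d) else x (sum_list d))
      else \<zero>)" for d
  have Z: "Z \<in> chain_space" using x by (auto simp: chain_space_def Z_def)
  have "proj i Z m = x m" for m
  proof (cases "even (i + int m)")
    case True
    have "proj i Z m = [proj_form i m [m]] \<cdot> Z [m]" unfolding proj_def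
      by (rule pairing_single[OF Z _ finite_proj_form]) (use True in \<open>auto simp: proj_form_def\<close>)
    thus ?thesis using True x by (simp add: Z_def proj_form_def)
  next
    case odd: False
    show ?thesis
    proof (cases "m = 0")
      case True
      thus ?thesis using odd x0 proj_zero by simp
    next
      case False
      have "proj i Z m = [proj_form i m [m - 1, 1]] \<cdot> Z [m - 1, 1]" unfolding proj_def
      proof (rule pairing_single[OF Z _ finite_proj_form])
        fix d :: "nat list" assume d: "d \<noteq> [m - 1, 1]"
        show "proj_form i m d = 0 \<or> Z d = \<zero>"
        proof (rule ccontr)
          assume "\<not> (proj_form i m d = 0 \<or> Z d = \<zero>)"
          hence nz: "proj_form i m d \<noteq> 0" "Z d \<noteq> \<zero>" by auto
          have "d \<noteq> [m]"
          proof
            assume "d = [m]"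
            hence "Z d = \<zero>" using odd by (simp add: Z_def)
            thus False using nz(2) by simp
          qed
          hence d2: "length d = 2" "sum_list d = m" using proj_form_supp[OF nz(1)] by blast+
          have "d ! 1 = 1"
          proof (rule ccontr)
            assume "d ! 1 \<noteq> 1"
            hence "Z d = \<zero>" using d2 by (simp add: Z_def)
            thus False using nz(2) by simp
          qed
          hence "d = [m - 1, 1]" using d2 by (auto simp: length_Suc_conv numeral_2_eq_2)
          thus False using d by simp
        qed
      qed
      thus ?thesis using odd False x[of m] by (auto simp: Z_def proj_form_def int_neg)
    qed
  qed
  thus ?thesis using Z by blast
qed

subsection \<open>Contraction of the kernel of the projection\<close>

definition cut :: "nat \<Rightarrow> (nat list \<Rightarrow> 'a) \<Rightarrow> nat list \<Rightarrow> 'a" where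
  "cut L Y d = (if length d = L then Y d else \<zero>)"

lemma cut_closed: "Y \<in> chain_space \<Longrightarrow> cut L Y \<in> chain_space"
  by (auto simp: chain_space_def cut_def)

lemma tot_htpy_supp: "tot_htpy i (ind e) d \<noteq> 0 \<Longrightarrow> length e = Suc (length d) \<and> sum_list e = sum_list d"
proof (rule ccontr)
  assume nz: "tot_htpy i (ind e) d \<noteq> 0" and "\<not> (length e = Suc (length d) \<and> sum_list e = sum_list d)"
  hence "tot_htpy i (ind e) d = tot_htpy i (\<lambda>_. 0) d" by (intro tot_htpy_cong) auto
  thus False using nz by (simp add: tot_htpy_lin lin_zero)
qed

lemma Htot_cut_zero: "length e \<noteq> Suc L \<Longrightarrow> Htot i (cut L Y) e = \<zero>"
  unfolding Htot_def transpose_op_def by (rule pairing_vanish) (use tot_htpy_supp in \<open>fastforce simp: cut_def\<close>)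

text \<open>
  In even columns the homotopy produces no words of length two. Together with
  \<open>Htot_cut_zero\<close> this keeps the image of the homotopy inside the kernel of
  the projection.
\<close>

lemma Htot_cut_pair:
  assumes "even_col (i + 1) e" "length e = 2"
  shows "Htot i (cut L Y) e = \<zero>"
  unfolding Htot_def transpose_op_def
proof (rule pairing_zero)
  fix d
  show "tot_htpy i (ind e) d = 0"
  proof (rule ccontr)
    assume nz: "tot_htpy i (ind e) d \<noteq> 0"
    from tot_htpy_supp[OF nz] assms have "length d = 1" "even_col i d" by (auto simp: even_col_def)
    thus False using nz by (simp add: tot_htpy_def hoch_htpy_def split: if_splits)
  qed
qed

lemma proj_Htot_cut: "L \<ge> 1 \<Longrightarrow> proj (i + 1) (Htot i (cut L Y)) m = \<zero>"
  unfolding proj_def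
proof (rule pairing_vanish)
  fix d assume L: "L \<ge> 1" and "proj_form (i + 1) m d \<noteq> 0"
  from proj_form_supp[OF this(2)] consider "length d = 1" | "length d = 2" "odd (i + 1 + int (sum_list d))" by auto
  thus "Htot i (cut L Y) d = \<zero>"
  proof cases
    case 1
    thus ?thesis using L by (intro Htot_cut_zero) auto
  next
    case 2
    thus ?thesis by (intro Htot_cut_pair) (auto simp: even_col_def)
  qed
qed

text \<open>
  Up to sign, the coordinate \<open>m\<close> of the projection of \<open>Y\<close> is the
  total coefficient of \<open>x\<^bsup>m-1\<^esup> dx\<close>, provided the additional
  term at \<open>[m]\<close> vanishes.
\<close>

lemma proj_pair:
  assumes m: "odd (i + int m)" and Y: "Y \<in> chain_space" and Y1: "Y [m] = \<zero>"
  shows "proj i Y m = \<zero> \<Longrightarrow> pairing (\<lambda>d. if length d = 2 \<and> sum_list d = m then pair_coeff (d ! 0) (d ! 1) else 0) Y = \<zero>"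
proof -
  assume proj: "proj i Y m = \<zero>"
  let ?k = "\<lambda>d :: nat list. if length d = 2 \<and> sum_list d = m then pair_coeff (d ! 0) (d ! 1) else 0"
  have fin: "finite {d. ?k d \<noteq> 0}" by (rule finite_subset[OF _ finite_box'[of 2 m]]) auto
  have Y1': "cut 2 Y \<in> chain_space" by (rule cut_closed[OF Y])
  have "pairing ?k Y = pairing ?k (cut 2 Y)" by (rule pairing_local[OF _ Y1']) (auto simp: cut_def split: if_splits)
  also have "\<dots> = pairing (\<lambda>d. (if even i then -1 else 1) * proj_form i m d) (cut 2 Y)"
  proof -
    let ?Q = "\<lambda>d. if length d = 2 then (if even i then -1 else 1) * proj_form i m d else 0"
    have "pairing ?k (cut 2 Y) = pairing ?Q (cut 2 Y)"
    proof (rule pairing_cong)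
      fix d :: "nat list"
      show "?k d = ?Q d"
      proof (cases "length d = 2")
        case True
        then obtain a c where "d = [a, c]" by (auto simp: length_Suc_conv numeral_2_eq_2)
        thus ?thesis using m by (auto simp: proj_form_def pair_coeff_def)
      qed simp
    qed
    also have "\<dots> = pairing (\<lambda>d. (if even i then -1 else 1) * proj_form i m d) (cut 2 Y)"
    proof -
      let ?P = "\<lambda>d. (if even i then -1 else 1) * proj_form i m d"
      have fP: "finite {d. ?P d \<noteq> 0}" by (rule finite_subset[OF _ finite_proj_form[of i m]]) auto
      have "pairing ?Q (cut 2 Y) = int_comb {d. ?P d \<noteq> 0} ?Q (cut 2 Y)" by (rule pairing_eq[OF fP _ Y1']) (auto split: if_splits)
      also have "\<dots> = int_comb {d. ?P d \<noteq> 0} ?P (cut 2 Y)" unfolding int_comb_def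
        by (rule finsum_cong') (use chain_space_val[OF Y1'] in \<open>auto simp: cut_def\<close>)
      also have "\<dots> = pairing ?P (cut 2 Y)" by (simp add: pairing_def)
      finally show ?thesis .
    qed
    finally show ?thesis .
  qed
  also have "\<dots> = [(if even i then -1 else 1 :: int)] \<cdot> pairing (proj_form i m) (cut 2 Y)" by (rule pairing_scale[OF finite_proj_form Y1'])
  also have "pairing (proj_form i m) (cut 2 Y) = pairing (proj_form i m) Y"
    by (rule pairing_local[OF _ Y]) (use proj_form_supp m Y1 in \<open>fastforce simp: cut_def\<close>)
  finally show ?thesis using proj by (simp add: proj_def)
qed

text \<open>
  On the kernel of the projection the defect of the homotopy disappears in the lowest word
  length on which \<open>Y\<close> is supported: for words of length one in even columns
  and for the retraction to \<open>[m - 1, 1]\<close> the missing part is a coordinate of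
  the projection.
\<close>

lemma htpy_defect_eval:
  assumes Y: "Y \<in> chain_space" and low: "\<And>d. length d < length e \<Longrightarrow> Y d = \<zero>" and proj: "\<And>m. proj i Y m = \<zero>" and e: "e \<noteq> []"
  shows "pairing (\<lambda>d. if length d = length e then htpy_defect i (ind e) d else 0) Y = Y e"
proof -
  let ?L = "length e" and ?m = "sum_list e"
  have fe: "finite {d. (if length d = length e then ind e d else 0) \<noteq> 0}" by (rule finite_subset[of _ "{e}"]) auto
  consider "\<not> even_col i e \<or> ?L \<ge> 3" | "even_col i e" "?L = 1" | "even_col i e" "?L = 2"
  proof -
    have "?L \<noteq> 0" using e by simp
    hence "?L = 1 \<or> ?L = 2 \<or> ?L \<ge> 3" by arith
    thus ?thesis using that by blast
  qed
  thus ?thesis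
  proof cases
    case 1
    have "(if length d = ?L then htpy_defect i (ind e) d else 0) = ind e d" for d
    proof (cases "length d = ?L \<and> even_col i d \<and> length d = 2")
      case True
      then obtain a c where d: "d = [a, c]" by (auto simp: length_Suc_conv numeral_2_eq_2)
      have "pair_coeff a c * ind e [a + c - 1, 1] = 0"
      proof (rule ccontr)
        assume "pair_coeff a c * ind e [a + c - 1, 1] \<noteq> 0"
        hence k: "pair_coeff a c \<noteq> 0" "e = [a + c - 1, 1]" by (auto split: if_splits)
        have "a + c \<noteq> 0"
        proof
          assume "a + c = 0"
          thus False using k(1) by (simp add: pair_coeff_def)
        qed
        hence "sum_list e = a + c" using k by simp
        moreover have "length e = 2" using True by linarith
        ultimately have "even_col i e = even_col i d" unfolding even_col_def using d by simp
        hence "even_col i e" using True by blast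
        thus False using 1 True by simp
      qed
      thus ?thesis using True d by (auto simp: htpy_defect_def)
    next
      case False
      thus ?thesis using 1 by (auto simp: htpy_defect_def)
    qed
    hence "pairing (\<lambda>d. if length d = ?L then htpy_defect i (ind e) d else 0) Y = pairing (ind e) Y" by (rule pairing_cong)
    thus ?thesis by (simp add: pairing_ind[OF Y])
  next
    case 2
    then obtain m where em: "e = [m]" by (auto simp: length_Suc_conv)
    have im: "even (i + int m)" using 2 em by (simp add: even_col_def)
    have "(if length d = ?L then htpy_defect i (ind e) d else 0) = 0" for d using em 2 by (auto simp: htpy_defect_def)
    hence "pairing (\<lambda>d. if length d = ?L then htpy_defect i (ind e) d else 0) Y = \<zero>" by (rule pairing_zero)
    moreover have "proj_form i m = ind e" using im em by (auto simp: proj_form_def fun_eq_iff)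
    hence "Y e = \<zero>" using proj[of m] pairing_ind[OF Y, of e] by (simp add: proj_def)
    ultimately show ?thesis by simp
  next
    case 3
    have im: "odd (i + int ?m)" using 3 by (simp add: even_col_def)
    let ?k = "\<lambda>d :: nat list. if length d = 2 \<and> sum_list d = ?m then pair_coeff (d ! 0) (d ! 1) else 0"
    let ?c = "if e = [?m - 1, 1] then -1 else 0 :: int"
    have fk: "finite {d. ?k d \<noteq> 0}" by (rule finite_subset[OF _ finite_box'[of 2 ?m]]) auto
    have fck: "finite {d. ?c * ?k d \<noteq> 0}" by (rule finite_subset[OF _ fk]) auto
    have "(if length d = ?L then htpy_defect i (ind e) d else 0) = ind e d + ?c * ?k d" for d
    proof (cases "length d = 2")
      case True
      then obtain a c where d: "d = [a, c]" by (auto simp: length_Suc_conv numeral_2_eq_2)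
      show ?thesis
      proof (cases "a + c = 0")
        case True
        thus ?thesis using 3 d by (auto simp: htpy_defect_def pair_coeff_def)
      next
        case False
        hence s: "sum_list [a + c - 1, 1] = a + c" by simp
        have "even_col i d" if "a + c = ?m" using 3 d that by (auto simp: even_col_def)
        thus ?thesis using 3 d s by (auto simp: htpy_defect_def)
      qed
    next
      case False
      thus ?thesis using 3 by auto
    qed
    hence "pairing (\<lambda>d. if length d = ?L then htpy_defect i (ind e) d else 0) Y = pairing (\<lambda>d. ind e d + ?c * ?k d) Y" by (rule pairing_cong)
    also have "\<dots> = Y e \<oplus> [?c] \<cdot> pairing ?k Y"
      using pairing_add[OF finite_ind fck Y] pairing_scale[OF fk Y] pairing_ind[OF Y] by simp
    also have "pairing ?k Y = \<zero>" by (rule proj_pair[OF im Y]) (use low 3 proj in auto)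
    finally show ?thesis using chain_space_val[OF Y] by simp
  qed
qed

text \<open>
  Let \<open>Y\<close> be a cycle in the kernel of the projection that vanishes on words
  of length at most \<open>l\<close>. The homotopy applied to the part of \<open>Y\<close>
  in length \<open>l + 1\<close> gives a chain in length \<open>l + 2\<close> whose
  boundary agrees with \<open>Y\<close> up to length \<open>l + 1\<close>. The homotopy
  formula has the second summand \<open>h D Y\<close>, which vanishes for a cycle.
\<close>

lemma contraction_step:
  assumes Y: "Y \<in> chain_space" and low: "\<And>d. length d \<le> l \<Longrightarrow> Y d = \<zero>"
    and DY: "\<And>d. Dtot i Y d = \<zero>" and proj: "\<And>m. proj i Y m = \<zero>" and e: "length e \<le> Suc l"
  shows "Dtot (i + 1) (Htot i (cut (Suc l) Y)) e = Y e"
proof (cases "length e = Suc l")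
  case False
  have "Dtot (i + 1) (Htot i (cut (Suc l) Y)) e = \<zero>" unfolding Dtot_def transpose_op_def[of "tot p (i + 1)"]
  proof (rule pairing_vanish)
    fix d assume "tot p (i + 1) (ind e) d \<noteq> 0"
    hence "d \<in> box e" using local_supp[OF local_tot] by blast
    thus "Htot i (cut (Suc l) Y) d = \<zero>" using e False by (intro Htot_cut_zero) (auto simp: box_def)
  qed
  thus ?thesis using low[of e] e False by simp
next
  case True
  hence ne: "e \<noteq> []" by auto
  let ?Y = "cut (Suc l) Y" and ?g = "tot_htpy (i - 1) (ind e)"
  let ?h = "tot_htpy i (tot p (i + 1) (ind e))" and ?t = "tot p i ?g"
  have cY: "?Y \<in> chain_space" by (rule cut_closed[OF Y])
  have fg: "finite {d. ?g d \<noteq> 0}" by (rule local_finite(1)[OF local_tot_htpy finite_ind])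
  have ft: "finite {d. ?t d \<noteq> 0}" by (rule local_finite(1)[OF local_tot fg])
  have ff: "finite {d. tot p (i + 1) (ind e) d \<noteq> 0}" by (rule local_finite(1)[OF local_tot finite_ind])
  have fh: "finite {d. ?h d \<noteq> 0}" by (rule local_finite(1)[OF local_tot_htpy ff])
  (* The summand of the homotopy formula that contains D Y. The words shorter than l + 1 that
     it involves may be added to the cut, as Y vanishes there. *)
  have tz: "pairing ?t ?Y = \<zero>"
  proof -
    have "pairing ?t ?Y = pairing ?t Y"
    proof (rule pairing_local[OF _ Y])
      fix d assume "?t d \<noteq> 0"
      from local_finite(2)[OF local_tot fg this] obtain f where f: "?g f \<noteq> 0" "d \<in> box f" by auto
      hence "length d \<le> Suc l" using tot_htpy_supp[OF f(1)] True by (auto simp: box_def)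
      thus "?Y d = Y d" using low[of d] by (auto simp: cut_def le_Suc_eq)
    qed
    also have "\<dots> = pairing ?g (Dtot i Y)" unfolding Dtot_def by (rule adjoint[OF local_tot Y fg, symmetric])
    also have "\<dots> = \<zero>" using DY by (intro pairing_vanish)
    finally show ?thesis .
  qed
  have "Dtot (i + 1) (Htot i ?Y) e = pairing ?h ?Y"
    unfolding Dtot_def Htot_def transpose_op_def[of "tot p (i + 1)"] by (rule adjoint[OF local_tot_htpy cY ff])
  also have "\<dots> = pairing ?h ?Y \<oplus> pairing ?t ?Y" using tz cY by simp
  also have "\<dots> = pairing (\<lambda>d. ?h d + ?t d) ?Y" by (rule pairing_add[OF fh ft cY, symmetric])
  also have "\<dots> = pairing (\<lambda>d. if length d = length e then htpy_defect i (ind e) d else 0) ?Y"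
  proof -
    let ?r = "\<lambda>d. if length d = length e then htpy_defect i (ind e) d else 0"
    have eq: "?h d + ?t d = htpy_defect i (ind e) d" if "length d = length e" for d
      by (rule tot_htpy_tot) (use that ne in auto)
    let ?S = "{d. ?h d \<noteq> 0} \<union> {d. ?t d \<noteq> 0}"
    have "pairing (\<lambda>d. ?h d + ?t d) ?Y = int_comb ?S (\<lambda>d. ?h d + ?t d) ?Y" by (rule pairing_eq) (use fh ft cY in auto)
    also have "\<dots> = int_comb ?S ?r ?Y" unfolding int_comb_def
      by (rule finsum_cong') (use eq chain_space_val[OF cY] True in \<open>auto simp: cut_def\<close>)
    also have "\<dots> = pairing ?r ?Y"
    proof (rule pairing_eq[symmetric, OF _ _ cY])
      show "finite ?S" using fh ft by simp
      fix d assume "?r d \<noteq> 0"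
      hence "?h d + ?t d \<noteq> 0" using eq by (auto split: if_splits)
      thus "d \<in> ?S" by auto
    qed
    finally show ?thesis .
  qed
  also have "\<dots> = pairing (\<lambda>d. if length d = length e then htpy_defect i (ind e) d else 0) Y"
    by (rule pairing_local[OF _ Y]) (use True in \<open>auto simp: cut_def split: if_splits\<close>)
  also have "\<dots> = Y e" by (rule htpy_defect_eval[OF Y _ proj ne]) (use low True in auto)
  finally show ?thesis .
qed

text \<open>
  The successive approximations to a preimage of \<open>Z\<close>. Step \<open>l\<close>
  changes only values in word length \<open>l + 2\<close>, so at each word the
  approximations are eventually constant.
\<close>

primrec approx :: "int \<Rightarrow> (nat list \<Rightarrow> 'a) \<Rightarrow> nat \<Rightarrow> nat list \<Rightarrow> 'a" where
  "approx i Z 0 = (\<lambda>_. \<zero>)"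
| "approx i Z (Suc l) = (\<lambda>d. approx i Z l d \<oplus> Htot i (cut (Suc l) (\<lambda>d. Z d \<ominus> Dtot (i + 1) (approx i Z l) d)) d)"

lemma approx_closed: "Z \<in> chain_space \<Longrightarrow> approx i Z l \<in> chain_space"
proof (induction l)
  case 0
  show ?case by (simp add: chain_space_def)
next
  case (Suc l)
  thus ?case unfolding approx.simps by (intro chain_space_add Htot_closed cut_closed chain_space_minus Dtot_closed) auto
qed

lemma proj_add: "\<lbrakk>Y \<in> chain_space; Z \<in> chain_space\<rbrakk> \<Longrightarrow> proj i (\<lambda>d. Y d \<oplus> Z d) m = proj i Y m \<oplus> proj i Z m"
  by (simp add: proj_def pairing_add_right)

lemma proj_minus: "\<lbrakk>Y \<in> chain_space; Z \<in> chain_space\<rbrakk> \<Longrightarrow> proj i (\<lambda>d. Y d \<ominus> Z d) m = proj i Y m \<ominus> proj i Z m"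
  by (simp add: proj_def pairing_minus_right)

lemma proj_approx: "Z \<in> chain_space \<Longrightarrow> proj (i + 1) (approx i Z l) m = \<zero>"
proof (induction l)
  case 0
  show ?case unfolding proj_def by (rule pairing_vanish) simp
next
  case (Suc l)
  have "Htot i (cut (Suc l) (\<lambda>d. Z d \<ominus> Dtot (i + 1) (approx i Z l) d)) \<in> chain_space"
    using Suc.prems by (intro Htot_closed cut_closed chain_space_minus Dtot_closed approx_closed)
  thus ?case using Suc approx_closed[of Z i l] by (simp add: proj_add proj_Htot_cut)
qed

lemma approx_eq: "length e \<le> Suc l \<Longrightarrow> l \<le> N \<Longrightarrow> Z \<in> chain_space \<Longrightarrow> approx i Z N e = approx i Z l e"
proof (induction N)
  case (Suc N)
  show ?case
  proof (cases "l \<le> N")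
    case True
    hence "length e \<noteq> Suc (Suc N)" using Suc.prems by simp
    thus ?thesis using Suc.IH True Suc.prems chain_space_val[OF approx_closed[OF Suc.prems(3)], of i N e] Htot_cut_zero by simp
  next
    case False
    hence "l = Suc N" using Suc.prems by simp
    thus ?thesis by simp
  qed
qed simp

lemma minus_zero_iff: "x \<in> carrier R \<Longrightarrow> y \<in> carrier R \<Longrightarrow> x \<ominus> y = \<zero> \<longleftrightarrow> x = y"
  by (metis a_minus_def minus_equality minus_minus r_neg a_inv_closed)

lemma approx_residue:
  assumes Z: "Z \<in> chain_space" and DZ: "\<And>d. Dtot i Z d = \<zero>" and proj: "\<And>m. proj i Z m = \<zero>" and e: "length e \<le> l"
  shows "Dtot (i + 1) (approx i Z l) e = Z e"
  using e
proof (induction l arbitrary: e)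
  case 0
  thus ?case using Z Dtot_closed[OF approx_closed[OF Z], of "i + 1" i 0] by (simp add: chain_space_def)
next
  case (Suc l)
  define Y where "Y d = Z d \<ominus> Dtot (i + 1) (approx i Z l) d" for d
  have a: "approx i Z l \<in> chain_space" by (rule approx_closed[OF Z])
  have Da: "Dtot (i + 1) (approx i Z l) \<in> chain_space" by (rule Dtot_closed[OF a])
  have Y: "Y \<in> chain_space" unfolding Y_def by (rule chain_space_minus[OF Z Da])
  have low: "Y d = \<zero>" if "length d \<le> l" for d
    using Suc.IH[OF that] chain_space_val[OF Z] by (simp add: Y_def minus_zero_iff)
  have DY: "Dtot i Y d = \<zero>" for d
    unfolding Y_def Dtot_minus[OF Z Da] using Dtot_Dtot[OF a, of "i + 1" d] DZ by (simp add: a_minus_def)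
  have prjY: "proj i Y m = \<zero>" for m
    unfolding Y_def proj_minus[OF Z Da] using proj_Dtot[OF a, of "i + 1" m] proj proj_approx[OF Z] by (simp add: a_minus_def)
  have h: "Htot i (cut (Suc l) Y) \<in> chain_space" by (intro Htot_closed cut_closed Y)
  have "Dtot (i + 1) (approx i Z (Suc l)) e = Dtot (i + 1) (approx i Z l) e \<oplus> Dtot (i + 1) (Htot i (cut (Suc l) Y)) e"
    unfolding approx.simps Y_def[symmetric] by (rule Dtot_add[OF a h])
  also have "\<dots> = Dtot (i + 1) (approx i Z l) e \<oplus> Y e"
    using contraction_step[OF Y low DY prjY Suc.prems] by simp
  also have "\<dots> = Z e" unfolding Y_def using chain_space_val[OF Z, of e] chain_space_val[OF Da, of e]
    by (simp add: a_minus_def a_lcomm[of _ "Z e"] r_neg)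
  finally show ?case .
qed

lemma kernel_acyclic:
  assumes Z: "Z \<in> chain_space" and DZ: "\<And>d. Dtot i Z d = \<zero>" and proj: "\<And>m. proj i Z m = \<zero>"
  shows "\<exists>W\<in>chain_space. proj (i + 1) W = (\<lambda>_. \<zero>) \<and> Dtot (i + 1) W = Z"
proof -
  define W where "W e = approx i Z (length e) e" for e
  note a = approx_closed[OF Z, of i]
  have W: "W \<in> chain_space" using a by (simp add: chain_space_def W_def)
  have Wa: "W d = approx i Z N d" if "length d \<le> Suc N" for d N
    unfolding W_def using approx_eq[of d N "length d" Z i] approx_eq[of d "length d" N Z i] that Z
    by (cases "N \<le> length d") auto
  have "proj (i + 1) W m = proj (i + 1) (approx i Z 2) m" for m
    unfolding proj_def by (rule pairing_local[OF _ a]) (use proj_form_supp in \<open>fastforce intro: Wa\<close>)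
  hence "proj (i + 1) W = (\<lambda>_. \<zero>)" using proj_approx[OF Z] by auto
  moreover have "Dtot (i + 1) W e = Z e" for e
  proof -
    have "Dtot (i + 1) W e = Dtot (i + 1) (approx i Z (length e)) e" unfolding Dtot_def transpose_op_def
    proof (rule pairing_local[OF _ a])
      fix d assume "tot p (i + 1) (ind e) d \<noteq> 0"
      hence "d \<in> box e" using local_supp[OF local_tot] by blast
      thus "W d = approx i Z (length e) d" by (intro Wa) (simp add: box_def)
    qed
    thus ?thesis using approx_residue[OF Z DZ proj, of e "length e"] by simp
  qed
  ultimately show ?thesis using W by blast
qed

section \<open>Cycles and boundaries\<close>

lemma Dtot_smult: "\<lbrakk>r \<in> carrier R; Z \<in> chain_space\<rbrakk> \<Longrightarrow> Dtot i (\<lambda>d. r \<otimes> Z d) e = r \<otimes> Dtot i Z e"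
  unfolding Dtot_def transpose_op_def by (rule pairing_smult_right) (auto intro: local_finite(1)[OF local_tot finite_ind])

lemma proj_smult: "\<lbrakk>r \<in> carrier R; Z \<in> chain_space\<rbrakk> \<Longrightarrow> proj i (\<lambda>d. r \<otimes> Z d) m = r \<otimes> proj i Z m"
  unfolding proj_def by (rule pairing_smult_right) auto

lemma proj_closed [simp]: "Z \<in> chain_space \<Longrightarrow> proj i Z m \<in> carrier R"
  by (simp add: proj_def)

lemma chain_space_zero: "(\<lambda>_. \<zero>) \<in> chain_space" by (simp add: chain_space_def)

lemma chain_space_smult: "r \<in> carrier R \<Longrightarrow> Z \<in> chain_space \<Longrightarrow> (\<lambda>d. r \<otimes> Z d) \<in> chain_space" by (simp add: chain_space_def)

definition cycles :: "int \<Rightarrow> (nat \<times> nat \<Rightarrow> ((nat \<times> (nat \<Rightarrow> 'a)) list \<Rightarrow> 'a) set) set" where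
  "cycles i = {z \<in> carrier PT. periodic_diff R A i z = \<zero>\<^bsub>PT\<^esub>}"

lemma cycles_iff: "z \<in> cycles i \<longleftrightarrow> z \<in> carrier PT \<and> Dtot i (coord z) = (\<lambda>_. \<zero>)"
proof -
  interpret PT: module R PT by (rule module_PT)
  have "periodic_diff R A i z = \<zero>\<^bsub>PT\<^esub> \<longleftrightarrow> Dtot i (coord z) = (\<lambda>_. \<zero>)" if z: "z \<in> carrier PT"
  proof
    assume "periodic_diff R A i z = \<zero>\<^bsub>PT\<^esub>"
    thus "Dtot i (coord z) = (\<lambda>_. \<zero>)" using coord_diff[OF z, of i] coord_zero by auto
  next
    assume "Dtot i (coord z) = (\<lambda>_. \<zero>)"
    hence "coord (periodic_diff R A i z) d = coord \<zero>\<^bsub>PT\<^esub> d" for d using coord_diff[OF z, of i] coord_zero by simp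
    thus "periodic_diff R A i z = \<zero>\<^bsub>PT\<^esub>" using periodic_coord(1)[OF z] by (intro coord_inj) auto
  qed
  thus ?thesis by (auto simp: cycles_def)
qed

lemma boundary_iff:
  assumes w: "w \<in> carrier PT"
  shows "w \<in> periodic_diff R A i ` carrier PT \<longleftrightarrow> (\<exists>W\<in>chain_space. Dtot i W = coord w)"
proof
  assume "w \<in> periodic_diff R A i ` carrier PT"
  then obtain z where z: "w = periodic_diff R A i z" "z \<in> carrier PT" by (rule imageE)
  show "\<exists>W\<in>chain_space. Dtot i W = coord w" using coord_diff[OF z(2), of i] coord_closed[OF z(2)] unfolding z(1) by (intro bexI[of _ "coord z"]) auto
next
  assume "\<exists>W\<in>chain_space. Dtot i W = coord w"
  then obtain W where W: "W \<in> chain_space" "Dtot i W = coord w" by blast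
  then obtain z where z: "z \<in> carrier PT" "coord z = W" using coord_surj by blast
  have "periodic_diff R A i z = w" using coord_diff[OF z(1), of i] W z w periodic_coord(1)[OF z(1)] by (intro coord_inj) auto
  thus "w \<in> periodic_diff R A i ` carrier PT" using z by blast
qed

lemma coord_addf: "y \<in> carrier PT \<Longrightarrow> z \<in> carrier PT \<Longrightarrow> coord (y \<oplus>\<^bsub>PT\<^esub> z) = (\<lambda>d. coord y d \<oplus> coord z d)"
  by (rule ext) (rule coord_add)

lemma coord_smultf: "r \<in> carrier R \<Longrightarrow> z \<in> carrier PT \<Longrightarrow> coord (r \<odot>\<^bsub>PT\<^esub> z) = (\<lambda>d. r \<otimes> coord z d)"
  by (rule ext) (rule coord_smult)

lemma cycles_submodule: "submodule (cycles i) R PT"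
proof -
  interpret PT: module R PT by (rule module_PT)
  have z: "Dtot i (coord \<zero>\<^bsub>PT\<^esub>) e = \<zero>" for e unfolding Dtot_def transpose_op_def by (rule pairing_vanish) (rule coord_zero)
  show ?thesis
    by (rule PT.submodule_intro) (auto simp: cycles_iff coord_addf coord_smultf fun_eq_iff Dtot_add Dtot_smult coord_closed z)
qed

abbreviation "CY i \<equiv> PT\<lparr>carrier := cycles i\<rparr>"

lemma module_CY: "module R (CY i)"
proof -
  interpret PT: module R PT by (rule module_PT)
  show ?thesis by (rule submodule.submodule_is_module[OF cycles_submodule module_PT])
qed

lemma boundary_submodule: "submodule (periodic_diff R A (i + 1) ` carrier PT) R (CY i)"
proof -
  interpret M: module R "CY i" by (rule module_CY)
  interpret PT: module R PT by (rule module_PT)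
  let ?N = "periodic_diff R A (i + 1) ` carrier PT"
  have sub: "?N \<subseteq> carrier PT" using periodic_coord(1) by auto
  have N: "w \<in> ?N \<longleftrightarrow> w \<in> carrier PT \<and> (\<exists>W\<in>chain_space. Dtot (i + 1) W = coord w)" for w
    using boundary_iff[of w "i + 1"] sub by blast
  have z: "Dtot (i + 1) (\<lambda>_. \<zero>) e = \<zero>" for e unfolding Dtot_def transpose_op_def by (rule pairing_vanish) simp
  show ?thesis
  proof (rule M.submodule_intro)
    show "?N \<subseteq> carrier (CY i)"
    proof
      fix w assume "w \<in> ?N"
      then obtain W where "w \<in> carrier PT" "W \<in> chain_space" "Dtot (i + 1) W = coord w" using N by blast
      thus "w \<in> carrier (CY i)" using Dtot_Dtot[of W "i + 1"] by (auto simp: cycles_iff)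
    qed
    show "\<zero>\<^bsub>CY i\<^esub> \<in> ?N" unfolding N using z chain_space_zero coord_zero by (auto simp: fun_eq_iff)
  next
    fix x y assume "x \<in> ?N" "y \<in> ?N"
    then obtain X Y where "x \<in> carrier PT" "X \<in> chain_space" "Dtot (i + 1) X = coord x" "y \<in> carrier PT" "Y \<in> chain_space" "Dtot (i + 1) Y = coord y"
      unfolding N by blast
    thus "x \<oplus>\<^bsub>CY i\<^esub> y \<in> ?N" unfolding N using chain_space_add[of X Y]
      by (auto simp: coord_addf Dtot_add fun_eq_iff intro!: bexI[of _ "\<lambda>d. X d \<oplus> Y d"])
  next
    fix r x assume "r \<in> carrier R" "x \<in> ?N"
    then obtain X where "r \<in> carrier R" "x \<in> carrier PT" "X \<in> chain_space" "Dtot (i + 1) X = coord x"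
      unfolding N by blast
    thus "r \<odot>\<^bsub>CY i\<^esub> x \<in> ?N" unfolding N using chain_space_smult[of r X]
      by (auto simp: coord_smultf Dtot_smult fun_eq_iff intro!: bexI[of _ "\<lambda>d. r \<otimes> X d"])
  qed
qed

text \<open>
  Subtraction in the module of cycles is defined through its own additive inverses; it
  agrees with the subtraction of coordinates because addition does.
\<close>

lemma coord_minus_CY:
  assumes x: "x \<in> cycles i" and y: "y \<in> cycles i"
  shows "coord (x \<ominus>\<^bsub>CY i\<^esub> y) = (\<lambda>d. coord x d \<ominus> coord y d)" "x \<ominus>\<^bsub>CY i\<^esub> y \<in> cycles i"
proof -
  interpret M: module R "CY i" by (rule module_CY)
  have xy: "x \<in> carrier (CY i)" "y \<in> carrier (CY i)" using x y by auto
  have c: "x \<ominus>\<^bsub>CY i\<^esub> y \<in> carrier (CY i)" by (rule M.minus_closed[OF xy])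
  thus "x \<ominus>\<^bsub>CY i\<^esub> y \<in> cycles i" by simp
  hence PT: "x \<ominus>\<^bsub>CY i\<^esub> y \<in> carrier PT" "x \<in> carrier PT" "y \<in> carrier PT" using x y by (auto simp: cycles_iff)
  have "(x \<ominus>\<^bsub>CY i\<^esub> y) \<oplus>\<^bsub>CY i\<^esub> y = x"
    using xy M.a_inv_closed[OF xy(2)] by (simp only: a_minus_def M.a_assoc M.l_neg M.r_zero)
  hence "(x \<ominus>\<^bsub>CY i\<^esub> y) \<oplus>\<^bsub>PT\<^esub> y = x" by simp
  hence e: "coord (x \<ominus>\<^bsub>CY i\<^esub> y) d \<oplus> coord y d = coord x d" for d using coord_add[OF PT(1,3), of d] by simp
  show "coord (x \<ominus>\<^bsub>CY i\<^esub> y) = (\<lambda>d. coord x d \<ominus> coord y d)"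
  proof
    fix d
    have "u = (u \<oplus> v) \<ominus> v" if "u \<in> carrier R" "v \<in> carrier R" for u v
      using that by (simp add: a_minus_def a_assoc r_neg)
    from this[OF chain_space_val[OF coord_closed[OF PT(1)], of d] chain_space_val[OF coord_closed[OF PT(3)], of d]]
    show "coord (x \<ominus>\<^bsub>CY i\<^esub> y) d = coord x d \<ominus> coord y d" unfolding e .
  qed
qed

end

section \<open>Periodic cyclic homology\<close>

locale killed_zp = zp_algebra R p \<phi> + dg_poly R p
  for R :: "('a, 'r) ring_scheme" (structure) and p :: nat and \<phi> :: "rat \<Rightarrow> 'a"
begin

lemma proj_seqs: "Z \<in> chain_space \<Longrightarrow> proj i Z \<in> carrier seqs"
  by (simp add: seqs_simps)

lemma proj_seqs0: "Z \<in> chain_space \<Longrightarrow> odd i \<Longrightarrow> proj i Z \<in> seqs0"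
  by (simp add: seqs0_def proj_seqs proj_zero)

lemma proj_Dtot_even: "Z \<in> chain_space \<Longrightarrow> even i \<Longrightarrow> proj i (Dtot (i + 1) Z) = bidiag (proj (i + 1) Z)"
  using proj_Dtot[of Z "i + 1"] by (auto simp: bidiag_def)

lemma bidiag_inj:
  assumes x: "x \<in> seqs0" and b: "bidiag x = (\<lambda>_. \<zero>)"
  shows "x k = \<zero>"
proof (induction k)
  case 0
  show ?case using x by (simp add: seqs0_def)
next
  case (Suc k)
  have c: "x k \<in> carrier R" for k using x by (simp add: seqs0_def seqs_simps)
  have "bidiag x k = \<zero>" using b by simp
  hence "pR [^] (1::nat) \<otimes> x (Suc k) = \<zero>" using x Suc c by (simp add: bidiag_eq seqs0_D lamR_def phi_of_int)
  thus ?case by (rule pR_cancel) (rule c)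
qed

text \<open>
  A cycle of even degree bounds if its projection bounds in the small complex: subtracting
  the boundary of a lift leaves a cycle in the kernel of the projection, which is acyclic.
\<close>

lemma image_iff_even:
  assumes i: "even i" and Y: "Y \<in> chain_space" and DY: "Dtot i Y = (\<lambda>_. \<zero>)"
  shows "(\<exists>x\<in>seqs0. proj i Y = bidiag x) \<longleftrightarrow> (\<exists>W\<in>chain_space. Dtot (i + 1) W = Y)"
proof
  assume "\<exists>W\<in>chain_space. Dtot (i + 1) W = Y"
  then obtain W where W: "W \<in> chain_space" "Dtot (i + 1) W = Y" by blast
  have "proj (i + 1) W \<in> seqs0" by (rule proj_seqs0[OF W(1)]) (use i in simp)
  thus "\<exists>x\<in>seqs0. proj i Y = bidiag x" using proj_Dtot_even[OF W(1) i] unfolding W(2) by blast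
next
  assume "\<exists>x\<in>seqs0. proj i Y = bidiag x"
  then obtain x where x: "x \<in> seqs0" "proj i Y = bidiag x" by blast
  have "x m \<in> carrier R" for m using x by (simp add: seqs0_def seqs_simps)
  then obtain V where V: "V \<in> chain_space" "proj (i + 1) V = x"
    using proj_surj[of x "i + 1"] x by (auto simp: seqs0_def)
  let ?Y = "\<lambda>d. Y d \<ominus> Dtot (i + 1) V d"
  note DV = Dtot_closed[OF V(1), of "i + 1"]
  have L: "?Y \<in> chain_space" by (rule chain_space_minus[OF Y DV])
  have 1: "Dtot i ?Y d = \<zero>" for d
    unfolding Dtot_minus[OF Y DV] using DY Dtot_Dtot[OF V(1), of "i + 1" d] by (simp add: a_minus_def)
  have 2: "proj i ?Y m = \<zero>" for m
  proof -
    have "proj i ?Y m = proj i Y m \<ominus> proj i (Dtot (i + 1) V) m" by (rule proj_minus[OF Y DV])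
    also have "proj i (Dtot (i + 1) V) m = proj i Y m" using proj_Dtot_even[OF V(1) i] V(2) x(2) by simp
    finally show ?thesis using Y by (simp add: a_minus_def r_neg)
  qed
  from kernel_acyclic[OF L 1 2] obtain W where W: "W \<in> chain_space" "Dtot (i + 1) W = ?Y" by blast
  have "Dtot (i + 1) (\<lambda>d. V d \<oplus> W d) d = Y d" for d
    unfolding Dtot_add[OF V(1) W(1)] W(2) using chain_space_val[OF Y, of d] chain_space_val[OF DV, of d]
    by (simp add: a_minus_def a_lcomm[of _ "Y d"] r_neg)
  thus "\<exists>W\<in>chain_space. Dtot (i + 1) W = Y" using chain_space_add[OF V(1) W(1)] by (intro bexI[of _ "\<lambda>d. V d \<oplus> W d"]) auto
qed

text \<open>
  In even degree every sequence is a cycle of the small complex. A lift of it has a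
  boundary in the kernel of the projection, and acyclicity corrects the lift to a cycle.
\<close>

lemma lift_cycle:
  assumes i: "even i" and x: "x \<in> carrier seqs"
  shows "\<exists>Z\<in>chain_space. Dtot i Z = (\<lambda>_. \<zero>) \<and> proj i Z = x"
proof -
  have "x m \<in> carrier R" for m using x by (simp add: seqs_simps)
  then obtain Z where Z: "Z \<in> chain_space" "proj i Z = x" using proj_surj[of x i] i by auto
  note DZ = Dtot_closed[OF Z(1), of i]
  have "\<exists>W\<in>chain_space. proj (i - 1 + 1) W = (\<lambda>_. \<zero>) \<and> Dtot (i - 1 + 1) W = Dtot i Z"
    by (rule kernel_acyclic[OF DZ]) (use Dtot_Dtot[OF Z(1), of i] proj_Dtot[OF Z(1), of i] i in auto)
  then obtain W where W: "W \<in> chain_space" "proj i W = (\<lambda>_. \<zero>)" "Dtot i W = Dtot i Z" by auto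
  have "Dtot i (\<lambda>d. Z d \<ominus> W d) e = \<zero>" for e
    unfolding Dtot_minus[OF Z(1) W(1)] W(3) using chain_space_val[OF DZ, of e] by (simp add: a_minus_def r_neg)
  moreover have "proj i (\<lambda>d. Z d \<ominus> W d) m = x m" for m
    unfolding proj_minus[OF Z(1) W(1)] using W(2) Z x by (simp add: a_minus_def seqs_val)
  ultimately show ?thesis using chain_space_minus[OF Z(1) W(1)] by (intro bexI[of _ "\<lambda>d. Z d \<ominus> W d"]) auto
qed

text \<open>
  The projection of a cycle of odd degree is killed by the bidiagonal map, hence it is
  zero.
\<close>

lemma odd_exact:
  assumes i: "odd i" and Z: "Z \<in> chain_space" and DZ: "Dtot i Z = (\<lambda>_. \<zero>)"
  shows "\<exists>W\<in>chain_space. Dtot (i + 1) W = Z"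
proof -
  have "proj (i - 1) (Dtot i Z) m = \<zero>" for m unfolding DZ proj_def by (rule pairing_vanish) simp
  hence "bidiag (proj i Z) = (\<lambda>_. \<zero>)" using proj_Dtot_even[OF Z, of "i - 1"] i by auto
  hence "proj i Z m = \<zero>" for m by (rule bidiag_inj[OF proj_seqs0[OF Z i]])
  from kernel_acyclic[OF Z _ this] DZ show ?thesis by auto
qed

lemma HP_quot: "HP R A i = quot_module (CY i) (periodic_diff R A (i + 1) ` carrier PT)"
  by (simp add: HP_def cycles_def)

lemma HP_odd:
  assumes i: "odd i"
  shows "carrier (HP R A i) = {\<zero>\<^bsub>HP R A i\<^esub>}"
proof -
  let ?N = "periodic_diff R A (i + 1) ` carrier PT"
  interpret S: submod R "CY i" ?N by (rule submodI[OF module_CY boundary_submodule])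
  have "w \<in> ?N" if "w \<in> cycles i" for w
  proof -
    have w: "w \<in> carrier PT" "Dtot i (coord w) = (\<lambda>_. \<zero>)" using that by (auto simp: cycles_iff)
    from odd_exact[OF i coord_closed[OF w(1)] w(2)] show ?thesis using boundary_iff[OF w(1)] by blast
  qed
  hence N: "carrier (CY i) \<subseteq> ?N" by auto
  have cs: "S.cs x = \<zero>\<^bsub>quot_module (CY i) ?N\<^esub>" if "x \<in> carrier (CY i)" for x
  proof -
    have z: "S.cs \<zero>\<^bsub>CY i\<^esub> = \<zero>\<^bsub>quot_module (CY i) ?N\<^esub>" by (rule S.zero_quot[symmetric])
    have "x \<ominus>\<^bsub>CY i\<^esub> \<zero>\<^bsub>CY i\<^esub> \<in> ?N"
      using N S.M.minus_closed[OF that S.M.zero_closed] by (rule subsetD)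
    hence "S.cs x = S.cs \<zero>\<^bsub>CY i\<^esub>" unfolding S.cs_eq_iff[OF that S.M.zero_closed] .
    thus ?thesis using z by simp
  qed
  show ?thesis unfolding HP_quot S.carrier_quot using cs S.M.zero_closed by blast
qed

lemma HP_even:
  assumes i: "even i"
  shows "module_isomorphic R (HP R A i) target"
proof -
  let ?N = "periodic_diff R A (i + 1) ` carrier PT"
  interpret S: submod R "CY i" ?N by (rule submodI[OF module_CY boundary_submodule])
  define F where "F z = compare (proj i (coord z))" for z
  have cyc: "z \<in> carrier PT" "coord z \<in> chain_space" "Dtot i (coord z) = (\<lambda>_. \<zero>)" "proj i (coord z) \<in> carrier seqs" if "z \<in> carrier (CY i)" for z
    using that coord_closed proj_seqs by (auto simp: cycles_iff)
  show ?thesis unfolding HP_quot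
  proof (rule S.quot_iso)
    fix z assume z: "z \<in> carrier (CY i)"
    show "F z \<in> carrier target" unfolding F_def by (rule compare_closed[OF cyc(4)[OF z]])
  next
    fix y z assume y: "y \<in> carrier (CY i)" and z: "z \<in> carrier (CY i)"
    have "proj i (coord (y \<oplus>\<^bsub>CY i\<^esub> z)) = proj i (coord y) \<oplus>\<^bsub>seqs\<^esub> proj i (coord z)"
      using cyc[OF y] cyc[OF z] by (auto simp: seqs_simps coord_addf proj_add)
    thus "F (y \<oplus>\<^bsub>CY i\<^esub> z) = F y \<oplus>\<^bsub>target\<^esub> F z"
      unfolding F_def using compare_add[OF cyc(4)[OF y] cyc(4)[OF z]] by simp
  next
    fix r z assume r: "r \<in> carrier R" and z: "z \<in> carrier (CY i)"
    have "proj i (coord (r \<odot>\<^bsub>CY i\<^esub> z)) = r \<odot>\<^bsub>seqs\<^esub> proj i (coord z)"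
      using cyc[OF z] r by (auto simp: seqs_simps coord_smultf proj_smult)
    thus "F (r \<odot>\<^bsub>CY i\<^esub> z) = r \<odot>\<^bsub>target\<^esub> F z"
      unfolding F_def using compare_smult[OF r cyc(4)[OF z]] by simp
  next
    fix y assume "y \<in> carrier target"
    then obtain a where a: "a \<in> carrier seqs" "compare a = y" using compare_surj by blast
    from lift_cycle[OF i a(1)] obtain Z where Z: "Z \<in> chain_space" "Dtot i Z = (\<lambda>_. \<zero>)" "proj i Z = a" by blast
    then obtain z where "z \<in> carrier PT" "coord z = Z" using coord_surj by blast
    thus "\<exists>z\<in>carrier (CY i). F z = y" using Z a by (intro bexI[of _ z]) (auto simp: F_def cycles_iff)
  next
    fix y z assume y: "y \<in> carrier (CY i)" and z: "z \<in> carrier (CY i)"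
    let ?w = "y \<ominus>\<^bsub>CY i\<^esub> z"
    have cw: "coord ?w = (\<lambda>d. coord y d \<ominus> coord z d)" "?w \<in> cycles i" using coord_minus_CY[of y i z] y z by auto
    have w: "?w \<in> carrier PT" "Dtot i (coord ?w) = (\<lambda>_. \<zero>)" using cw(2) by (auto simp: cycles_iff)
    have "F y = F z \<longleftrightarrow> (\<exists>x\<in>seqs0. proj i (coord y) \<ominus>\<^bsub>seqs\<^esub> proj i (coord z) = bidiag x)"
      unfolding F_def by (rule compare_eq_iff[OF cyc(4)[OF y] cyc(4)[OF z]])
    also have "proj i (coord y) \<ominus>\<^bsub>seqs\<^esub> proj i (coord z) = proj i (coord ?w)"
      unfolding cw(1) using cyc[OF y] cyc[OF z] by (auto simp: seqs_minus proj_minus)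
    also have "(\<exists>x\<in>seqs0. proj i (coord ?w) = bidiag x) \<longleftrightarrow> (\<exists>W\<in>chain_space. Dtot (i + 1) W = coord ?w)"
      by (rule image_iff_even[OF i coord_closed[OF w(1)] w(2)])
    also have "\<dots> \<longleftrightarrow> ?w \<in> ?N" using boundary_iff[OF w(1)] by blast
    finally show "F y = F z \<longleftrightarrow> ?w \<in> ?N" .
  qed
qed

end

theorem theorem1p1:
  fixes R :: "('a, 'r) ring_scheme" and p :: nat and \<phi> :: "rat \<Rightarrow> 'a"
  assumes "prime p" and "odd p"
    and "cring R"
    and "\<phi> \<in> ring_hom (localized_integers p) R"
    and "inj_on (\<lambda>x. [p] \<cdot>\<^bsub>R\<^esub> x) (carrier R)"
  shows "(\<forall>i::int. odd i \<longrightarrow> carrier (HP R (dg_kill R p) i) = {\<zero>\<^bsub>HP R (dg_kill R p) i\<^esub>}) \<and>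
         (\<forall>i::int. even i \<longrightarrow> module_isomorphic R (HP R (dg_kill R p) i)
            (pair_module (adic_completion R p) (prod_module {n. odd n} (ring_mod R))))"
proof -
  interpret killed_zp R p \<phi>
    by (intro killed_zp.intro zp_algebra.intro zp_algebra_axioms.intro dg_poly.intro assms)
  show ?thesis using HP_odd HP_even by blast
qed
end
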